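(* Let $k\ge1$, $n=k(k+1)/2$, $\rho=(k,k-1,\dots,2,1)$, and let $\lambda$ be a partition of $n$ such that the irreducible complex character $\chi^\lambda$ of $\mathfrak S_n$ is of height $0$ (for the prime $2$). Then $g(\rho,\rho,\lambda)>0$. In particular, every $\chi^\lambda$ of odd degree is a constituent of $(\chi^\rho)^2$.
   Context: For a partition $\lambda$ of $n$, $\chi^\lambda$ is the complex irreducible character of $\mathfrak S_n$ labelled by $\lambda$ (the character of the Specht module). The Kronecker coefficient $g(\lambda,\mu,\nu)$ is the multiplicity of $\chi^\nu$ in $\chi^\lambda\chi^\mu$. Height zero: successively removing rim $2$-hooks (dominoes) from the Young diagram of $\lambda$ until none can be removed leaves a well-defined $2$-core; the number $w$ of dominoes removed is the weight of $\lambda$ and of the $2$-block $B$ of $\mathfrak S_n$ containing $\chi^\lambda$. For $m\ge0$ let $s(m)$ be the number of digits equal to $1$ in the binary expansion of $m$. The defect of $B$ is $d(B)=2w-s(w)$. The degree of every irreducible character in $B$ is divisible by $2^{\,n-s(n)-d(B)}$; $\chi^\lambda$ is of height $0$ if this is the exact power of $2$ dividing $\chi^\lambda(1)$. *)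

theory Defs
  imports
    Complex_Main
    "HOL-Library.Function_Algebras"
    "HOL-Combinatorics.Permutations"
    "HOL-Computational_Algebra.Primes"
begin

definition partition_of :: "nat list \<Rightarrow> nat \<Rightarrow> bool" where
  "partition_of la n \<longleftrightarrow> sorted_wrt (\<ge>) la \<and> 0 \<notin> set la \<and> sum_list la = n"

text \<open>Cells are pairs (row, column), both counted from 0.\<close>

definition diagram :: "nat list \<Rightarrow> (nat \<times> nat) set" where
  "diagram la = {(i, j). i < length la \<and> j < la ! i}"

definition staircase :: "nat \<Rightarrow> nat list" where
  "staircase k = rev [1..<Suc k]"


interpretation cfun: vector_space "\<lambda>(c :: complex) (f :: 'a \<Rightarrow> complex) x. c * f x"
  by unfold_locales (auto simp: fun_eq_iff algebra_simps)

text \<open>The trace of an endomorphism of a finite-dimensional subspace, computed in an arbitrary basis;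
  it does not depend on the basis.\<close>

definition trace_on :: "('a \<Rightarrow> complex) set \<Rightarrow> (('a \<Rightarrow> complex) \<Rightarrow> ('a \<Rightarrow> complex)) \<Rightarrow> complex" where
  "trace_on V F =
     (let B = (SOME B. cfun.independent B \<and> cfun.span B = V)
      in \<Sum>b\<in>B. cfun.representation B (F b) b)"


definition tableau :: "nat list \<Rightarrow> (nat \<times> nat \<Rightarrow> nat) \<Rightarrow> bool" where
  "tableau la t \<longleftrightarrow> bij_betw t (diagram la) {1..sum_list la}"

text \<open>A tabloid (a tableau up to permutation of the entries within each row) is represented by the
  function sending a row index to the set of entries of that row.\<close>

definition tabloid :: "nat list \<Rightarrow> (nat \<times> nat \<Rightarrow> nat) \<Rightarrow> (nat \<Rightarrow> nat set)" where
  "tabloid la t = (\<lambda>i. t ` {c \<in> diagram la. fst c = i})"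

definition column_stabilizer :: "nat list \<Rightarrow> (nat \<times> nat \<Rightarrow> nat) \<Rightarrow> (nat \<Rightarrow> nat) set" where
  "column_stabilizer la t =
     {\<sigma>. \<sigma> permutes {1..sum_list la} \<and>
         (\<forall>j. \<sigma> ` (t ` {c \<in> diagram la. snd c = j}) = t ` {c \<in> diagram la. snd c = j})}"

text \<open>The permutation module with the tabloids as basis is realised inside the complex functions
  on tabloids, a tabloid being identified with its indicator function.  The polytabloid of t is the
  alternating sum of the tabloids of \<open>\<sigma> \<circ> t\<close> over the column stabilizer.\<close>

definition polytabloid :: "nat list \<Rightarrow> (nat \<times> nat \<Rightarrow> nat) \<Rightarrow> ((nat \<Rightarrow> nat set) \<Rightarrow> complex)" where
  "polytabloid la t =
     (\<lambda>T. \<Sum>\<sigma>\<in>column_stabilizer la t. of_int (sign \<sigma>) * of_bool (T = tabloid la (\<sigma> \<circ> t)))"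

definition specht_module :: "nat list \<Rightarrow> ((nat \<Rightarrow> nat set) \<Rightarrow> complex) set" where
  "specht_module la = cfun.span {polytabloid la t | t. tableau la t}"

text \<open>The linear extension of the action on tabloids: the inverse makes the indicator
  function of T go to that of the image of T.\<close>

definition perm_action ::
  "(nat \<Rightarrow> nat) \<Rightarrow> ((nat \<Rightarrow> nat set) \<Rightarrow> complex) \<Rightarrow> ((nat \<Rightarrow> nat set) \<Rightarrow> complex)" where
  "perm_action \<sigma> f = (\<lambda>T. f (\<lambda>i. inv \<sigma> ` T i))"

definition specht_char :: "nat list \<Rightarrow> (nat \<Rightarrow> nat) \<Rightarrow> complex" where
  "specht_char la \<sigma> = trace_on (specht_module la) (perm_action \<sigma>)"

definition char_degree :: "nat list \<Rightarrow> nat" where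
  "char_degree la = cfun.dim (specht_module la)"

lemma specht_char_id: "specht_char la id = of_nat (char_degree la)"
proof -
  let ?V = "specht_module la"
  define B where "B = (SOME B. cfun.independent B \<and> cfun.span B = ?V)"
  have "\<exists>B. cfun.independent B \<and> cfun.span B = ?V"
  proof -
    obtain B where B: "B \<subseteq> ?V" "cfun.independent B" "?V \<subseteq> cfun.span B"
      using cfun.maximal_independent_subset[of ?V] by blast
    have "cfun.span B \<subseteq> ?V"
      using cfun.span_minimal[OF B(1)] by (simp add: specht_module_def cfun.subspace_span)
    with B show ?thesis by blast
  qed
  then have B: "cfun.independent B \<and> cfun.span B = ?V"
    unfolding B_def by (rule someI_ex)
  have act: "perm_action id f = f" for f by (simp add: perm_action_def)
  have "specht_char la id = (\<Sum>b\<in>B. cfun.representation B (perm_action id b) b)"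
    by (simp add: specht_char_def trace_on_def Let_def B_def)
  also have "\<dots> = (\<Sum>b\<in>B. 1)"
    using B by (intro sum.cong refl) (simp add: act cfun.representation_basis)
  also have "\<dots> = of_nat (card B)" by simp
  also have "card B = cfun.dim ?V"
    using B cfun.dim_span_eq_card_independent[of B] by simp
  finally show ?thesis unfolding char_degree_def .
qed


definition char_inner :: "nat \<Rightarrow> ((nat \<Rightarrow> nat) \<Rightarrow> complex) \<Rightarrow> ((nat \<Rightarrow> nat) \<Rightarrow> complex) \<Rightarrow> complex" where
  "char_inner n \<phi> \<psi> = (\<Sum>\<sigma> | \<sigma> permutes {1..n}. \<phi> \<sigma> * cnj (\<psi> \<sigma>)) / fact n"

text \<open>The multiplicity of an irreducible character \<open>\<psi>\<close> of the symmetric group of degree n in a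
  character \<open>\<phi>\<close>; the inner product is then a natural number.\<close>

definition char_multiplicity ::
  "nat \<Rightarrow> ((nat \<Rightarrow> nat) \<Rightarrow> complex) \<Rightarrow> ((nat \<Rightarrow> nat) \<Rightarrow> complex) \<Rightarrow> nat" where
  "char_multiplicity n \<psi> \<phi> = (THE m. char_inner n \<phi> \<psi> = of_nat m)"

definition constituent ::
  "nat \<Rightarrow> ((nat \<Rightarrow> nat) \<Rightarrow> complex) \<Rightarrow> ((nat \<Rightarrow> nat) \<Rightarrow> complex) \<Rightarrow> bool" where
  "constituent n \<psi> \<phi> \<longleftrightarrow> char_multiplicity n \<psi> \<phi> \<noteq> 0"

definition kronecker :: "nat list \<Rightarrow> nat list \<Rightarrow> nat list \<Rightarrow> nat" where
  "kronecker la \<mu> \<nu> =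
     char_multiplicity (sum_list \<nu>) (specht_char \<nu>) (\<lambda>\<sigma>. specht_char la \<sigma> * specht_char \<mu> \<sigma>)"


definition domino :: "(nat \<times> nat) set \<Rightarrow> bool" where
  "domino D \<longleftrightarrow> (\<exists>i j. D = {(i, j), (i, Suc j)} \<or> D = {(i, j), (Suc i, j)})"

text \<open>A rim 2-hook is a domino of the diagram whose complement is again the diagram of a
  partition.\<close>

definition remove_domino :: "nat list \<Rightarrow> nat list \<Rightarrow> bool" where
  "remove_domino la \<mu> \<longleftrightarrow>
     partition_of \<mu> (sum_list \<mu>) \<and> diagram \<mu> \<subseteq> diagram la \<and> domino (diagram la - diagram \<mu>)"

definition is_2core :: "nat list \<Rightarrow> bool" where
  "is_2core \<kappa> \<longleftrightarrow> (\<nexists>\<mu>. remove_domino \<kappa> \<mu>)"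

definition weight2 :: "nat list \<Rightarrow> nat" where
  "weight2 la = (THE w. \<exists>\<kappa>. (remove_domino ^^ w) la \<kappa> \<and> is_2core \<kappa>)"

definition binary_digit_sum :: "nat \<Rightarrow> nat" where
  "binary_digit_sum m = card {i. bit m i}"

definition defect2 :: "nat list \<Rightarrow> nat" where
  "defect2 la = 2 * weight2 la - binary_digit_sum (weight2 la)"

text \<open>The truncated subtractions here and in \<open>defect2\<close> agree with integer subtraction:
  n minus its binary digit sum is the exponent of 2 in \<open>n!\<close>, the defect is the exponent of 2
  in \<open>(2w)!\<close>, and \<open>2w \<le> n\<close>.\<close>

definition height_zero2 :: "nat list \<Rightarrow> bool" where
  "height_zero2 la \<longleftrightarrow>
     (let n = sum_list la
      in multiplicity (2::nat) (char_degree la) = n - binary_digit_sum n - defect2 la)"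

end

theory Submission
  imports Defs "HOL-Computational_Algebra.Polynomial" "HOL-Library.Multiset_Order" "HOL-Library.Nat_Bijection"
begin

text \<open>Let \<open>\<kappa>\<close> be the 2-core of \<open>\<lambda>\<close>, \<open>m = |\<kappa>|\<close>, and let \<open>\<tau>\<close> be \<open>\<kappa>\<close> with \<open>n - m\<close> cells added to its first row.
 The degree formula for beta-sets, split into even and odd beta-numbers, shows that height 0 (or odd degree)
 makes the number of paths from \<open>\<kappa>\<close> to \<open>\<lambda>\<close> in Young's graph odd. As \<open>\<kappa>\<close> has defect 0, a suitable integral
 matrix coefficient c of \<open>S\<^sup>\<kappa>\<close> satisfies \<open>\<Sum> c(g)\<^sup>2 c(g\<^sup>-\<^sup>1) \<equiv> \<Sum> c(g) c(g\<^sup>-\<^sup>1) \<equiv> 1 (mod 2)\<close>, so \<open>g(\<kappa>,\<kappa>,\<kappa>) > 0\<close>, and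
 shuffle products turn an invariant of \<open>(\<kappa>,\<kappa>,\<kappa>)\<close> into a nonzero one of \<open>S\<^sup>\<rho> \<otimes> S\<^sup>\<rho> \<otimes> S\<^sup>\<tau>\<close>. Work over the rationals with
 odd denominator. If \<open>g(\<rho>,\<rho>,\<lambda>) = 0\<close>, the latter invariant yields U in the group ring which kills \<open>S\<^sup>\<lambda>\<close> but does not
 map a generator of a lattice in \<open>S\<^sup>\<tau>\<close> into twice that lattice. A multiple of U then fixes t0, a rank one element for
 \<open>\<kappa>\<close>, symmetrized over the last \<open>n - m\<close> points and multiplied by a central element separating the block. The form
 on \<open>S\<^sup>\<lambda>\<close> forbids this: on the image of the rank one element, whose rank is the odd number of paths, it has a
 vector whose norm has the minimal 2-adic valuation of all values of the form.\<close>

text \<open>In modular terms: \<rho> is its own 2-core, so it has defect 0 and the tensor square of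
  its Specht module is projective modulo 2. The invariant with \<tau> puts the projective cover of a
  certain simple module into this square, and \<lambda> occurs there once the corresponding
  decomposition number is nonzero. Neither projective covers nor decomposition numbers are
  constructed; integrality of explicit group ring elements replaces them, with
  \<open>fact n / syt n (stair k)\<close> being a unit in the role of projectivity. The prime 2
  enters through two facts. Since c * c is congruent to c, a double sum of w g * w h * P g h with P
  symmetric reduces modulo 2 to its diagonal, and the diagonal vanishes by the symmetrization over
  the last points. On the other hand a symmetric matrix with even diagonal has even rank modulo 2,
  so the odd number of paths produces an odd norm. The form on the lattice of \<kappa> may take only
  even values on the diagonal. Therefore the rank one idempotent is built from two vectors, is not
  self-adjoint in general, and the form on its image is twisted accordingly.\<close>

type_synonym word = "nat => nat"
type_synonym wfun = "word => rat"
type_synonym cells = "(nat \<times> nat) set"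

section \<open>Coordinates and traces on function spaces\<close>

definition lsp :: "('a => 'k::field) set => bool" where
 "lsp S \<longleftrightarrow> (%_. 0) \<in> S \<and> (\<forall>f\<in>S. \<forall>g\<in>S. \<forall>c. (%a. f a + c * g a) \<in> S)"

definition lfun :: "('a => 'k::field) set => (('a => 'k) => 'k) => bool" where
 "lfun S x \<longleftrightarrow> (\<forall>f\<in>S. \<forall>g\<in>S. \<forall>c. x (%a. f a + c * g a) = x f + c * x g)"

definition lmap :: "('a => 'k::field) set => (('a => 'k) => ('b => 'k)) => bool" where
 "lmap S F \<longleftrightarrow> (\<forall>f\<in>S. \<forall>g\<in>S. \<forall>c. F (%a. f a + c * g a) = (%b. F f b + c * F g b))"

text \<open>A basis together with its dual basis. The families are indexed and the functionals are
  constrained on \<open>S\<close> only, so that coordinates can be plain evaluations.\<close>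

definition frame ::
 "('a => 'k::field) set => 'i set => ('i => 'a => 'k) => ('i => ('a => 'k) => 'k) => bool" where
 "frame S K v x \<longleftrightarrow> finite K \<and> (\<forall>k\<in>K. v k \<in> S \<and> lfun S (x k)) \<and>
   (\<forall>f\<in>S. f = (%a. SUM k:K. x k f * v k a)) \<and> (\<forall>k\<in>K. \<forall>l\<in>K. x k (v l) = of_bool (k = l))"

text \<open>A basis in reduced echelon form: the coordinates of \<open>f\<close> are its own values
  on \<open>J\<close>. Hence a function with integral values has integral coordinates.\<close>

definition pivot :: "('a => 'k::field) set => 'a set => ('a => 'a => 'k) => bool" where
 "pivot S J b \<longleftrightarrow> finite J \<and> (\<forall>j\<in>J. b j \<in> S \<and> (\<forall>i\<in>J. b j i = of_bool (i = j))) \<and>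
   (\<forall>f\<in>S. f = (%a. SUM j:J. f j * b j a))"

lemma lspD: assumes "lsp S"
 shows lsp_zero: "(%_. 0) \<in> S"
  and lsp_addc: "f \<in> S ==> g \<in> S ==> (%a. f a + c * g a) \<in> S" using assms unfolding lsp_def by auto

lemma lsp_scale: "lsp S ==> f \<in> S ==> (%a. c * f a) \<in> S" using lsp_addc[of S "%_. 0" f c] lsp_zero by force

lemma lsp_add: "lsp S ==> f \<in> S ==> g \<in> S ==> (%a. f a + g a) \<in> S" using lsp_addc[of S f g 1] by simp

lemma lsp_diff: "lsp S ==> f \<in> S ==> g \<in> S ==> (%a. f a - g a) \<in> S" using lsp_addc[of S f g "-1"] by simp

lemma lsp_sum: assumes "lsp S" "\<And>k. k \<in> K ==> v k \<in> S"
 shows "(%a. SUM k:K. c k * v k a) \<in> S"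
proof (cases "finite K")
 case True thus ?thesis using assms(2) proof (induction K)
  case empty thus ?case using assms(1) by (simp add: lsp_zero)
 next case (insert k K)
  thus ?case using lsp_addc[OF assms(1), of "%a. SUM k:K. c k * v k a" "v k" "c k"] by (simp add: add.commute)
 qed
qed (use assms(1) in \<open>simp add: lsp_zero\<close>)

lemma lsp_sum': "lsp S ==> (\<And>k. k \<in> K ==> v k \<in> S) ==> (%a. SUM k:K. v k a) \<in> S"
 using lsp_sum[of S K v "%_. 1"] by simp

lemma lfun_zero: "lsp S ==> lfun S x ==> x (%_. 0) = 0"
 unfolding lfun_def using lsp_zero[of S] by (force dest: bspec[of _ _ "%_. 0"])

lemma lfun_scale: "lsp S ==> lfun S x ==> f \<in> S ==> x (%a. c * f a) = c * x f"
 using lfun_zero[of S x] lsp_zero[of S] unfolding lfun_def by (metis (no_types, lifting) add_0 ext)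

lemma lfun_sum: assumes "lsp S" "lfun S x" "\<And>k. k \<in> K ==> v k \<in> S"
 shows "x (%a. SUM k:K. c k * v k a) = (SUM k:K. c k * x (v k))"
proof (cases "finite K")
 case True thus ?thesis using assms(3) proof (induction K)
  case empty thus ?case using lfun_zero[OF assms(1,2)] by simp
 next case (insert k K)
  have "x (%a. (SUM k:K. c k * v k a) + c k * v k a) = x (%a. SUM k:K. c k * v k a) + c k * x (v k)"
   using assms(2) insert.prems lsp_sum[OF assms(1), of K v c] unfolding lfun_def by simp
  with insert show ?case by (simp add: add.commute)
 qed
qed (use lfun_zero[OF assms(1,2)] in simp)

lemma lmap_lfun: "lmap S F ==> lfun S (%f. F f a)" unfolding lmap_def lfun_def by simp

lemma lmap_sum: assumes "lsp S" "lmap S F" "\<And>k. k \<in> K ==> v k \<in> S"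
 shows "F (%a. SUM k:K. c k * v k a) = (%a. SUM k:K. c k * F (v k) a)"
 using lfun_sum[OF assms(1) lmap_lfun[OF assms(2)], of K v c] assms(3) by (intro ext) simp

lemma lmap_zero: "lsp S ==> lmap S F ==> F (%_. 0) = (%_. 0)" using lfun_zero lmap_lfun by (intro ext) fast

lemma lmap_scale: "lsp S ==> lmap S F ==> f \<in> S ==> F (%a. c * f a) = (%a. c * F f a)"
 using lfun_scale[OF _ lmap_lfun] by (intro ext) fast

lemma frameD: assumes "frame S K v x"
 shows "finite K" "\<And>k. k \<in> K ==> v k \<in> S" "\<And>k. k \<in> K ==> lfun S (x k)"
  "\<And>f. f \<in> S ==> f = (%a. SUM k:K. x k f * v k a)"
  "\<And>k l. k \<in> K ==> l \<in> K ==> x k (v l) = of_bool (k = l)" using assms unfolding frame_def by blast+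

lemma pivotD: assumes "pivot S J b"
 shows "finite J" "\<And>j. j \<in> J ==> b j \<in> S" "\<And>i j. i \<in> J ==> j \<in> J ==> b j i = of_bool (i = j)"
  "\<And>f. f \<in> S ==> f = (%a. SUM j:J. f j * b j a)" using assms unfolding pivot_def by blast+

lemma pivot_frame: "pivot S J b ==> frame S J b (%j f. f j)" unfolding pivot_def frame_def lfun_def by auto

text \<open>Expanding \<open>v k\<close> in the second basis and \<open>F (w l)\<close> in the first
  turns either side into the same double sum.\<close>

lemma frame_trace_eq: assumes S: "lsp S" and K: "frame S K v x" and L: "frame S L w y"
  and F: "lmap S F" "\<And>f. f \<in> S ==> F f \<in> S"
 shows "(SUM k:K. x k (F (v k))) = (SUM l:L. y l (F (w l)))"
proof -
 note K = frameD[OF K] and L = frameD[OF L]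
 have "x k (F (v k)) = (SUM l:L. y l (v k) * x k (F (w l)))" if k: "k \<in> K" for k proof -
  have "F (v k) = F (%a. SUM l:L. y l (v k) * w l a)" using L(4)[OF K(2)[OF k]] by simp
  also have "... = (%a. SUM l:L. y l (v k) * F (w l) a)" by (rule lmap_sum[OF S F(1) L(2)])
  finally have "x k (F (v k)) = x k (%a. SUM l:L. y l (v k) * F (w l) a)" by simp
  also have "... = (SUM l:L. y l (v k) * x k (F (w l)))" by (rule lfun_sum[OF S K(3)[OF k]]) (use F(2) L(2) in blast)
  finally show ?thesis .
 qed
 hence "(SUM k:K. x k (F (v k))) = (SUM k:K. SUM l:L. y l (v k) * x k (F (w l)))" by simp
 also have "... = (SUM l:L. SUM k:K. x k (F (w l)) * y l (v k))" by (subst sum.swap) (simp add: mult.commute)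
 also have "... = (SUM l:L. y l (F (w l)))" proof (rule sum.cong[OF refl])
  fix l assume l: "l \<in> L"
  have "y l (F (w l)) = y l (%a. SUM k:K. x k (F (w l)) * v k a)" using K(4)[OF F(2)[OF L(2)[OF l]]] by simp
  also have "... = (SUM k:K. x k (F (w l)) * y l (v k))" by (rule lfun_sum[OF S L(3)[OF l]]) (use K(2) in blast)
  finally show "(SUM k:K. x k (F (w l)) * y l (v k)) = y l (F (w l))" by simp
 qed
 finally show ?thesis .
qed

text \<open>The dimension is read off as the trace of the identity; characteristic 0 turns the
  equality of traces into one of natural numbers.\<close>

lemma frame_card_eq: fixes S :: "('a => 'k::field_char_0) set"
 assumes S: "lsp S" and K: "frame S K v x" and L: "frame S L w y" shows "card K = card L"
proof -
 have "(SUM k:K. x k (v k)) = (SUM l:L. y l (w l))" using frame_trace_eq[OF S K L, of "%f. f"] by (simp add: lmap_def)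
 moreover have "(SUM k:K. x k (v k)) = of_nat (card K)" "(SUM l:L. y l (w l)) = of_nat (card L)"
  using frameD(5)[OF K] frameD(5)[OF L] by simp_all
 ultimately show ?thesis by simp
qed

lemma frame_lin_indep: assumes "frame S K v x" "lsp S" "(%a. SUM k:K. c k * v k a) = (%_. 0)" "k \<in> K"
 shows "c k = 0"
proof -
 note K = frameD[OF assms(1)]
 have "x k (%a. SUM l:K. c l * v l a) = (SUM l:K. c l * x k (v l))" by (rule lfun_sum[OF assms(2) K(3)[OF assms(4)] K(2)])
 also have "... = (SUM l:K. if l = k then c k else 0)" using K(5)[OF assms(4)] by (intro sum.cong) auto
 also have "... = c k" using K(1) assms(4) by simp
 finally show ?thesis using assms(3) lfun_zero[OF assms(2) K(3)[OF assms(4)]] by simp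
qed

text \<open>Pivots are chosen at the entries of smallest 2-adic valuation below; the exchange step of
 that elimination is isolated here.\<close>

lemma pivot_extend: assumes S: "lsp S" and f: "f \<in> S" "f p = 1" and J: "pivot {h \<in> S. h p = 0} J b"
 defines "f' \<equiv> (%a. f a - (SUM j:J. f j * b j a))"
 shows "pivot S (insert p J) (%j. if j = p then f' else b j)" "p \<notin> J"
proof -
 note J = pivotD[OF J]
 show p: "p \<notin> J" using J(2,3) by fastforce
 have bS: "b j \<in> S" "b j p = 0" if "j \<in> J" for j using J(2)[OF that] by auto
 have f'S: "f' \<in> S" unfolding f'_def by (intro lsp_diff[OF S f(1)] lsp_sum[OF S] bS)
 have f'p: "f' p = 1" using f bS by (simp add: f'_def)
 have f'J: "f' i = 0" if "i \<in> J" for i proof -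
  have "(SUM j:J. f j * b j i) = (SUM j:J. if j = i then f i else 0)" using J(3)[OF that] by (intro sum.cong) auto
  thus ?thesis using that J(1) by (simp add: f'_def)
 qed
 have "h = (%a. SUM j:insert p J. h j * (if j = p then f' else b j) a)" if h: "h \<in> S" for h proof -
  define h' where "h' = (%a. h a + (- h p) * f' a)"
  have "h' \<in> {h \<in> S. h p = 0}" unfolding h'_def using lsp_addc[OF S h f'S, of "- h p"] f'p by simp
  hence "h' = (%a. SUM j:J. h' j * b j a)" by (rule J(4))
  moreover have "h' j = h j" if "j \<in> J" for j using f'J[OF that] by (simp add: h'_def)
  ultimately have h'_eq: "h' = (%a. SUM j:J. h j * b j a)" by simp
  show ?thesis proof
   fix a
   have "h a = h p * f' a + h' a" by (simp add: h'_def)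
   also have "... = h p * f' a + (SUM j:J. h j * b j a)" by (simp add: h'_eq)
   also have "(SUM j:J. h j * b j a) = (SUM j:J. h j * (if j = p then f' else b j) a)" using p by (intro sum.cong) auto
   finally show "h a = (SUM j:insert p J. h j * (if j = p then f' else b j) a)" using J(1) p by simp
  qed
 qed
 thus "pivot S (insert p J) (%j. if j = p then f' else b j)"
  unfolding pivot_def using J(1,3) bS f'S f'p f'J p by (auto simp: )
qed

section \<open>Rationals with odd denominator\<close>

text \<open>The integers localized at 2. The predicate \<open>zev\<close> below is membership in the
  maximal ideal, so congruence modulo 2 is expressed by \<open>zev\<close> of a difference.\<close>

definition zint :: "rat => bool" where
 "zint q \<longleftrightarrow> (\<exists>a b. odd b \<and> q = of_int a / of_int b)"

definition zev :: "rat => bool" where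
 "zev q \<longleftrightarrow> zint (q / 2)"

lemma zint_of_int [simp]: "zint (of_int a)" unfolding zint_def by (intro exI[of _ a] exI[of _ 1]) simp

lemma zint_simps [simp]: "zint 0" "zint 1" "zint (of_nat n)" "zint (numeral k)" "zint (of_bool P)"
 using zint_of_int[of 0] zint_of_int[of 1] zint_of_int[of "int n"] zint_of_int[of "numeral k"]
 by (auto simp del: zint_of_int)

lemma zint_add [intro]: "zint p ==> zint q ==> zint (p + q)"
proof -
 assume "zint p" "zint q"
 then obtain a b c d where "odd b" "odd d" "p = of_int a / of_int b" "q = of_int c / of_int d" unfolding zint_def by blast
 moreover from this have "b ~= 0" "d ~= 0" by auto
 ultimately have "odd (b * d)" "p + q = of_int (a * d + c * b) / of_int (b * d)" by (auto simp: field_simps)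
 thus ?thesis unfolding zint_def by blast
qed

lemma zint_mult [intro]: "zint p ==> zint q ==> zint (p * q)"
proof -
 assume "zint p" "zint q"
 then obtain a b c d where "odd b" "odd d" "p = of_int a / of_int b" "q = of_int c / of_int d" unfolding zint_def by blast
 hence "odd (b * d)" "p * q = of_int (a * c) / of_int (b * d)" by auto
 thus ?thesis unfolding zint_def by blast
qed

lemma zint_uminus [simp]: "zint (- p) \<longleftrightarrow> zint p"
 using zint_mult[of "-1" p] zint_mult[of "-1" "-p"] zint_of_int[of "-1"] by fastforce

lemma zint_diff [intro]: "zint p ==> zint q ==> zint (p - q)" using zint_add[of p "-q"] by simp

lemma zint_sum [intro]: "(\<And>k. k \<in> K ==> zint (f k)) ==> zint (sum f K)"
 by (induction K rule: infinite_finite_induct) auto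

lemma zint_prod [intro]: "(\<And>k. k \<in> K ==> zint (f k)) ==> zint (prod f K)"
 by (induction K rule: infinite_finite_induct) auto

lemma zint_power [intro]: "zint p ==> zint (p ^ n)" by (induction n) auto

lemma zev_zint: "zev q ==> zint q" unfolding zev_def using zint_mult[of 2 "q / 2"] by simp

lemma zev_0 [simp]: "zev 0" by (simp add: zev_def)

lemma zev_add [intro]: "zev p ==> zev q ==> zev (p + q)" unfolding zev_def by (auto simp: add_divide_distrib)

lemma zev_uminus [simp]: "zev (- p) \<longleftrightarrow> zev p" unfolding zev_def by (metis minus_divide_left zint_uminus)

lemma zev_diff [intro]: "zev p ==> zev q ==> zev (p - q)" using zev_add[of p "-q"] by simp

lemma zev_mult1 [intro]: "zev p ==> zint q ==> zev (p * q)" unfolding zev_def using zint_mult[of "p/2" q] by simp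

lemma zev_mult2 [intro]: "zint p ==> zev q ==> zev (p * q)" using zev_mult1[of q p] by (simp add: mult.commute)

lemma zev_sum [intro]: "(\<And>k. k \<in> K ==> zev (f k)) ==> zev (sum f K)"
 by (induction K rule: infinite_finite_induct) auto

lemma zev_double: "zint q ==> zev (2 * q)" by (simp add: zev_def)

lemma zev_of_int [simp]: "zev (of_int a) \<longleftrightarrow> even a"
proof
 assume "zev (of_int a)"
 then obtain c d where d: "odd d" "of_int a / 2 = (of_int c / of_int d :: rat)" unfolding zev_def zint_def by blast
 hence "d ~= 0" by auto
 with d have "(of_int (a * d) :: rat) = of_int (2 * c)" by (simp add: field_simps)
 hence "a * d = 2 * c" using of_int_eq_iff by blast
 thus "even a" using d(1) by (metis dvd_triv_left even_mult_iff)
next assume "even a"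
 then obtain c where "a = 2 * c" by blast
 thus "zev (of_int a)" by (simp add: zev_def)
qed

lemma zev_of_nat [simp]: "zev (of_nat n) \<longleftrightarrow> even n" using zev_of_int[of "int n"] by simp

lemma zev_1 [simp]: "\<not> zev 1" using zev_of_nat[of 1] by simp

lemma zint_cases: assumes "zint q" obtains "zev q" | "zev (q - 1)"
proof -
 obtain a b where ab: "odd b" "q = of_int a / of_int b" using assms unfolding zint_def by blast
 show thesis proof (cases "even a")
  case True then obtain c where "a = 2 * c" by blast hence "q / 2 = of_int c / of_int b" using ab by simp
  thus thesis using that(1) ab(1) unfolding zev_def zint_def by blast
 next case False
  hence "even (a - b)" using ab by simp
  then obtain c where "a - b = 2 * c" by blast
  moreover have "b ~= 0" using ab by auto
  hence "q - 1 = of_int (a - b) / of_int b" using ab by (simp add: field_simps)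
  ultimately have "(q - 1) / 2 = of_int c / of_int b" by simp
  thus thesis using that(2) ab(1) unfolding zev_def zint_def by blast
 qed
qed

lemma zev_mult_iff: "zint p ==> zint q ==> zev (p * q) \<longleftrightarrow> zev p \<or> zev q"
proof -
 assume pq: "zint p" "zint q"
 have "zev p \<or> zev q" if e: "zev (p * q)" proof (rule ccontr)
  assume "\<not> (zev p \<or> zev q)"
  hence "zev (p - 1)" "zev (q - 1)" using zint_cases pq by blast+
  hence "zev ((p - 1) * q + (q - 1))" using pq by blast
  hence "zev (p * q - 1)" by (simp add: algebra_simps)
  from zev_diff[OF e this] show False by simp
 qed
 with pq show ?thesis by blast
qed

lemma zint_inverse: assumes "zint q" "\<not> zev q" shows "zint (1 / q)" "\<not> zev (1 / q)"
proof -
 obtain a b where ab: "odd b" "q = of_int a / of_int b" using assms unfolding zint_def by blast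
 have "odd a" proof
  assume "even a"
  then obtain c where "a = 2 * c" by blast
  hence "q / 2 = of_int c / of_int b" using ab by simp
  thus False using assms(2) ab(1) unfolding zev_def zint_def by blast
 qed
 thus i: "zint (1 / q)" unfolding zint_def using ab by (intro exI[of _ b] exI[of _ a]) simp
 have "q ~= 0" using assms(2) by auto
 thus "\<not> zev (1 / q)" using zev_mult1[of "1/q" q] assms(1) by auto
qed

lemma zint_or_inverse: assumes "\<not> zint q" shows "zev (1 / q)"
proof -
 obtain a b where ab: "b > 0" "coprime a b" "q = of_int a / of_int b"
  by (metis quotient_of_coprime quotient_of_denom_pos quotient_of_div surj_pair)
 have "even b" using assms ab unfolding zint_def by blast
 then obtain c where c: "b = 2 * c" by blast
 have "odd a" using ab(2) \<open>even b\<close> by (meson coprime_common_divisor odd_one)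
 moreover have "1 / q / 2 = of_int c / of_int a" using ab c by simp
 ultimately show ?thesis unfolding zev_def zint_def by blast
qed

lemma zint_pow2_bound: assumes "q ~= 0" shows "\<exists>e. \<not> zint (q / 2 ^ e)"
proof -
 obtain a b where ab: "b > 0" "q = of_int a / of_int b" by (metis quotient_of_denom_pos quotient_of_div surj_pair)
 have a: "a ~= 0" using assms ab by auto
 \<comment> \<open>A nonzero integer is smaller in absolute value than 2 to the power of its
   absolute value, so this power cannot divide the numerator.\<close>
 define e where "e = nat \<bar>a\<bar>"
 have "\<not> zint (q / 2 ^ e)" proof
  assume "zint (q / 2 ^ e)"
  then obtain c d where cd: "odd d" "q / 2 ^ e = of_int c / of_int d" unfolding zint_def by blast
  hence "d ~= 0" by auto
  with cd ab have "(of_int (a * d) :: rat) = of_int (c * b * 2 ^ e)" by (simp add: field_simps)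
  hence "a * d = c * b * 2 ^ e" using of_int_eq_iff by blast
  hence "2 ^ e dvd a * d" by simp
  moreover have "coprime (2 ^ e) d" using cd(1) by simp
  ultimately have "2 ^ e dvd a" by (simp add: coprime_dvd_mult_left_iff)
  hence "2 ^ e \<le> \<bar>a\<bar>" using dvd_imp_le_int[OF a, of "2 ^ e"] by simp
  moreover have "\<bar>a\<bar> < 2 ^ e"  using of_nat_less_two_power[of e, where 'a=int] unfolding e_def by simp
  ultimately show False by simp
 qed
 thus ?thesis by blast
qed

lemma min_valuation: assumes "finite P" "P ~= {}" "\<And>q. q \<in> P ==> q ~= 0"
 obtains p where "p \<in> P" "\<And>q. q \<in> P ==> zint (q / p)" proof -
 have "\<exists>p\<in>P. \<forall>q\<in>P. zint (q / p)" using assms proof (induction P rule: finite_ne_induct)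
  case (singleton x) thus ?case by simp
 next case (insert x P)
  then obtain p where p: "p \<in> P" "\<forall>q\<in>P. zint (q / p)" by blast
  show ?case proof (cases "zint (x / p)")
   case True thus ?thesis using p by blast
  next case False
   hence i: "zint (p / x)" using zint_or_inverse[of "x / p"] zev_zint by simp
   have "zint (q / x)" if "q \<in> insert x P" for q proof (cases "q = x")
    case False hence "zint (q / p * (p / x))" using that p i by blast
    moreover have "p ~= 0" using p insert.prems by blast
    ultimately show ?thesis by simp
   qed (use insert.prems in simp)
   thus ?thesis by blast
  qed
 qed
 with that show thesis by blast
qed

text \<open>Elimination that always pivots at an entry of least 2-adic valuation never leaves the
  2-local integers. As coordinates are values at the pivots, the result is also a basis of the
  lattice of integral functions in \<open>S\<close>.\<close>

lemma integral_pivot: fixes S :: "('a => rat) set"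
 assumes "finite W" "lsp S" "\<And>f a. f \<in> S ==> a \<notin> W ==> f a = 0"
 shows "\<exists>J b. J \<subseteq> W \<and> pivot S J b \<and> (\<forall>j\<in>J. \<forall>a. zint (b j a))" using assms
proof (induction W arbitrary: S rule: finite_psubset_induct)
 case (psubset W) show ?case proof (cases "\<exists>f\<in>S. f ~= (%_. 0)")
  case False hence "pivot S {} (%_ _. 0)" unfolding pivot_def by auto thus ?thesis by blast
 next case True
  then obtain f0 where f0: "f0 \<in> S" "f0 ~= (%_. 0)" by blast
  define P where "P = f0 ` {a \<in> W. f0 a ~= 0}"
  obtain a0 where a0: "f0 a0 ~= 0" using f0(2) by blast
  hence "a0 \<in> W" using f0(1) psubset.prems(2) by blast
  with a0 have "P ~= {}" "finite P" "\<And>q. q \<in> P ==> q ~= 0" using psubset.hyps unfolding P_def by auto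
  then obtain q where q: "q \<in> P" "\<And>x. x \<in> P ==> zint (x / q)" using min_valuation[of P] by metis
  then obtain p where p: "p \<in> W" "f0 p = q" "q ~= 0" unfolding P_def by blast
  define f where "f = (%a. (1 / q) * f0 a)"
  have f: "f \<in> S" "f p = 1" unfolding f_def using lsp_scale[OF psubset.prems(1) f0(1), of "1 / q"] p by auto
  have fi: "zint (f a)" for a proof (cases "f0 a = 0")
   case False hence "f0 a \<in> P" using psubset.prems(2)[OF f0(1), of a] unfolding P_def by blast
   thus ?thesis using q(2)[of "f0 a"] unfolding f_def by simp
  qed (simp add: f_def)
  let ?S = "{h \<in> S. h p = 0}"
  have "lsp ?S" using psubset.prems(1) unfolding lsp_def by auto
  moreover have "h a = 0" if "h \<in> ?S" "a \<notin> W - {p}" for h a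
   using that psubset.prems(2)[of h a] by (cases "a = p") auto
  moreover have "W - {p} \<subset> W" using p by blast
  ultimately have "\<exists>J b. J \<subseteq> W - {p} \<and> pivot ?S J b \<and> (\<forall>j\<in>J. \<forall>a. zint (b j a))"
   by (intro psubset.IH)
  then obtain J b where J: "J \<subseteq> W - {p}" "pivot ?S J b" "\<forall>j\<in>J. \<forall>a. zint (b j a)"
   by (elim exE conjE)
  have "pivot S (insert p J) (%j. if j = p then (%a. f a - (SUM j:J. f j * b j a)) else b j)"
   by (rule pivot_extend(1)[OF psubset.prems(1) f J(2)])
  moreover have "\<forall>j\<in>insert p J. \<forall>a. zint ((if j = p then (%a. f a - (SUM j:J. f j * b j a)) else b j) a)"
   using J(3) fi by (auto intro!: zint_diff zint_sum zint_mult)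
  moreover have "insert p J \<subseteq> W" using J(1) p(1) by auto
  ultimately show ?thesis by (intro exI conjI)
 qed
qed

section \<open>Dimension counts\<close>

interpretation kf: vector_space "%(c :: 'k::field) (f :: 'a => 'k) x. c * f x"
 by unfold_locales (auto simp: fun_eq_iff algebra_simps)

lemma fun_sum_apply: "(SUM k:K. f k) a = (SUM k:K. f k a)" by (induction K rule: infinite_finite_induct) auto

lemma sum_of_bool_eq: fixes f :: "'a => 'b::comm_semiring_1"
 assumes "finite A" "a \<in> A" shows "(SUM x:A. of_bool (x = a) * f x) = f a" "(SUM x:A. f x * of_bool (x = a)) = f a"
proof -
 have "(SUM x:A. of_bool (x = a) * f x) = (SUM x:A. if x = a then f x else 0)" by (rule sum.cong) auto
 thus "(SUM x:A. of_bool (x = a) * f x) = f a" using assms by simp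
 thus "(SUM x:A. f x * of_bool (x = a)) = f a" by (simp add: mult.commute)
qed

text \<open>Independence of a family rather than of a set: a repeated vector is a
  dependence.\<close>

definition lindep :: "'i set => ('i => 'a => 'k::field) => bool" where
 "lindep L w \<longleftrightarrow> finite L \<and>
   (\<forall>c. (\<forall>a. (SUM l:L. c l * w l a) = 0) --> (\<forall>l\<in>L. c l = 0))"

lemma lindepD: "lindep L w ==> (\<And>a. (SUM l:L. c l * w l a) = 0) ==> l \<in> L ==> c l = 0"
 unfolding lindep_def by blast

lemma lindep_image: assumes "lindep L w"
 shows "inj_on w L" "kf.independent (w ` L)"
proof -
 have fin: "finite L" using assms unfolding lindep_def by blast
 show inj: "inj_on w L" proof (rule inj_onI, rule ccontr)
  fix k l assume kl: "k \<in> L" "l \<in> L" "w k = w l" "k ~= l"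
  let ?c = "%i. if i = k then 1 else if i = l then -1 else 0"
  have "(SUM i:L. ?c i * w i a) = 0" for a proof -
   have "(SUM i:L. ?c i * w i a) = (SUM i:{k, l}. ?c i * w i a)" using kl fin by (intro sum.mono_neutral_right) auto
   also have "... = 0" using kl by simp
   finally show ?thesis .
  qed
  from lindepD[OF assms this kl(1)] show False by simp
 qed
 show "kf.independent (w ` L)" proof
  assume "kf.dependent (w ` L)"
  then obtain u where u: "\<exists>v\<in>w ` L. u v ~= 0" "(SUM v:w ` L. (%x. u v * v x)) = 0"
   using kf.dependent_finite[of "w ` L"] fin by auto
  have "(SUM v:w ` L. (%x. u v * v x)) a = 0" for a by (simp add: u(2))
  hence "(SUM l:L. u (w l) * w l a) = 0" for a unfolding fun_sum_apply sum.reindex[OF inj] by simp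
  from lindepD[OF assms this] u(1) show False by blast
 qed
qed

lemma lindep_card_le: assumes "frame S K v x" "lindep L w" "\<And>l. l \<in> L ==> w l \<in> S"
 shows "card L \<le> card K"
proof -
 note K = frameD[OF assms(1)]
 have "w ` L \<subseteq> kf.span (v ` K)" proof
  fix f assume "f \<in> w ` L"
  hence "f = (%a. SUM k:K. x k f * v k a)" using K(4) assms(3) by blast
  also have "... = (SUM k:K. (%a. x k f * v k a))" by (rule ext) (simp only: fun_sum_apply)
  also have "... \<in> kf.span (v ` K)" by (intro kf.span_sum kf.span_scale kf.span_base) auto
  finally show "f \<in> kf.span (v ` K)" .
 qed
 hence "card (w ` L) \<le> card (v ` K)" using kf.independent_span_bound[OF _ lindep_image(2)[OF assms(2)]] K(1) by blast
 also have "... \<le> card K" using K(1) by (rule card_image_le)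
 finally show ?thesis using card_image[OF lindep_image(1)[OF assms(2)]] by simp
qed

text \<open>The new vector gets the index \<open>None\<close>. A relation with a nonzero coefficient
  there could be solved for \<open>f\<close>.\<close>

lemma lindep_extend_or_span: fixes f :: "'a => 'k::field"
 assumes "lindep L w" "\<nexists>c. f = (%a. SUM l:L. c l * w l a)"
 shows "lindep (insert None (Some ` L)) (case_option f w)"
proof -
 have fin: "finite L" using assms(1) unfolding lindep_def by blast
 have "\<forall>l\<in>insert None (Some ` L). c l = 0"
  if c: "\<forall>a. (SUM l:insert None (Some ` L). c l * case_option f w l a) = 0" for c proof -
  have c': "c None * f a + (SUM l:L. c (Some l) * w l a) = 0" for a
   using c[rule_format, of a] fin by (simp add: sum.reindex)
  have "c None = 0" proof (rule ccontr)
   assume ne: "c None ~= 0"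
   define d where "d = (%l. - (c (Some l) / c None))"
   have "f a = (SUM l:L. d l * w l a)" for a proof -
    have "f a = - (SUM l:L. c (Some l) * w l a) / c None" using c'[of a] ne by (simp add: field_simps eq_neg_iff_add_eq_0)
    thus ?thesis by (simp add: d_def sum_divide_distrib sum_negf)
   qed
   hence "\<exists>c. f = (%a. SUM l:L. c l * w l a)" by (intro exI[of _ d] ext)
   with assms(2) show False by (rule notE)
  qed
  moreover from this have "\<forall>l\<in>L. c (Some l) = 0" using lindepD[OF assms(1), of "%l. c (Some l)"] c' by simp
  ultimately show ?thesis by auto
 qed
 thus ?thesis unfolding lindep_def using fin by auto
qed

text \<open>A vector outside the span could be added to the family, which would then be larger than
  \<open>lindep_card_le\<close> allows. So the family spans, and independence makes its coordinates
  linear functionals.\<close>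

lemma lindep_frame: assumes S: "lsp S" and K: "frame S K v x" and L: "lindep L w" "\<And>l. l \<in> L ==> w l \<in> S"
  and card: "card L = card K"
 shows "\<exists>y. frame S L w y"
proof -
 have fin: "finite L" using L(1) unfolding lindep_def by blast
 have ex: "\<exists>c. f = (%a. SUM l:L. c l * w l a)" if f: "f \<in> S" for f proof (rule ccontr)
  assume "\<not> ?thesis"
  from lindep_extend_or_span[OF L(1) this]
  have "card (insert None (Some ` L)) \<le> card K" by (rule lindep_card_le[OF K]) (use f L(2) in auto)
  thus False using fin card by (simp add: card_image)
 qed
 define y where "y = (%l f. (SOME c. f = (%a. SUM l:L. c l * w l a)) l)"
 have y: "f = (%a. SUM l:L. y l f * w l a)" if "f \<in> S" for f unfolding y_def by (rule someI_ex[OF ex[OF that]])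
 have uniq: "c l = y l f" if "f \<in> S" "f = (%a. SUM l:L. c l * w l a)" "l \<in> L" for c l f proof -
  have "(SUM l:L. (c l - y l f) * w l a) = 0" for a using fun_cong[OF y[OF that(1)], of a] fun_cong[OF that(2), of a]
   by (simp add: left_diff_distrib sum_subtractf)
  from lindepD[OF L(1) this that(3)] show ?thesis by simp
 qed
 have "lfun S (y l)" if l: "l \<in> L" for l unfolding lfun_def proof (intro ballI allI)
  fix f g c assume fg: "f \<in> S" "g \<in> S"
  have "(%a. f a + c * g a) = (%a. SUM l:L. (y l f + c * y l g) * w l a)"
   using fun_cong[OF y[OF fg(1)]] fun_cong[OF y[OF fg(2)]]
   by (intro ext) (simp add: ring_distribs sum.distrib sum_distrib_left mult.assoc)
  from uniq[OF lsp_addc[OF S fg] this l]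
  show "y l (%a. f a + c * g a) = y l f + c * y l g" by simp
 qed
 moreover have "y k (w l) = of_bool (k = l)" if "k \<in> L" "l \<in> L" for k l proof -
  have "w l = (%a. SUM i:L. of_bool (i = l) * w i a)"
   using that fin by (intro ext) (simp add: of_bool_def if_distrib[of "%c. c * _"] cong: if_cong)
  from uniq[OF L(2)[OF that(2)] this that(1)] show ?thesis by simp
 qed
 ultimately show ?thesis unfolding frame_def using fin L(2) y by blast
qed

section \<open>Traces on spaces of finitely supported functions and ranks of idempotents\<close>

definition tr :: "('a => rat) set => (('a => rat) => ('a => rat)) => rat" where
 "tr S F = (SOME t. \<exists>J b. pivot S J b \<and> t = (SUM j:J. F (b j) j))"

definition fdsp :: "'a set => ('a => rat) set => bool" where
 "fdsp W S \<longleftrightarrow> finite W \<and> lsp S \<and> (\<forall>f\<in>S. \<forall>a. a \<notin> W --> f a = 0)"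

lemma fdspD: assumes "fdsp W S"
 shows "finite W" "lsp S" "\<And>f a. f \<in> S ==> a \<notin> W ==> f a = 0" using assms unfolding fdsp_def by blast+

lemma fdsp_pivot: assumes "fdsp W S"
 obtains J b where "J \<subseteq> W" "pivot S J b" "\<And>j a. j \<in> J ==> zint (b j a)" proof -
 have "\<exists>J b. J \<subseteq> W \<and> pivot S J b \<and> (\<forall>j\<in>J. \<forall>a. zint (b j a))"
  by (rule integral_pivot[OF fdspD(1,2)[OF assms]]) (rule fdspD(3)[OF assms])
 thus thesis using that by meson
qed

lemma tr_frame: assumes S: "fdsp W S" and K: "frame S K v x"
  and F: "lmap S F" "\<And>f. f \<in> S ==> F f \<in> S"
 shows "tr S F = (SUM k:K. x k (F (v k)))"
proof -
 obtain J b where "pivot S J b" by (rule fdsp_pivot[OF S])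
 hence "\<exists>t. \<exists>J b. pivot S J b \<and> t = (SUM j:J. F (b j) j)"
  by (intro exI[of _ "SUM j:J. F (b j) j"] exI[of _ J] exI[of _ b]) simp
 hence "\<exists>J b. pivot S J b \<and> tr S F = (SUM j:J. F (b j) j)" unfolding tr_def by (rule someI_ex)
 then obtain J b where Jb: "pivot S J b" "tr S F = (SUM j:J. F (b j) j)" by (elim exE conjE)
 show ?thesis unfolding Jb(2) by (rule frame_trace_eq[OF fdspD(2)[OF S] pivot_frame[OF Jb(1)] K F])
qed

text \<open>The space is the direct sum of image and kernel. Pivot bases of the two form a frame, in
  which the image contributes its dimension to the trace and the kernel nothing.\<close>

lemma idempotent_trace: assumes S: "fdsp W S" and F: "lmap S F" "\<And>f. f \<in> S ==> F f \<in> S"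
  and idem: "\<And>f. f \<in> S ==> F (F f) = F f"
 obtains J b where "fdsp W (F ` S)" "pivot (F ` S) J b" "tr S F = of_nat (card J)" proof -
 note lsp = fdspD(2)[OF S]
 have lin: "F (%a. f a + c * g a) = (%a. F f a + c * F g a)" if "f \<in> S" "g \<in> S" for f g c
  using F(1) that unfolding lmap_def by blast
 have I: "lsp (F ` S)" unfolding lsp_def proof (intro conjI ballI allI)
  show "(%_. 0) \<in> F ` S" using lmap_zero[OF lsp F(1)] by (intro image_eqI[OF _ lsp_zero[OF lsp]]) simp
  fix f g c assume "f \<in> F ` S" "g \<in> F ` S"
  then obtain f' g' where fg: "f' \<in> S" "g' \<in> S" "f = F f'" "g = F g'" by blast
  show "(%a. f a + c * g a) \<in> F ` S" by (rule image_eqI[OF _ lsp_addc[OF lsp fg(1,2), of c]]) (simp add: fg lin)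
 qed
 hence fI: "fdsp W (F ` S)" using S F(2) unfolding fdsp_def by blast
 let ?N = "{f \<in> S. F f = (%_. 0)}"
 have "lsp ?N" using lsp lmap_zero[OF lsp F(1)] lin unfolding lsp_def by auto
 hence fN: "fdsp W ?N" using S unfolding fdsp_def by blast
 obtain J b where J: "pivot (F ` S) J b" by (rule fdsp_pivot[OF fI])
 obtain L d where L: "pivot ?N L d" by (rule fdsp_pivot[OF fN])
 note JD = pivotD[OF J] and LD = pivotD[OF L]
 have bS: "b j \<in> S" "F (b j) = b j" if "j \<in> J" for j using JD(2)[OF that] F(2) idem by auto
 have dS: "d j \<in> S" "F (d j) = (%_. 0)" if "j \<in> L" for j using LD(2)[OF that] by auto
 define x where "x = case_sum (%j f. F f j) (%l f. f l - F f l)"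
 have "frame S (J <+> L) (case_sum b d) x" unfolding frame_def proof (intro conjI ballI)
  show "finite (J <+> L)" using JD(1) LD(1) by simp
  show "case_sum b d k \<in> S" if "k \<in> J <+> L" for k using that bS dS by auto
  show "lfun S (x k)" if "k \<in> J <+> L" for k using that lin unfolding lfun_def x_def by (auto simp: algebra_simps)
  show "x k (case_sum b d l) = of_bool (k = l)" if "k \<in> J <+> L" "l \<in> J <+> L" for k l
   using that bS dS JD(3) LD(3) unfolding x_def by auto
  fix f assume f: "f \<in> S"
  have "(%a. f a + (-1) * F f a) \<in> ?N"
   using f lsp_addc[OF lsp f F(2)[OF f], of "-1"] lin[OF f F(2)[OF f], of "-1"] idem[OF f] by simp
  note N = fun_cong[OF LD(4)[OF this]]
  have eq1: "f a - F f a = (SUM j:L. (f j - F f j) * d j a)" for a using N[of a] by simp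
  have eq2: "F f a = (SUM j:J. F f j * b j a)" for a by (rule fun_cong[OF JD(4)[OF imageI[OF f]]])
  show "f = (%a. SUM k:J <+> L. x k f * case_sum b d k a)" proof
   fix a
   have "f a = F f a + (f a - F f a)" by simp
   also have "... = (SUM k:J <+> L. x k f * case_sum b d k a)"
    by (subst eq1, subst eq2) (use JD(1) LD(1) in \<open>simp add: sum.Plus x_def\<close>)
   finally show "f a = (SUM k:J <+> L. x k f * case_sum b d k a)" .
  qed
 qed
 from tr_frame[OF S this F] have "tr S F = (SUM j:J. F (F (b j)) j) + (SUM l:L. F (d l) l - F (F (d l)) l)"
  using JD(1) LD(1) by (simp add: sum.Plus x_def)
 also have "... = of_nat (card J)" using bS dS JD(3) lmap_zero[OF lsp F(1)] by simp
 finally show thesis by (rule that[OF fI J])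
qed

section \<open>Polytabloids\<close>

text \<open>A tabloid is encoded by the word sending an entry to its row (and 0 outside the entries), a
 tableau by the map sending an entry to its cell.\<close>

definition symg :: "nat => word set" where
 "symg n = {g. g permutes {1..n}}"

definition ga :: "word => (word => 'k) => (word => 'k)" where
 "ga g f = (%a. f (a o g))"

definition young :: "nat => cells => bool" where
 "young n D \<longleftrightarrow> finite D \<and> card D = n \<and>
   (\<forall>i j i' j'. (i, j) \<in> D \<and> i' \<le> i \<and> j' \<le> j --> (i', j') \<in> D)"

definition rowlen :: "cells => nat => nat" where
 "rowlen D i = card {j. (i, j) \<in> D}"

definition wd :: "nat => cells => word set" where
 "wd n D = {a. (\<forall>x. x \<notin> {1..n} --> a x = 0) \<and> (\<forall>i. card {x \<in> {1..n}. a x = i} = rowlen D i)}"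

definition tab :: "nat => cells => (nat => nat \<times> nat) => bool" where
 "tab n D p \<longleftrightarrow> bij_betw p {1..n} D"

definition rw :: "nat => (nat => nat \<times> nat) => nat => nat" where
 "rw n p = (%x. if x \<in> {1..n} then fst (p x) else 0)"

definition colst :: "nat => (nat => nat \<times> nat) => word set" where
 "colst n p = {\<sigma> \<in> symg n. \<forall>x\<in>{1..n}. snd (p (\<sigma> x)) = snd (p x)}"

definition pt :: "nat => (nat => nat \<times> nat) => wfun" where
 "pt n p = (%a. \<Sum>\<sigma>\<in>colst n p. of_int (sign \<sigma>) * of_bool (a = rw n p o inv \<sigma>))"

definition samecol :: "nat => (nat => nat \<times> nat) => nat => nat => bool" where
 "samecol n p x y \<longleftrightarrow> x \<in> {1..n} \<and> y \<in> {1..n} \<and> x ~= y \<and> snd (p x) = snd (p y)"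

text \<open>Alternation is required for transpositions of two entries of one column only;
  \<open>calt_colst\<close> extends it to the column stabilizer.\<close>

definition calt :: "nat => (nat => nat \<times> nat) => wfun => bool" where
 "calt n p f \<longleftrightarrow> (\<forall>x y. samecol n p x y --> (\<forall>a. f (a o transpose x y) = - f a))"

definition specht :: "nat => cells => wfun set" where
 "specht n D = kf.span {pt n p | p. tab n D p}"

lemma symD: assumes "g \<in> symg n"
 shows "g permutes {1..n}" "bij g" "permutation g" "inv g \<in> symg n"
  "g o inv g = id" "inv g o g = id" "inv (inv g) = g" using assms unfolding symg_def
 by (auto simp: permutes_bij permutes_inv permutes_inv_o permutes_inv_inv permutation_permutes)

lemma sym_comp: "g \<in> symg n ==> h \<in> symg n ==> g o h \<in> symg n"
 unfolding symg_def by (simp add: permutes_compose)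

lemma sym_id [simp]: "id \<in> symg n" unfolding symg_def by (simp add: permutes_id)

lemma sym_transpose: "x \<in> {1..n} ==> y \<in> {1..n} ==> transpose x y \<in> symg n"
 unfolding symg_def by (simp add: permutes_swap_id)

lemma finite_sym [simp]: "finite (symg n)" unfolding symg_def by (simp add: finite_permutations)

lemma card_sym: "card (symg n) = fact n" unfolding symg_def by (rule card_permutations) auto

lemma sym_mono: "m \<le> n ==> symg m \<subseteq> symg n"
 unfolding symg_def by (intro Collect_mono impI) (erule permutes_subset, simp)

lemma sym_in: "g \<in> symg n ==> g x \<in> {1..n} \<longleftrightarrow> x \<in> {1..n}"
 unfolding symg_def by (intro permutes_in_image) simp

lemma sym_out: "g \<in> symg n ==> x \<notin> {1..n} ==> g x = x"
 unfolding symg_def mem_Collect_eq by (rule permutes_not_in)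

lemma inv_comp: "g \<in> symg n ==> h \<in> symg n ==> inv (g o h) = inv h o inv g"
 using symD(2) by (simp add: o_inv_distrib)

lemma bij_sym_left: "g \<in> symg n ==> bij_betw (%h. g o h) (symg n) (symg n)"
 by (rule bij_betwI[where g = "%h. inv g o h"])
   (auto simp: sym_comp symD o_assoc)

lemma bij_sym_right: "g \<in> symg n ==> bij_betw (%h. h o g) (symg n) (symg n)"
 by (rule bij_betwI[where g = "%h. h o inv g"])
   (auto simp: sym_comp symD comp_assoc)

lemma bij_sym_inv: "bij_betw inv (symg n) (symg n)" by (rule bij_betwI[where g = inv]) (auto simp: symD)

lemma sum_sym_left: "g \<in> symg n ==> (SUM h:symg n. F (g o h)) = (SUM h:symg n. F h)"
 by (rule sum.reindex_bij_betw[OF bij_sym_left])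

lemma sum_sym_right: "g \<in> symg n ==> (SUM h:symg n. F (h o g)) = (SUM h:symg n. F h)"
 by (rule sum.reindex_bij_betw[OF bij_sym_right])

lemma sum_sym_inv: "(SUM h:symg n. F (inv h)) = (SUM h:symg n. F h)" by (rule sum.reindex_bij_betw[OF bij_sym_inv])

lemma ga_ga: "ga g (ga h f) = ga (g o h) f" by (simp add: ga_def o_assoc)

lemma ga_id [simp]: "ga id f = f" by (simp add: ga_def)

lemma ga_inv: "g \<in> symg n ==> ga g (ga (inv g) f) = f" "g \<in> symg n ==> ga (inv g) (ga g f) = f"
 by (simp_all add: ga_ga symD)

lemma lmap_ga: "lmap S (ga g)" unfolding lmap_def ga_def by simp

lemma youngD: assumes "young n D"
 shows "finite D" "card D = n" "\<And>i j i' j'. (i, j) \<in> D ==> i' \<le> i ==> j' \<le> j ==> (i', j') \<in> D"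
 using assms unfolding young_def by blast+

lemma tab_exists: "young n D ==> \<exists>p. tab n D p"
 unfolding tab_def using ex_bij_betw_nat_finite_1[of D] youngD(1,2) by blast

lemma tabD: assumes "tab n D p"
 shows "x \<in> {1..n} ==> p x \<in> D" "x \<in> {1..n} ==> y \<in> {1..n} ==> p x = p y ==> x = y"
  "c \<in> D ==> \<exists>x\<in>{1..n}. p x = c"
 using assms unfolding tab_def bij_betw_def inj_on_def by (blast, blast, blast)

lemma wd_out: "a \<in> wd n D ==> x \<notin> {1..n} ==> a x = 0"
 unfolding wd_def mem_Collect_eq by (elim conjE, erule allE, erule mp)

lemma wd_card: "a \<in> wd n D ==> card {x \<in> {1..n}. a x = i} = rowlen D i"
 unfolding wd_def mem_Collect_eq by (elim conjE, erule allE)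

lemma wd_comp: assumes "a \<in> wd n D" "g \<in> symg n" shows "a o g \<in> wd n D"
proof -
 have "card {x \<in> {1..n}. a (g x) = i} = card {x \<in> {1..n}. a x = i}" for i proof (rule bij_betw_same_card[of g])
  show "bij_betw g {x \<in> {1..n}. a (g x) = i} {x \<in> {1..n}. a x = i}" proof (rule bij_betwI')
   show "\<exists>x\<in>{x \<in> {1..n}. a (g x) = i}. y = g x" if "y \<in> {x \<in> {1..n}. a x = i}" for y
    using that sym_in[OF symD(4)[OF assms(2)], of y] pointfree_idE[OF symD(5)[OF assms(2)], of y]
    by (intro bexI[of _ "inv g y"]) auto
  qed (use bij_is_inj[OF symD(2)[OF assms(2)]] sym_in[OF assms(2)] in \<open>auto simp: inj_def\<close>)
 qed
 thus ?thesis using assms sym_out[OF assms(2)] unfolding wd_def by simp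
qed

lemma wd_comp_iff: "g \<in> symg n ==> a o g \<in> wd n D \<longleftrightarrow> a \<in> wd n D"
 using wd_comp[of a n D g] wd_comp[of "a o g" n D "inv g"] symD[of g n] by (auto simp: comp_assoc)

lemma finite_wd: assumes "finite D" shows "finite (wd n D)"
proof -
 have "a x \<in> fst ` D" if a: "a \<in> wd n D" "x \<in> {1..n}" for a x proof -
  have "{y \<in> {1..n}. a y = a x} ~= {}" using a(2) by blast
  hence "card {y \<in> {1..n}. a y = a x} ~= 0"  by (subst card_0_eq) simp_all
  moreover have "card {y \<in> {1..n}. a y = a x} = rowlen D (a x)" by (rule wd_card[OF a(1)])
  ultimately have "rowlen D (a x) ~= 0" by (rule subst[rotated])
  hence "{j. (a x, j) \<in> D} ~= {}" unfolding rowlen_def by (metis card.empty)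
  thus ?thesis by force
 qed
 hence "wd n D \<subseteq> {f. \<forall>x. (x \<in> {1..n} --> f x \<in> fst ` D) \<and> (x \<notin> {1..n} --> f x = 0)}"
  using wd_out by (intro subsetI CollectI allI conjI impI)
 moreover have "finite \<dots>" by (rule finite_set_of_finite_funs) (use assms in auto)
 ultimately show ?thesis by (rule finite_subset)
qed

lemma rw_wd: assumes "tab n D p" shows "rw n p \<in> wd n D"
proof -
 have "card {x \<in> {1..n}. fst (p x) = i} = card {j. (i, j) \<in> D}" for i
 proof (rule bij_betw_same_card[of "%x. snd (p x)"], rule bij_betwI')
  show "\<exists>x\<in>{x \<in> {1..n}. fst (p x) = i}. j = snd (p x)" if "j \<in> {j. (i, j) \<in> D}" for j
   using that tabD(3)[OF assms, of "(i, j)"] by force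
  show "snd (p x) \<in> {j. (i, j) \<in> D}" if "x \<in> {x \<in> {1..n}. fst (p x) = i}" for x
   using that tabD(1)[OF assms, of x] by auto
  show "snd (p x) = snd (p y) \<longleftrightarrow> x = y"
   if "x \<in> {x \<in> {1..n}. fst (p x) = i}" "y \<in> {x \<in> {1..n}. fst (p x) = i}" for x y
   using that tabD(2)[OF assms, of x y] by (auto simp: prod_eq_iff)
 qed
 moreover have "{x \<in> {1..n}. rw n p x = i} = {x \<in> {1..n}. fst (p x) = i}" for i by (auto simp: rw_def)
 ultimately show ?thesis unfolding wd_def rowlen_def by (auto simp: rw_def)
qed

text \<open>Compare with the initial segment of the same size h: the elements outside it are at
  least h, and the numbers they replace are equally many and smaller than h.\<close>

lemma sum_nat_set_ge: fixes A :: "nat set"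
 assumes "finite A" shows "\<Sum>{..<card A} \<le> \<Sum>A" "\<Sum>A = \<Sum>{..<card A} ==> A = {..<card A}"
proof -
 let ?h = "card A" let ?B = "{..<?h}"
 have eq: "\<Sum>A = \<Sum>(A \<inter> ?B) + \<Sum>(A - ?B)" "\<Sum>?B = \<Sum>(A \<inter> ?B) + \<Sum>(?B - A)"
  using sum.Int_Diff[OF assms, of "%x. x" ?B] sum.Int_Diff[of ?B "%x. x" A] by (simp_all add: Int_commute)
 have c: "card (A - ?B) = card (?B - A)"
  using card_Diff_subset_Int[of A ?B] card_Diff_subset_Int[of ?B A] assms by (simp add: Int_commute)
 have l: "card (A - ?B) * ?h \<le> \<Sum>(A - ?B)" using sum_mono[of "A - ?B" "%_. ?h" "%x. x"] by auto
 have u: "\<Sum>(?B - A) + card (?B - A) \<le> card (?B - A) * ?h" proof -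
  have "\<Sum>(?B - A) + card (?B - A) = (SUM x:?B - A. x + 1)" by (simp only: sum.distrib card_eq_sum)
  also have "... \<le> (SUM x:?B - A. ?h)" by (intro sum_mono) auto
  finally show ?thesis by simp
 qed
 show "\<Sum>?B \<le> \<Sum>A" using eq c l u by simp
 assume "\<Sum>A = \<Sum>?B"
 hence "card (A - ?B) = 0" using eq c l[unfolded c] u by linarith
 hence "A \<subseteq> ?B" using assms by simp
 thus "A = ?B" by (intro card_subset_eq) auto
qed

lemma sum_by_value: fixes a :: "'x => nat"
 assumes "finite A" "\<And>x. x \<in> A ==> a x < N" shows "(SUM x:A. a x) = (\<Sum>i<N. i * card {x \<in> A. a x = i})"
proof -
 have "(SUM x:A. a x) = (SUM x:A. \<Sum>i<N. i * of_bool (a x = i))"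
  using assms by (intro sum.cong refl) (simp add: of_bool_def if_distrib cong: if_cong)
 also have "... = (\<Sum>i<N. i * (SUM x:A. of_bool (a x = i)))" by (subst sum.swap) (simp add: sum_distrib_left)
 also have "... = (\<Sum>i<N. i * card {x \<in> A. a x = i})" using assms(1) by (simp add: sum.If_cases of_bool_def Int_def)
 finally show ?thesis .
qed

lemma wd_sum_eq: assumes "finite D" "a \<in> wd n D" "b \<in> wd n D" shows "(\<Sum>x=1..n. a x) = (\<Sum>x=1..n. b x)"
proof -
 obtain N where N: "\<forall>y\<in>a ` {1..n} \<union> b ` {1..n}. y < N"
  using finite_nat_set_iff_bounded[of "a ` {1..n} \<union> b ` {1..n}"] by auto
 have "(SUM x:{1..n}. c x) = (\<Sum>i<N. i * rowlen D i)" if "c \<in> {a, b}" for c proof -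
  have "(SUM x:{1..n}. c x) = (\<Sum>i<N. i * card {x \<in> {1..n}. c x = i})" by (rule sum_by_value) (use N that in auto)
  moreover have "card {x \<in> {1..n}. c x = i} = rowlen D i" for i proof -
   have "c \<in> wd n D" using that assms(2,3) by (elim insertE) auto
   thus ?thesis by (rule wd_card)
  qed
  ultimately show ?thesis by simp
 qed
 from this[of a] this[of b] show ?thesis by simp
qed

lemma down_closed_nat: assumes "finite (A :: nat set)" "\<And>i i'. i \<in> A ==> i' \<le> i ==> i' \<in> A"
 shows "A = {..<card A}"
proof (cases "A = {}")
 case False
 have "A = {..Max A}"
  by (intro equalityI subsetI) (simp_all add: Max_ge[OF assms(1)] assms(2)[OF Max_in[OF assms(1) False]])
 from arg_cong[OF this, of card] have "card A = Suc (Max A)" by simp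
 with \<open>A = {..Max A}\<close> show ?thesis by (simp add: lessThan_Suc_atMost)
qed simp

lemma rw_column_image: assumes "young n D" "tab n D p"
 defines "C \<equiv> %c. {x \<in> {1..n}. snd (p x) = c}"
 shows "inj_on (rw n p) (C c)" "rw n p ` C c = {..<card (C c)}"
proof -
 show inj: "inj_on (rw n p) (C c)" proof (rule inj_onI)
  fix x y assume xy: "x \<in> C c" "y \<in> C c" "rw n p x = rw n p y"
  hence "p x = p y" by (simp add: C_def rw_def prod_eq_iff)
  thus "x = y" using xy by (intro tabD(2)[OF assms(2)]) (auto simp: C_def)
 qed
 have img: "rw n p ` C c = {i. (i, c) \<in> D}" proof (intro equalityI subsetI)
  fix i assume "i \<in> rw n p ` C c"
  then obtain x where "x \<in> {1..n}" "snd (p x) = c" "i = fst (p x)" by (auto simp: C_def rw_def)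
  thus "i \<in> {i. (i, c) \<in> D}" using tabD(1)[OF assms(2), of x] by auto
 next fix i assume "i \<in> {i. (i, c) \<in> D}"
  hence "(i, c) \<in> D" by simp
  from tabD(3)[OF assms(2) this] obtain x where "x \<in> {1..n}" "p x = (i, c)" by (elim bexE)
  thus "i \<in> rw n p ` C c" by (intro image_eqI[of _ _ x]) (auto simp: C_def rw_def)
 qed
 have fin: "finite {i. (i, c) \<in> D}"
  using finite_imageI[OF youngD(1)[OF assms(1)], of fst] by (rule rev_finite_subset) force
 have h: "{i. (i, c) \<in> D} = {..<card {i. (i, c) \<in> D}}" proof (rule down_closed_nat[OF fin])
  fix i i' assume "i \<in> {i. (i, c) \<in> D}" "i' \<le> i"
  thus "i' \<in> {i. (i, c) \<in> D}" using youngD(3)[OF assms(1), of i c i' c] by simp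
 qed
 have cc: "card (C c) = card {i. (i, c) \<in> D}" using card_image[OF inj] unfolding img by (rule sym)
 show "rw n p ` C c = {..<card (C c)}" unfolding img cc by (rule h)
qed

text \<open>A word of the right content with distinct letters in every column of a tableau has the
 smallest possible sum in each column, so it is a column rearrangement of the row word.\<close>

lemma column_rearrangement: assumes D: "young n D" "tab n D p" and a: "a \<in> wd n D"
  and dist: "\<And>x y. samecol n p x y ==> a x ~= a y"
 shows "\<exists>\<sigma>\<in>colst n p. a = rw n p o inv \<sigma>"
proof -
 define C where "C = (%c. {x \<in> {1..n}. snd (p x) = c})"
 let ?Cs = "(%x. snd (p x)) ` {1..n}"
 have fC: "finite (C c)" for c unfolding C_def by simp
 have rwC: "inj_on (rw n p) (C c)" "rw n p ` C c = {..<card (C c)}" for c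
  using rw_column_image[OF D, of c] unfolding C_def by auto
 have aC: "inj_on a (C c)" for c proof (rule inj_onI, rule ccontr)
  fix x y assume xy: "x \<in> C c" "y \<in> C c" "a x = a y" "x ~= y"
  hence "samecol n p x y" by (simp add: C_def samecol_def)
  from dist[OF this] xy(3) show False by simp
 qed
 have ca: "card (a ` C c) = card (C c)" for c by (rule card_image[OF aC])
 have split: "(\<Sum>x=1..n. f x) = (SUM c:?Cs. SUM x:C c. f x)" for f :: word unfolding C_def by (rule sum.image_gen) simp
 have sa: "(SUM x:C c. a x) = \<Sum>(a ` C c)" for c using sum.reindex[OF aC, of "%x. x"] by simp
 have sr: "(SUM x:C c. rw n p x) = \<Sum>{..<card (C c)}" for c using sum.reindex[OF rwC(1), of "%x. x" c] rwC(2) by simp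
 have le: "(SUM x:C c. rw n p x) \<le> (SUM x:C c. a x)" for c
  using sum_nat_set_ge(1)[of "a ` C c"] fC ca unfolding sa sr by simp
 have tot: "(SUM c:?Cs. SUM x:C c. rw n p x) = (SUM c:?Cs. SUM x:C c. a x)"
  using wd_sum_eq[OF youngD(1)[OF D(1)] a rw_wd[OF D(2)]] unfolding split by simp
 have imgC: "a ` C c = rw n p ` C c" for c proof (cases "c \<in> ?Cs")
  case True
  have "(SUM x:C c. rw n p x) = (SUM x:C c. a x)" using sum_mono_inv[OF tot le True] by simp
  hence "a ` C c = {..<card (a ` C c)}" by (intro sum_nat_set_ge(2)) (use fC ca sa sr in auto)
  thus ?thesis using ca rwC(2) by simp
 next case False
  hence "C c = {}" by (auto simp: C_def)
  thus ?thesis by simp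
 qed
 define \<sigma> where "\<sigma> = (%x. if x \<in> {1..n} then inv_into (C (snd (p x))) a (rw n p x) else x)"
 have \<sigma>: "\<sigma> x \<in> C (snd (p x))" "a (\<sigma> x) = rw n p x" if "x \<in> {1..n}" for x proof -
  have "x \<in> C (snd (p x))" using that by (simp add: C_def)
  hence "rw n p x \<in> a ` C (snd (p x))" unfolding imgC by blast
  thus "\<sigma> x \<in> C (snd (p x))" "a (\<sigma> x) = rw n p x"
   using that inv_into_into[of "rw n p x" a "C (snd (p x))"]
    f_inv_into_f[of "rw n p x" a "C (snd (p x))"] by (simp_all add: \<sigma>_def)
 qed
 have "inj_on \<sigma> {1..n}" proof (rule inj_onI)
  fix x y assume xy: "x \<in> {1..n}" "y \<in> {1..n}" "\<sigma> x = \<sigma> y"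
  hence "snd (p x) = snd (p y)" "rw n p x = rw n p y" using \<sigma>[OF xy(1)] \<sigma>[OF xy(2)] by (auto simp: C_def)
  thus "x = y" using xy tabD(2)[OF D(2), of x y] by (auto simp: rw_def prod_eq_iff)
 qed
 moreover have "\<sigma> ` {1..n} \<subseteq> {1..n}" using \<sigma> by (auto simp: C_def)
 ultimately have "bij_betw \<sigma> {1..n} {1..n}" by (simp add: bij_betw_def endo_inj_surj)
 hence perm: "\<sigma> \<in> symg n"
  unfolding symg_def mem_Collect_eq by (rule bij_imp_permutes) (simp only: \<sigma>_def if_False)
 have "\<sigma> \<in> colst n p" unfolding colst_def using perm \<sigma>(1) by (auto simp: C_def)
 moreover have "a o \<sigma> = rw n p" proof
  fix x show "(a o \<sigma>) x = rw n p x" using \<sigma>(2)[of x] wd_out[OF a, of x] sym_out[OF perm, of x]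
   by (cases "x \<in> {1..n}") (auto simp: rw_def)
 qed
 hence "rw n p o inv \<sigma> = a o (\<sigma> o inv \<sigma>)" by (simp add: o_assoc)
 hence "a = rw n p o inv \<sigma>" using symD(5)[OF perm] by simp
 ultimately show ?thesis by blast
qed

lemma colst_sym: "\<sigma> \<in> colst n p ==> \<sigma> \<in> symg n" by (simp add: colst_def)

text \<open>Induction on the number of moved points: composing with
  \<open>transpose x (\<sigma> x)\<close>, which swaps two entries of one column, fixes
  \<open>x\<close> and moves no new point.\<close>

lemma calt_colst: assumes "calt n p f" "\<sigma> \<in> colst n p"
 shows "f (b o inv \<sigma>) = of_int (sign \<sigma>) * f b" using assms(2)
proof (induction "card {x. \<sigma> x ~= x}" arbitrary: \<sigma> b rule: less_induct)
 case less
 note s = colst_sym[OF less.prems]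
 have fin: "finite {x. \<sigma> x ~= x}" by (rule finite_subset[of _ "{1..n}"]) (use sym_out[OF s] in blast, simp)
 show ?case proof (cases "\<sigma> = id")
  case False then obtain x where x: "\<sigma> x ~= x" by (auto simp: fun_eq_iff)
  define t where "t = transpose x (\<sigma> x)"
  have xin: "x \<in> {1..n}" "\<sigma> x \<in> {1..n}" using x sym_out[OF s] sym_in[OF s, of x] by blast+
  hence sc: "samecol n p x (\<sigma> x)" using x less.prems by (auto simp: samecol_def colst_def)
  have t: "t \<in> symg n" unfolding t_def by (rule sym_transpose[OF xin])
  have tt: "t o t = id" "inv t = t" unfolding t_def by (simp_all add: inv_transpose_eq)
  define \<tau> where "\<tau> = t o \<sigma>"
  have \<sigma>: "\<sigma> = t o \<tau>" unfolding \<tau>_def by (simp add: o_assoc tt)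
  have \<tau>s: "\<tau> \<in> symg n" unfolding \<tau>_def by (rule sym_comp[OF t s])
  have "snd (p (t y)) = snd (p y)" for y using sc unfolding t_def samecol_def by (simp add: transpose_def)
  hence \<tau>: "\<tau> \<in> colst n p" using \<tau>s less.prems unfolding colst_def \<tau>_def by simp
  have "{y. \<tau> y ~= y} \<subset> {y. \<sigma> y ~= y}" proof
   show "{y. \<tau> y ~= y} \<subseteq> {y. \<sigma> y ~= y}" proof
    fix y assume "y \<in> {y. \<tau> y ~= y}"
    hence y: "t (\<sigma> y) ~= y" by (simp add: \<tau>_def)
    have "\<sigma> y ~= y" proof
     assume eq: "\<sigma> y = y"
     hence "t y ~= y" using y by simp
     hence "y = x \<or> y = \<sigma> x" unfolding t_def by (metis transpose_apply_other)
     thus False using eq x bij_is_inj[OF symD(2)[OF s]] by (auto simp: inj_def)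
    qed
    thus "y \<in> {y. \<sigma> y ~= y}" by simp
   qed
   have "\<tau> x = x" unfolding \<tau>_def t_def by simp
   with x show "{y. \<tau> y ~= y} ~= {y. \<sigma> y ~= y}" by blast
  qed
  hence "card {y. \<tau> y ~= y} < card {y. \<sigma> y ~= y}" by (rule psubset_card_mono[OF fin])
  from less.hyps[OF this \<tau>] have IH: "f (b o inv \<tau>) = of_int (sign \<tau>) * f b" .
  have "b o inv \<sigma> = (b o inv \<tau>) o t" unfolding \<sigma> by (simp add: inv_comp[OF t \<tau>s] tt o_assoc)
  hence "f (b o inv \<sigma>) = - f (b o inv \<tau>)" using assms(1) sc unfolding calt_def t_def by simp
  moreover have "sign \<sigma> = - sign \<tau>"
   unfolding \<sigma> using sign_compose[OF symD(3)[OF t] symD(3)[OF \<tau>s]] x by (simp add: t_def sign_swap_id)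
  ultimately show ?thesis using IH by simp
 qed (simp add: sign_id)
qed

lemma pt_calt: "calt n p (pt n p)" unfolding calt_def
proof (intro allI impI)
 fix x y a assume sc: "samecol n p x y"
 define t where "t = transpose x y"
 have t: "t \<in> symg n" unfolding t_def by (rule sym_transpose) (use sc in \<open>auto simp: samecol_def\<close>)
 have tt: "t o t = id" "inv t = t" unfolding t_def by (simp_all add: inv_transpose_eq)
 have tc: "t o \<sigma> \<in> colst n p" if "\<sigma> \<in> colst n p" for \<sigma> proof -
  have "snd (p (t z)) = snd (p z)" for z using sc unfolding t_def samecol_def by (simp add: transpose_def)
  thus ?thesis using that sym_comp[OF t] unfolding colst_def by simp
 qed
 have bij: "bij_betw (%\<sigma>. t o \<sigma>) (colst n p) (colst n p)"
  by (rule bij_betwI[where g = "%\<sigma>. t o \<sigma>"]) (auto simp: tc o_assoc tt)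
 have eq: "a o t = rw n p o inv \<sigma> \<longleftrightarrow> a = rw n p o inv (t o \<sigma>)" if "\<sigma> \<in> colst n p" for \<sigma>
 proof -
  have "inv (t o \<sigma>) = inv \<sigma> o t" using inv_comp[OF t colst_sym[OF that]] tt by simp
  hence e: "rw n p o inv (t o \<sigma>) = (rw n p o inv \<sigma>) o t" by (simp only: comp_assoc)
  show ?thesis proof
   assume h: "a o t = rw n p o inv \<sigma>"
   have "a = (a o t) o t" by (simp only: comp_assoc tt comp_id)
   thus "a = rw n p o inv (t o \<sigma>)" by (simp only: h e)
  next assume h: "a = rw n p o inv (t o \<sigma>)"
   show "a o t = rw n p o inv \<sigma>" unfolding h e by (simp only: comp_assoc tt comp_id)
  qed
 qed
 have sg: "sign (t o \<sigma>) = - sign \<sigma>" if "\<sigma> \<in> colst n p" for \<sigma>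
  using sign_compose[OF symD(3)[OF t] symD(3)[OF colst_sym[OF that]]] sc by (simp add: t_def sign_swap_id samecol_def)
 have "pt n p (a o t) = (\<Sum>\<sigma>\<in>colst n p. - (of_int (sign (t o \<sigma>)) * of_bool (a = rw n p o inv (t o \<sigma>))))"
  unfolding pt_def using eq sg by (intro sum.cong refl) simp
 also have "... = (\<Sum>\<sigma>\<in>colst n p. - (of_int (sign \<sigma>) * of_bool (a = rw n p o inv \<sigma>)))"
  by (rule sum.reindex_bij_betw[OF bij])
 finally show "pt n p (a o transpose x y) = - pt n p a" unfolding t_def pt_def by (simp add: sum_negf)
qed

lemma finite_colst [simp]: "finite (colst n p)" unfolding colst_def by simp

lemma pt_supp: assumes "tab n D p" "a \<notin> wd n D" shows "pt n p a = 0" unfolding pt_def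
proof (rule sum.neutral, intro ballI)
 fix \<sigma> assume "\<sigma> \<in> colst n p"
 hence "rw n p o inv \<sigma> \<in> wd n D" by (intro wd_comp rw_wd[OF assms(1)] symD(4) colst_sym)
 thus "of_int (sign \<sigma>) * of_bool (a = rw n p o inv \<sigma>) = (0::rat)" using assms(2) by auto
qed

text \<open>Only the identity preserves both the rows and the columns of a tableau.\<close>

lemma pt_rw: assumes "tab n D p" shows "pt n p (rw n p) = 1"
proof -
 have "\<sigma> = id" if \<sigma>: "\<sigma> \<in> colst n p" "rw n p = rw n p o inv \<sigma>" for \<sigma> proof -
  note s = colst_sym[OF \<sigma>(1)]
  have "rw n p o \<sigma> = rw n p" using \<sigma>(2) symD(6)[OF s] by (metis comp_assoc comp_id)
  hence "fst (p (\<sigma> x)) = fst (p x)" if "x \<in> {1..n}" for x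
   using that sym_in[OF s, of x] by (metis comp_apply rw_def)
  hence "\<sigma> x = x" if "x \<in> {1..n}" for x
   using that \<sigma>(1) sym_in[OF s, of x] tabD(2)[OF assms, of "\<sigma> x" x]
   unfolding colst_def by (auto simp: prod_eq_iff)
  thus "\<sigma> = id" using sym_out[OF s] by (auto simp: fun_eq_iff)
 qed
 moreover have "id \<in> colst n p" by (simp add: colst_def)
 ultimately have "pt n p (rw n p) = (\<Sum>\<sigma>\<in>{id}. of_int (sign \<sigma>) * of_bool (rw n p = rw n p o inv \<sigma>))"
  unfolding pt_def by (intro sum.mono_neutral_right) auto
 thus ?thesis by (simp add: sign_id)
qed

text \<open>A word with equal letters at two entries of one column is fixed by their transposition,
  so \<open>f\<close> vanishes there; every other word of the right content is a column
  rearrangement of the row word. This one-dimensionality is used wherever a function has to be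
  recognized as a multiple of a polytabloid.\<close>

lemma pt_unique: assumes D: "young n D" "tab n D p" and f: "calt n p f" "\<And>a. a \<notin> wd n D ==> f a = 0"
 shows "f = (%a. f (rw n p) * pt n p a)"
proof
 fix a
 show "f a = f (rw n p) * pt n p a" proof (cases "a \<in> wd n D")
  case False thus ?thesis using f(2) pt_supp[OF D(2)] by simp
 next case True
  show ?thesis proof (cases "\<exists>x y. samecol n p x y \<and> a x = a y")
   case eq: True then obtain x y where xy: "samecol n p x y" "a x = a y" by blast
   have "a o transpose x y = a" using xy(2) by (auto simp: fun_eq_iff transpose_def)
   hence "f a = - f a" "pt n p a = - pt n p a" using f(1) pt_calt[of n p] xy(1) unfolding calt_def by metis+
   thus ?thesis by simp
  next case False
   then obtain \<sigma> where \<sigma>: "\<sigma> \<in> colst n p" "a = rw n p o inv \<sigma>"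
    using column_rearrangement[OF D True] by blast
   show ?thesis unfolding \<sigma>(2) calt_colst[OF f(1) \<sigma>(1)] calt_colst[OF pt_calt \<sigma>(1)]
    using pt_rw[OF D(2)] by simp
  qed
 qed
qed

lemma tab_inv: assumes "tab n D p" "g \<in> symg n" shows "tab n D (p o inv g)"
 using bij_betw_trans[OF permutes_imp_bij[OF symD(1)[OF symD(4)[OF assms(2)]]]] assms(1) unfolding tab_def by blast

lemma pt_ga: assumes D: "young n D" "tab n D p" and g: "g \<in> symg n"
 shows "ga g (pt n p) = pt n (p o inv g)"
proof -
 let ?q = "p o inv g"
 have tq: "tab n D ?q" by (rule tab_inv[OF D(2) g])
 have bg: "bij g" "inj (inv g)" using symD(2)[OF g] bij_imp_bij_inv bij_is_inj by blast+
 have "calt n ?q (ga g (pt n p))" unfolding calt_def proof (intro allI impI)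
  fix x y a assume "samecol n ?q x y"
  hence "samecol n p (inv g x) (inv g y)" using sym_in[OF symD(4)[OF g]] bg(2) by (auto simp: samecol_def inj_def)
  moreover have "transpose x y o g = g o transpose (inv g x) (inv g y)"
   using bg(1) by (auto simp: fun_eq_iff transpose_def bij_inv_eq_iff bij_is_surj surj_f_inv_f)
  ultimately show "ga g (pt n p) (a o transpose x y) = - ga g (pt n p) a"
   using pt_calt[of n p] unfolding ga_def calt_def by (simp add: comp_assoc) (simp flip: comp_assoc)
 qed
 moreover have "ga g (pt n p) a = 0" if "a \<notin> wd n D" for a
  using that pt_supp[OF D(2)] wd_comp_iff[OF g] by (simp add: ga_def)
 ultimately have "ga g (pt n p) = (%a. ga g (pt n p) (rw n ?q) * pt n ?q a)" by (rule pt_unique[OF D(1) tq])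
 moreover have "rw n ?q o g = rw n p" using sym_in[OF g] bg by (auto simp: fun_eq_iff rw_def bij_is_inj inv_f_f)
 ultimately show ?thesis using pt_rw[OF D(2)] by (simp add: ga_def)
qed

lemma lsp_subspace: "lsp S \<longleftrightarrow> kf.subspace S"
proof
 assume S: "lsp S"
 have "f + g \<in> S" if "f \<in> S" "g \<in> S" for f g using lsp_add[OF S that] by (simp add: plus_fun_def)
 thus "kf.subspace S" unfolding kf.subspace_def using lsp_zero[OF S] lsp_scale[OF S] by (simp add: zero_fun_def)
next assume S: "kf.subspace S"
 show "lsp S" unfolding lsp_def proof (intro conjI ballI allI)
  show "(%_. 0) \<in> S" using kf.subspace_0[OF S] by (simp add: zero_fun_def)
  fix f g c assume "f \<in> S" "g \<in> S"
  hence "f + (%x. c * g x) \<in> S" by (intro kf.subspace_add[OF S] kf.subspace_scale[OF S])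
  thus "(%a. f a + c * g a) \<in> S" by (simp add: plus_fun_def)
 qed
qed

lemma lsp_specht: "lsp (specht n D)" unfolding lsp_subspace specht_def by (rule kf.subspace_span)

lemma pt_specht: "tab n D p ==> pt n p \<in> specht n D" unfolding specht_def by (rule kf.span_base) blast

lemma specht_least: "lsp Q ==> (\<And>p. tab n D p ==> pt n p \<in> Q) ==> f \<in> specht n D ==> f \<in> Q"
 unfolding specht_def lsp_subspace using kf.span_minimal[of "{pt n p |p. tab n D p}" Q] by blast

lemma lmapD: "lmap S F ==> f \<in> S ==> g \<in> S ==> F (%a. f a + c * g a) = (%b. F f b + c * F g b)"
 unfolding lmap_def by (drule (1) bspec, drule (1) bspec, erule spec)

lemma lsp_preimage: assumes "lsp T" "lmap UNIV F" shows "lsp {f. F f \<in> T}"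
proof -
 have "F (%_. 0) = (%_. 0)" using lmap_zero[OF _ assms(2)] by (simp add: lsp_def)
 thus ?thesis unfolding lsp_def by (auto simp: lsp_zero[OF assms(1)] lsp_addc[OF assms(1)] lmapD[OF assms(2)])
qed

lemma specht_image: assumes "lsp T" "lmap UNIV F" "\<And>p. tab n D p ==> F (pt n p) \<in> T" "f \<in> specht n D"
 shows "F f \<in> T" using specht_least[OF lsp_preimage[OF assms(1,2)], of n D f] assms(3,4) by simp

lemma specht_supp: assumes "f \<in> specht n D" "a \<notin> wd n D" shows "f a = 0"
proof -
 have "lsp {f. f a = (0::rat)}" unfolding lsp_def by simp
 from specht_least[OF this _ assms(1)] show ?thesis using pt_supp assms(2) by blast
qed

lemma fdsp_specht: "young n D ==> fdsp (wd n D) (specht n D)"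
 unfolding fdsp_def by (intro conjI ballI allI impI finite_wd youngD(1) lsp_specht specht_supp)

lemma ga_specht: "young n D ==> g \<in> symg n ==> f \<in> specht n D ==> ga g f \<in> specht n D"
 by (rule specht_image[OF lsp_specht lmap_ga]) (auto simp: pt_ga intro!: pt_specht tab_inv)

lemma lmap_specht_eq:
 assumes "lmap UNIV F" "lmap UNIV G" "\<And>p. tab n D p ==> F (pt n p) = G (pt n p)" "f \<in> specht n D" shows "F f = G f"
proof -
 have z: "F (%_. 0) = (%_. 0)" "G (%_. 0) = (%_. 0)"
  using lmap_zero[of UNIV F] lmap_zero[of UNIV G] assms(1,2) by (simp_all add: lsp_def)
 have "lsp {f. F f = G f}" unfolding lsp_def by (auto simp: z lmapD[OF assms(1)] lmapD[OF assms(2)])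
 from specht_least[OF this _ assms(4)] show ?thesis using assms(3) by simp
qed

text \<open>Tableaux are functions on all naturals, so the permutation that carries one to the other
  gives agreement on the entries only. The second alternative states what this yields: equality of
  the polytabloids.\<close>

lemma tab_transitive:
 assumes "tab n D p" "tab n D q" shows "\<exists>g\<in>symg n. q = p o inv g \<or> pt n q = pt n (p o inv g)"
proof -
 define g where "g = (%x. if x \<in> {1..n} then inv_into {1..n} q (p x) else x)"
 have b: "bij_betw (inv_into {1..n} q o p) {1..n} {1..n}"
  using bij_betw_trans[OF _ bij_betw_inv_into] assms unfolding tab_def by blast
 have "bij_betw g {1..n} {1..n} \<longleftrightarrow> bij_betw (inv_into {1..n} q o p) {1..n} {1..n}"
  by (rule bij_betw_cong) (simp add: g_def)
 with b have "bij_betw g {1..n} {1..n}" by blast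
 hence g: "g \<in> symg n" unfolding symg_def mem_Collect_eq by (rule bij_imp_permutes) (simp only: g_def if_False)
 have qg: "q (g x) = p x" if "x \<in> {1..n}" for x proof -
  have "p x \<in> q ` {1..n}" using tabD(1)[OF assms(1) that] assms(2) by (simp add: tab_def bij_betw_def)
  from f_inv_into_f[OF this] that show ?thesis by (simp add: g_def)
 qed
 have eq: "q x = (p o inv g) x" if "x \<in> {1..n}" for x
  using qg[of "inv g x"] that sym_in[OF symD(4)[OF g], of x] pointfree_idE[OF symD(5)[OF g], of x] by simp
 have "rw n q = rw n (p o inv g)" using eq by (auto simp: rw_def fun_eq_iff)
 moreover have "colst n q = colst n (p o inv g)"
  unfolding colst_def using eq sym_in by (intro Collect_cong conj_cong refl ball_cong) auto
 ultimately have "pt n q = pt n (p o inv g)" unfolding pt_def by simp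
 with g show ?thesis by blast
qed

section \<open>Jucys--Murphy elements\<close>

definition act :: "nat => wfun => wfun => wfun" where
 "act n u f = (%a. SUM g:symg n. u g * f (a o g))"

definition jm :: "nat => wfun => wfun" where
 "jm k f = (%a. SUM i:{1..<k}. f (a o transpose i k))"

definition jsum :: "nat => wfun => wfun" where
 "jsum n f = (%a. SUM k:{1..n}. jm k f a)"

text \<open>The coefficient of \<open>x\<^sup>i\<close> in the product of \<open>x + X\<^sub>k\<close> over the Jucys--Murphy elements
 \<open>X\<^sub>1, \<dots>, X\<^sub>n\<close>.\<close>

primrec jel :: "nat => nat => wfun => wfun" where
 "jel 0 i f = (%a. of_bool (i = 0) * f a)"
| "jel (Suc n) i f = (%a. jm (Suc n) (jel n i f) a + (if i = 0 then 0 else jel n (i - 1) f a))"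

definition cont :: "nat \<times> nat => int" where
 "cont c = int (snd c) - int (fst c)"

definition cpoly :: "cells => int poly" where
 "cpoly D = (\<Prod>c\<in>D. [:cont c, 1:])"

definition comm :: "nat => (wfun => wfun) => bool" where
 "comm n F \<longleftrightarrow> lmap UNIV F \<and> (\<forall>g\<in>symg n. \<forall>f. F (ga g f) = ga g (F f))"

lemma commD: assumes "comm n F"
 shows "lmap UNIV F" "g \<in> symg n ==> F (ga g f) = ga g (F f)"
  "F (%a. f a + c * h a) = (%a. F f a + c * F h a)"
  "F (%a. f a + h a) = (%a. F f a + F h a)"
  "F (%_. 0) = (%_. 0)"
  "F (%a. c * f a) = (%a. c * F f a)"
  "F (%a. SUM k:K. v k a) = (%a. SUM k:K. F (v k) a)" proof -
 have U: "lsp (UNIV :: wfun set)" by (simp add: lsp_def)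
 show l: "lmap UNIV F" using assms by (simp add: comm_def)
 show "F (ga g f) = ga g (F f)" if "g \<in> symg n" using assms that by (simp add: comm_def)
 show "F (%a. f a + c * h a) = (%a. F f a + c * F h a)" for c by (rule lmapD[OF l]) auto
 from this[of 1] show "F (%a. f a + h a) = (%a. F f a + F h a)" by simp
 show "F (%_. 0) = (%_. 0)" by (rule lmap_zero[OF U l])
 show "F (%a. c * f a) = (%a. c * F f a)" by (rule lmap_scale[OF U l]) simp
 show "F (%a. SUM k:K. v k a) = (%a. SUM k:K. F (v k) a)" using lmap_sum[OF U l, of K v "%_. 1"] by simp
qed

lemma comm_mono: "comm n F ==> m \<le> n ==> comm m F" unfolding comm_def using sym_mono by blast

lemma lmap_jm: "lmap S (jm k)" unfolding lmap_def jm_def by (simp add: sum.distrib sum_distrib_left)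

lemma lmap_jsum: "lmap S (jsum n)"
proof -
 have "jm k (%a. f a + c * g a) = (%a. jm k f a + c * jm k g a)" for k f g c by (rule lmapD[OF lmap_jm[of UNIV]]) auto
 thus ?thesis unfolding lmap_def jsum_def by (simp add: sum.distrib sum_distrib_left)
qed

lemma lmap_jel: "lmap UNIV (jel n i)"
proof (induction n arbitrary: i)
 case (Suc n)
 have "jm k (%a. f a + c * g a) = (%a. jm k f a + c * jm k g a)" for k f g c by (rule lmapD[OF lmap_jm[of UNIV]]) auto
 moreover have "jel n i (%a. f a + c * g a) = (%a. jel n i f a + c * jel n i g a)" for i f g c by (rule lmapD[OF Suc]) auto
 ultimately show ?case unfolding lmap_def by (cases "i = 0") (simp_all add: algebra_simps)
qed (simp add: lmap_def algebra_simps)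

lemma lmap_act: "lmap S (act n u)"
 unfolding lmap_def act_def by (simp add: ring_distribs sum.distrib sum_distrib_left mult.left_commute)

lemma transpose_conj: "bij g ==> g o transpose i k = transpose (g i) (g k) o g"
 by (auto simp: fun_eq_iff transpose_def bij_is_inj inj_eq)

lemma jm_comm: "comm n (jm (Suc n))" unfolding comm_def
proof (intro conjI ballI allI lmap_jm)
 fix g f assume g: "g \<in> symg n"
 have k: "g (Suc n) = Suc n" by (rule sym_out[OF g]) simp
 show "jm (Suc n) (ga g f) = ga g (jm (Suc n) f)" proof
  fix a
  have "ga g (jm (Suc n) f) a = (SUM i:{1..<Suc n}. f (a o transpose (g i) (Suc n) o g))"
   unfolding ga_def jm_def by (simp add: comp_assoc transpose_conj[OF symD(2)[OF g]] k)
  also have "... = (SUM i:{1..<Suc n}. f (a o transpose i (Suc n) o g))" by (rule sum.reindex_bij_betw)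
     (use permutes_imp_bij[OF symD(1)[OF g]] in \<open>simp add: atLeastLessThanSuc_atLeastAtMost\<close>)
  finally show "jm (Suc n) (ga g f) a = ga g (jm (Suc n) f) a" by (simp add: jm_def ga_def)
 qed
qed

lemma jm_comm_fix: assumes "bij g" "\<And>x. x \<le> k ==> g x = x" shows "jm k (ga g f) = ga g (jm k f)"
proof
 fix a show "jm k (ga g f) a = ga g (jm k f) a"
  unfolding ga_def jm_def by (intro sum.cong refl) (simp add: comp_assoc transpose_conj[OF assms(1)] assms(2))
qed

lemma jel_comm_fix: assumes "bij g" "\<And>x. x \<le> n ==> g x = x" shows "jel n i (ga g f) = ga g (jel n i f)"
 using assms(2)
proof (induction n arbitrary: i)
 case 0 thus ?case by (simp add: ga_def)
next case (Suc n)
 have "jel n i (ga g f) = ga g (jel n i f)" for i by (rule Suc.IH) (use Suc.prems in simp)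
 thus ?case using jm_comm_fix[OF assms(1) Suc.prems] by (auto simp: ga_def)
qed

lemma jm_ga: "jm k f = (%a. SUM i:{1..<k}. ga (transpose i k) f a)" by (simp add: jm_def ga_def)

lemma comm_jm: assumes F: "comm n F" and k: "k \<le> n" shows "F (jm k f) = jm k (F f)"
proof -
 have "F (jm k f) = (%a. SUM i:{1..<k}. F (ga (transpose i k) f) a)" unfolding jm_ga by (rule commD(7)[OF F])
 also have "... = (%a. SUM i:{1..<k}. ga (transpose i k) (F f) a)" proof (rule ext, rule sum.cong[OF refl])
  fix a i assume "i \<in> {1..<k}"
  hence "transpose i k \<in> symg n" using k by (intro sym_transpose) auto
  thus "F (ga (transpose i k) f) a = ga (transpose i k) (F f) a" by (simp add: commD(2)[OF F])
 qed
 finally show ?thesis unfolding jm_ga .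
qed

lemma comm_jsum: assumes F: "comm n F" shows "F (jsum n f) = jsum n (F f)"
proof -
 have "F (jsum n f) = (%a. SUM k:{1..n}. F (jm k f) a)" unfolding jsum_def by (rule commD(7)[OF F])
 also have "... = jsum n (F f)" unfolding jsum_def by (rule ext, rule sum.cong) (simp_all add: comm_jm[OF F])
 finally show ?thesis .
qed

lemma jel_intertwine: assumes "comm n F" shows "F (jel n i f) = jel n i (F f)" using assms
proof (induction n arbitrary: i)
 case 0 show ?case by (simp add: commD(6)[OF 0])
next case (Suc n)
 note C = commD[OF Suc.prems]
 have IH: "F (jel n i f) = jel n i (F f)" for i by (rule Suc.IH[OF comm_mono[OF Suc.prems]]) simp
 have "F (jm (Suc n) h) = jm (Suc n) (F h)" for h by (rule comm_jm[OF Suc.prems order_refl])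
 thus ?case using C(4,5) IH by (cases "i = 0") (simp_all)
qed

text \<open>The defining relation of the degenerate affine Hecke algebra, for Jucys-Murphy elements
  and an adjacent transposition.\<close>

lemma adjacent_jm: fixes k :: nat assumes "k \<ge> 1"
 shows "ga (transpose k (Suc k)) (jm k f) = (%a. jm (Suc k) (ga (transpose k (Suc k)) f) a - f a)"
proof
 fix a
 let ?s = "transpose k (Suc k)"
 have b: "bij ?s" by simp
 have "ga ?s (jm k f) a = (SUM i:{1..<k}. f (a o transpose i (Suc k) o ?s))" proof -
  have "?s o transpose i k = transpose i (Suc k) o ?s" if "i \<in> {1..<k}" for i
   using transpose_conj[OF b, of i k] that by (simp add: transpose_def)
  thus ?thesis unfolding ga_def jm_def by (intro sum.cong refl) (simp only: comp_assoc)
 qed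
 moreover have "jm (Suc k) (ga ?s f) a = (SUM i:{1..<k}. f (a o transpose i (Suc k) o ?s)) + f (a o ?s o ?s)"
  unfolding ga_def jm_def using assms by simp
 moreover have "a o ?s o ?s = a" by (simp add: comp_assoc)
 ultimately show "ga ?s (jm k f) a = jm (Suc k) (ga ?s f) a - f a" by simp
qed

lemma adjacent_jm': fixes k :: nat assumes "k \<ge> 1"
 shows "ga (transpose k (Suc k)) (jm (Suc k) f) = (%a. jm k (ga (transpose k (Suc k)) f) a + f a)"
proof -
 let ?s = "transpose k (Suc k)"
 have ss: "ga ?s (ga ?s h) = h" for h :: wfun by (simp add: ga_ga)
 have "ga ?s (ga ?s (jm k (ga ?s f))) = ga ?s (%a. jm (Suc k) f a - ga ?s f a)" unfolding adjacent_jm[OF assms] ss ..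
 hence "jm k (ga ?s f) = (%a. ga ?s (jm (Suc k) f) a - ga ?s (ga ?s f) a)" unfolding ss by (simp add: ga_def comp_assoc)
 thus ?thesis unfolding ss by simp
qed

lemma jm_jm: "jm (Suc n) (jm n f) = jm n (jm (Suc n) f)"
proof -
 note C = commD[OF jm_comm[of n]]
 have "jm n f = (%a. SUM i:{1..<n}. ga (transpose i n) f a)" by (simp add: jm_def ga_def)
 hence "jm (Suc n) (jm n f) = (%a. SUM i:{1..<n}. jm (Suc n) (ga (transpose i n) f) a)" using C(7) by simp
 also have "... = (%a. SUM i:{1..<n}. ga (transpose i n) (jm (Suc n) f) a)"
  by (intro ext sum.cong refl) (simp add: C(2) sym_transpose)
 finally show ?thesis by (simp add: jm_def[of n] ga_def)
qed

text \<open>\<open>transpose i (Suc k)\<close> is conjugate to \<open>transpose i k\<close> under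
  \<open>transpose k (Suc k)\<close>, so all transpositions are reached, and they generate the
  group.\<close>

lemma comm_adjacent: assumes "lmap UNIV F"
  "\<And>k f. 1 \<le> k ==> k < n ==> F (ga (transpose k (Suc k)) f) = ga (transpose k (Suc k)) (F f)"
 shows "comm n F"
proof -
 have tr: "F (ga (transpose i k) f) = ga (transpose i k) (F f)" if "1 \<le> i" "i < k" "k \<le> n" for i k f using that
 proof (induction k arbitrary: f)
  case (Suc k) show ?case proof (cases "i = k")
   case True thus ?thesis using assms(2)[of k f] Suc.prems by simp
  next case False
   let ?s = "transpose k (Suc k)"
   have "transpose i (Suc k) = ?s o transpose i k o ?s" using False Suc.prems by (auto simp: fun_eq_iff transpose_def)
   hence "ga (transpose i (Suc k)) h = ga ?s (ga (transpose i k) (ga ?s h))"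
    for h :: wfun by (simp add: ga_ga comp_assoc)
   moreover have "F (ga (transpose i k) h) = ga (transpose i k) (F h)" for h by (rule Suc.IH) (use False Suc.prems in auto)
   moreover have "F (ga ?s h) = ga ?s (F h)" for h using assms(2)[of k h] Suc.prems by simp
   ultimately show ?thesis by simp
  qed
 qed simp
 have tr': "F (ga (transpose i k) f) = ga (transpose i k) (F f)" if "i \<in> {1..n}" "k \<in> {1..n}" for i k f
 proof (cases i k rule: linorder_cases)
  case less thus ?thesis using tr[of i k] that by simp
 next case equal thus ?thesis by simp
 next case greater thus ?thesis using tr[of k i] that by (simp add: transpose_commute)
 qed
 have "\<forall>f. F (ga g f) = ga g (F f)" if "g permutes {1..n}" for g using that finite_atLeastAtMost
 proof (induction rule: permutes_induct)
  case (swap a b p)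
  have "ga (transpose a b o p) h = ga (transpose a b) (ga p h)" for h :: wfun by (simp only: ga_ga)
  moreover have "\<forall>f. F (ga p f) = ga p (F f)" "a \<in> {1..n}" "b \<in> {1..n}" using swap by auto
  ultimately show ?case by (simp only: tr') simp
 next case id
  show ?case by (simp only: ga_id) simp
 qed
 thus ?thesis unfolding comm_def symg_def using assms(1) by simp
qed

text \<open>Symmetric polynomials in the Jucys-Murphy elements are central. By induction only the
  transposition of the last two points is left; the last two factors enter through their sum and
  their product, which commute with it.\<close>

lemma jel_comm: "comm n (jel n i)"
proof (induction n arbitrary: i)
 case 0 show ?case unfolding comm_def by (simp add: lmap_jel symg_def)
next case (Suc n)
 note C = commD[OF jm_comm[of n]]
 show ?case proof (rule comm_adjacent[OF lmap_jel])
  fix k f assume k: "1 \<le> k" "k < Suc n"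
  let ?s = "transpose k (Suc k)"
  show "jel (Suc n) i (ga ?s f) = ga ?s (jel (Suc n) i f)" proof (cases "k = n")
   case False hence s: "?s \<in> symg n" using k by (intro sym_transpose) auto
   have "jel n i (ga ?s f) = ga ?s (jel n i f)" for i by (rule commD(2)[OF Suc s])
   thus ?thesis using C(2)[OF s] by (auto simp: ga_def)
  next case True
   obtain m where m: "n = Suc m" using True k by (cases n) auto
   \<comment> \<open>The coefficient of \<open>x ^ i\<close> is
     \<open>X Y Q_i + (X + Y) Q_(i-1) + Q_(i-2)\<close>, where Q is the product of the other
     factors. \<open>A 2\<close>, \<open>A 1\<close> and \<open>A 0\<close> are these three
     coefficients of Q, with 0 at negative indices.\<close>
   define A where "A = (%j f. if j < 2 then (if i + j < 2 then (%_. 0) else jel m (i + j - 2) f) else jel m i f)"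
   have A: "A j (ga ?s f) = ga ?s (A j f)" for j
    unfolding A_def using jel_comm_fix[of ?s m _ f] True m by (auto simp: transpose_def ga_def)
   let ?x = "jm n" and ?y = "jm (Suc n)"
   have addx: "?x (%a. f a + g a) = (%a. ?x f a + ?x g a)" for f g by (simp add: jm_def sum.distrib)
   have addy: "?y (%a. f a + g a) = (%a. ?y f a + ?y g a)" for f g by (simp add: jm_def sum.distrib)
   have z: "jm k (%_. 0) = (%_. 0)" for k by (simp add: jm_def)
   have E: "jel (Suc n) i f = (%a. ?y (?x (A 2 f)) a + (?y (A 1 f) a + ?x (A 1 f) a) + A 0 f a)" for f
    unfolding A_def using z
    by (auto simp: m numeral_2_eq_2 addy[unfolded m] add.commute add.left_commute split: nat.splits intro!: ext)
   have sx: "ga ?s (?x h) = (%a. ?y (ga ?s h) a - h a)" and sy: "ga ?s (?y h) = (%a. ?x (ga ?s h) a + h a)" for h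
    using adjacent_jm[of n h] adjacent_jm'[of n h] True k by simp_all
   have 1: "ga ?s (?y (?x h)) = ?y (?x (ga ?s h))" for h proof -
    have "ga ?s (?y (?x h)) = (%a. ?x (%a. ?y (ga ?s h) a - h a) a + ?x h a)" by (simp only: sy sx)
    also have "... = ?x (?y (ga ?s h))" by (simp add: jm_def sum_subtractf)
    finally show ?thesis by (simp only: jm_jm)
   qed
   have 2: "ga ?s (%a. ?y h a + ?x h a) = (%a. ?y (ga ?s h) a + ?x (ga ?s h) a)" for h
    using fun_cong[OF sx[of h]] fun_cong[OF sy[of h]] by (auto simp: ga_def)
   show ?thesis unfolding E A using fun_cong[OF 1[of "A 2 f"]] fun_cong[OF 2[of "A 1 f"]] by (auto simp: ga_def)
  qed
 qed
qed

lemma jsum_Suc: "jsum (Suc n) f = (%a. jsum n f a + jm (Suc n) f a)" by (simp add: jsum_def)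

lemma jsum_comm_fix: assumes "bij g" "\<And>x. x \<le> n ==> g x = x" shows "jsum n (ga g f) = ga g (jsum n f)"
proof
 fix a
 have "jm k (ga g f) = ga g (jm k f)" if "k \<le> n" for k by (rule jm_comm_fix[OF assms(1)]) (use assms(2) that in auto)
 thus "jsum n (ga g f) a = ga g (jsum n f) a" by (simp add: jsum_def ga_def)
qed

text \<open>For the transposition of the last two points, the correction terms -1 and +1 in
  \<open>adjacent_jm\<close> and \<open>adjacent_jm'\<close> cancel.\<close>

lemma jsum_comm: "comm n (jsum n)"
proof (induction n)
 case 0 show ?case unfolding comm_def by (simp add: lmap_jsum symg_def)
next case (Suc n)
 show ?case proof (rule comm_adjacent[OF lmap_jsum])
  fix k f assume k: "1 \<le> k" "k < Suc n"
  let ?s = "transpose k (Suc k)"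
  show "jsum (Suc n) (ga ?s f) = ga ?s (jsum (Suc n) f)" proof (cases "k = n")
   case False hence s: "?s \<in> symg n" using k by (intro sym_transpose) auto
   show ?thesis unfolding jsum_Suc commD(2)[OF Suc s] commD(2)[OF jm_comm s] by (simp add: ga_def)
  next case True
   obtain m where m: "n = Suc m" using True k by (cases n) auto
   have fix': "jsum m (ga ?s f) = ga ?s (jsum m f)"
    by (rule jsum_comm_fix) (use True m in \<open>auto simp: transpose_def\<close>)
   have "ga ?s (jm n f) = (%a. jm (Suc n) (ga ?s f) a - f a)"
    "ga ?s (jm (Suc n) f) = (%a. jm n (ga ?s f) a + f a)" using adjacent_jm[of n f] adjacent_jm'[of n f] True k by simp_all
   from fun_cong[OF this(1)] fun_cong[OF this(2)] fun_cong[OF fix']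
   have "jsum (Suc n) (ga ?s f) a = ga ?s (jsum (Suc n) f) a" for a unfolding jsum_Suc m by (simp add: ga_def)
   thus ?thesis by (rule ext)
  qed
 qed
qed


section \<open>Contents\<close>

definition wsup :: "nat => cells => wfun => bool" where
 "wsup n D f \<longleftrightarrow> (\<forall>a. a \<notin> wd n D --> f a = 0)"

lemma wsup_ga: "g \<in> symg n ==> wsup n D f ==> wsup n D (ga g f)" unfolding wsup_def ga_def using wd_comp_iff by simp

lemma wsup_jm: assumes "k \<le> n" "wsup n D f" shows "wsup n D (jm k f)"
proof -
 have "wsup n D (ga (transpose i k) f)" if "i \<in> {1..<k}" for i
  by (rule wsup_ga[OF sym_transpose assms(2)]) (use that assms in auto)
 thus ?thesis unfolding wsup_def jm_def ga_def by simp
qed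

lemma wsup_jsum: "wsup n D f ==> wsup n D (jsum n f)" using wsup_jm[of _ n D f] unfolding jsum_def by (simp add: wsup_def)

lemma wsup_jel: "m \<le> n ==> wsup n D f ==> wsup n D (jel m i f)"
proof (induction m arbitrary: i)
 case (Suc m)
 have "wsup n D (jel m i f)" "wsup n D (jel m (i - 1) f)" by (rule Suc.IH; use Suc.prems in simp)+
 with wsup_jm[OF Suc.prems(1)] show ?case by (simp add: wsup_def)
qed (simp add: wsup_def)

lemma pt_wsup: "tab n D p ==> wsup n D (pt n p)" unfolding wsup_def using pt_supp by blast

text \<open>An operator commuting with the group maps a polytabloid to a function alternating along
  the same columns, hence to a multiple of it. The factor is the same for all tableaux because the
  group permutes them transitively. This takes the place of Schur's lemma and works over the
  rationals.\<close>

lemma specht_scalar: assumes D: "young n D" "tab n D p" and F: "comm n F" "\<And>f. wsup n D f ==> wsup n D (F f)"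
  and f: "f \<in> specht n D"
 shows "F f = (%a. F (pt n p) (rw n p) * f a)"
proof (rule lmap_specht_eq[OF commD(1)[OF F(1)] _ _ f])
 show "lmap UNIV (%f a. F (pt n p) (rw n p) * f a)" by (simp add: lmap_def algebra_simps)
 have eig: "F (pt n p) = (%a. F (pt n p) (rw n p) * pt n p a)" proof (rule pt_unique[OF D])
  show "calt n p (F (pt n p))" unfolding calt_def proof (intro allI impI)
   fix x y a assume sc: "samecol n p x y"
   hence t: "transpose x y \<in> symg n" by (intro sym_transpose) (auto simp: samecol_def)
   have "ga (transpose x y) (pt n p) = (%a. (-1) * pt n p a)" using pt_calt[of n p] sc unfolding calt_def ga_def by auto
   hence "ga (transpose x y) (F (pt n p)) = (%a. (-1) * F (pt n p) a)"
    using commD(2)[OF F(1) t, of "pt n p"] commD(6)[OF F(1), of "-1" "pt n p"] by simp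
   from fun_cong[OF this, of a] show "F (pt n p) (a o transpose x y) = - F (pt n p) a" by (simp add: ga_def)
  qed
  show "F (pt n p) a = 0" if "a \<notin> wd n D" for a using F(2)[OF pt_wsup[OF D(2)]] that unfolding wsup_def by blast
 qed
 fix q assume "tab n D q"
 then obtain g where g: "g \<in> symg n" "pt n q = pt n (p o inv g)" using tab_transitive[OF D(2)] by blast
 hence q: "pt n q = ga g (pt n p)" by (simp add: pt_ga[OF D])
 have "F (pt n q) = ga g (F (pt n p))" unfolding q by (rule commD(2)[OF F(1) g(1)])
 also have "... = ga g (%a. F (pt n p) (rw n p) * pt n p a)" by (rule arg_cong[OF eig])
 also have "... = (%a. F (pt n p) (rw n p) * pt n q a)" unfolding q by (simp add: ga_def)
 finally show "F (pt n q) = (%a. F (pt n p) (rw n p) * pt n q a)" .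
qed

lemma sum_pairs_symmetric: fixes w :: "nat => nat => rat"
 assumes "\<And>x y. w x y = w y x"
 shows "2 * (SUM k:{1..n}. SUM i:{1..<k}. w i k) = (SUM x:{1..n}. SUM y:{1..n} - {x}. w x y)"
proof (induction n)
 case (Suc n)
 have "(SUM x:{1..Suc n}. SUM y:{1..Suc n} - {x}. w x y)
   = (SUM x:{1..n}. SUM y:{1..Suc n} - {x}. w x y) + (SUM y:{1..n}. w (Suc n) y)" proof -
  have "{1..Suc n} - {Suc n} = {1..n}" by auto
  thus ?thesis by simp
 qed
 also have "(SUM x:{1..n}. SUM y:{1..Suc n} - {x}. w x y)
   = (SUM x:{1..n}. (SUM y:{1..n} - {x}. w x y) + w x (Suc n))" proof (rule sum.cong[OF refl])
  fix x assume "x \<in> {1..n}"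
  hence "{1..Suc n} - {x} = insert (Suc n) ({1..n} - {x})" by auto
  thus "(SUM y:{1..Suc n} - {x}. w x y) = (SUM y:{1..n} - {x}. w x y) + w x (Suc n)" by simp
 qed
 also have "... = (SUM x:{1..n}. SUM y:{1..n} - {x}. w x y) + (SUM x:{1..n}. w x (Suc n))" by (rule sum.distrib)
 also have "(SUM x:{1..n}. SUM y:{1..n} - {x}. w x y) = 2 * (SUM k:{1..n}. SUM i:{1..<k}. w i k)"
  by (rule Suc.IH[symmetric])
 also have "(SUM y:{1..n}. w (Suc n) y) = (SUM x:{1..n}. w x (Suc n))" using assms by (intro sum.cong) auto
 finally show ?case by (simp add: atLeastLessThanSuc_atLeastAtMost)
qed simp

text \<open>Within a class of equal \<open>u\<close> the values of \<open>v\<close> are distinct and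
  fill an initial segment, so exactly \<open>v y\<close> members precede \<open>y\<close>. Every
  unordered pair is counted in both orders.\<close>

lemma sum_ordered_pairs: fixes u v :: "'x => nat"
 assumes "finite A" "\<And>x y. x \<in> A ==> y \<in> A ==> u x = u y ==> v x = v y ==> x = y"
  and "\<And>y j. y \<in> A ==> j < v y ==> \<exists>x\<in>A. u x = u y \<and> v x = j"
 shows "(SUM x:A. SUM y:A - {x}. of_bool (u x = u y)) = (2 * (SUM y:A. of_nat (v y)) :: rat)"
proof -
 have lt: "(SUM x:A. of_bool (u x = u y \<and> v x < v y)) = (of_nat (v y) :: rat)" if y: "y \<in> A" for y proof -
  have "(SUM x:A. of_bool (u x = u y \<and> v x < v y)) = (of_nat (card {x \<in> A. u x = u y \<and> v x < v y}) :: rat)"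
   using assms(1) by (simp add: of_bool_def sum.If_cases Int_def)
  also have "card {x \<in> A. u x = u y \<and> v x < v y} = card {..<v y}"
  proof (rule bij_betw_same_card[of v], rule bij_betwI')
   show "v x = v z \<longleftrightarrow> x = z" if "x \<in> {x \<in> A. u x = u y \<and> v x < v y}" "z \<in> {x \<in> A. u x = u y \<and> v x < v y}" for x z
    using that assms(2)[of x z] by auto
   show "\<exists>x\<in>{x \<in> A. u x = u y \<and> v x < v y}. j = v x" if "j \<in> {..<v y}" for j
    using assms(3)[OF y, of j] that by auto
  qed auto
  finally show ?thesis by simp
 qed
 have "(SUM x:A. SUM y:A - {x}. of_bool (u x = u y) :: rat)
   = (SUM x:A. SUM y:A. of_bool (u x = u y \<and> v x < v y) + of_bool (u y = u x \<and> v y < v x))"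
 proof (rule sum.cong[OF refl])
  fix x assume x: "x \<in> A"
  have "(SUM y:A - {x}. of_bool (u x = u y) :: rat)
    = (SUM y:A - {x}. of_bool (u x = u y \<and> v x < v y) + of_bool (u y = u x \<and> v y < v x))"
  proof (rule sum.cong[OF refl])
   fix y assume "y \<in> A - {x}"
   thus "(of_bool (u x = u y) :: rat) = of_bool (u x = u y \<and> v x < v y) + of_bool (u y = u x \<and> v y < v x)"
    using assms(2)[OF x, of y] by (cases "v x" "v y" rule: linorder_cases) auto
  qed
  also have "... = (SUM y:A. of_bool (u x = u y \<and> v x < v y) + of_bool (u y = u x \<and> v y < v x))"
   using assms(1) by (intro sum.mono_neutral_left) auto
  finally show "(SUM y:A - {x}. of_bool (u x = u y) :: rat)
   = (SUM y:A. of_bool (u x = u y \<and> v x < v y) + of_bool (u y = u x \<and> v y < v x))" .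
 qed
 also have "... = (SUM x:A. SUM y:A. of_bool (u x = u y \<and> v x < v y))
   + (SUM x:A. SUM y:A. of_bool (u y = u x \<and> v y < v x))" by (simp only: sum.distrib)
 also have "(SUM x:A. SUM y:A. of_bool (u x = u y \<and> v x < v y)) = (SUM y:A. of_nat (v y) :: rat)"
  by (subst sum.swap) (intro sum.cong refl lt)
 also have "(SUM x:A. SUM y:A. of_bool (u y = u x \<and> v y < v x)) = (SUM y:A. of_nat (v y) :: rat)"
  by (intro sum.cong refl lt)
 finally show ?thesis by simp
qed

lemma comp_transpose_eq: "h x = h y ==> h o transpose x y = h" by (auto simp: fun_eq_iff transpose_def)

lemma jsum_pt: assumes D: "young n D" "tab n D p"
 shows "jsum n (pt n p) (rw n p) = of_int (SUM c:D. cont c)"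
proof -
 \<comment> \<open>The value of the polytabloid at the row word with two letters swapped: 1 for
   entries of one row, -1 for entries of one column, 0 otherwise.\<close>
 let ?w = "%x y. of_bool (fst (p x) = fst (p y)) - of_bool (snd (p x) = snd (p y)) :: rat"
 have w_sym: "?w x y = ?w y x" for x y by (cases "fst (p x) = fst (p y)"; cases "snd (p x) = snd (p y)") auto
 have "pt n p (rw n p o transpose i k) = ?w i k" if ik: "i \<in> {1..n}" "k \<in> {1..n}" "i < k" for i k proof -
  have pne: "p i ~= p k" using tabD(2)[OF D(2) ik(1,2)] ik(3) by auto
  consider "fst (p i) = fst (p k)" | "snd (p i) = snd (p k)" | "fst (p i) ~= fst (p k)" "snd (p i) ~= snd (p k)" by blast
  thus ?thesis proof cases
   case 1 hence "rw n p o transpose i k = rw n p" using ik by (auto simp: fun_eq_iff transpose_def rw_def)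
   thus ?thesis using 1 pne pt_rw[OF D(2)] by (auto simp: prod_eq_iff)
  next case 2
   hence "samecol n p i k" using ik by (simp add: samecol_def)
   hence "pt n p (rw n p o transpose i k) = - pt n p (rw n p)" using pt_calt[of n p] unfolding calt_def by blast
   thus ?thesis using 2 pne pt_rw[OF D(2)] by (auto simp: prod_eq_iff)
  next case 3
   \<comment> \<open>The entry \<open>i\<close> lies in the upper of the two rows. The cell in the
     row of \<open>i\<close> and the column of \<open>k\<close> belongs to the diagram, and after
     the swap its entry carries the same letter as \<open>k\<close>, in the same column.\<close>
   have "\<exists>x y. samecol n p x y \<and> (rw n p o transpose i k) x = (rw n p o transpose i k) y"
    if lt: "fst (p i) < fst (p k)" and ik: "i \<in> {1..n}" "k \<in> {1..n}" "i ~= k" and s: "snd (p i) ~= snd (p k)" for i k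
   proof -
    have "(fst (p i), snd (p k)) \<in> D"
     using youngD(3)[OF D(1), of "fst (p k)" "snd (p k)" "fst (p i)" "snd (p k)"] tabD(1)[OF D(2) ik(2)] lt by simp
    then obtain z where z: "z \<in> {1..n}" "p z = (fst (p i), snd (p k))" using tabD(3)[OF D(2)] by blast
    have "z ~= i" using z(2) s by (metis snd_conv)
    moreover have "z ~= k" using z(2) lt by (metis fst_conv less_irrefl)
    ultimately show ?thesis using z ik by (intro exI[of _ k] exI[of _ z]) (auto simp: samecol_def rw_def transpose_def)
   qed
   from this[of i k] this[of k i] 3 ik obtain x y where
    xy: "samecol n p x y" "(rw n p o transpose i k) x = (rw n p o transpose i k) y"
    by (cases "fst (p i)" "fst (p k)" rule: linorder_cases) (auto simp: transpose_commute)
   hence "(rw n p o transpose i k) o transpose x y = rw n p o transpose i k" by (intro comp_transpose_eq)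
   hence "pt n p (rw n p o transpose i k) = - pt n p (rw n p o transpose i k)"
    using pt_calt[of n p] xy(1) unfolding calt_def by metis
   thus ?thesis using 3 by simp
  qed
 qed
 hence "jsum n (pt n p) (rw n p) = (SUM k:{1..n}. SUM i:{1..<k}. ?w i k)"
  unfolding jsum_def jm_def by (intro sum.cong refl) auto
 hence "2 * jsum n (pt n p) (rw n p) = (SUM x:{1..n}. SUM y:{1..n} - {x}. ?w x y)"
  using sum_pairs_symmetric[of ?w n, OF w_sym] by simp
 also have "... = (SUM x:{1..n}. SUM y:{1..n} - {x}. of_bool (fst (p x) = fst (p y)))
   - (SUM x:{1..n}. SUM y:{1..n} - {x}. of_bool (snd (p x) = snd (p y)))" by (simp only: sum_subtractf)
 also have "(SUM x:{1..n}. SUM y:{1..n} - {x}. of_bool (fst (p x) = fst (p y))) = (2 * (SUM y:{1..n}. of_nat (snd (p y))) :: rat)"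
 proof (rule sum_ordered_pairs)
  fix y j assume y: "y \<in> {1..n}" "j < snd (p y)"
  have "(fst (p y), j) \<in> D"
   using youngD(3)[OF D(1), of "fst (p y)" "snd (p y)" "fst (p y)" j] tabD(1)[OF D(2) y(1)] y(2) by simp
  from tabD(3)[OF D(2) this] obtain x where "x \<in> {1..n}" "p x = (fst (p y), j)" by (elim bexE)
  thus "\<exists>x\<in>{1..n}. fst (p x) = fst (p y) \<and> snd (p x) = j" by (intro bexI[of _ x]) simp_all
 next fix x y assume "x \<in> {1..n}" "y \<in> {1..n}" "fst (p x) = fst (p y)" "snd (p x) = snd (p y)"
  thus "x = y" by (intro tabD(2)[OF D(2)]) (simp_all add: prod_eq_iff)
 qed simp
 also have "(SUM x:{1..n}. SUM y:{1..n} - {x}. of_bool (snd (p x) = snd (p y))) = (2 * (SUM y:{1..n}. of_nat (fst (p y))) :: rat)"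
 proof (rule sum_ordered_pairs)
  fix y j assume y: "y \<in> {1..n}" "j < fst (p y)"
  have "(j, snd (p y)) \<in> D"
   using youngD(3)[OF D(1), of "fst (p y)" "snd (p y)" j "snd (p y)"] tabD(1)[OF D(2) y(1)] y(2) by simp
  from tabD(3)[OF D(2) this] obtain x where "x \<in> {1..n}" "p x = (j, snd (p y))" by (elim bexE)
  thus "\<exists>x\<in>{1..n}. snd (p x) = snd (p y) \<and> fst (p x) = j" by (intro bexI[of _ x]) simp_all
 next fix x y assume "x \<in> {1..n}" "y \<in> {1..n}" "snd (p x) = snd (p y)" "fst (p x) = fst (p y)"
  thus "x = y" by (intro tabD(2)[OF D(2)]) (simp_all add: prod_eq_iff)
 qed simp
 finally have "jsum n (pt n p) (rw n p) = (SUM y:{1..n}. of_nat (snd (p y)) - of_nat (fst (p y)))"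
  by (simp add: sum_subtractf)
 also have "... = (SUM y:{1..n}. of_int (cont (p y)))" by (simp add: cont_def)
 also have "... = (SUM c:D. of_int (cont c))" by (rule sum.reindex_bij_betw) (use D(2) in \<open>simp add: tab_def\<close>)
 finally show ?thesis by simp
qed

section \<open>Corners and the Schur relations\<close>

text \<open>The size \<open>n\<close> is that of the diagram left after the removal.\<close>

definition corners :: "nat => cells => cells" where
 "corners n D = {c \<in> D. young n (D - {c})}"

lemma cornerD: assumes "young (Suc n) D" "c \<in> corners n D"
 shows "c \<in> D" "young n (D - {c})" "\<And>d. d \<in> D ==> fst c \<le> fst d ==> snd c \<le> snd d ==> d = c"
proof -
 show 1: "c \<in> D" "young n (D - {c})" using assms(2) by (auto simp: corners_def)
 fix d assume d: "d \<in> D" "fst c \<le> fst d" "snd c \<le> snd d"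
 show "d = c" proof (rule ccontr)
  assume "d ~= c"
  hence "(fst d, snd d) \<in> D - {c}" using d by simp
  from youngD(3)[OF 1(2) this d(2,3)] show False by simp
 qed
qed

lemma cornerI:
 assumes "young (Suc n) D" "c \<in> D" "\<And>d. d \<in> D ==> fst c \<le> fst d ==> snd c \<le> snd d ==> d = c"
 shows "c \<in> corners n D"
proof -
 have "young n (D - {c})" unfolding young_def proof (intro conjI allI impI)
  show "finite (D - {c})" "card (D - {c}) = n" using youngD(1,2)[OF assms(1)] assms(2) by auto
  fix i j i' j' assume h: "(i, j) \<in> D - {c} \<and> i' \<le> i \<and> j' \<le> j"
  have "(i', j') \<in> D" by (rule youngD(3)[OF assms(1)]) (use h in auto)
  moreover have "(i', j') ~= c" using h assms(3)[of "(i, j)"] by auto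
  ultimately show "(i', j') \<in> D - {c}" by simp
 qed
 with assms(2) show ?thesis by (simp add: corners_def)
qed

lemma finite_corners: "young (Suc n) D ==> finite (corners n D)" unfolding corners_def using youngD(1) by auto

lemma corner_exists: assumes "young (Suc n) D" shows "corners n D ~= {}"
proof -
 have D: "finite D" "D ~= {}" using youngD(1,2)[OF assms] by auto
 let ?h = "%c. fst c + snd c"
 have "Max (?h ` D) \<in> ?h ` D" using D by (intro Max_in) auto
 then obtain c where c: "c \<in> D" "Max (?h ` D) = ?h c" by blast
 have "d = c" if "d \<in> D" "fst c \<le> fst d" "snd c \<le> snd d" for d proof -
  have "?h d \<le> Max (?h ` D)" using D(1) that(1) by (intro Max_ge) auto
  thus "d = c" using that c(2) by (auto simp: prod_eq_iff)
 qed
 from cornerI[OF assms c(1) this] show ?thesis by blast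
qed

lemma tab_extend: assumes "tab n (D - {c}) q" "c \<in> D" shows "tab (Suc n) D (q(Suc n := c))"
proof -
 have "bij_betw (q(Suc n := c)) {1..n} (D - {c})" using assms(1) unfolding tab_def by (subst bij_betw_cong[of _ _ q]) auto
 from notIn_Un_bij_betw[OF _ _ this, of "Suc n"]
 have "bij_betw (q(Suc n := c)) ({1..n} \<union> {Suc n}) (D - {c} \<union> {c})" by simp
 moreover have "{1..n} \<union> {Suc n} = {1..Suc n}" "D - {c} \<union> {c} = D" using assms(2) by auto
 ultimately show ?thesis unfolding tab_def by simp
qed

text \<open>The component of a function at the words with letter \<open>r\<close> in position
  \<open>Suc n\<close>, read as a function of words on \<open>n\<close> positions; there this letter
  is replaced by the default value 0. These operators carry the branching rule.\<close>

definition rs :: "nat => nat => wfun => wfun" where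
 "rs n r f = (%a. if a (Suc n) = 0 then f (a(Suc n := r)) else 0)"

lemma rs_comm: "comm n (rs n r)" unfolding comm_def
proof (intro conjI ballI allI)
 show "lmap UNIV (rs n r)" by (auto simp: lmap_def rs_def)
 fix g f assume g: "g \<in> symg n"
 have gS: "g (Suc n) = Suc n" by (rule sym_out[OF g]) simp
 have "(a o g)(Suc n := r) = a(Suc n := r) o g" for a proof
  fix x show "((a o g)(Suc n := r)) x = (a(Suc n := r) o g) x"
   using gS bij_is_inj[OF symD(2)[OF g]] by (cases "x = Suc n") (auto simp: inj_def)
 qed
 thus "rs n r (ga g f) = ga g (rs n r f)" using gS by (intro ext) (simp add: rs_def ga_def del: fun_upd_apply)
qed

lemma rs_wd: assumes "finite D" "c \<in> D" "a (Suc n) = 0" "a(Suc n := fst c) \<in> wd (Suc n) D"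
 shows "a \<in> wd n (D - {c})"
proof -
 let ?b = "a(Suc n := fst c)"
 have "a x = 0" if "x \<notin> {1..n}" for x using wd_out[OF assms(4), of x] assms(3) that by (cases "x = Suc n") auto
 moreover have "card {x \<in> {1..n}. a x = i} = rowlen (D - {c}) i" for i proof -
  have 1: "{x \<in> {1..Suc n}. ?b x = i} = {x \<in> {1..n}. a x = i} \<union> (if fst c = i then {Suc n} else {})" by auto
  have f: "finite {j. (i, j) \<in> D}" using finite_imageI[OF assms(1), of snd] by (rule rev_finite_subset) force
  have "card {x \<in> {1..n}. a x = i} + of_bool (fst c = i) = card {x \<in> {1..Suc n}. ?b x = i}"
   unfolding 1 by (subst card_Un_disjoint) auto
  also have "... = rowlen D i" by (rule wd_card[OF assms(4)])
  also have "... = rowlen (D - {c}) i + of_bool (fst c = i)" proof (cases "fst c = i")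
   case True hence "{j. (i, j) \<in> D} = insert (snd c) {j. (i, j) \<in> D - {c}}" using assms(2) by (cases c) auto
   moreover have "snd c \<notin> {j. (i, j) \<in> D - {c}}" using True by auto
   moreover have "finite {j. (i, j) \<in> D - {c}}" by (rule finite_subset[OF _ f]) auto
   ultimately show ?thesis using True unfolding rowlen_def by simp
  next case False
   hence "{j. (i, j) \<in> D - {c}} = {j. (i, j) \<in> D}" by auto
   thus ?thesis using False by (simp add: rowlen_def)
  qed
  finally show ?thesis by simp
 qed
 ultimately show ?thesis unfolding wd_def by simp
qed

lemma rs_pt: assumes D: "young (Suc n) D" "c \<in> corners n D" "tab n (D - {c}) q"
 shows "rs n (fst c) (pt (Suc n) (q(Suc n := c))) = pt n q"
proof -
 let ?p = "q(Suc n := c)"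
 note c = cornerD(1,2)[OF D(1,2)]
 have p: "tab (Suc n) D ?p" by (rule tab_extend[OF D(3) c(1)])
 have "calt n q (rs n (fst c) (pt (Suc n) ?p))" unfolding calt_def proof (intro allI impI)
  fix x y a assume sc: "samecol n q x y"
  hence sc': "samecol (Suc n) ?p x y" by (auto simp: samecol_def)
  have "(a o transpose x y)(Suc n := fst c) = a(Suc n := fst c) o transpose x y"
   using sc by (auto simp: fun_eq_iff samecol_def transpose_def)
  moreover have "(a o transpose x y) (Suc n) = a (Suc n)" using sc by (simp add: samecol_def transpose_def)
  ultimately show "rs n (fst c) (pt (Suc n) ?p) (a o transpose x y) = - rs n (fst c) (pt (Suc n) ?p) a"
   using pt_calt[of "Suc n" ?p] sc' unfolding rs_def calt_def by simp
 qed
 moreover have "rs n (fst c) (pt (Suc n) ?p) a = 0" if "a \<notin> wd n (D - {c})" for a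
  using rs_wd[OF youngD(1)[OF D(1)] c(1), of a n] that pt_supp[OF p] unfolding rs_def by auto
 ultimately have "rs n (fst c) (pt (Suc n) ?p) = (%a. rs n (fst c) (pt (Suc n) ?p) (rw n q) * pt n q a)"
  by (rule pt_unique[OF c(2) D(3)])
 moreover have "(rw n q)(Suc n := fst c) = rw (Suc n) ?p" by (auto simp: rw_def fun_eq_iff)
 hence "rs n (fst c) (pt (Suc n) ?p) (rw n q) = 1" using pt_rw[OF p] unfolding rs_def by (simp add: rw_def)
 ultimately show ?thesis by simp
qed

text \<open>A corner is the lowest cell of its column, so a column permutation only brings letters
  of rows up to \<open>fst c\<close> to position \<open>Suc n\<close>.\<close>

lemma pt_above: assumes D: "young (Suc n) D" "c \<in> corners n D" "tab n (D - {c}) q" and a: "a (Suc n) > fst c"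
 shows "pt (Suc n) (q(Suc n := c)) a = 0" unfolding pt_def
proof (rule sum.neutral, intro ballI)
 let ?p = "q(Suc n := c)"
 fix \<sigma> assume \<sigma>: "\<sigma> \<in> colst (Suc n) ?p"
 have p: "tab (Suc n) D ?p" by (rule tab_extend[OF D(3) cornerD(1)[OF D(1,2)]])
 have s: "\<sigma> \<in> symg (Suc n)" by (rule colst_sym[OF \<sigma>])
 have "a ~= rw (Suc n) ?p o inv \<sigma>" proof
  assume eq: "a = rw (Suc n) ?p o inv \<sigma>"
  define z where "z = inv \<sigma> (Suc n)"
  have z: "z \<in> {1..Suc n}" unfolding z_def using sym_in[OF symD(4)[OF s], of "Suc n"] by simp
  have \<sigma>z: "\<sigma> z = Suc n" unfolding z_def using pointfree_idE[OF symD(5)[OF s]] by simp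
  have "snd (?p (\<sigma> z)) = snd (?p z)" using \<sigma> z unfolding colst_def by blast
  hence "snd (?p z) = snd c" unfolding \<sigma>z by simp
  moreover have "fst (?p z) = a (Suc n)" unfolding eq using z by (simp add: rw_def z_def del: fun_upd_apply)
  ultimately have "?p z = c" using cornerD(3)[OF D(1,2) tabD(1)[OF p z]] a by simp
  with \<open>fst (?p z) = a (Suc n)\<close> a show False by simp
 qed
 thus "of_int (sign \<sigma>) * of_bool (a = rw (Suc n) ?p o inv \<sigma>) = (0::rat)" by simp
qed

lemma pt_nonzero: "tab n D p ==> pt n p ~= (%_. 0)" using pt_rw[of n D p] by (auto dest: fun_cong[of _ _ "rw n p"])

lemma cpoly_insert: assumes "finite D" "c \<in> D"
 shows "coeff (cpoly D) i = cont c * coeff (cpoly (D - {c})) i + (if i = 0 then 0 else coeff (cpoly (D - {c})) (i - 1))"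
proof -
 have "cpoly D = [:cont c, 1:] * cpoly (D - {c})" unfolding cpoly_def by (rule prod.remove[OF assms])
 thus ?thesis by (simp add: coeff_pCons split: nat.split)
qed

lemma jsum_specht: assumes "young n D" "f \<in> specht n D" shows "jsum n f = (%a. of_int (SUM c:D. cont c) * f a)"
proof -
 obtain p where p: "tab n D p" using tab_exists[OF assms(1)] by blast
 show ?thesis using specht_scalar[OF assms(1) p jsum_comm wsup_jsum assms(2)] jsum_pt[OF assms(1) p] by simp
qed

text \<open>The action is scalar by \<open>specht_scalar\<close>, and the scalar is computed after
  applying \<open>rs\<close> at a corner that holds the last entry. There \<open>jm (Suc n)\<close>,
  the difference of two values of \<open>jsum\<close>, becomes multiplication by the content of the
  corner.\<close>

lemma jel_specht: assumes "young n D" "f \<in> specht n D"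
 shows "jel n i f = (%a. of_int (coeff (cpoly D) i) * f a)" using assms
proof (induction n arbitrary: D f i)
 case 0 hence "D = {}" using youngD(1,2) by fastforce thus ?case by (auto simp: cpoly_def)
next case (Suc n)
 obtain c where c: "c \<in> corners n D" using corner_exists[OF Suc.prems(1)] by blast
 let ?D = "D - {c}"
 note cD = cornerD(1,2)[OF Suc.prems(1) c]
 obtain q where q: "tab n ?D q" using tab_exists[OF cD(2)] by blast
 define p where "p = q(Suc n := c)"
 define e where "e = pt (Suc n) p"
 have p: "tab (Suc n) D p" unfolding p_def by (rule tab_extend[OF q cD(1)])
 have eS: "e \<in> specht (Suc n) D" unfolding e_def by (rule pt_specht[OF p])
 note R = commD[OF rs_comm[of n "fst c"]]
 define s where "s = jel (Suc n) i e (rw (Suc n) p)"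
 have scal: "jel (Suc n) i f = (%a. s * f a)" if "f \<in> specht (Suc n) D" for f unfolding s_def e_def
  by (rule specht_scalar[OF Suc.prems(1) p jel_comm wsup_jel[OF order_refl] that])
 let ?r = "rs n (fst c)"
 have re: "?r e = pt n q" unfolding e_def p_def by (rule rs_pt[OF Suc.prems(1) c q])
 have IH: "jel n i (pt n q) = (%a. of_int (coeff (cpoly ?D) i) * pt n q a)" for i by (rule Suc.IH[OF cD(2) pt_specht[OF q]])
 have rj: "?r (jel n i f) = jel n i (?r f)" for i f by (rule jel_intertwine[OF rs_comm])
 have "jm (Suc n) e = (%a. jsum (Suc n) e a + (-1) * jsum n e a)" by (simp add: jsum_Suc)
 hence "?r (jm (Suc n) e) = ?r (%a. jsum (Suc n) e a + (-1) * jsum n e a)" by (rule arg_cong)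
 also have "... = (%a. ?r (jsum (Suc n) e) a + (-1) * ?r (jsum n e) a)" by (rule R(3))
 also have "?r (jsum (Suc n) e) = (%a. of_int (SUM c:D. cont c) * pt n q a)"
  unfolding jsum_specht[OF Suc.prems(1) eS] R(6) re ..
 also have "?r (jsum n e) = jsum n (pt n q)" unfolding comm_jsum[OF rs_comm] re ..
 also have "jsum n (pt n q) = (%a. of_int (SUM c:?D. cont c) * pt n q a)" by (rule jsum_specht[OF cD(2) pt_specht[OF q]])
 finally have rjm: "?r (jm (Suc n) e) = (%a. of_int (cont c) * pt n q a)"
  using sum.remove[OF youngD(1)[OF Suc.prems(1)] cD(1), of cont] by (simp add: algebra_simps)
 have "jel (Suc n) i e = (%a. jel n i (jm (Suc n) e) a + (if i = 0 then 0 else 1) * jel n (i - 1) e a)"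
  using jel_intertwine[OF jm_comm] by simp
 hence "?r (jel (Suc n) i e)
   = ?r (%a. jel n i (jm (Suc n) e) a + (if i = 0 then 0 else 1) * jel n (i - 1) e a)" by (rule arg_cong)
 also have "... = (%a. jel n i (?r (jm (Suc n) e)) a + (if i = 0 then 0 else 1) * jel n (i - 1) (pt n q) a)"
  unfolding R(3) rj re ..
 also have "... = (%a. of_int (coeff (cpoly D) i) * pt n q a)"
  unfolding rjm commD(6)[OF jel_comm] IH cpoly_insert[OF youngD(1)[OF Suc.prems(1)] cD(1)] by (auto simp: algebra_simps)
 finally have "(%a. s * pt n q a) = (%a. of_int (coeff (cpoly D) i) * pt n q a)" unfolding scal[OF eS] R(6) re .
 from fun_cong[OF this, of "rw n q"] have "s = of_int (coeff (cpoly D) i)" using pt_rw[OF q] by simp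
 with scal[OF Suc.prems(2)] show ?case by simp
qed

text \<open>The contents are the negated roots of \<open>cpoly\<close>, with multiplicities.\<close>

lemma cpoly_card: assumes "finite D" "cpoly D = cpoly D'" "finite D'"
 shows "card {c \<in> D. cont c = z} = card {c \<in> D'. cont c = z}"
proof -
 have "count (proots (cpoly D)) (- z) = card {c \<in> D. cont c = z}" if "finite D" for D proof -
  have "proots (cpoly D) = (SUM c:D. {#- cont c#})" unfolding cpoly_def by (subst proots_prod) auto
  hence "count (proots (cpoly D)) (- z) = (SUM c:D. count {#- cont c#} (- z))" by (simp add: count_sum)
  also have "... = (SUM c:D. of_bool (cont c = z))" by (intro sum.cong) auto
  also have "... = card {c \<in> D. cont c = z}" using that by (simp add: of_bool_def sum.If_cases Int_def)
  finally show ?thesis .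
 qed
 from this[OF assms(1)] this[OF assms(3)] assms(2) show ?thesis by simp
qed

text \<open>A diagram meets every diagonal in an initial segment, so it is determined by the number
  of its cells of each content.\<close>

lemma young_diagonal: assumes "young n D"
 shows "(i, j) \<in> D \<longleftrightarrow> min i j < card {c \<in> D. cont c = int j - int i}"
proof -
 let ?z = "int j - int i"
 let ?T = "{t. (t + (i - min i j), t + (j - min i j)) \<in> D}"
 have fD: "finite D" by (rule youngD(1)[OF assms])
 have bij: "bij_betw (%c. min (fst c) (snd c)) {c \<in> D. cont c = ?z} ?T" proof (rule bij_betwI')
  fix c d assume "c \<in> {c \<in> D. cont c = ?z}" "d \<in> {c \<in> D. cont c = ?z}"
  thus "(min (fst c) (snd c) = min (fst d) (snd d)) = (c = d)"
   by (cases c; cases d) (auto simp: cont_def min_def split: if_splits)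
 next fix c assume c: "c \<in> {c \<in> D. cont c = ?z}"
  hence "min (fst c) (snd c) + (i - min i j) = fst c" "min (fst c) (snd c) + (j - min i j) = snd c"
   by (auto simp: cont_def min_def split: if_splits)
  thus "min (fst c) (snd c) \<in> ?T" using c by simp
 next fix t assume "t \<in> ?T"
  thus "\<exists>c\<in>{c \<in> D. cont c = ?z}. t = min (fst c) (snd c)"
   by (intro bexI[of _ "(t + (i - min i j), t + (j - min i j))"]) (auto simp: cont_def)
 qed
 have fT: "finite ?T" using bij_betw_finite[OF bij] fD by simp
 have "?T = {..<card ?T}" proof (rule down_closed_nat[OF fT])
  fix s t assume st: "s \<in> ?T" "t \<le> s"
  have "(t + (i - min i j), t + (j - min i j)) \<in> D"
   by (rule youngD(3)[OF assms, of "s + (i - min i j)" "s + (j - min i j)"]) (use st in auto)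
  thus "t \<in> ?T" by simp
 qed
 hence "min i j \<in> ?T \<longleftrightarrow> min i j < card ?T" by blast
 moreover have "min i j \<in> ?T \<longleftrightarrow> (i, j) \<in> D" by simp
 ultimately show ?thesis using bij_betw_same_card[OF bij] by simp
qed

lemma cpoly_inj: assumes "young n D" "young n' D'" "cpoly D = cpoly D'" shows "D = D'"
proof -
 have "(i, j) \<in> D \<longleftrightarrow> (i, j) \<in> D'" for i j
  unfolding young_diagonal[OF assms(1)] young_diagonal[OF assms(2)]
   cpoly_card[OF youngD(1)[OF assms(1)] assms(3) youngD(1)[OF assms(2)]] ..
 thus ?thesis by auto
qed

section \<open>Integral bases of Specht modules and Schur orthogonality\<close>

definition pJ :: "nat => cells => word set" where
 "pJ n D = fst (SOME x. pivot (specht n D) (fst x) (snd x) \<and> (\<forall>j\<in>fst x. \<forall>a. zint (snd x j a)))"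

text \<open>The choice operator is applied to the same pair as in \<open>pJ\<close>, so index set
  and vectors fit together. Integrality makes this a basis, over the 2-local integers, of the
  integral functions in the module.\<close>

definition pB :: "nat => cells => word => wfun" where
 "pB n D = snd (SOME x. pivot (specht n D) (fst x) (snd x) \<and> (\<forall>j\<in>fst x. \<forall>a. zint (snd x j a)))"

definition sdim :: "nat => cells => nat" where
 "sdim n D = card (pJ n D)"

lemma pivot_specht: assumes "young n D"
 shows "pivot (specht n D) (pJ n D) (pB n D)" "j \<in> pJ n D ==> zint (pB n D j a)"
proof -
 note f = fdspD[OF fdsp_specht[OF assms]]
 have "\<exists>J b. J \<subseteq> wd n D \<and> pivot (specht n D) J b \<and> (\<forall>j\<in>J. \<forall>a. zint (b j a))"
  by (rule integral_pivot[OF f(1,2)]) (rule f(3))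
 then obtain J b where "pivot (specht n D) J b" "\<forall>j\<in>J. \<forall>a. zint (b j a)" by (elim exE conjE)
 hence "\<exists>x. pivot (specht n D) (fst x) (snd x) \<and> (\<forall>j\<in>fst x. \<forall>a. zint (snd x j a))"
  by (intro exI[of _ "(J, b)"]) simp
 from someI_ex[OF this]
 have h: "pivot (specht n D) (pJ n D) (pB n D) \<and> (\<forall>j\<in>pJ n D. \<forall>a. zint (pB n D j a))"
  unfolding pJ_def pB_def .
 show "pivot (specht n D) (pJ n D) (pB n D)" by (rule conjunct1[OF h])
 show "zint (pB n D j a)" if "j \<in> pJ n D" using conjunct2[OF h] that by simp
qed

lemmas pBD = pivotD[OF pivot_specht(1)]

lemma sdim_pos: assumes "young n D" shows "sdim n D > 0"
proof -
 obtain p where p: "tab n D p" using tab_exists[OF assms] by blast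
 have "pJ n D ~= {}" proof
  assume "pJ n D = {}"
  with pBD(4)[OF assms pt_specht[OF p]] have "pt n p = (%_. 0)" by simp
  with pt_nonzero[OF p] show False by simp
 qed
 thus ?thesis using pBD(1)[OF assms] by (simp add: sdim_def card_gt_0_iff)
qed

text \<open>The sum of the conjugates of the rank one operator \<open>v \<mapsto> \<psi> v \<cdot> u\<close>.\<close>

definition avg :: "nat => (wfun => rat) => wfun
  => wfun => wfun" where
 "avg n \<psi> u v = (%a. SUM g:symg n. \<psi> (ga (inv g) v) * ga g u a)"

lemma lfunD: "lfun S x ==> f \<in> S ==> g \<in> S ==> x (%a. f a + c * g a) = x f + c * x g"
 unfolding lfun_def by (drule (1) bspec, drule (1) bspec, erule spec)

lemma lsp_UNIV [simp]: "lsp UNIV" by (simp add: lsp_def)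

lemma avg_comm: assumes "lfun UNIV \<psi>" shows "comm n (avg n \<psi> u)" unfolding comm_def
proof (intro conjI ballI allI)
 have l: "\<psi> (ga g (%a. f a + c * h a)) = \<psi> (ga g f) + c * \<psi> (ga g h)" for g f h c
  using lfunD[OF assms UNIV_I UNIV_I, of "ga g f" c "ga g h"] by (simp add: ga_def)
 show "lmap UNIV (avg n \<psi> u)"
  unfolding lmap_def avg_def l by (simp add: ring_distribs sum.distrib sum_distrib_left mult.assoc)
 fix g f assume g: "g \<in> symg n"
 show "avg n \<psi> u (ga g f) = ga g (avg n \<psi> u f)" proof
  fix a
  have "avg n \<psi> u (ga g f) a = (SUM h:symg n. \<psi> (ga (inv (g o h) o g) f) * ga (g o h) u a)"
   unfolding avg_def ga_ga by (rule sum_sym_left[OF g, symmetric])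
  also have "... = (SUM h:symg n. \<psi> (ga (inv h) f) * ga (g o h) u a)" proof (intro sum.cong refl)
   fix h assume h: "h \<in> symg n"
   have "inv (g o h) o g = inv h" unfolding inv_comp[OF g h] by (simp add: comp_assoc symD[OF g])
   thus "\<psi> (ga (inv (g o h) o g) f) * ga (g o h) u a = \<psi> (ga (inv h) f) * ga (g o h) u a" by simp
  qed
  finally show "avg n \<psi> u (ga g f) a = ga g (avg n \<psi> u f) a" by (simp add: avg_def ga_def comp_assoc)
 qed
qed

lemma avg_specht: "young n D ==> u \<in> specht n D ==> avg n \<psi> u v \<in> specht n D"
 unfolding avg_def by (rule lsp_sum[OF lsp_specht]) (rule ga_specht)

text \<open>The averaged operator commutes with the central elements \<open>jel\<close>, whose
  eigenvalues on the two modules are the coefficients of different polynomials.\<close>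

lemma schur_distinct: assumes D: "young n D" "young n D'" "D ~= D'" and \<psi>: "lfun UNIV \<psi>"
  and u: "u \<in> specht n D'" and v: "v \<in> specht n D"
 shows "avg n \<psi> u v = (%_. 0)"
proof -
 have "cpoly D ~= cpoly D'" using cpoly_inj[OF D(1,2)] D(3) by blast
 then obtain i where i: "coeff (cpoly D) i ~= coeff (cpoly D') i" using poly_eqI by blast
 have "avg n \<psi> u (jel n i v) = jel n i (avg n \<psi> u v)" by (rule jel_intertwine[OF avg_comm[OF \<psi>]])
 hence "(%a. of_int (coeff (cpoly D) i) * avg n \<psi> u v a) = (%a. of_int (coeff (cpoly D') i) * avg n \<psi> u v a)"
  unfolding jel_specht[OF D(1) v] jel_specht[OF D(2) avg_specht[OF D(2) u]] commD(6)[OF avg_comm[OF \<psi>]] .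
 from fun_cong[OF this] i have "avg n \<psi> u v a = 0" for a by simp
 thus ?thesis by (rule ext)
qed

text \<open>The scalar is found from the trace in the pivot basis: each of the \<open>fact n\<close>
  conjugates of the operator has trace \<open>\<psi> u\<close>.\<close>

lemma schur_scalar:
 assumes D: "young n D" and \<psi>: "lfun UNIV \<psi>" and u: "u \<in> specht n D" and v: "v \<in> specht n D"
 shows "avg n \<psi> u v = (%a. fact n * \<psi> u / of_nat (sdim n D) * v a)"
proof -
 obtain p where p: "tab n D p" using tab_exists[OF D] by blast
 define c where "c = avg n \<psi> u (pt n p) (rw n p)"
 have c: "avg n \<psi> u w = (%a. c * w a)" if "w \<in> specht n D" for w unfolding c_def
 proof (rule specht_scalar[OF D p avg_comm[OF \<psi>] _ that])
  show "wsup n D (avg n \<psi> u f)" for f using specht_supp[OF avg_specht[OF D u]] by (simp add: wsup_def)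
 qed
 let ?J = "pJ n D" and ?b = "pB n D"
 note b = pBD[OF D]
 have "c * of_nat (sdim n D) = (SUM j:?J. avg n \<psi> u (?b j) j)" using c[OF b(2)] b(3) by (simp add: sdim_def)
 also have "... = (SUM g:symg n. SUM j:?J. ga g u j * \<psi> (ga (inv g) (?b j)))"
  unfolding avg_def by (subst sum.swap) (simp add: mult.commute)
 also have "... = (SUM g:symg n. \<psi> u)" proof (intro sum.cong refl)
  fix g assume g: "g \<in> symg n"
  have "(SUM j:?J. ga g u j * \<psi> (ga (inv g) (?b j))) = \<psi> (%a. SUM j:?J. ga g u j * ga (inv g) (?b j) a)"
   by (rule lfun_sum[OF lsp_UNIV \<psi>, symmetric]) simp
  also have "(%a. SUM j:?J. ga g u j * ga (inv g) (?b j) a) = ga (inv g) (%a. SUM j:?J. ga g u j * ?b j a)"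
   by (simp add: ga_def)
  also have "(%a. SUM j:?J. ga g u j * ?b j a) = ga g u" by (rule b(4)[OF ga_specht[OF D g u], symmetric])
  also have "ga (inv g) (ga g u) = u" by (rule ga_inv(2)[OF g])
  finally show "(SUM j:?J. ga g u j * \<psi> (ga (inv g) (?b j))) = \<psi> u" .
 qed
 also have "... = fact n * \<psi> u" by (simp add: card_sym)
 finally have "c = fact n * \<psi> u / of_nat (sdim n D)" using sdim_pos[OF D] by (simp add: field_simps)
 with c[OF v] show ?thesis by simp
qed

lemma lfun_eval: "lfun S (%f. f a)" by (simp add: lfun_def)

lemma schur_functional:
 assumes D: "young n D" and \<phi>: "lfun UNIV \<phi>" and \<psi>: "lfun UNIV \<psi>" and u: "u \<in> specht n D" and v: "v \<in> specht n D"
 shows "(SUM g:symg n. \<phi> (ga g u) * \<psi> (ga (inv g) v)) = fact n / of_nat (sdim n D) * \<phi> v * \<psi> u"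
proof -
 have "\<phi> (avg n \<psi> u v) = (SUM g:symg n. \<psi> (ga (inv g) v) * \<phi> (ga g u))"
  unfolding avg_def by (rule lfun_sum[OF lsp_UNIV \<phi>]) simp
 moreover have "\<phi> (avg n \<psi> u v) = fact n * \<psi> u / of_nat (sdim n D) * \<phi> v"
  unfolding schur_scalar[OF D \<psi> u v] by (rule lfun_scale[OF lsp_UNIV \<phi>]) simp
 ultimately show ?thesis by (simp add: mult.commute mult.left_commute)
qed

section \<open>Counting standard tableaux\<close>

text \<open>Paths in Young's graph from \<open>K\<close>, of size \<open>m\<close>, to
  \<open>D\<close> in \<open>p\<close> steps, followed downwards from \<open>D\<close>; for empty
  \<open>K\<close> they are the standard tableaux.\<close>

primrec pathc :: "cells => nat => nat => cells => nat" where
 "pathc K m 0 D = of_bool (D = K)"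
| "pathc K m (Suc p) D = (SUM c:corners (m + p) D. pathc K m p (D - {c}))"

definition addable :: "nat => cells => cells" where
 "addable n D = {c. c \<notin> D \<and> young (Suc n) (insert c D)}"

definition par :: "nat => cells set" where
 "par n = {D. young n D}"

lemma young_0 [simp]: "young 0 D \<longleftrightarrow> D = {}" unfolding young_def by auto

lemma young_rowlen: assumes "young n D" shows "(i, j) \<in> D \<longleftrightarrow> j < rowlen D i"
proof -
 have "finite {j. (i, j) \<in> D}" using finite_imageI[OF youngD(1)[OF assms], of snd] by (rule rev_finite_subset) force
 hence "{j. (i, j) \<in> D} = {..<rowlen D i}" unfolding rowlen_def proof (rule down_closed_nat)
  fix j j' assume "j \<in> {j. (i, j) \<in> D}" "j' \<le> j"
  thus "j' \<in> {j. (i, j) \<in> D}" using youngD(3)[OF assms, of i j i j'] by simp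
 qed
 thus ?thesis by blast
qed

lemma rowlen_antimono: assumes "young n D" "i \<le> i'" shows "rowlen D i' \<le> rowlen D i"
proof (rule ccontr)
 assume "\<not> ?thesis"
 hence "(i', rowlen D i) \<in> D" using young_rowlen[OF assms(1)] by simp
 hence "(i, rowlen D i) \<in> D" using youngD(3)[OF assms(1), of i' "rowlen D i" i "rowlen D i"] assms(2) by simp
 thus False using young_rowlen[OF assms(1)] by simp
qed

lemma young_bound: assumes "young n D" "(i, j) \<in> D" shows "i < n" "j < n"
proof -
 have "(%t. (t, j)) ` {..i} \<subseteq> D" "(%t. (i, t)) ` {..j} \<subseteq> D" using youngD(3)[OF assms(1,2)] by auto
 from card_mono[OF youngD(1)[OF assms(1)] this(1)] card_mono[OF youngD(1)[OF assms(1)] this(2)]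
 show "i < n" "j < n" using youngD(2)[OF assms(1)] by (simp_all add: card_image inj_on_def)
qed

lemma finite_par [simp]: "finite (par n)"
proof (rule finite_subset)
 show "par n \<subseteq> Pow ({..<n} \<times> {..<n})" unfolding par_def using young_bound by fast
qed simp

lemma young_Int: assumes "young a A" "young b B" "card (A \<inter> B) = n" shows "young n (A \<inter> B)"
 unfolding young_def proof (intro conjI allI impI)
 show "finite (A \<inter> B)" using youngD(1)[OF assms(1)] by simp
 fix i j i' j' assume h: "(i, j) \<in> A \<inter> B \<and> i' \<le> i \<and> j' \<le> j"
 have "(i', j') \<in> A" by (rule youngD(3)[OF assms(1)]) (use h in auto)
 moreover have "(i', j') \<in> B" by (rule youngD(3)[OF assms(2)]) (use h in auto)
 ultimately show "(i', j') \<in> A \<inter> B" by simp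
qed (rule assms(3))

lemma young_Un: assumes "young a A" "young b B" "card (A \<union> B) = n" shows "young n (A \<union> B)" unfolding young_def
proof (intro conjI allI impI)
 show "finite (A \<union> B)" using youngD(1)[OF assms(1)] youngD(1)[OF assms(2)] by simp
 fix i j i' j' assume h: "(i, j) \<in> A \<union> B \<and> i' \<le> i \<and> j' \<le> j"
 then consider "(i, j) \<in> A" | "(i, j) \<in> B" by blast
 thus "(i', j') \<in> A \<union> B"
  using youngD(3)[OF assms(1), of i j i' j'] youngD(3)[OF assms(2), of i j i' j'] h by cases simp_all
qed (rule assms(3))

lemma corners_rowlen: assumes "young (Suc n) D"
 shows "corners n D = (%i. (i, rowlen D i - 1)) ` {i. rowlen D (Suc i) < rowlen D i}"
proof (intro equalityI subsetI)
 fix c assume c: "c \<in> corners n D"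
 obtain i j where ij: "c = (i, j)" by (cases c)
 have j: "j < rowlen D i" using cornerD(1)[OF assms c] young_rowlen[OF assms] ij by simp
 have "(i, Suc j) \<notin> D" "(Suc i, j) \<notin> D"
  using cornerD(3)[OF assms c, of "(i, Suc j)"] cornerD(3)[OF assms c, of "(Suc i, j)"] ij by auto
 hence "rowlen D i \<le> Suc j" "rowlen D (Suc i) \<le> j" using young_rowlen[OF assms] by simp_all
 thus "c \<in> (%i. (i, rowlen D i - 1)) ` {i. rowlen D (Suc i) < rowlen D i}"
  using j ij by (intro image_eqI[of _ _ i]) auto
next fix c assume "c \<in> (%i. (i, rowlen D i - 1)) ` {i. rowlen D (Suc i) < rowlen D i}"
 then obtain i where i: "c = (i, rowlen D i - 1)" "rowlen D (Suc i) < rowlen D i" by blast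
 show "c \<in> corners n D" proof (rule cornerI[OF assms])
  show "c \<in> D" using i young_rowlen[OF assms] by simp
  fix d assume d: "d \<in> D" "fst c \<le> fst d" "snd c \<le> snd d"
  have l: "snd d < rowlen D (fst d)" using d(1) young_rowlen[OF assms, of "fst d" "snd d"] by simp
  have "fst d = i" proof (rule ccontr)
   assume "fst d ~= i"
   hence "rowlen D (fst d) \<le> rowlen D (Suc i)" using d(2) i by (intro rowlen_antimono[OF assms]) simp
   thus False using l d(3) i by simp
  qed
  thus "d = c" using l d(3) i by (simp add: prod_eq_iff)
 qed
qed

lemma addable_rowlen: assumes "young n D"
 shows "addable n D = (%i. (i, rowlen D i)) ` {i. i = 0 \<or> rowlen D i < rowlen D (i - 1)}"
proof (intro equalityI subsetI)
 fix c assume c: "c \<in> addable n D"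
 obtain i j where ij: "c = (i, j)" by (cases c)
 have y: "young (Suc n) (insert (i, j) D)" and nD: "(i, j) \<notin> D" using c ij by (auto simp: addable_def)
 have "rowlen D i \<le> j" using nD young_rowlen[OF assms] by simp
 moreover have "j \<le> rowlen D i" proof (rule ccontr)
  assume "\<not> ?thesis"
  hence "(i, rowlen D i) \<in> insert (i, j) D" "rowlen D i ~= j" using youngD(3)[OF y, of i j i "rowlen D i"] by auto
  thus False using young_rowlen[OF assms] by auto
 qed
 ultimately have j: "j = rowlen D i" by simp
 have "rowlen D i < rowlen D (i - 1)" if "i ~= 0" proof -
  have "(i - 1, j) \<in> insert (i, j) D" using youngD(3)[OF y, of i j "i - 1" j] by simp
  hence "(i - 1, j) \<in> D" using that by auto
  thus ?thesis using young_rowlen[OF assms] j by simp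
 qed
 thus "c \<in> (%i. (i, rowlen D i)) ` {i. i = 0 \<or> rowlen D i < rowlen D (i - 1)}"
  using ij j by (intro image_eqI[of _ _ i]) auto
next fix c assume "c \<in> (%i. (i, rowlen D i)) ` {i. i = 0 \<or> rowlen D i < rowlen D (i - 1)}"
 then obtain i where i: "c = (i, rowlen D i)" "i = 0 \<or> rowlen D i < rowlen D (i - 1)" by blast
 have nD: "c \<notin> D" using i young_rowlen[OF assms] by simp
 have "young (Suc n) (insert c D)" unfolding young_def proof (intro conjI allI impI)
  show "finite (insert c D)" "card (insert c D) = Suc n" using youngD(1,2)[OF assms] nD by auto
  fix a b a' b' assume h: "(a, b) \<in> insert c D \<and> a' \<le> a \<and> b' \<le> b"
  show "(a', b') \<in> insert c D" proof (cases "(a, b) = c")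
   case False thus ?thesis using youngD(3)[OF assms, of a b a' b'] h by simp
  next case True
   hence ab: "a = i" "b = rowlen D i" using i by auto
   show ?thesis proof (cases "a' = a")
    case True thus ?thesis using ab h i young_rowlen[OF assms, of a' b'] by (cases "b' = b") auto
   next case False
    hence "a' \<le> i - 1" "i ~= 0" using h ab by auto
    hence "rowlen D (i - 1) \<le> rowlen D a'" by (intro rowlen_antimono[OF assms])
    hence "b' < rowlen D a'" using h ab i \<open>i ~= 0\<close> by simp
    thus ?thesis using young_rowlen[OF assms] by simp
   qed
  qed
 qed
 thus "c \<in> addable n D" using nD by (simp add: addable_def)
qed

lemma finite_addable: "young n D ==> finite (addable n D)"
proof -
 assume "young n D"
 have "addable n D \<subseteq> {..<Suc n} \<times> {..<Suc n}" unfolding addable_def using young_bound by fast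
 thus ?thesis by (rule finite_subset) simp
qed

text \<open>A cell can always be added to the first row, and to row \<open>Suc i\<close> exactly
  when row \<open>i\<close> ends in a corner.\<close>

lemma card_addable: assumes "young (Suc n) D" shows "card (addable (Suc n) D) = card (corners n D) + 1"
proof -
 let ?L = "rowlen D"
 have c: "card (corners n D) = card {i. ?L (Suc i) < ?L i}"
  unfolding corners_rowlen[OF assms] by (rule card_image) (auto simp: inj_on_def)
 have fin: "finite {i. ?L (Suc i) < ?L i}" proof (rule finite_subset)
  show "{i. ?L (Suc i) < ?L i} \<subseteq> {..<Suc n}" proof
   fix i assume "i \<in> {i. ?L (Suc i) < ?L i}"
   hence "(i, 0) \<in> D" using young_rowlen[OF assms] by simp
   thus "i \<in> {..<Suc n}" using young_bound(1)[OF assms] by simp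
  qed
 qed simp
 have "card (addable (Suc n) D) = card {i. i = 0 \<or> ?L i < ?L (i - 1)}"
  unfolding addable_rowlen[OF assms] by (rule card_image) (auto simp: inj_on_def)
 also have "{i. i = 0 \<or> ?L i < ?L (i - 1)} = insert 0 (Suc ` {i. ?L (Suc i) < ?L i})" proof (intro equalityI subsetI)
  fix i assume "i \<in> {i. i = 0 \<or> ?L i < ?L (i - 1)}"
  thus "i \<in> insert 0 (Suc ` {i. ?L (Suc i) < ?L i})" by (cases i) auto
 qed auto
 also have "card \<dots> = card {i. ?L (Suc i) < ?L i} + 1" using fin by (simp add: card_image)
 finally show ?thesis using c by simp
qed

abbreviation syt :: "nat => cells => nat" where
 "syt n D \<equiv> pathc {} 0 n D"

lemma syt_Suc: "syt (Suc n) D = (SUM c:corners n D. syt n (D - {c}))" by simp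

text \<open>Intersections and unions of diagrams are diagrams, so the addition and the removal of
  distinct cells can be exchanged.\<close>

lemma exchange_corner_addable: assumes D: "young (Suc n) D" and ne: "c ~= c'"
 shows "c \<in> addable (Suc n) D \<and> c' \<in> corners (Suc n) (insert c D)
   \<longleftrightarrow> c' \<in> corners n D \<and> c \<in> addable n (D - {c'})" proof
 have fD: "finite D" "card D = Suc n" using youngD(1,2)[OF D] by auto
 {
  assume h: "c \<in> addable (Suc n) D \<and> c' \<in> corners (Suc n) (insert c D)"
  hence y: "young (Suc (Suc n)) (insert c D)" "c \<notin> D" "c' \<in> D" "young (Suc n) (insert c D - {c'})"
   using ne by (auto simp: addable_def corners_def)
  have "D \<inter> (insert c D - {c'}) = D - {c'}" using y by auto
  hence "young n (D - {c'})" using young_Int[OF D y(4), of n] fD y(3) by simp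
  moreover have "insert c (D - {c'}) = insert c D - {c'}" using ne by auto
  ultimately show "c' \<in> corners n D \<and> c \<in> addable n (D - {c'})" using y by (simp add: addable_def corners_def)
 next assume h: "c' \<in> corners n D \<and> c \<in> addable n (D - {c'})"
  hence y: "c' \<in> D" "young n (D - {c'})" "c \<notin> D" "young (Suc n) (insert c (D - {c'}))"
   using ne by (auto simp: addable_def corners_def)
  have "D \<union> insert c (D - {c'}) = insert c D" by auto
  hence "young (Suc (Suc n)) (insert c D)" using young_Un[OF D y(4), of "Suc (Suc n)"] fD y(3) by simp
  moreover have "insert c D - {c'} = insert c (D - {c'})" using ne by auto
  ultimately show "c \<in> addable (Suc n) D \<and> c' \<in> corners (Suc n) (insert c D)"
   using y by (simp add: addable_def corners_def)
 }
qed

lemma addableD: assumes "c \<in> addable n D" shows "c \<notin> D" "young (Suc n) (insert c D)"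
 using assms by (auto simp: addable_def)

text \<open>The commutation relation of adding and removing cells: exchanging the two steps matches
  all pairs of distinct cells, and the pairs of equal cells leave the surplus 1 from
  \<open>card_addable\<close>.\<close>

lemma syt_up: "young n D ==> (SUM c:addable n D. int (syt (Suc n) (insert c D))) = (int n + 1) * int (syt n D)"
proof (induction n arbitrary: D)
 case 0 hence D: "D = {}" by simp
 have r: "rowlen {} i = 0" for i by (simp add: rowlen_def)
 have a: "addable 0 {} = {(0, 0)}" using addable_rowlen[of 0 "{}"] r by auto
 have "(0, 0) \<in> corners 0 {(0, 0)}" by (simp add: corners_def)
 hence "corners 0 {(0, 0)} = {(0, 0)}" by (auto simp: corners_def)
 thus ?case unfolding D a by simp
next case (Suc n)
 note D = Suc.prems
 let ?s = "syt (Suc n)"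
 have fa: "finite (addable (Suc n) D)" and fc: "finite (corners n D)"
  by (rule finite_addable[OF D], rule finite_corners[OF D])
 have st: "int (syt (Suc (Suc n)) (insert c D))
   = int (?s D) + (\<Sum>c'\<in>corners (Suc n) (insert c D) - {c}. int (?s (insert c D - {c'})))"
  if c: "c \<in> addable (Suc n) D" for c proof -
  have y: "young (Suc (Suc n)) (insert c D)" "c \<notin> D" using addableD[OF c] by auto
  hence cc: "c \<in> corners (Suc n) (insert c D)" using D by (simp add: corners_def)
  have "int (syt (Suc (Suc n)) (insert c D)) = (\<Sum>c'\<in>corners (Suc n) (insert c D). int (?s (insert c D - {c'})))"
   by simp
  also have "... = int (?s (insert c D - {c})) + (\<Sum>c'\<in>corners (Suc n) (insert c D) - {c}. int (?s (insert c D - {c'})))"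
   by (rule sum.remove[OF finite_corners[OF y(1)] cc])
  finally show ?thesis using y(2) by (simp add: insert_Diff_if)
 qed
 have "(SUM c:addable (Suc n) D. int (syt (Suc (Suc n)) (insert c D)))
   = (SUM c:addable (Suc n) D. int (?s D))
    + (SUM c:addable (Suc n) D. \<Sum>c'\<in>corners (Suc n) (insert c D) - {c}. int (?s (insert c D - {c'})))"
  unfolding sum.distrib[symmetric] by (rule sum.cong[OF refl st])
 also have "(SUM c:addable (Suc n) D. \<Sum>c'\<in>corners (Suc n) (insert c D) - {c}. int (?s (insert c D - {c'})))
   = (\<Sum>(c, c')\<in>(SIGMA c:addable (Suc n) D. corners (Suc n) (insert c D) - {c}). int (?s (insert c D - {c'})))"
  by (rule sum.Sigma) (use fa finite_corners addableD in auto)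
 also have "... = (\<Sum>(c', c)\<in>(SIGMA c':corners n D. addable n (D - {c'}) - {c'}). int (?s (insert c (D - {c'}))))"
 proof (rule sum.reindex_bij_witness[where i = prod.swap and j = prod.swap])
  fix x assume "x \<in> (SIGMA c:addable (Suc n) D. corners (Suc n) (insert c D) - {c})"
  then obtain c c' where x: "x = (c, c')" "c \<in> addable (Suc n) D" "c' \<in> corners (Suc n) (insert c D)" "c' ~= c" by auto
  thus "prod.swap x \<in> (SIGMA c':corners n D. addable n (D - {c'}) - {c'})"
   using exchange_corner_addable[OF D, of c c'] by auto
  have "insert c (D - {c'}) = insert c D - {c'}" using x(4) by auto
  thus "(case prod.swap x of (c', c) => int (?s (insert c (D - {c'})))) = (case x of (c, c') => int (?s (insert c D - {c'})))"
   using x(1) by simp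
 next fix x assume "x \<in> (SIGMA c':corners n D. addable n (D - {c'}) - {c'})"
  then obtain c c' where x: "x = (c', c)" "c' \<in> corners n D" "c \<in> addable n (D - {c'})" "c ~= c'" by auto
  thus "prod.swap x \<in> (SIGMA c:addable (Suc n) D. corners (Suc n) (insert c D) - {c})"
   using exchange_corner_addable[OF D, of c c'] by auto
 qed simp_all
 also have "... = (\<Sum>c'\<in>corners n D. SUM c:addable n (D - {c'}) - {c'}. int (?s (insert c (D - {c'}))))"
  by (rule sum.Sigma[symmetric]) (use fc finite_addable cornerD(2)[OF D] in auto)
 also have "... = (\<Sum>c'\<in>corners n D. (int n + 1) * int (syt n (D - {c'})) - int (?s D))"
 proof (rule sum.cong[OF refl])
  fix c' assume c': "c' \<in> corners n D"
  note y = cornerD(1,2)[OF D c']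
  have ins: "insert c' (D - {c'}) = D" using y(1) by auto
  have ca: "c' \<in> addable n (D - {c'})" using D ins by (simp add: addable_def)
  have "(SUM c:addable n (D - {c'}). int (?s (insert c (D - {c'})))) = (int n + 1) * int (syt n (D - {c'}))"
   by (rule Suc.IH[OF y(2)])
  moreover have "(SUM c:addable n (D - {c'}). int (?s (insert c (D - {c'}))))
    = int (?s D) + (SUM c:addable n (D - {c'}) - {c'}. int (?s (insert c (D - {c'}))))"
   using sum.remove[OF finite_addable[OF y(2)] ca, of "%c. int (?s (insert c (D - {c'})))"] unfolding ins .
  ultimately show "(SUM c:addable n (D - {c'}) - {c'}. int (?s (insert c (D - {c'})))) = (int n + 1) * int (syt n (D - {c'})) - int (?s D)"
   by linarith
 qed
 also have "... = (int n + 1) * int (?s D) - int (card (corners n D)) * int (?s D)"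
  by (simp add: sum_subtractf sum_distrib_left)
 also have "(SUM c:addable (Suc n) D. int (?s D)) = (int (card (corners n D)) + 1) * int (?s D)"
  using card_addable[OF D] by simp
 finally show ?case by (simp add: algebra_simps)
qed

text \<open>One factor of each square is expanded over the corners; summing over the smaller diagram
  and the added cell instead gives the sums of \<open>syt_up\<close>.\<close>

lemma sum_syt_squares: "(SUM D:par n. (syt n D)\<^sup>2) = fact n"
proof (induction n)
 case 0
 have "par 0 = {{}}" by (auto simp: par_def)
 thus ?case by simp
next case (Suc n)
 have "(SUM D:par (Suc n). int (syt (Suc n) D) ^ 2)
   = (SUM D:par (Suc n). SUM c:corners n D. int (syt n (D - {c})) * int (syt (Suc n) D))"
  by (simp add: power2_eq_square sum_distrib_right)
 also have "... = (\<Sum>(D, c)\<in>(SIGMA D:par (Suc n). corners n D). int (syt n (D - {c})) * int (syt (Suc n) D))"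
  by (rule sum.Sigma[OF finite_par]) (simp add: par_def finite_corners)
 also have "... = (\<Sum>(D, c)\<in>(SIGMA D:par n. addable n D). int (syt n D) * int (syt (Suc n) (insert c D)))"
 proof (rule sum.reindex_bij_witness[where i = "%(D, c). (insert c D, c)" and j = "%(D, c). (D - {c}, c)"])
  fix x assume "x \<in> (SIGMA D:par (Suc n). corners n D)"
  then obtain D c where x: "x = (D, c)" "young (Suc n) D" "c \<in> D" "young n (D - {c})"
   by (auto simp: par_def corners_def)
  have i: "insert c (D - {c}) = D" using x(3) by auto
  show "(case case x of (D, c) => (D - {c}, c) of (D, c) => (insert c D, c)) = x" using x(1) i by simp
  show "(case x of (D, c) => (D - {c}, c)) \<in> (SIGMA D:par n. addable n D)" using x i by (simp add: par_def addable_def)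
  show "(case case x of (D, c) => (D - {c}, c) of (D, c) => int (syt n D) * int (syt (Suc n) (insert c D)))
    = (case x of (D, c) => int (syt n (D - {c})) * int (syt (Suc n) D))" using x(1) i by (simp del: pathc.simps)
 next fix x assume "x \<in> (SIGMA D:par n. addable n D)"
  then obtain D c where x: "x = (D, c)" "young n D" "c \<notin> D" "young (Suc n) (insert c D)"
   by (auto simp: par_def addable_def)
  have i: "insert c D - {c} = D" using x(3) by auto
  show "(case case x of (D, c) => (insert c D, c) of (D, c) => (D - {c}, c)) = x" using x(1) i by simp
  show "(case x of (D, c) => (insert c D, c)) \<in> (SIGMA D:par (Suc n). corners n D)"
   using x i by (simp add: par_def corners_def)
 qed
 also have "... = (SUM D:par n. SUM c:addable n D. int (syt n D) * int (syt (Suc n) (insert c D)))"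
  by (rule sum.Sigma[OF finite_par, symmetric]) (simp add: par_def finite_addable)
 also have "... = (SUM D:par n. int (syt n D) * ((int n + 1) * int (syt n D)))" proof (rule sum.cong[OF refl])
  fix D assume "D \<in> par n"
  hence "young n D" by (simp add: par_def)
  from syt_up[OF this] show "(SUM c:addable n D. int (syt n D) * int (syt (Suc n) (insert c D))) = int (syt n D) * ((int n + 1) * int (syt n D))"
   by (simp only: sum_distrib_left[symmetric])
 qed
 also have "... = (int n + 1) * (SUM D:par n. int (syt n D) ^ 2)"
  by (simp add: sum_distrib_left power2_eq_square algebra_simps)
 also have "(SUM D:par n. int (syt n D) ^ 2) = int (SUM D:par n. (syt n D)\<^sup>2)" by simp
 finally have "int (SUM D:par (Suc n). (syt (Suc n) D)\<^sup>2) = (int n + 1) * fact n" unfolding Suc.IH by simp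
 also have "... = int (fact (Suc n))" by (simp add: algebra_simps)
 finally show ?case by (simp only: of_nat_eq_iff)
qed

section \<open>Branching and completeness\<close>

lemma comm_act: assumes "comm n F" shows "F (act n u f) = act n u (F f)"
proof -
 note C = commD[OF assms]
 have "act n u f = (%a. SUM g:symg n. u g * ga g f a)" by (simp add: act_def ga_def)
 hence "F (act n u f) = F (%a. SUM g:symg n. u g * ga g f a)" by (rule arg_cong)
 also have "... = (%a. SUM g:symg n. F (%a. u g * ga g f a) a)" by (rule C(7))
 also have "... = (%a. SUM g:symg n. u g * ga g (F f) a)" by (intro ext sum.cong refl) (simp add: C(6) C(2))
 finally show ?thesis by (simp add: act_def ga_def)
qed

lemma act_specht: "young n D ==> f \<in> specht n D ==> act n u f \<in> specht n D"
proof -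
 assume h: "young n D" "f \<in> specht n D"
 have "(%a. SUM g:symg n. u g * ga g f a) \<in> specht n D"
  by (rule lsp_sum[OF lsp_specht]) (rule ga_specht[OF h(1) _ h(2)])
 thus ?thesis by (simp add: act_def ga_def)
qed

lemma act_specht_Suc: assumes "young (Suc n) D" "f \<in> specht (Suc n) D" shows "act n u f \<in> specht (Suc n) D"
proof -
 have "(%a. SUM g:symg n. u g * ga g f a) \<in> specht (Suc n) D"
  by (rule lsp_sum[OF lsp_specht], rule ga_specht[OF assms(1) _ assms(2)])
    (use sym_mono[of n "Suc n"] in auto)
 thus ?thesis by (simp add: act_def ga_def)
qed

text \<open>For a polytabloid the last entry is put into the corner, where \<open>pt_above\<close>
  and \<open>rs_pt\<close> apply; the properties pass to linear combinations.\<close>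

lemma lift_exists: assumes D: "young (Suc n) D" "c \<in> corners n D" and f: "f \<in> specht n (D - {c})"
 shows "\<exists>h\<in>specht (Suc n) D. (\<forall>a. fst c < a (Suc n) --> h a = 0) \<and> rs n (fst c) h = f"
proof -
 note R = commD[OF rs_comm[of n "fst c"]]
 let ?Q = "{f. \<exists>h\<in>specht (Suc n) D. (\<forall>a. fst c < a (Suc n) --> h a = 0) \<and> rs n (fst c) h = f}"
 have "lsp ?Q" unfolding lsp_def proof (intro conjI ballI allI)
  show "(%_. 0) \<in> ?Q" using R(5) lsp_zero[OF lsp_specht, of "Suc n" D] by (intro CollectI bexI[of _ "%_. 0"]) simp_all
  fix f g k assume "f \<in> ?Q" "g \<in> ?Q"
  then obtain h h' where h: "h \<in> specht (Suc n) D" "\<forall>a. fst c < a (Suc n) --> h a = 0" "rs n (fst c) h = f"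
   "h' \<in> specht (Suc n) D" "\<forall>a. fst c < a (Suc n) --> h' a = 0" "rs n (fst c) h' = g"
   unfolding mem_Collect_eq by (elim bexE conjE)
  show "(%a. f a + k * g a) \<in> ?Q" unfolding mem_Collect_eq
  proof (rule bexI[of _ "%a. h a + k * h' a"], intro conjI allI impI)
   show "h a + k * h' a = 0" if "fst c < a (Suc n)" for a using h(2,5) that by simp
   show "rs n (fst c) (%a. h a + k * h' a) = (%a. f a + k * g a)" unfolding R(3) h(3,6) ..
   show "(%a. h a + k * h' a) \<in> specht (Suc n) D" by (rule lsp_addc[OF lsp_specht h(1,4)])
  qed
 qed
 moreover have "pt n q \<in> ?Q" if q: "tab n (D - {c}) q" for q unfolding mem_Collect_eq
 proof (rule bexI[of _ "pt (Suc n) (q(Suc n := c))"], intro conjI allI impI)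
  show "pt (Suc n) (q(Suc n := c)) a = 0" if "fst c < a (Suc n)" for a by (rule pt_above[OF D q], rule that)
  show "rs n (fst c) (pt (Suc n) (q(Suc n := c))) = pt n q" by (rule rs_pt[OF D q])
  show "pt (Suc n) (q(Suc n := c)) \<in> specht (Suc n) D" by (rule pt_specht[OF tab_extend[OF q cornerD(1)[OF D]]])
 qed
 ultimately have "f \<in> ?Q" using f by (rule specht_least)
 thus ?thesis by simp
qed

definition lift :: "nat => cells => nat \<times> nat => wfun => wfun" where
 "lift n D c f = (SOME h. h \<in> specht (Suc n) D \<and> (\<forall>a. fst c < a (Suc n) --> h a = 0) \<and> rs n (fst c) h = f)"

lemma liftD: assumes D: "young (Suc n) D" "c \<in> corners n D" and f: "f \<in> specht n (D - {c})"
 shows "lift n D c f \<in> specht (Suc n) D" "fst c < a (Suc n) ==> lift n D c f a = 0"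
  "rs n (fst c) (lift n D c f) = f" proof -
 have "\<exists>h. h \<in> specht (Suc n) D \<and> (\<forall>a. fst c < a (Suc n) --> h a = 0) \<and> rs n (fst c) h = f"
  using lift_exists[OF assms] by (simp add: Bex_def)
 from someI_ex[OF this]
 have h: "lift n D c f \<in> specht (Suc n) D \<and> (\<forall>a. fst c < a (Suc n) --> lift n D c f a = 0) \<and> rs n (fst c) (lift n D c f) = f"
  unfolding lift_def .
 show "lift n D c f \<in> specht (Suc n) D" "rs n (fst c) (lift n D c f) = f" using h by simp_all
 show "lift n D c f a = 0" if "fst c < a (Suc n)" using h that by simp
qed

definition bidx :: "nat => cells => ((nat \<times> nat) \<times> word) set" where
 "bidx n D = (SIGMA c:corners n D. pJ n (D - {c}))"

definition bvec :: "nat => cells => (nat \<times> nat) \<times> word => wfun" where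
 "bvec n D k = lift n D (fst k) (pB n (D - {fst k}) (snd k))"

lemma corner_row_inj: assumes "young (Suc n) D" "c \<in> corners n D" "d \<in> corners n D" "fst c = fst d" shows "c = d"
proof (cases "snd c \<le> snd d")
 case True
 have "d = c" by (rule cornerD(3)[OF assms(1,2) cornerD(1)[OF assms(1,3)]]) (use assms(4) True in simp_all)
 thus ?thesis by (rule sym)
next case False
 show ?thesis by (rule cornerD(3)[OF assms(1,3) cornerD(1)[OF assms(1,2)]]) (use assms(4) False in simp_all)
qed

lemma bidx_finite: assumes "young (Suc n) D" shows "finite (bidx n D)"
 unfolding bidx_def by (intro finite_SigmaI finite_corners[OF assms] pBD(1) cornerD(2)[OF assms])

lemma bvecD: assumes D: "young (Suc n) D" and k: "k \<in> bidx n D"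
 shows "bvec n D k \<in> specht (Suc n) D" "fst (fst k) < a (Suc n) ==> bvec n D k a = 0"
  "rs n (fst (fst k)) (bvec n D k) = pB n (D - {fst k}) (snd k)" proof -
 have k': "fst k \<in> corners n D" "snd k \<in> pJ n (D - {fst k})" using k by (auto simp: bidx_def)
 have "pB n (D - {fst k}) (snd k) \<in> specht n (D - {fst k})" by (rule pBD(2)[OF cornerD(2)[OF D k'(1)] k'(2)])
 note L = liftD[OF D k'(1) this]
 show "bvec n D k \<in> specht (Suc n) D" "rs n (fst (fst k)) (bvec n D k) = pB n (D - {fst k}) (snd k)"
  unfolding bvec_def by (rule L)+
 show "bvec n D k a = 0" if "fst (fst k) < a (Suc n)" unfolding bvec_def by (rule L(2), rule that)
qed

text \<open>Basis vectors of corners above \<open>c\<close> vanish at words with last letter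
  \<open>fst c\<close>, and those of corners below have coefficient 0 by assumption, so only the
  corner \<open>c\<close> contributes. This triangularity yields both the independence of the lifts
  and the branching of traces.\<close>

lemma bvec_top: assumes D: "young (Suc n) D" and c: "c \<in> corners n D"
  and z: "\<And>k. k \<in> bidx n D ==> fst c < fst (fst k) ==> x k = 0"
 defines "f \<equiv> (%a. SUM k:bidx n D. x k * bvec n D k a)"
 shows "rs n (fst c) f = (%a. SUM j:pJ n (D - {c}). x (c, j) * pB n (D - {c}) j a)"
  "fst c < a (Suc n) ==> f a = 0" proof -
 note R = commD[OF rs_comm[of n "fst c"]]
 let ?J = "pJ n (D - {c})"
 show "f a = 0" if "fst c < a (Suc n)" unfolding f_def proof (rule sum.neutral, intro ballI)
  fix k assume k: "k \<in> bidx n D"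
  show "x k * bvec n D k a = 0" using z[OF k] bvecD(2)[OF D k, of a] that by (cases "fst c < fst (fst k)") auto
 qed
 show "rs n (fst c) f = (%a. SUM j:?J. x (c, j) * pB n (D - {c}) j a)" proof
  fix a
  have "rs n (fst c) f = (%a. SUM k:bidx n D. rs n (fst c) (%a. x k * bvec n D k a) a)" unfolding f_def by (rule R(7))
  hence "rs n (fst c) f a = (SUM k:bidx n D. x k * rs n (fst c) (bvec n D k) a)" by (simp add: R(6))
  also have "... = (SUM k:Pair c ` ?J. x k * rs n (fst c) (bvec n D k) a)"
  proof (rule sum.mono_neutral_right[OF bidx_finite[OF D]])
   show "Pair c ` ?J \<subseteq> bidx n D" using c by (auto simp: bidx_def)
   show "\<forall>k\<in>bidx n D - Pair c ` ?J. x k * rs n (fst c) (bvec n D k) a = 0" proof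
    fix k assume k: "k \<in> bidx n D - Pair c ` ?J"
    have kc: "fst k \<in> corners n D" using k by (auto simp: bidx_def)
    have "fst k ~= c" using k by (auto simp: bidx_def)
    hence "fst (fst k) ~= fst c" using corner_row_inj[OF D kc c] by blast
    then consider "fst c < fst (fst k)" | "fst (fst k) < fst c" by linarith
    thus "x k * rs n (fst c) (bvec n D k) a = 0" proof cases
     case 1 thus ?thesis using z[of k] k by simp
    next case 2
     thus ?thesis using bvecD(2)[OF D, of k "a(Suc n := fst c)"] k by (simp add: rs_def)
    qed
   qed
  qed
  also have "... = (SUM j:?J. x (c, j) * rs n (fst c) (bvec n D (c, j)) a)" by (subst sum.reindex) (auto simp: inj_on_def)
  also have "... = (SUM j:?J. x (c, j) * pB n (D - {c}) j a)" proof (rule sum.cong[OF refl])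
   fix j assume "j \<in> ?J"
   hence "(c, j) \<in> bidx n D" using c by (simp add: bidx_def)
   from bvecD(3)[OF D this]
   show "x (c, j) * rs n (fst c) (bvec n D (c, j)) a = x (c, j) * pB n (D - {c}) j a" by simp
  qed
  finally show "rs n (fst c) f a = (SUM j:?J. x (c, j) * pB n (D - {c}) j a)" .
 qed
qed

lemma pivot_coeff: assumes "pivot S J b" "i \<in> J" shows "(SUM j:J. x j * b j i) = x i"
proof -
 have "(SUM j:J. x j * b j i) = (SUM j:J. if j = i then x i else 0)"
  using pivotD(3)[OF assms(1)] assms(2) by (intro sum.cong) auto
 thus ?thesis using pivotD(1)[OF assms(1)] assms(2) by simp
qed

lemma bvec_max_corner: assumes D: "young (Suc n) D" and "k0 \<in> bidx n D" "x k0 ~= 0"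
 obtains c where "c \<in> corners n D" "fst (fst k0) \<le> fst c"
  "\<And>k. k \<in> bidx n D ==> fst c < fst (fst k) ==> x k = 0"
  "\<exists>j\<in>pJ n (D - {c}). x (c, j) ~= 0" proof -
 let ?K = "{k \<in> bidx n D. x k ~= 0}"
 let ?R = "(%k. fst (fst k)) ` ?K"
 have fin: "finite ?R" using bidx_finite[OF D] by simp
 have k0: "fst (fst k0) \<in> ?R" using assms by blast
 hence "Max ?R \<in> ?R" using fin by (intro Max_in) auto
 then obtain k where k: "k \<in> bidx n D" "x k ~= 0" "Max ?R = fst (fst k)" by blast
 have mx: "fst (fst l) \<le> fst (fst k)" if "l \<in> bidx n D" "x l ~= 0" for l
  using Max_ge[OF fin, of "fst (fst l)"] that k(3) by auto
 show thesis proof (rule that[of "fst k"])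
  show "fst k \<in> corners n D" using k(1) by (auto simp: bidx_def)
  show "fst (fst k0) \<le> fst (fst k)" using mx[OF assms(2,3)] .
  show "x l = 0" if "l \<in> bidx n D" "fst (fst k) < fst (fst l)" for l using mx[OF that(1)] that(2) by force
  show "\<exists>j\<in>pJ n (D - {fst k}). x (fst k, j) ~= 0"
   using k(1,2) by (intro bexI[of _ "snd k"]) (auto simp: bidx_def)
 qed
qed

lemma bvec_lindep: assumes D: "young (Suc n) D" shows "lindep (bidx n D) (bvec n D)" unfolding lindep_def
proof (intro conjI allI impI ballI bidx_finite[OF D])
 fix x k0 assume z: "\<forall>a. (SUM k:bidx n D. x k * bvec n D k a) = 0" and k0: "k0 \<in> bidx n D"
 show "x k0 = 0" proof (rule ccontr)
  assume "x k0 ~= 0"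
  then obtain c where c: "c \<in> corners n D" "\<And>k. k \<in> bidx n D ==> fst c < fst (fst k) ==> x k = 0"
   "\<exists>j\<in>pJ n (D - {c}). x (c, j) ~= 0" using bvec_max_corner[OF D k0] by metis
  from c(3) obtain j where j: "j \<in> pJ n (D - {c})" "x (c, j) ~= 0" by blast
  have "(%a. SUM k:bidx n D. x k * bvec n D k a) = (%_. 0)" using z by blast
  hence "rs n (fst c) (%a. SUM k:bidx n D. x k * bvec n D k a) = (%_. 0)" by (simp add: rs_def)
  with bvec_top(1)[OF D c(1,2)]
  have "(SUM i:pJ n (D - {c}). x (c, i) * pB n (D - {c}) i j) = 0" by (simp add: fun_eq_iff)
  with j pivot_coeff[OF pivot_specht(1)[OF cornerD(2)[OF D c(1)]] j(1)] show False by simp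
 qed
qed

lemma card_bidx: assumes "young (Suc n) D" shows "card (bidx n D) = (SUM c:corners n D. sdim n (D - {c}))"
 unfolding bidx_def sdim_def by (intro card_SigmaI finite_corners[OF assms] ballI pBD(1) cornerD(2)[OF assms])

lemma sdim_ge_corners: assumes "young (Suc n) D" shows "(SUM c:corners n D. sdim n (D - {c})) \<le> sdim (Suc n) D"
 using lindep_card_le[OF pivot_frame[OF pivot_specht(1)[OF assms]] bvec_lindep[OF assms] bvecD(1)[OF assms]]
 unfolding card_bidx[OF assms] sdim_def[of "Suc n"] .

lemma syt_le_sdim: "young n D ==> syt n D \<le> sdim n D"
proof (induction n arbitrary: D)
 case 0 thus ?case using sdim_pos[of 0 D] by simp
next case (Suc n)
 have "syt (Suc n) D \<le> (SUM c:corners n D. sdim n (D - {c}))"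
  unfolding syt_Suc by (intro sum_mono Suc.IH cornerD(2)[OF Suc.prems])
 also have "... \<le> sdim (Suc n) D" by (rule sdim_ge_corners[OF Suc.prems])
 finally show ?case .
qed

section \<open>Matrix coefficients and completeness of the Specht modules\<close>

definition cidx :: "nat => (cells \<times> word \<times> word) set" where
 "cidx n = (SIGMA D:par n. pJ n D \<times> pJ n D)"

definition cfn :: "nat => cells \<times> word \<times> word => wfun" where
 "cfn n x = (%g. if g \<in> symg n then ga g (pB n (fst x) (snd (snd x))) (fst (snd x)) else 0)"

lemma cidx_finite: "finite (cidx n)"
 unfolding cidx_def by (intro finite_SigmaI finite_par finite_cartesian_product pBD(1)) (simp_all add: par_def)

lemma card_cidx: "card (cidx n) = (SUM D:par n. (sdim n D)\<^sup>2)"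
proof -
 have "card (cidx n) = (SUM D:par n. card (pJ n D \<times> pJ n D))" unfolding cidx_def
  by (intro card_SigmaI finite_par ballI finite_cartesian_product pBD(1)) (simp_all add: par_def)
 thus ?thesis by (simp add: sdim_def card_cartesian_product power2_eq_square)
qed

lemma cfn_orthogonal: assumes x: "(D, i, j) \<in> cidx n" and y: "(D', k, l) \<in> cidx n"
 shows "(SUM g:symg n. cfn n (D, i, j) g * ga (inv g) (pB n D' k) l)
  = (if (D, i, j) = (D', k, l) then fact n / of_nat (sdim n D) else 0)" proof -
 have D: "young n D" "i \<in> pJ n D" "j \<in> pJ n D" "young n D'" "k \<in> pJ n D'" "l \<in> pJ n D'"
  using x y by (auto simp: cidx_def par_def)
 have "(SUM g:symg n. cfn n (D, i, j) g * ga (inv g) (pB n D' k) l)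
   = (SUM g:symg n. ga g (pB n D j) i * ga (inv g) (pB n D' k) l)" by (intro sum.cong) (auto simp: cfn_def)
 also have "... = (if (D, i, j) = (D', k, l) then fact n / of_nat (sdim n D) else 0)" proof (cases "D = D'")
  case True
  have "(SUM g:symg n. ga g (pB n D j) i * ga (inv g) (pB n D k) l)
    = fact n / of_nat (sdim n D) * pB n D k i * pB n D j l"
   by (rule schur_functional[OF D(1) lfun_eval lfun_eval pBD(2)[OF D(1,3)] pBD(2)[OF D(1)]])
     (use D True in simp)
  thus ?thesis using True D pBD(3)[OF D(1)] by auto
 next case False
  have "avg n (%f. f l) (pB n D j) (pB n D' k) = (%_. 0)"
   by (rule schur_distinct[OF D(4,1) _ lfun_eval pBD(2)[OF D(1,3)] pBD(2)[OF D(4,5)]]) (use False in blast)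
  from fun_cong[OF this, of i] False show ?thesis by (simp add: avg_def mult.commute)
 qed
 finally show ?thesis .
qed

lemma cfn_lindep: "lindep (cidx n) (cfn n)" unfolding lindep_def
proof (intro conjI allI impI ballI cidx_finite)
 fix x y assume z: "\<forall>g. (SUM k:cidx n. x k * cfn n k g) = 0" and y: "y \<in> cidx n"
 obtain D i j where yD: "y = (D, i, j)" by (cases y)
 have D: "young n D" using y by (auto simp: yD cidx_def par_def)
 have "0 = (SUM g:symg n. (SUM k:cidx n. x k * cfn n k g) * ga (inv g) (pB n D i) j)" using z by simp
 also have "... = (SUM k:cidx n. x k * (SUM g:symg n. cfn n k g * ga (inv g) (pB n D i) j))"
  by (simp add: sum_distrib_right sum_distrib_left mult.assoc) (rule sum.swap)
 also have "... = (SUM k:cidx n. if k = y then x y * (fact n / of_nat (sdim n D)) else 0)" proof (rule sum.cong[OF refl])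
  fix k assume k: "k \<in> cidx n"
  obtain D' i' j' where kD: "k = (D', i', j')" by (cases k)
  show "x k * (SUM g:symg n. cfn n k g * ga (inv g) (pB n D i) j) = (if k = y then x y * (fact n / of_nat (sdim n D)) else 0)"
   unfolding kD cfn_orthogonal[OF k[unfolded kD] y[unfolded yD]] yD by auto
 qed
 also have "... = x y * (fact n / of_nat (sdim n D))" using y cidx_finite by simp
 finally show "x y = 0" using sdim_pos[OF D] by simp
qed

lemma symg_frame: "frame {f :: wfun. \<forall>g. g \<notin> symg n --> f g = 0} (symg n) (%g h. of_bool (h = g)) (%g f. f g)"
 unfolding frame_def proof (intro conjI ballI)
 show "f = (%a. SUM k:symg n. f k * of_bool (a = k))"
  if "f \<in> {f :: wfun. \<forall>g. g \<notin> symg n --> f g = 0}" for f proof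
  fix a
  have "(SUM k:symg n. f k * of_bool (a = k)) = (SUM k:symg n. if k = a then f a else 0)" by (intro sum.cong) auto
  thus "f a = (SUM k:symg n. f k * of_bool (a = k))" using that by auto
 qed
qed (auto simp: lfun_def)

text \<open>By Schur orthogonality the matrix coefficients are independent functions on the group,
  so the squares of the dimensions sum to at most \<open>fact n\<close>. This is also the sum of the
  squares of the numbers of standard tableaux, and each of these is at most the dimension.\<close>

lemma sdim_syt: "D \<in> par n ==> sdim n D = syt n D"
proof -
 assume D: "D \<in> par n"
 have "card (cidx n) \<le> card (symg n)" by (rule lindep_card_le[OF symg_frame cfn_lindep]) (simp add: cfn_def)
 hence le: "(SUM D:par n. (sdim n D)\<^sup>2) \<le> (SUM D:par n. (syt n D)\<^sup>2)"
  by (simp add: card_cidx card_sym sum_syt_squares)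
 have ge: "(syt n E)\<^sup>2 \<le> (sdim n E)\<^sup>2" if "E \<in> par n" for E
  using syt_le_sdim[of n E] that by (intro power_mono) (simp_all add: par_def)
 have "(SUM D:par n. (syt n D)\<^sup>2) = (SUM D:par n. (sdim n D)\<^sup>2)"
  using le sum_mono[of "par n" "%E. (syt n E)\<^sup>2", OF ge] by simp
 from sum_mono_inv[OF this ge D finite_par] show ?thesis by simp
qed

lemma sdim_eq_syt: "young n D ==> sdim n D = syt n D" by (rule sdim_syt) (simp add: par_def)

text \<open>The matrix coefficients now form a basis of the functions on the group. An element
  killing all Specht modules is orthogonal to each of them, hence to itself. Identities in the group
  ring are proved below by comparing actions on Specht modules.\<close>

lemma faithful: assumes "\<And>D f. young n D ==> f \<in> specht n D ==> act n u f = (%_. 0)" "g \<in> symg n"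
 shows "u g = 0"
proof -
 let ?S = "{f :: wfun. \<forall>g. g \<notin> symg n --> f g = 0}"
 have S: "lsp ?S" by (simp add: lsp_def)
 have card: "card (cidx n) = card (symg n)" using sdim_syt sum_syt_squares[of n] by (simp add: card_cidx card_sym)
 obtain y where y: "frame ?S (cidx n) (cfn n) y"
  using lindep_frame[OF S symg_frame cfn_lindep _ card] by (force simp: cfn_def)
 define w where "w = (%g. if g \<in> symg n then u g else 0)"
 have "w \<in> ?S" by (simp add: w_def)
 note wy = frameD(4)[OF y this]
 have z: "(SUM g:symg n. u g * cfn n k g) = 0" if k: "k \<in> cidx n" for k proof -
  obtain D i j where kD: "k = (D, i, j)" by (cases k)
  have D: "young n D" "j \<in> pJ n D" using k by (auto simp: kD cidx_def par_def)
  have "(SUM g:symg n. u g * cfn n k g) = act n u (pB n D j) i" by (auto simp: kD cfn_def act_def ga_def intro!: sum.cong)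
  also have "... = 0" unfolding assms(1)[OF D(1) pBD(2)[OF D]] ..
  finally show ?thesis .
 qed
 have "(SUM g:symg n. (u g)\<^sup>2) = (SUM g:symg n. u g * w g)" by (simp add: w_def power2_eq_square)
 also have "... = (SUM g:symg n. SUM k:cidx n. y k w * (u g * cfn n k g))" proof (rule sum.cong[OF refl])
  fix g
  show "u g * w g = (SUM k:cidx n. y k w * (u g * cfn n k g))"
   using fun_cong[OF wy, of g] by (simp add: sum_distrib_left mult.left_commute)
 qed
 also have "... = (SUM k:cidx n. y k w * (SUM g:symg n. u g * cfn n k g))" by (subst sum.swap) (simp add: sum_distrib_left)
 also have "... = 0" using z by simp
 finally have "\<forall>g\<in>symg n. (u g)\<^sup>2 = 0" by (subst (asm) sum_nonneg_eq_0_iff) auto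
 thus ?thesis using assms(2) by simp
qed

lemma bvec_frame: assumes D: "young (Suc n) D" obtains y where "frame (specht (Suc n) D) (bidx n D) (bvec n D) y"
proof -
 have "card (bidx n D) = (SUM c:corners n D. syt n (D - {c}))"
  unfolding card_bidx[OF D] by (intro sum.cong refl sdim_eq_syt cornerD(2)[OF D])
 also have "... = sdim (Suc n) D" using sdim_eq_syt[OF D] by simp
 finally have card: "card (bidx n D) = card (pJ (Suc n) D)" by (simp add: sdim_def)
 have "\<exists>y. frame (specht (Suc n) D) (bidx n D) (bvec n D) y"
  by (rule lindep_frame[OF lsp_specht pivot_frame[OF pivot_specht(1)[OF D]] bvec_lindep[OF D] bvecD(1)[OF D] card])
 thus thesis by (elim exE) (rule that)
qed

text \<open>The leading term of \<open>f\<close> in the basis of lifts: among the corners that occur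
  in \<open>f\<close>, the lowest one is taken.\<close>

lemma specht_top: assumes D: "young (Suc n) D" and f: "f \<in> specht (Suc n) D" "f ~= (%_. 0)"
 obtains c where "c \<in> corners n D" "\<And>a. fst c < a (Suc n) ==> f a = 0"
  "rs n (fst c) f \<in> specht n (D - {c})" "rs n (fst c) f ~= (%_. 0)" proof -
 obtain y where y: "frame (specht (Suc n) D) (bidx n D) (bvec n D) y" by (rule bvec_frame[OF D])
 note fy = frameD(4)[OF y f(1)]
 have "\<exists>k0\<in>bidx n D. y k0 f ~= 0" proof (rule ccontr)
  assume "\<not> ?thesis"
  hence "(%a. SUM k:bidx n D. y k f * bvec n D k a) = (%_. 0)" by simp
  with fy f(2) show False by simp
 qed
 then obtain k0 where k0: "k0 \<in> bidx n D" "y k0 f ~= 0" by blast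
 obtain c where c: "c \<in> corners n D" "\<And>k. k \<in> bidx n D ==> fst c < fst (fst k) ==> y k f = 0"
  "\<exists>j\<in>pJ n (D - {c}). y (c, j) f ~= 0"
  by (rule bvec_max_corner[where x = "%k. y k f", OF D k0]) (rule that; assumption)
 note y' = cornerD(2)[OF D c(1)]
 have r: "rs n (fst c) f = (%a. SUM j:pJ n (D - {c}). y (c, j) f * pB n (D - {c}) j a)"
  by (subst fy) (rule bvec_top(1)[OF D c(1,2)])
 from c(3) obtain j where j: "j \<in> pJ n (D - {c})" "y (c, j) f ~= 0" by blast
 show thesis proof (rule that[OF c(1)])
  show "f a = 0" if "fst c < a (Suc n)" for a
   by (subst fy) (rule bvec_top(2)[OF D c(1,2)], assumption, assumption, rule that)
  show "rs n (fst c) f \<in> specht n (D - {c})" unfolding r by (rule lsp_sum[OF lsp_specht pBD(2)[OF y']])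
  have "rs n (fst c) f j = y (c, j) f" unfolding r by (rule pivot_coeff[OF pivot_specht(1)[OF y'] j(1)])
  thus "rs n (fst c) f ~= (%_. 0)" using j(2) by (auto dest: fun_cong[of _ _ j])
 qed
qed

text \<open>An element of the smaller group ring leaves the last position alone, so its action is
  block triangular with respect to the rows of the corners. The diagonal blocks are its actions on
  the smaller modules.\<close>

lemma trace_branching: assumes D: "young (Suc n) D"
 shows "tr (specht (Suc n) D) (act n u) = (SUM c:corners n D. tr (specht n (D - {c})) (act n u))"
proof -
 obtain y where y: "frame (specht (Suc n) D) (bidx n D) (bvec n D) y" by (rule bvec_frame[OF D])
 have "y k (act n u (bvec n D k)) = act n u (pB n (D - {fst k}) (snd k)) (snd k)" if k: "k \<in> bidx n D" for k proof -
  let ?f = "act n u (bvec n D k)"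
  obtain c j where cj: "k = (c, j)" "c \<in> corners n D" "j \<in> pJ n (D - {c})" using k by (auto simp: bidx_def)
  note b = bvecD[OF D k]
  have fS: "?f \<in> specht (Suc n) D" by (rule act_specht_Suc[OF D b(1)])
  note fy = frameD(4)[OF y fS]
  have above: "?f a = 0" if "fst c < a (Suc n)" for a proof -
   have "bvec n D k (a o g) = 0" if "g \<in> symg n" for g proof (rule b(2))
    have "g (Suc n) = Suc n" by (rule sym_out[OF that]) simp
    thus "fst (fst k) < (a o g) (Suc n)" using \<open>fst c < a (Suc n)\<close> cj(1) by simp
   qed
   thus ?thesis by (simp add: act_def)
  qed
  have z: "y l ?f = 0" if l: "l \<in> bidx n D" "fst c < fst (fst l)" for l proof (rule ccontr)
   assume ne: "y l ?f ~= 0"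
   obtain c' where c': "c' \<in> corners n D" "fst (fst l) \<le> fst c'" "\<And>k. k \<in> bidx n D ==> fst c' < fst (fst k) ==> y k ?f = 0"
    "\<exists>j\<in>pJ n (D - {c'}). y (c', j) ?f ~= 0"
    by (rule bvec_max_corner[where x = "%k. y k ?f", OF D l(1) ne]) (rule that; assumption)
   from c'(4) obtain j' where j': "j' \<in> pJ n (D - {c'})" "y (c', j') ?f ~= 0" by blast
   have r: "rs n (fst c') ?f = (%a. SUM j:pJ n (D - {c'}). y (c', j) ?f * pB n (D - {c'}) j a)"
    by (subst fy) (rule bvec_top(1)[OF D c'(1,3)])
   have "rs n (fst c') ?f j' = y (c', j') ?f"
    unfolding r by (rule pivot_coeff[OF pivot_specht(1)[OF cornerD(2)[OF D c'(1)]] j'(1)])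
   moreover have "rs n (fst c') ?f j' = 0" unfolding rs_def using above[of "j'(Suc n := fst c')"] l(2) c'(2) by simp
   ultimately show False using j'(2) by simp
  qed
  have "rs n (fst c) ?f = (%a. SUM j:pJ n (D - {c}). y (c, j) ?f * pB n (D - {c}) j a)"
   by (subst fy) (rule bvec_top(1)[OF D cj(2) z])
  hence "rs n (fst c) ?f j = y (c, j) ?f" using pivot_coeff[OF pivot_specht(1)[OF cornerD(2)[OF D cj(2)]] cj(3)] by simp
  moreover have "rs n (fst c) ?f = act n u (pB n (D - {c}) j)" unfolding comm_act[OF rs_comm] using b(3) cj(1) by simp
  ultimately show ?thesis using cj(1) by simp
 qed
 moreover have "tr (specht (Suc n) D) (act n u) = (SUM k:bidx n D. y k (act n u (bvec n D k)))"
  by (rule tr_frame[OF fdsp_specht[OF D] y lmap_act act_specht_Suc[OF D]])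
 ultimately have "tr (specht (Suc n) D) (act n u) = (SUM k:bidx n D. act n u (pB n (D - {fst k}) (snd k)) (snd k))" by simp
 also have "... = (\<Sum>(c, j)\<in>(SIGMA c:corners n D. pJ n (D - {c})). act n u (pB n (D - {c}) j) j)"
  unfolding bidx_def by (intro sum.cong) auto
 also have "... = (SUM c:corners n D. SUM j:pJ n (D - {c}). act n u (pB n (D - {c}) j) j)"
  by (rule sum.Sigma[symmetric]) (intro finite_corners[OF D] ballI pBD(1) cornerD(2)[OF D], assumption?)+
 also have "... = (SUM c:corners n D. tr (specht n (D - {c})) (act n u))" proof (rule sum.cong[OF refl])
  fix c assume "c \<in> corners n D"
  note y = cornerD(2)[OF D this]
  show "(SUM j:pJ n (D - {c}). act n u (pB n (D - {c}) j) j) = tr (specht n (D - {c})) (act n u)"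
   by (rule tr_frame[OF fdsp_specht[OF y] pivot_frame[OF pivot_specht(1)[OF y]] lmap_act act_specht[OF y], symmetric])
 qed
 finally show ?thesis .
qed

section \<open>Beta-sets\<close>

text \<open>For the beta-set of a diagram these numbers belong to the rows that end in a corner, and
  \<open>mv\<close> removes that corner.\<close>

definition mov :: "nat set => nat set" where
 "mov X = {x \<in> X. x \<ge> 1 \<and> x - 1 \<notin> X}"

definition mv :: "nat set => nat => nat set" where
 "mv X x = insert (x - 1) (X - {x})"

primrec bpath :: "nat set => nat => nat set => nat" where
 "bpath Y 0 X = of_bool (X = Y)"
| "bpath Y (Suc p) X = (SUM x:mov X. bpath Y p (mv X x))"

primrec bpath2 :: "nat => nat set => nat set => nat" where
 "bpath2 0 A B = of_bool (A = {..<card A} \<and> B = {..<card B})"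
| "bpath2 (Suc w) A B = (SUM a:mov A. bpath2 w (mv A a) B) + (SUM b:mov B. bpath2 w A (mv B b))"

definition vdm :: "nat set => nat" where
 "vdm X = (\<Prod>(x, y)\<in>{(x, y). x \<in> X \<and> y \<in> X \<and> y < x}. x - y)"

text \<open>The factor by which the Vandermonde product changes when \<open>x\<close> is lowered by
  1. It vanishes if \<open>x\<close> is positive and \<open>x - 1\<close> is in the set
  already.\<close>

definition shiftq :: "nat set => nat => rat" where
 "shiftq X x = (\<Prod>y\<in>X - {x}. 1 - 1 / (of_nat x - of_nat y))"

lemma shiftq_insert: assumes "finite X" "u \<notin> X"
 shows "x \<in> X ==> shiftq (insert u X) x = shiftq X x * (1 - 1 / (of_nat x - of_nat u))"
  "shiftq (insert u X) u = shiftq X u" proof -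
 assume x: "x \<in> X"
 have "insert u X - {x} = insert u (X - {x})" using assms x by auto
 thus "shiftq (insert u X) x = shiftq X x * (1 - 1 / (of_nat x - of_nat u))"
  unfolding shiftq_def using assms by (simp add: mult.commute)
next
 have "insert u X - {u} = X - {u}" by auto
 thus "shiftq (insert u X) u = shiftq X u" unfolding shiftq_def by simp
qed

text \<open>The partial fraction expansion of the product of \<open>1 - 1 / (z - y)\<close> as a
  rational function of \<open>z\<close>: its residue at \<open>x\<close> is
  \<open>- shiftq X x\<close>. One pole is added at a time.\<close>

lemma shiftq_partial_fractions: assumes "finite X" "z \<notin> X"
 shows "shiftq X z = 1 - (SUM x:X. shiftq X x / (of_nat z - of_nat x))" using assms
proof (induction X arbitrary: z)
 case empty thus ?case by (simp add: shiftq_def)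
next case (insert u X)
 let ?r = "of_nat :: nat => rat"
 have zu: "?r z - ?r u ~= 0" using insert.prems by auto
 have z: "z \<notin> X" using insert.prems by simp
 have "insert u X - {z} = insert u (X - {z})" using insert.prems by auto
 hence l: "shiftq (insert u X) z = shiftq X z * (1 - 1 / (?r z - ?r u))"
  unfolding shiftq_def using insert.hyps insert.prems by (simp add: mult.commute)
 have trm: "shiftq (insert u X) x / (?r z - ?r x)
   = shiftq X x / (?r z - ?r x) + (shiftq X x / (?r u - ?r x) - shiftq X x / (?r z - ?r x)) / (?r z - ?r u)"
  if x: "x \<in> X" for x proof -
  have ne: "?r x - ?r u ~= 0" "?r u - ?r x ~= 0" "?r z - ?r x ~= 0" using x insert z by auto
  show ?thesis unfolding shiftq_insert(1)[OF insert.hyps x] using ne zu by (simp add: divide_simps) (simp add: algebra_simps)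
 qed
 have "(SUM x:insert u X. shiftq (insert u X) x / (?r z - ?r x))
   = shiftq X u / (?r z - ?r u) + (SUM x:X. shiftq (insert u X) x / (?r z - ?r x))"
  using insert.hyps shiftq_insert(2)[OF insert.hyps] by simp
 also have "(SUM x:X. shiftq (insert u X) x / (?r z - ?r x))
   = (SUM x:X. shiftq X x / (?r z - ?r x)
    + (shiftq X x / (?r u - ?r x) - shiftq X x / (?r z - ?r x)) / (?r z - ?r u))" by (rule sum.cong[OF refl trm])
 also have "... = (SUM x:X. shiftq X x / (?r z - ?r x))
   + ((SUM x:X. shiftq X x / (?r u - ?r x)) - (SUM x:X. shiftq X x / (?r z - ?r x))) / (?r z - ?r u)"
  by (simp only: sum.distrib sum_subtractf sum_divide_distrib[symmetric])
 also have "(SUM x:X. shiftq X x / (?r z - ?r x)) = 1 - shiftq X z" using insert.IH[OF z] by simp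
 also have "(SUM x:X. shiftq X x / (?r u - ?r x)) = 1 - shiftq X u" using insert.IH[OF insert.hyps(2)] by simp
 finally have sum: "(SUM x:insert u X. shiftq (insert u X) x / (?r z - ?r x)) = shiftq X u / (?r z - ?r u)
   + (1 - shiftq X z + (1 - shiftq X u - (1 - shiftq X z)) / (?r z - ?r u))" .
 have "P * (1 - 1 / d) = 1 - (U / d + (1 - P + (1 - U - (1 - P)) / d))" for P U d :: rat
  by (simp add: algebra_simps diff_divide_distrib)
 thus ?case unfolding l sum .
qed

text \<open>This is the coefficient of \<open>1 / z\<close> in the expansion above at infinity. In
  the induction, the correction at the old poles is the expansion taken at the new one.\<close>

lemma sum_shiftq: "finite X ==> (SUM x:X. shiftq X x) = of_nat (card X)"
proof (induction X rule: finite_induct)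
 case (insert u X)
 have "(SUM x:X. shiftq (insert u X) x) = (SUM x:X. shiftq X x + shiftq X x / (of_nat u - of_nat x))"
 proof (rule sum.cong[OF refl])
  fix x assume x: "x \<in> X"
  hence "(of_nat x - of_nat u :: rat) ~= 0" "(of_nat u - of_nat x :: rat) ~= 0" using insert.hyps by auto
  thus "shiftq (insert u X) x = shiftq X x + shiftq X x / (of_nat u - of_nat x)"
   unfolding shiftq_insert(1)[OF insert.hyps x] by (simp add: divide_simps) (simp add: algebra_simps)
 qed
 also have "... = of_nat (card X) + (1 - shiftq X u)"
  using shiftq_partial_fractions[OF insert.hyps] insert.IH by (simp add: sum.distrib)
 finally show ?case using insert.hyps shiftq_insert(2)[OF insert.hyps] by simp
qed simp

text \<open>In the same way, the coefficient of \<open>1 / z ^ 2\<close> at infinity.\<close>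

lemma sum_mult_shiftq: "finite X ==> (SUM x:X. of_nat x * shiftq X x) = of_nat (\<Sum>X) - of_nat (\<Sum>{..<card X})"
proof (induction X rule: finite_induct)
 case (insert u X)
 let ?r = "of_nat :: nat => rat"
 have "(SUM x:X. ?r x * shiftq (insert u X) x)
   = (SUM x:X. ?r x * shiftq X x - shiftq X x + ?r u * (shiftq X x / (?r u - ?r x)))" proof (rule sum.cong[OF refl])
  fix x assume x: "x \<in> X"
  hence "?r x - ?r u ~= 0" "?r u - ?r x ~= 0" using insert.hyps by auto
  thus "?r x * shiftq (insert u X) x = ?r x * shiftq X x - shiftq X x + ?r u * (shiftq X x / (?r u - ?r x))"
   unfolding shiftq_insert(1)[OF insert.hyps x] by (simp add: divide_simps) (simp add: algebra_simps)
 qed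
 also have "... = ?r (\<Sum>X) - ?r (\<Sum>{..<card X}) - ?r (card X) + ?r u * (1 - shiftq X u)"
  using shiftq_partial_fractions[OF insert.hyps] insert.IH sum_shiftq[OF insert.hyps(1)]
  by (simp only: sum.distrib sum_subtractf sum_distrib_left[symmetric]) simp
 finally show ?case using insert.hyps shiftq_insert(2)[OF insert.hyps] by (simp add: lessThan_Suc algebra_simps)
qed simp

lemma vdm_insert: assumes "finite Y" "z \<notin> Y"
 shows "vdm (insert z Y) = vdm Y * (\<Prod>y\<in>Y. if y < z then z - y else y - z)"
proof -
 let ?P = "{(x, y). x \<in> Y \<and> y \<in> Y \<and> y < x}"
 let ?L = "Pair z ` {y \<in> Y. y < z}" and ?G = "(%y. (y, z)) ` {y \<in> Y. z < y}"
 have fP: "finite ?P" by (rule finite_subset[of _ "Y \<times> Y"]) (use assms(1) in auto)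
 have "{(x, y). x \<in> insert z Y \<and> y \<in> insert z Y \<and> y < x} = ?P \<union> (?L \<union> ?G)" by auto
 hence "vdm (insert z Y) = (\<Prod>(x, y)\<in>?P \<union> (?L \<union> ?G). x - y)" by (simp add: vdm_def)
 also have "... = vdm Y * (\<Prod>(x, y)\<in>?L \<union> ?G. x - y)"
  unfolding vdm_def by (rule prod.union_disjoint[OF fP]) (use assms in auto)
 also have "(\<Prod>(x, y)\<in>?L \<union> ?G. x - y) = (\<Prod>(x, y)\<in>?L. x - y) * (\<Prod>(x, y)\<in>?G. x - y)"
  by (rule prod.union_disjoint) (use assms in auto)
 also have "(\<Prod>(x, y)\<in>?L. x - y) = (\<Prod>y\<in>{y \<in> Y. y < z}. z - y)"
  by (subst prod.reindex) (auto simp: inj_on_def)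
 also have "(\<Prod>(x, y)\<in>?G. x - y) = (\<Prod>y\<in>{y \<in> Y. z < y}. y - z)"
  by (subst prod.reindex) (auto simp: inj_on_def)
 also have "(\<Prod>y\<in>{y \<in> Y. y < z}. z - y) * (\<Prod>y\<in>{y \<in> Y. z < y}. y - z)
   = (\<Prod>y\<in>Y. if y < z then z - y else y - z)" proof -
  have "{y \<in> Y. z < y} = Y \<inter> - {y. y < z}" "{y \<in> Y. y < z} = Y \<inter> {y. y < z}"
   using assms(2) by (auto simp: not_less_iff_gr_or_eq)
  thus ?thesis using prod.If_cases[OF assms(1), of "%y. y < z" "%y. z - y" "%y. y - z"] by simp
 qed
 finally show ?thesis .
qed

lemma vdm_pos: "finite X ==> vdm X > 0" unfolding vdm_def by (rule prod_pos) auto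

lemma movD: assumes "x \<in> mov X" shows "x \<in> X" "x \<ge> 1" "x - 1 \<notin> X" "x - 1 ~= x" "x - 1 \<notin> X - {x}"
 using assms by (auto simp: mov_def)

lemma card_mv: "finite X ==> x \<in> mov X ==> card (mv X x) = card X"
 unfolding mv_def using movD(1,5)[of x X] card_Suc_Diff1[of X x] by simp

lemma finite_mv: "finite X ==> finite (mv X x)" by (simp add: mv_def)

lemma finite_mov: "finite X ==> finite (mov X)" by (simp add: mov_def)

lemma sum_mv: assumes "finite X" "x \<in> mov X" shows "\<Sum>X = Suc (\<Sum>(mv X x))"
proof -
 have "\<Sum>X = x + \<Sum>(X - {x})" using sum.remove[OF assms(1) movD(1)[OF assms(2)], of "%x. x"] by simp
 thus ?thesis using movD[OF assms(2)] assms(1) by (simp add: mv_def)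
qed

lemma vdm_mv: assumes "finite X" "x \<in> mov X"
 shows "rat_of_nat (vdm (mv X x)) = of_nat (vdm X) * shiftq X x"
proof -
 let ?Y = "X - {x}"
 note m = movD[OF assms(2)]
 have fY: "finite ?Y" using assms(1) by simp
 have X: "X = insert x ?Y" using m(1) by auto
 have vx: "vdm (insert x ?Y) = vdm ?Y * (\<Prod>y\<in>?Y. if y < x then x - y else y - x)" by (rule vdm_insert[OF fY]) simp
 have "rat_of_nat (\<Prod>y\<in>?Y. if y < x - 1 then x - 1 - y else y - (x - 1))
   = (\<Prod>y\<in>?Y. of_nat (if y < x then x - y else y - x) * (1 - 1 / (of_nat x - of_nat y)))" unfolding of_nat_prod
 proof (rule prod.cong[OF refl])
  fix y assume y: "y \<in> ?Y"
  hence "y ~= x" "y ~= x - 1" using m by auto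
  thus "rat_of_nat (if y < x - 1 then x - 1 - y else y - (x - 1))
   = of_nat (if y < x then x - y else y - x) * (1 - 1 / (of_nat x - of_nat y))"
   using m(2) by (cases "y < x - 1") (auto simp: of_nat_diff field_simps)
 qed
 hence "rat_of_nat (vdm (insert (x - 1) ?Y)) = of_nat (vdm (insert x ?Y)) * shiftq X x"
  unfolding vdm_insert[OF fY m(5)] vx by (simp add: shiftq_def prod.distrib)
 thus ?thesis using X by (simp add: mv_def)
qed

text \<open>The numbers that cannot be lowered contribute nothing to \<open>sum_mult_shiftq\<close>:
  0 because of the factor \<open>x\<close>, the others because \<open>shiftq\<close>
  vanishes.\<close>

lemma sum_vdm_mv: assumes "finite X"
 shows "(SUM x:mov X. rat_of_nat x * of_nat (vdm (mv X x))) = of_nat (vdm X) * (of_nat (\<Sum>X) - of_nat (\<Sum>{..<card X}))"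
proof -
 have "(SUM x:mov X. rat_of_nat x * of_nat (vdm (mv X x))) = (SUM x:mov X. of_nat (vdm X) * (of_nat x * shiftq X x))"
  by (intro sum.cong refl) (simp add: vdm_mv[OF assms])
 also have "... = (SUM x:X. of_nat (vdm X) * (of_nat x * shiftq X x))" proof (rule sum.mono_neutral_left[OF assms])
  show "mov X \<subseteq> X" by (auto simp: mov_def)
  show "\<forall>x\<in>X - mov X. rat_of_nat (vdm X) * (of_nat x * shiftq X x) = 0" proof
   fix x assume x: "x \<in> X - mov X"
   show "rat_of_nat (vdm X) * (of_nat x * shiftq X x) = 0" proof (cases "x = 0")
    case False hence "x - 1 \<in> X - {x}" using x by (auto simp: mov_def)
    moreover have "(1 - 1 / (rat_of_nat x - of_nat (x - 1))) = 0" using False by (simp add: of_nat_diff)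
    ultimately have "shiftq X x = 0" unfolding shiftq_def using assms by (intro prod_zero bexI[of _ "x - 1"]) auto
    thus ?thesis by simp
   qed simp
  qed
 qed
 finally show ?thesis by (simp only: sum_distrib_left[symmetric] sum_mult_shiftq[OF assms])
qed

lemma prod_fact_mv: assumes "finite X" "x \<in> mov X"
 shows "(\<Prod>x\<in>X. fact x) = x * (\<Prod>x\<in>mv X x. fact x :: nat)"
proof -
 note m = movD[OF assms(2)]
 have "(\<Prod>x\<in>X. fact x :: nat) = fact x * (\<Prod>x\<in>X - {x}. fact x)" by (rule prod.remove[OF assms(1) m(1)])
 also have "(fact x :: nat) = x * fact (x - 1)" using fact_reduce[of x, where 'a = nat] m(2) by simp
 also have "x * fact (x - 1) * (\<Prod>x\<in>X - {x}. fact x) = x * (\<Prod>x\<in>mv X x. fact x)"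
  using m assms(1) by (simp add: mv_def)
 finally show ?thesis .
qed

lemma vdm_initial: "vdm {..<r} = (\<Prod>x<r. fact x)"
proof (induction r)
 case 0 thus ?case by (simp add: vdm_def)
next case (Suc r)
 have "vdm (insert r {..<r}) = vdm {..<r} * (\<Prod>y<r. if y < r then r - y else y - r)" by (rule vdm_insert) auto
 also have "(\<Prod>y<r. if y < r then r - y else y - r) = (\<Prod>y<r. r - y)" by (intro prod.cong) auto
 also have "... = fact r" proof -
  have "(\<Prod>y<r. r - y) = (\<Prod>y\<in>{1..r}. y)"
   by (rule prod.reindex_bij_witness[where i = "%y. r - y" and j = "%y. r - y"]) auto
  thus ?thesis by (simp add: fact_prod)
 qed
 finally show ?case using Suc by (simp add: lessThan_Suc mult.commute)
qed

text \<open>The degree formula of Frobenius in terms of beta-numbers. Lowering \<open>x\<close>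
  divides the product of the factorials by \<open>x\<close>, so the recursion for the paths is
  \<open>sum_vdm_mv\<close>.\<close>

lemma bpath_formula: assumes "finite X" "\<Sum>X = \<Sum>{..<card X} + p"
 shows "bpath {..<card X} p X * (\<Prod>x\<in>X. fact x) = fact p * vdm X" using assms
proof (induction p arbitrary: X)
 case 0 hence "X = {..<card X}" using sum_nat_set_ge(2)[of X] by simp then obtain r where r: "X = {..<r}" by blast
 show ?case unfolding r by (simp add: vdm_initial)
next case (Suc p)
 note fin = Suc.prems(1)
 have "rat_of_nat (bpath {..<card X} (Suc p) X * (\<Prod>x\<in>X. fact x))
   = (SUM x:mov X. of_nat (bpath {..<card X} p (mv X x) * (\<Prod>x\<in>X. fact x)))" by (simp add: sum_distrib_right)
 also have "... = (SUM x:mov X. fact p * (of_nat x * of_nat (vdm (mv X x))))" proof (rule sum.cong[OF refl])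
  fix x assume x: "x \<in> mov X"
  have "bpath {..<card (mv X x)} p (mv X x) * (\<Prod>x\<in>mv X x. fact x) = fact p * vdm (mv X x)"
   by (rule Suc.IH[OF finite_mv[OF fin]]) (use sum_mv[OF fin x] Suc.prems(2) card_mv[OF fin x] in simp)
  hence "bpath {..<card X} p (mv X x) * (\<Prod>x\<in>X. fact x) = fact p * (x * vdm (mv X x))"
   unfolding card_mv[OF fin x] prod_fact_mv[OF fin x] by (simp add: ac_simps)
  hence "rat_of_nat (bpath {..<card X} p (mv X x) * (\<Prod>x\<in>X. fact x)) = of_nat (fact p * (x * vdm (mv X x)))"
   by (rule arg_cong)
  thus "rat_of_nat (bpath {..<card X} p (mv X x) * (\<Prod>x\<in>X. fact x)) = fact p * (of_nat x * of_nat (vdm (mv X x)))"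
   by simp
 qed
 also have "... = fact p * (of_nat (vdm X) * (of_nat (\<Sum>X) - of_nat (\<Sum>{..<card X})))"
  by (simp only: sum_distrib_left[symmetric] sum_vdm_mv[OF fin])
 also have "... = fact p * (of_nat (vdm X) * of_nat (Suc p))" unfolding Suc.prems(2) by simp
 also have "... = of_nat (fact (Suc p) * vdm X)" by (simp add: algebra_simps)
 finally show ?case by (simp only: of_nat_eq_iff)
qed

text \<open>The analogue for two sets whose moves are interleaved: the excesses of \<open>A\<close>
  and \<open>B\<close> over initial segments add up to \<open>Suc w\<close>, the next factor of the
  factorial.\<close>

lemma bpath2_formula: assumes "finite A" "finite B" "\<Sum>A + \<Sum>B = \<Sum>{..<card A} + \<Sum>{..<card B} + w"
 shows "bpath2 w A B * ((\<Prod>x\<in>A. fact x) * (\<Prod>x\<in>B. fact x)) = fact w * (vdm A * vdm B)" using assms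
proof (induction w arbitrary: A B)
 case 0
 have "\<Sum>A = \<Sum>{..<card A}" "\<Sum>B = \<Sum>{..<card B}"
  using 0 sum_nat_set_ge(1)[of A] sum_nat_set_ge(1)[of B] by linarith+
 hence "A = {..<card A}" "B = {..<card B}" using 0 sum_nat_set_ge(2) by blast+
 then obtain r s where r: "A = {..<r}" "B = {..<s}" by blast
 show ?case unfolding r by (simp add: vdm_initial)
next case (Suc w)
 note fin = Suc.prems(1,2)
 let ?fA = "\<Prod>x\<in>A. fact x :: nat" and ?fB = "\<Prod>x\<in>B. fact x :: nat"
 have a: "bpath2 w (mv A x) B * (?fA * ?fB) = fact w * (x * vdm (mv A x) * vdm B)" if x: "x \<in> mov A" for x proof -
  have "bpath2 w (mv A x) B * ((\<Prod>x\<in>mv A x. fact x) * ?fB) = fact w * (vdm (mv A x) * vdm B)"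
   by (rule Suc.IH[OF finite_mv[OF fin(1)] fin(2)])
     (use sum_mv[OF fin(1) x] Suc.prems(3) card_mv[OF fin(1) x] in simp)
  thus ?thesis unfolding prod_fact_mv[OF fin(1) x] by (simp add: ac_simps)
 qed
 have b: "bpath2 w A (mv B x) * (?fA * ?fB) = fact w * (x * vdm (mv B x) * vdm A)" if x: "x \<in> mov B" for x proof -
  have "bpath2 w A (mv B x) * (?fA * (\<Prod>x\<in>mv B x. fact x)) = fact w * (vdm A * vdm (mv B x))"
   by (rule Suc.IH[OF fin(1) finite_mv[OF fin(2)]])
     (use sum_mv[OF fin(2) x] Suc.prems(3) card_mv[OF fin(2) x] in simp)
  thus ?thesis unfolding prod_fact_mv[OF fin(2) x] by (simp add: ac_simps)
 qed
 have "bpath2 (Suc w) A B * (?fA * ?fB)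
   = (SUM x:mov A. bpath2 w (mv A x) B * (?fA * ?fB)) + (SUM x:mov B. bpath2 w A (mv B x) * (?fA * ?fB))"
  by (simp add: distrib_right sum_distrib_right)
 also have "... = (SUM x:mov A. fact w * (x * vdm (mv A x) * vdm B)) + (SUM x:mov B. fact w * (x * vdm (mv B x) * vdm A))"
  using a b by simp
 finally have "rat_of_nat (bpath2 (Suc w) A B * (?fA * ?fB))
   = of_nat ((SUM x:mov A. fact w * (x * vdm (mv A x) * vdm B)) + (SUM x:mov B. fact w * (x * vdm (mv B x) * vdm A)))"
  by (rule arg_cong)
 also have "... = fact w * of_nat (vdm B) * (SUM x:mov A. of_nat x * of_nat (vdm (mv A x)))
   + fact w * of_nat (vdm A) * (SUM x:mov B. of_nat x * of_nat (vdm (mv B x)))" by (simp add: sum_distrib_left ac_simps)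
 also have "... = fact w * of_nat (vdm A * vdm B) * (of_nat (\<Sum>A + \<Sum>B) - of_nat (\<Sum>{..<card A} + \<Sum>{..<card B}))"
  unfolding sum_vdm_mv[OF fin(1)] sum_vdm_mv[OF fin(2)] by (simp add: algebra_simps)
 also have "... = of_nat (fact (Suc w) * (vdm A * vdm B))" unfolding Suc.prems(3) by (simp add: algebra_simps)
 finally show ?case by (simp only: of_nat_eq_iff)
qed

section \<open>Moves by two and the parity of path numbers\<close>

definition dmov :: "nat set => nat set" where
 "dmov X = {x \<in> X. x \<ge> 2 \<and> x - 2 \<notin> X}"

definition dmv :: "nat set => nat => nat set" where
 "dmv X x = insert (x - 2) (X - {x})"

lemma even_sum_involution: fixes h :: "'a => nat"
 assumes "finite P" "\<And>x. x \<in> P ==> s x \<in> P \<and> s (s x) = x \<and> s x ~= x \<and> h (s x) = h x"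
 shows "even (SUM x:P. h x)" using assms
proof (induction "card P" arbitrary: P rule: less_induct)
 case less show ?case proof (cases "P = {}")
  case False then obtain x where x: "x \<in> P" by blast
  let ?Q = "P - {x, s x}"
  have sx: "s x \<in> P" "s (s x) = x" "s x ~= x" "h (s x) = h x" using less.prems(2)[OF x] by auto
  have "even (SUM x:?Q. h x)" proof (rule less.hyps)
   show "card ?Q < card P" using less.prems(1) x by (intro psubset_card_mono) auto
   show "finite ?Q" using less.prems(1) by simp
   fix y assume y: "y \<in> ?Q"
   hence "s y \<in> P" "s (s y) = y" "s y ~= y" "h (s y) = h y" using less.prems(2)[of y] by auto
   moreover have "s y ~= x" "s y ~= s x" using y sx calculation by auto
   ultimately show "s y \<in> ?Q \<and> s (s y) = y \<and> s y ~= y \<and> h (s y) = h y" by simp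
  qed
  moreover have "(SUM x:P. h x) = (SUM x:?Q. h x) + (SUM x:{x, s x}. h x)"
   using less.prems(1) x sx(1) by (subst sum.subset_diff[of "{x, s x}"]) auto
  moreover have "(SUM x:{x, s x}. h x) = 2 * h x" using sx by simp
  ultimately show ?thesis by simp
 qed simp
qed

text \<open>Two successive single moves either combine to a move by two, which happens in exactly one way,
 or can be interchanged.\<close>

lemma bpath_two_step: assumes "finite X"
 shows "even (bpath Y (Suc (Suc p)) X + (SUM x:dmov X. bpath Y p (dmv X x)))"
proof -
 let ?S = "SIGMA x:mov X. mov (mv X x)"
 let ?h = "%(x, y). bpath Y p (mv (mv X x) y)"
 define P where "P = {(x, y) \<in> ?S. y ~= x - 1 \<and> y ~= x + 1}"
 have fS: "finite ?S" using assms finite_mov finite_mv by (intro finite_SigmaI) auto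
 have "bpath Y (Suc (Suc p)) X = (SUM z:?S. ?h z)" using assms finite_mov finite_mv by (simp add: sum.Sigma)
 also have "... = (SUM z:P. ?h z) + (SUM z:?S - P. ?h z)"
  using fS by (subst sum.subset_diff[of P]) (auto simp: P_def add.commute)
 \<comment> \<open>The order of the single moves is forced: if \<open>x - 1\<close> is occupied it
   has to move first, otherwise \<open>x\<close> moves twice.\<close>
 also have "(SUM z:?S - P. ?h z) = (SUM x:dmov X. bpath Y p (dmv X x))" proof (rule sum.reindex_bij_witness[where
    i = "%x. if x - 1 \<in> X then (x - 1, x) else (x, x - 1)" and j = "%(x, y). max x y"])
  fix z assume z: "z \<in> ?S - P"
  then obtain x y where xy: "z = (x, y)" "x \<in> mov X" "y \<in> mov (mv X x)" "y = x - 1 \<or> y = x + 1"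
   by (auto simp: P_def)
  have m: "x \<in> X" "x \<ge> 1" "x - 1 \<notin> X" "y \<in> mv X x" "y \<ge> 1" "y - 1 \<notin> mv X x"
   using movD(1,2,3)[OF xy(2)] movD(1,2,3)[OF xy(3)] by auto
  then obtain u where u: "x = Suc u" by (cases x) auto
  have "(case z of (x, y) => max x y) \<in> dmov X
   \<and> (if (case z of (x, y) => max x y) - 1 \<in> X
     then ((case z of (x, y) => max x y) - 1, case z of (x, y) => max x y)
     else (case z of (x, y) => max x y, (case z of (x, y) => max x y) - 1)) = z
   \<and> dmv X (case z of (x, y) => max x y) = mv (mv X x) y" proof (cases "y = u")
   case True
   have f: "Suc u \<in> X" "u \<notin> X" "u \<ge> 1" "u - 1 \<notin> X" using m True u by (auto simp: mv_def)
   have "mv (mv X (Suc u)) u = dmv X (Suc u)" using f by (auto simp: mv_def dmv_def)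
   thus ?thesis using f True u xy(1) by (auto simp: dmov_def)
  next case False
   hence y: "y = Suc (Suc u)" using xy(4) u by simp
   have f: "Suc u \<in> X" "u \<notin> X" "Suc (Suc u) \<in> X" using m y u by (auto simp: mv_def)
   have "mv (mv X (Suc u)) (Suc (Suc u)) = dmv X (Suc (Suc u))" using f by (auto simp: mv_def dmv_def)
   thus ?thesis using f y u xy(1) by (auto simp: dmov_def)
  qed
  thus "(if (case z of (x, y) => max x y) - 1 \<in> X
     then ((case z of (x, y) => max x y) - 1, case z of (x, y) => max x y)
     else (case z of (x, y) => max x y, (case z of (x, y) => max x y) - 1)) = z"
   "(case z of (x, y) => max x y) \<in> dmov X"
   "bpath Y p (dmv X (case z of (x, y) => max x y)) = (case z of (x, y) => bpath Y p (mv (mv X x) y))"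
   using xy(1) by simp_all
 next fix x assume x: "x \<in> dmov X"
  hence m: "x \<in> X" "x \<ge> 2" "x - 2 \<notin> X" by (auto simp: dmov_def)
  show "(case if x - 1 \<in> X then (x - 1, x) else (x, x - 1) of (x, y) => max x y) = x" using m by auto
  show "(if x - 1 \<in> X then (x - 1, x) else (x, x - 1)) \<in> ?S - P"
   using m by (auto simp: P_def mov_def mv_def numeral_2_eq_2)
 qed
 also have "even (SUM z:P. ?h z)" proof (rule even_sum_involution[where s = prod.swap])
  show "finite P" by (rule finite_subset[OF _ fS]) (auto simp: P_def)
  fix z assume "z \<in> P"
  then obtain x y where xy: "z = (x, y)" "x \<in> mov X" "y \<in> mov (mv X x)" "y ~= x - 1" "y ~= x + 1"
   by (auto simp: P_def)
  have m: "x \<in> X" "x \<ge> 1" "x - 1 \<notin> X" "y \<in> mv X x" "y \<ge> 1" "y - 1 \<notin> mv X x"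
   using movD(1,2,3)[OF xy(2)] movD(1,2,3)[OF xy(3)] by auto
  have y: "y \<in> X" "y ~= x" using m xy(4) by (auto simp: mv_def)
  have y1: "y - 1 ~= x - 1" "y - 1 ~= x" using m xy(5) y by auto
  have y2: "y - 1 \<notin> X" using m y1 by (auto simp: mv_def)
  have "mv (mv X x) y = mv (mv X y) x" using y y1 xy(4) m by (auto simp: mv_def)
  moreover have "y \<in> mov X" "x \<in> mov (mv X y)" using y y1 y2 m by (auto simp: mov_def mv_def)
  moreover have "x ~= y - 1" "x ~= y + 1" using xy(4,5) m by auto
  ultimately show "prod.swap z \<in> P \<and> prod.swap (prod.swap z) = z \<and> prod.swap z ~= z
    \<and> (case prod.swap z of (x, y) => bpath Y p (mv (mv X x) y)) = (case z of (x, y) => bpath Y p (mv (mv X x) y))"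
   using xy y by (auto simp: P_def)
 qed
 ultimately show ?thesis by simp
qed

text \<open>Inverse to splitting a beta-set into its even and odd members; the pair of sets
  represents the 2-quotient.\<close>

definition join :: "nat set => nat set => nat set" where
 "join A B = (%a. 2 * a) ` A \<union> (%b. 2 * b + 1) ` B"

lemma join_iff: "2 * a \<in> join A B \<longleftrightarrow> a \<in> A" "2 * a + 1 \<in> join A B \<longleftrightarrow> a \<in> B" "Suc (2 * a) \<in> join A B \<longleftrightarrow> a \<in> B"
 unfolding join_def by (auto, presburger+)

lemma join_inj: "join A B = join A' B' \<longleftrightarrow> A = A' \<and> B = B'" using join_iff by (metis set_eqI)

lemma join_ext: "(\<And>a. 2 * a \<in> X \<longleftrightarrow> a \<in> A) ==> (\<And>a. 2 * a + 1 \<in> X \<longleftrightarrow> a \<in> B) ==> X = join A B"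
proof (rule set_eqI)
 fix x assume h: "\<And>a. 2 * a \<in> X \<longleftrightarrow> a \<in> A" "\<And>a. 2 * a + 1 \<in> X \<longleftrightarrow> a \<in> B"
 show "x \<in> X \<longleftrightarrow> x \<in> join A B" proof (cases "even x")
  case True then obtain a where "x = 2 * a" by blast thus ?thesis using h(1) join_iff(1) by simp
 next case False
  then obtain a where "x = 2 * a + 1" by (rule oddE)
  thus ?thesis using h(2) join_iff(2) by blast
 qed
qed

lemma finite_join: "finite A ==> finite B ==> finite (join A B)" by (simp add: join_def)

lemma dmov_join: assumes "finite A" "finite B"
 shows "(SUM x:dmov (join A B). h (dmv (join A B) x)) = (SUM a:mov A. h (join (mv A a) B)) + (SUM b:mov B. h (join A (mv B b)) :: nat)"
proof -
 have d: "dmov (join A B) = join (mov A) (mov B)" proof (rule join_ext)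
  fix a :: nat
  have e: "2 * a - 2 = 2 * (a - 1)" by simp
  have od: "2 * a + 1 - 2 = 2 * (a - 1) + 1" if "a \<ge> 1" using that by simp
  show "2 * a \<in> dmov (join A B) \<longleftrightarrow> a \<in> mov A" unfolding dmov_def mov_def using join_iff(1)[of a A B] join_iff(1)[of "a - 1" A B] e by auto
  show "2 * a + 1 \<in> dmov (join A B) \<longleftrightarrow> a \<in> mov B" proof (cases "a \<ge> 1")
   case True thus ?thesis unfolding dmov_def mov_def mem_Collect_eq od[OF True] join_iff(2) by auto
  qed (auto simp: dmov_def mov_def)
 qed
 have ma: "dmv (join A B) (2 * a) = join (mv A a) B" if "a \<in> mov A" for a proof (rule join_ext)
  fix x :: nat
  have e: "2 * a - 2 = 2 * (a - 1)" by simp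
  show "2 * x \<in> dmv (join A B) (2 * a) \<longleftrightarrow> x \<in> mv A a" unfolding dmv_def mv_def e using join_iff(1)[of x A B] by auto
  show "2 * x + 1 \<in> dmv (join A B) (2 * a) \<longleftrightarrow> x \<in> B" unfolding dmv_def e using join_iff(2)[of x A B] by (auto, presburger+)
 qed
 have mb: "dmv (join A B) (2 * b + 1) = join A (mv B b)" if "b \<in> mov B" for b proof (rule join_ext)
  fix x :: nat
  have od: "2 * b + 1 - 2 = 2 * (b - 1) + 1" using movD(2)[OF that] by simp
  show "2 * x \<in> dmv (join A B) (2 * b + 1) \<longleftrightarrow> x \<in> A" unfolding dmv_def od using join_iff(1)[of x A B] by (auto, presburger+)
  show "2 * x + 1 \<in> dmv (join A B) (2 * b + 1) \<longleftrightarrow> x \<in> mv B b" unfolding dmv_def od mv_def using join_iff(2)[of x A B] by auto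
 qed
 have "(SUM x:dmov (join A B). h (dmv (join A B) x))
   = (SUM x:(%a. 2 * a) ` mov A. h (dmv (join A B) x)) + (SUM x:(%b. 2 * b + 1) ` mov B. h (dmv (join A B) x))" proof -
  have ne: "2 * a ~= 2 * b + 1" for a b :: nat by presburger
  have "(%a. 2 * a) ` mov A \<inter> (%b. 2 * b + 1) ` mov B = {}" using ne by blast
  thus ?thesis unfolding d join_def[of "mov A"] by (intro sum.union_disjoint finite_imageI finite_mov assms)
 qed
 also have "(SUM x:(%a. 2 * a) ` mov A. h (dmv (join A B) x)) = (SUM a:mov A. h (join (mv A a) B))"
  by (subst sum.reindex) (auto simp: inj_on_def ma)
 also have "(SUM x:(%b. 2 * b + 1) ` mov B. h (dmv (join A B) x)) = (SUM b:mov B. h (join A (mv B b)))"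
  by (subst sum.reindex) (auto simp: inj_on_def mb[simplified])
 finally show ?thesis .
qed

text \<open>Modulo 2, two single moves may be replaced by one move by two, which on
  \<open>join A B\<close> is a single move in \<open>A\<close> or in \<open>B\<close>. So the parity
  of the number of paths from the core is found from the 2-quotient.\<close>

lemma bpath_parity: assumes "finite A" "finite B"
 shows "even (bpath (join {..<card A} {..<card B}) (2 * w) (join A B) + bpath2 w A B)" using assms
proof (induction w arbitrary: A B)
 case 0 show ?case by (simp add: join_inj)
next case (Suc w)
 let ?Y = "join {..<card A} {..<card B}"
 note fin = Suc.prems
 have IA: "even (bpath ?Y (2 * w) (join (mv A a) B) + bpath2 w (mv A a) B)" if "a \<in> mov A" for a
  using Suc.IH[OF finite_mv[OF fin(1)] fin(2), of a] card_mv[OF fin(1) that] by simp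
 have IB: "even (bpath ?Y (2 * w) (join A (mv B b)) + bpath2 w A (mv B b))" if "b \<in> mov B" for b
  using Suc.IH[OF fin(1) finite_mv[OF fin(2)], of b] card_mv[OF fin(2) that] by simp
 have "even ((SUM a:mov A. bpath ?Y (2 * w) (join (mv A a) B) + bpath2 w (mv A a) B)
   + (SUM b:mov B. bpath ?Y (2 * w) (join A (mv B b)) + bpath2 w A (mv B b)))"
  by (rule dvd_add; rule dvd_sum; (rule IA | rule IB); assumption)
 hence "even ((SUM x:dmov (join A B). bpath ?Y (2 * w) (dmv (join A B) x)) + bpath2 (Suc w) A B)"
  unfolding dmov_join[OF fin] by (simp add: sum.distrib ac_simps)
 moreover have "even (bpath ?Y (Suc (Suc (2 * w))) (join A B) + (SUM x:dmov (join A B). bpath ?Y (2 * w) (dmv (join A B) x)))"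
  by (rule bpath_two_step[OF finite_join[OF fin]])
 ultimately have "even (bpath ?Y (Suc (Suc (2 * w))) (join A B) + bpath2 (Suc w) A B)"
  by (simp del: bpath.simps bpath2.simps)
 thus ?case by (simp del: bpath.simps bpath2.simps)
qed

section \<open>Valuations of degrees\<close>

abbreviation v2 :: "nat => nat" where "v2 \<equiv> multiplicity 2"

lemma v2_mult: "x ~= 0 ==> y ~= 0 ==> v2 (x * y) = v2 x + v2 y" by (intro prime_elem_multiplicity_mult_distrib) auto

lemma v2_double: "x ~= 0 ==> v2 (2 * x) = Suc (v2 x)" by (simp add: multiplicity_times_same)

lemma v2_odd: "odd x ==> v2 x = 0" by (rule not_dvd_imp_multiplicity_0)

lemma v2_eq_0_iff: "x ~= 0 ==> v2 x = 0 \<longleftrightarrow> odd x" using multiplicity_eq_zero_iff[of x 2] by auto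

lemma v2_prod: "finite K ==> (\<And>k. k \<in> K ==> f k ~= 0) ==> v2 (\<Prod>k\<in>K. f k) = (SUM k:K. v2 (f k))"
 by (induction K rule: finite_induct) (simp_all add: v2_mult)

lemma v2_fact_double: "v2 (fact (2 * a)) = a + v2 (fact a)" "v2 (fact (2 * a + 1)) = a + v2 (fact a)"
proof -
 show 1: "v2 (fact (2 * a)) = a + v2 (fact a)" proof (induction a)
  case (Suc a)
  have e: "fact (2 * Suc a) = 2 * ((Suc a * (2 * a + 1)) * fact (2 * a) :: nat)" by (simp add: algebra_simps)
  have "(Suc a * (2 * a + 1)) * fact (2 * a) ~= (0 :: nat)" by simp
  from v2_double[OF this] have "v2 (fact (2 * Suc a)) = Suc (v2 ((Suc a * (2 * a + 1)) * fact (2 * a)))" unfolding e .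
  also have "v2 ((Suc a * (2 * a + 1)) * fact (2 * a)) = v2 (Suc a) + v2 (2 * a + 1) + v2 (fact (2 * a))"
   by (subst v2_mult, simp, simp, subst v2_mult, simp_all)
  also have "v2 (2 * a + 1) = 0" by (rule v2_odd) simp
  also have "v2 (fact (Suc a)) = v2 (Suc a) + v2 (fact a)" using v2_mult[of "Suc a" "fact a"] by simp
  ultimately show ?case using Suc by simp
 qed simp
 have "v2 (fact (2 * a + 1)) = v2 ((2 * a + 1) * fact (2 * a))" by simp
 also have "... = v2 (2 * a + 1) + v2 (fact (2 * a))" by (rule v2_mult) simp_all
 also have "v2 (2 * a + 1) = 0" by (rule v2_odd) simp
 finally show "v2 (fact (2 * a + 1)) = a + v2 (fact a)" using 1 by simp
qed

lemma binary_digit_sum_double: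
 "finite {i. bit m i} \<and> binary_digit_sum (2 * m) = binary_digit_sum m \<and> binary_digit_sum (2 * m + 1) = Suc (binary_digit_sum m)"
proof -
 have f: "finite {i. bit m i}" proof (rule finite_subset)
  show "{i. bit m i} \<subseteq> {..m}" proof
   fix i assume "i \<in> {i. bit m i}"
   hence "odd (m div 2 ^ i)" by (simp add: bit_iff_odd)
   hence "m div 2 ^ i ~= 0" by (metis even_zero)
   hence "2 ^ i \<le> m" by (metis div_less not_le)
   hence "i < m" by (rule order_less_le_trans[OF less_exp])
   thus "i \<in> {..m}" by simp
  qed
 qed simp
 have "{i. bit (2 * m) i} = Suc ` {i. bit m i}" proof (intro set_eqI)
  fix i show "i \<in> {i. bit (2 * m) i} \<longleftrightarrow> i \<in> Suc ` {i. bit m i}"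
   by (cases i) (auto simp: bit_Suc bit_0)
 qed
 moreover have "{i. bit (2 * m + 1) i} = insert 0 (Suc ` {i. bit m i})" proof (intro set_eqI)
  fix i show "i \<in> {i. bit (2 * m + 1) i} \<longleftrightarrow> i \<in> insert 0 (Suc ` {i. bit m i})"
   by (cases i) (auto simp: bit_Suc bit_0)
 qed
 ultimately show ?thesis using f by (simp add: binary_digit_sum_def card_image)
qed

lemma legendre_2: "v2 (fact n) + binary_digit_sum n = n"
proof (induction n rule: less_induct)
 case (less n) show ?case proof (cases "n = 0")
  case False
  define q where "q = n div 2"
  have IH: "v2 (fact q) + binary_digit_sum q = q" using less[of q] False by (simp add: q_def)
  show ?thesis proof (cases "even n")
   case True hence "n = 2 * q" by (simp add: q_def)
   thus ?thesis using IH v2_fact_double(1)[of q] binary_digit_sum_double[of q] by simp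
  next case False
   hence n: "n = 2 * q + 1" by (simp add: q_def)
   have "v2 (fact n) = q + v2 (fact q)" "binary_digit_sum n = Suc (binary_digit_sum q)"
    unfolding n using v2_fact_double(2)[of q] binary_digit_sum_double[of q] by simp_all
   thus ?thesis using IH n by simp
  qed
 qed (simp add: binary_digit_sum_def)
qed

definition gap :: "nat => nat => nat" where
 "gap z y = (if y < z then z - y else y - z)"

lemma gap_simps: "gap (2 * a) (2 * b) = 2 * gap a b" "gap (2 * a + 1) (2 * b + 1) = 2 * gap a b"
 "odd (gap (2 * a) (2 * b + 1))" "odd (gap (2 * a + 1) (2 * b))" "a ~= b ==> gap a b ~= 0"
 unfolding gap_def by (simp_all, presburger+)

lemma v2_vdm_insert: assumes "finite Y" "z \<notin> Y" shows "v2 (vdm (insert z Y)) = v2 (vdm Y) + (SUM y:Y. v2 (gap z y))"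
proof -
 have "vdm (insert z Y) = vdm Y * (\<Prod>y\<in>Y. gap z y)" unfolding gap_def by (rule vdm_insert[OF assms])
 moreover have ne: "gap z y ~= 0" if "y \<in> Y" for y using gap_simps(5)[of z y] assms(2) that by blast
 ultimately show ?thesis using vdm_pos[OF assms(1)] assms(1) by (simp add: v2_mult v2_prod)
qed

lemma sum_join: assumes "finite A" "finite B"
 shows "(SUM x:join A B. h x) = (SUM a:A. h (2 * a)) + (SUM b:B. h (2 * b + 1))"
proof -
 have ne: "2 * a ~= 2 * b + 1" for a b :: nat by presburger
 have "(%a. 2 * a) ` A \<inter> (%b. 2 * b + 1) ` B = {}" using ne by blast
 hence "(SUM x:join A B. h x) = (SUM x:(%a. 2 * a) ` A. h x) + (SUM x:(%b. 2 * b + 1) ` B. h x)"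
  unfolding join_def by (intro sum.union_disjoint finite_imageI assms)
 thus ?thesis by (simp add: sum.reindex inj_on_def)
qed

lemma card_join: "finite A ==> finite B ==> card (join A B) = card A + card B" using sum_join[of A B "%_. 1 :: nat"] by simp

text \<open>Differences of numbers of opposite parity are odd. Those of equal parity are twice a
  difference within \<open>A\<close> or within \<open>B\<close>, which gives one factor 2 for each
  pair.\<close>

lemma v2_vdm_join: assumes "finite A" "finite B"
 shows "v2 (vdm (join A B)) = \<Sum>{..<card A} + v2 (vdm A) + \<Sum>{..<card B} + v2 (vdm B)"
proof -
 have one: "v2 (gap (2 * a) (2 * b)) = Suc (v2 (gap a b))" "v2 (gap (2 * a + 1) (2 * b + 1)) = Suc (v2 (gap a b))"
  if "a ~= b" for a b unfolding gap_simps(1,2) using gap_simps(5)[OF that] by (rule v2_double)+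
 have zero: "v2 (gap (2 * a) (2 * b + 1)) = 0" "v2 (gap (2 * a + 1) (2 * b)) = 0" for a b by (rule v2_odd, rule gap_simps)+
 have B: "v2 (vdm (join {} B)) = \<Sum>{..<card B} + v2 (vdm B)" using assms(2) proof (induction B rule: finite_induct)
  case empty thus ?case by (simp add: join_def)
 next case (insert b B)
  have j: "join {} (insert b B) = insert (2 * b + 1) (join {} B)" by (simp add: join_def)
  have "2 * b + 1 \<notin> join {} B" using insert.hyps join_iff(2) by simp
  hence "v2 (vdm (join {} (insert b B))) = v2 (vdm (join {} B)) + (SUM y:join {} B. v2 (gap (2 * b + 1) y))"
   unfolding j using finite_join[of "{}" B] insert.hyps by (intro v2_vdm_insert) auto
  also have "(SUM y:join {} B. v2 (gap (2 * b + 1) y)) = (SUM y:B. Suc (v2 (gap b y)))" proof -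
   have "v2 (gap (2 * b + 1) (2 * y + 1)) = Suc (v2 (gap b y))" if "y \<in> B" for y
    by (rule one(2)) (use that insert.hyps in blast)
   thus ?thesis using sum_join[of "{}" B "%y. v2 (gap (2 * b + 1) y)"] insert.hyps by simp
  qed
  also have "... = card B + (SUM y:B. v2 (gap b y))" by (simp add: sum_Suc)
  finally show ?case using insert v2_vdm_insert[OF insert.hyps] by (simp add: lessThan_Suc)
 qed
 show ?thesis using assms(1) proof (induction A rule: finite_induct)
  case empty show ?case using B by (simp add: vdm_def)
 next case (insert a A)
  have j: "join (insert a A) B = insert (2 * a) (join A B)" by (simp add: join_def)
  have "2 * a \<notin> join A B" using insert.hyps join_iff(1) by simp
  hence "v2 (vdm (join (insert a A) B)) = v2 (vdm (join A B)) + (SUM y:join A B. v2 (gap (2 * a) y))"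
   unfolding j using finite_join[of A B] insert.hyps assms(2) by (intro v2_vdm_insert) auto
  also have "(SUM y:join A B. v2 (gap (2 * a) y)) = (SUM y:A. Suc (v2 (gap a y)))" proof -
   have "v2 (gap (2 * a) (2 * y)) = Suc (v2 (gap a y))" if "y \<in> A" for y
    by (rule one(1)) (use that insert.hyps in blast)
   thus ?thesis using sum_join[OF insert.hyps(1) assms(2), of "%y. v2 (gap (2 * a) y)"] zero(1) by simp
  qed
  also have "... = card A + (SUM y:A. v2 (gap a y))" by (simp add: sum_Suc)
  finally show ?case using insert v2_vdm_insert[OF insert.hyps] by (simp add: lessThan_Suc)
 qed
qed

text \<open>The valuations of the two degree formulas are compared by \<open>v2_vdm_join\<close>. As
  \<open>w + v2 (fact w)\<close> is the valuation of \<open>fact (2 * w)\<close>, that is, the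
  defect, the valuation of \<open>bpath2\<close> is the height.\<close>

lemma v2_bpath: assumes fin: "finite A" "finite B" and X: "\<Sum>(join A B) = \<Sum>{..<card (join A B)} + n"
  and w: "\<Sum>A + \<Sum>B = \<Sum>{..<card A} + \<Sum>{..<card B} + w"
 shows "v2 (bpath {..<card (join A B)} n (join A B)) + w + v2 (fact w) = v2 (fact n) + v2 (bpath2 w A B)"
  "bpath {..<card (join A B)} n (join A B) > 0" "bpath2 w A B > 0" proof -
 let ?X = "join A B"
 note fX = finite_join[OF fin]
 let ?f = "bpath {..<card ?X} n ?X" and ?b = "bpath2 w A B"
 have pf: "(\<Prod>x\<in>Y. fact x :: nat) ~= 0" for Y by (induction Y rule: infinite_finite_induct) auto
 have 1: "?f * (\<Prod>x\<in>?X. fact x) = fact n * vdm ?X" by (rule bpath_formula[OF fX X])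
 have 2: "?b * ((\<Prod>x\<in>A. fact x) * (\<Prod>x\<in>B. fact x)) = fact w * (vdm A * vdm B)" by (rule bpath2_formula[OF fin w])
 have vp: "vdm ?X ~= 0" "vdm A ~= 0" "vdm B ~= 0" using vdm_pos fX fin by (metis less_numeral_extra(3))+
 have "?f * (\<Prod>x\<in>?X. fact x) ~= 0" unfolding 1 using vp by simp
 thus f0: "?f > 0" by (simp add: mult_eq_0_iff)
 have "?b * ((\<Prod>x\<in>A. fact x) * (\<Prod>x\<in>B. fact x)) ~= 0" unfolding 2 using vp by simp
 thus b0: "?b > 0" by (simp add: mult_eq_0_iff)
 have "v2 ?f + v2 (\<Prod>x\<in>?X. fact x) = v2 (fact n) + v2 (vdm ?X)"
  using arg_cong[OF 1, of v2] f0 pf vp by (simp add: v2_mult)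
 moreover have "v2 (\<Prod>x\<in>?X. fact x) = (\<Sum>A + \<Sum>B) + ((SUM a:A. v2 (fact a)) + (SUM b:B. v2 (fact b)))"
  by (simp add: v2_prod[OF fX] sum_join[OF fin] v2_fact_double[simplified] sum.distrib)
 moreover have "v2 ?b + ((SUM a:A. v2 (fact a)) + (SUM b:B. v2 (fact b))) = v2 (fact w) + (v2 (vdm A) + v2 (vdm B))"
  using arg_cong[OF 2, of v2] b0 pf vp by (simp add: v2_mult v2_prod fin)
 ultimately show "v2 ?f + w + v2 (fact w) = v2 (fact n) + v2 ?b" using v2_vdm_join[OF fin] w by linarith
qed

section \<open>Beta-sets of diagrams\<close>

text \<open>\<open>R\<close> is the number of rows considered, empty ones included.\<close>

definition beta :: "nat => cells => nat => nat" where
 "beta R D i = rowlen D i + (R - Suc i)"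

definition bset :: "nat => cells => nat set" where
 "bset R D = beta R D ` {..<R}"

lemma beta_less: assumes "young n D" "i < j" "j < R" shows "beta R D j < beta R D i"
 using rowlen_antimono[OF assms(1), of i j] assms(2,3) unfolding beta_def by linarith

lemma beta_inj: assumes "young n D" shows "inj_on (beta R D) {..<R}"
proof (rule inj_onI)
 fix i j assume "i \<in> {..<R}" "j \<in> {..<R}" "beta R D i = beta R D j"
 thus "i = j" using beta_less[OF assms, of i j R] beta_less[OF assms, of j i R] by (cases i j rule: linorder_cases) auto
qed

lemma card_bset: "young n D ==> card (bset R D) = R" unfolding bset_def by (simp add: card_image beta_inj)

lemma finite_bset [simp]: "finite (bset R D)" by (simp add: bset_def)

lemma rowlen_0: assumes "young n D" "n \<le> i" shows "rowlen D i = 0"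
proof (rule ccontr)
 assume "rowlen D i ~= 0"
 hence "(i, 0) \<in> D" using young_rowlen[OF assms(1)] by simp
 from young_bound(1)[OF assms(1) this] assms(2) show False by simp
qed

lemma young_Sigma: assumes "young n D" "n \<le> R" shows "D = (SIGMA i:{..<R}. {..<rowlen D i})"
 using young_rowlen[OF assms(1)] young_bound(1)[OF assms(1)] assms(2) by fastforce

lemma sum_rowlen: assumes "young n D" "n \<le> R" shows "(\<Sum>i<R. rowlen D i) = n"
proof -
 have "card D = (\<Sum>i<R. rowlen D i)" by (subst young_Sigma[OF assms]) simp
 thus ?thesis using youngD(2)[OF assms(1)] by simp
qed

lemma sum_bset: assumes "young n D" "n \<le> R" shows "\<Sum>(bset R D) = \<Sum>{..<R} + n"
proof -
 have "\<Sum>(bset R D) = (\<Sum>i<R. beta R D i)" unfolding bset_def by (simp add: sum.reindex beta_inj[OF assms(1)])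
 also have "... = n + (\<Sum>i<R. R - Suc i)" by (simp only: beta_def sum.distrib sum_rowlen[OF assms])
 also have "(\<Sum>i<R. R - Suc i) = \<Sum>{..<R}" by (rule sum.nat_diff_reindex)
 finally show ?thesis by simp
qed

text \<open>Beta-numbers decrease strictly with the row, so the row of a number can be recovered
  from the set; this makes \<open>bset\<close> injective.\<close>

lemma beta_rank: assumes "young n D" "i < R" shows "card {y \<in> bset R D. beta R D i < y} = i"
proof -
 have "{y \<in> bset R D. beta R D i < y} = beta R D ` {..<i}" proof (intro equalityI subsetI)
  fix y assume "y \<in> {y \<in> bset R D. beta R D i < y}"
  then obtain j where j: "j < R" "y = beta R D j" "beta R D i < beta R D j" by (auto simp: bset_def)
  hence "j < i" using beta_less[OF assms(1), of i j R] by (cases i j rule: linorder_cases) auto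
  thus "y \<in> beta R D ` {..<i}" using j by simp
 qed (use beta_less[OF assms(1) _ assms(2)] assms(2) in \<open>auto simp: bset_def\<close>)
 moreover have "inj_on (beta R D) {..<i}" by (rule inj_on_subset[OF beta_inj[OF assms(1)]]) (use assms(2) in auto)
 ultimately show ?thesis by (simp add: card_image)
qed

lemma bset_inj: assumes "young n D" "young m K" "n \<le> R" "m \<le> R" "bset R D = bset R K" shows "D = K"
proof -
 have "rowlen D i = rowlen K i" for i proof (cases "i < R")
  case True hence "beta R D i \<in> bset R K" unfolding assms(5)[symmetric] by (simp add: bset_def)
  then obtain k where k: "k < R" "beta R D i = beta R K k" by (auto simp: bset_def)
  have "i = k" using beta_rank[OF assms(1) True] beta_rank[OF assms(2) k(1)] k(2) assms(5) by simp
  thus ?thesis using k(2) by (simp add: beta_def)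
 next case False
  thus ?thesis using rowlen_0[OF assms(1)] rowlen_0[OF assms(2)] assms(3,4) by simp
 qed
 thus ?thesis using young_Sigma[OF assms(1,3)] young_Sigma[OF assms(2,4)] by simp
qed

lemma beta_movable: assumes D: "young n D" "n \<le> R" and i: "i < R"
 shows "beta R D i \<in> mov (bset R D) \<longleftrightarrow> rowlen D (Suc i) < rowlen D i"
proof
 assume "beta R D i \<in> mov (bset R D)"
 hence m: "beta R D i \<ge> 1" "beta R D i - 1 \<notin> bset R D" by (auto simp: mov_def)
 show "rowlen D (Suc i) < rowlen D i" proof (rule ccontr)
  assume "\<not> ?thesis"
  hence eq: "rowlen D (Suc i) = rowlen D i" using rowlen_antimono[OF D(1), of i "Suc i"] by simp
  show False proof (cases "Suc i < R")
   case True hence "beta R D (Suc i) = beta R D i - 1" using eq by (simp add: beta_def)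
   moreover have "beta R D (Suc i) \<in> bset R D" using True unfolding bset_def by (intro imageI) simp
   ultimately show False using m(2) by simp
  next case False
   hence "rowlen D (Suc i) = 0" using rowlen_0[OF D(1), of "Suc i"] D(2) i by simp
   thus False using m(1) eq False by (simp add: beta_def)
  qed
 qed
next assume l: "rowlen D (Suc i) < rowlen D i"
 have "beta R D i - 1 ~= beta R D j" if "j < R" for j proof (cases "j \<le> i")
  case True hence "beta R D i \<le> beta R D j" using beta_less[OF D(1), of j i R] i by (cases "j = i") auto
  thus ?thesis using l by (simp add: beta_def)
 next case False
  hence "beta R D j \<le> beta R D (Suc i)" using beta_less[OF D(1), of "Suc i" j R] that by (cases "j = Suc i") auto
  moreover have "beta R D (Suc i) < beta R D i - 1" using l False that by (simp add: beta_def)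
  ultimately show ?thesis by simp
 qed
 thus "beta R D i \<in> mov (bset R D)" using l i by (auto simp: mov_def bset_def beta_def)
qed

lemma rowlen_remove: assumes "young n D" "(r, j) \<in> D" shows "rowlen (D - {(r, j)}) i = rowlen D i - of_bool (i = r)"
proof (cases "i = r")
 case True
 have "{k. (r, k) \<in> D - {(r, j)}} = {..<rowlen D r} - {j}" using young_rowlen[OF assms(1)] by auto
 moreover have "j < rowlen D r" using young_rowlen[OF assms(1)] assms(2) by simp
 ultimately have "rowlen (D - {(r, j)}) r = card ({..<rowlen D r} - {j})" unfolding rowlen_def by simp
 also have "... = rowlen D r - 1" using \<open>j < rowlen D r\<close> by simp
 finally show ?thesis using True by simp
next case False
 hence "{k. (i, k) \<in> D - {(r, j)}} = {k. (i, k) \<in> D}" by auto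
 thus ?thesis using False by (simp add: rowlen_def)
qed

lemma pathc_bpath: assumes K: "young m K" "m + p \<le> R"
 shows "young (m + p) D ==> pathc K m p D = bpath (bset R K) p (bset R D)" using K(2)
proof (induction p arbitrary: D)
 case 0 thus ?case using bset_inj[of m D m K R] K by auto
next case (Suc p)
 have D: "young (Suc (m + p)) D" using Suc.prems(1) by simp
 let ?I = "{i. rowlen D (Suc i) < rowlen D i}"
 have I: "?I \<subseteq> {..<R}" proof
  fix i assume i: "i \<in> ?I"
  show "i \<in> {..<R}" using rowlen_0[OF D, of i] i Suc.prems(2) by (cases "i < R") auto
 qed
 have mov: "mov (bset R D) = beta R D ` ?I" proof (intro equalityI subsetI)
  fix x assume x: "x \<in> mov (bset R D)"
  then obtain i where "i < R" "x = beta R D i" by (auto simp: mov_def bset_def)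
  thus "x \<in> beta R D ` ?I" using x beta_movable[OF D, of R i] Suc.prems(2) by auto
 next fix x assume "x \<in> beta R D ` ?I"
  then obtain i where "i \<in> ?I" "x = beta R D i" by blast
  thus "x \<in> mov (bset R D)" using I beta_movable[OF D, of R i] Suc.prems(2) by auto
 qed
 have "pathc K m (Suc p) D = (SUM i:?I. pathc K m p (D - {(i, rowlen D i - 1)}))"
  unfolding pathc.simps(2) corners_rowlen[OF D] by (subst sum.reindex) (auto simp: inj_on_def)
 also have "... = (SUM i:?I. bpath (bset R K) p (mv (bset R D) (beta R D i)))" proof (rule sum.cong[OF refl])
  fix i assume i: "i \<in> ?I"
  let ?D = "D - {(i, rowlen D i - 1)}"
  have "(i, rowlen D i - 1) \<in> corners (m + p) D" unfolding corners_rowlen[OF D] using i by blast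
  note c = cornerD(1,2)[OF D this]
  have iR: "i < R" using i I by auto
  have b: "beta R ?D k = beta R D k - of_bool (k = i)" for k unfolding beta_def rowlen_remove[OF D c(1)] using i by auto
  have "bset R ?D = mv (bset R D) (beta R D i)" proof -
   have "bset R ?D = insert (beta R ?D i) (beta R ?D ` ({..<R} - {i}))"
    unfolding bset_def using iR by (metis image_insert insert_Diff lessThan_iff)
   also have "beta R ?D ` ({..<R} - {i}) = beta R D ` ({..<R} - {i})" by (rule image_cong[OF refl], subst b, simp)
   also have "... = bset R D - {beta R D i}"
    unfolding bset_def using inj_on_image_set_diff[OF beta_inj[OF D], of "{..<R}" "{i}"] iR by auto
   finally show ?thesis unfolding mv_def b by simp
  qed
  moreover have "pathc K m p ?D = bpath (bset R K) p (bset R ?D)" by (rule Suc.IH[OF c(2)]) (use Suc.prems(2) in simp)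
  ultimately show "pathc K m p ?D = bpath (bset R K) p (mv (bset R D) (beta R D i))" by simp
 qed
 also have "... = (SUM x:mov (bset R D). bpath (bset R K) p (mv (bset R D) x))"
  unfolding mov by (rule sum.reindex_cong[symmetric, OF inj_on_subset[OF beta_inj[OF D] I] refl refl])
 finally show ?case by simp
qed

lemma bset_empty: "bset R {} = {..<R}"
proof -
 have "beta R {} i = R - Suc i" for i by (simp add: beta_def rowlen_def)
 moreover have "(%i. R - Suc i) ` {..<R} = {..<R}" proof (intro equalityI subsetI)
  fix x assume "x \<in> {..<R}"
  thus "x \<in> (%i. R - Suc i) ` {..<R}" by (intro image_eqI[of _ _ "R - Suc x"]) auto
 qed auto
 ultimately show ?thesis by (simp add: bset_def)
qed

lemma syt_bpath: "young n D ==> n \<le> R ==> syt n D = bpath {..<R} n (bset R D)"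
 using pathc_bpath[of 0 "{}" n R D] by (simp add: bset_empty)

section \<open>The checkerboard count as an invariant of the 2-core\<close>

definition ediff :: "cells => int" where
 "ediff D = (SUM c:D. (- 1) ^ (fst c + snd c))"

lemma alternating_sum: "2 * (\<Sum>j<l. (- 1 :: int) ^ j) = 1 - (- 1) ^ l" by (induction l) (simp_all)

text \<open>Up to a common sign, row \<open>i\<close> contributes half the difference between the
  sign of its beta-number and that of an empty row in its place. Thus \<open>ediff\<close>
  determines how many beta-numbers are even.\<close>

lemma ediff_bset: assumes "young n D" "n \<le> R"
 shows "(SUM x:bset R D. (- 1 :: int) ^ x) = (\<Sum>x<R. (- 1) ^ x) + 2 * (- 1) ^ R * ediff D"
proof -
 have "ediff D = (\<Sum>i<R. \<Sum>j<rowlen D i. (- 1) ^ (i + j))"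
  unfolding ediff_def by (subst young_Sigma[OF assms]) (simp add: sum.Sigma case_prod_unfold)
 hence "2 * (- 1) ^ R * ediff D = (\<Sum>i<R. (- 1) ^ R * (- 1) ^ i * (2 * (\<Sum>j<rowlen D i. (- 1) ^ j)))"
  by (simp add: sum_distrib_left power_add mult.assoc mult.left_commute)
 also have "... = (\<Sum>i<R. (- 1) ^ (R - Suc i) * (- 1) ^ rowlen D i - (- 1) ^ (R - Suc i))"
 proof (rule sum.cong[OF refl])
  fix i assume "i \<in> {..<R}"
  hence "R + i = Suc (R - Suc i) + 2 * i" by auto
  hence "(- 1 :: int) ^ R * (- 1) ^ i = - ((- 1) ^ (R - Suc i))"
   by (metis (no_types, lifting) power_add power_Suc mult_minus1 power_mult power2_minus one_power2 power_one mult.right_neutral)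
  thus "(- 1) ^ R * (- 1) ^ i * (2 * (\<Sum>j<rowlen D i. (- 1 :: int) ^ j)) = (- 1) ^ (R - Suc i) * (- 1) ^ rowlen D i - (- 1) ^ (R - Suc i)"
   unfolding alternating_sum by (simp add: algebra_simps)
 qed
 also have "... = (\<Sum>i<R. (- 1) ^ beta R D i) - (\<Sum>i<R. (- 1) ^ (R - Suc i))"
  by (simp only: sum_subtractf beta_def power_add mult.commute)
 also have "(\<Sum>i<R. (- 1 :: int) ^ (R - Suc i)) = (\<Sum>x<R. (- 1) ^ x)" by (rule sum.nat_diff_reindex)
 also have "(\<Sum>i<R. (- 1 :: int) ^ beta R D i) = (SUM x:bset R D. (- 1) ^ x)"
  unfolding bset_def by (simp add: sum.reindex beta_inj[OF assms(1)])
 finally show ?thesis by simp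
qed

definition stair :: "nat => cells" where
 "stair j = {(i, c). i + c < j}"

definition evens :: "nat set => nat set" where "evens X = {a. 2 * a \<in> X}"
definition odds :: "nat set => nat set" where "odds X = {a. 2 * a + 1 \<in> X}"

lemma join_evens_odds: "join (evens X) (odds X) = X" by (rule sym, rule join_ext) (simp_all add: evens_def odds_def)

lemma finite_evens_odds: assumes "finite X" shows "finite (evens X)" "finite (odds X)"
proof -
 show "finite (evens X)" unfolding evens_def
  using finite_vimageI[OF assms, of "%a. 2 * a"] by (simp add: vimage_def inj_on_def)
 show "finite (odds X)" unfolding odds_def
  using finite_vimageI[OF assms, of "%a. 2 * a + 1"] by (simp add: vimage_def inj_on_def)
qed

lemma stair_young: "young (\<Sum>{..j}) (stair j)"
proof -
 have S: "stair j = (SIGMA i:{..<j}. {..<j - i})" by (auto simp: stair_def)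
 have "card (stair j) = (\<Sum>i<j. j - i)" unfolding S by simp
 also have "... = \<Sum>{..j}" proof (induction j)
  case (Suc j)
  have "(\<Sum>i<Suc j. Suc j - i) = Suc j + (\<Sum>i<j. j - i)" by (subst sum.lessThan_Suc_shift) simp
  thus ?case using Suc by simp
 qed simp
 finally have c: "card (stair j) = \<Sum>{..j}" .
 have "finite (stair j)" unfolding S by simp
 with c show ?thesis unfolding young_def by (auto simp: stair_def)
qed

lemma stair_rowlen: "rowlen (stair j) i = j - i"
proof -
 have "{c. (i, c) \<in> stair j} = {..<j - i}" by (auto simp: stair_def)
 thus ?thesis by (simp add: rowlen_def)
qed

text \<open>The beta-set of a staircase is closed under subtracting 2, so its even and odd halves
  are initial segments: the 2-quotient is empty.\<close>

lemma stair_bset: assumes "\<Sum>{..j} \<le> R"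
 shows "bset R (stair j) = join {..<card (evens (bset R (stair j)))} {..<card (odds (bset R (stair j)))}"
proof -
 let ?X = "bset R (stair j)"
 have "j \<le> \<Sum>{..j}" by (induction j) auto
 hence jR: "j \<le> R" using assms by simp
 have step: "x - 2 \<in> ?X" if x: "x \<in> ?X" "x \<ge> 2" for x proof -
  obtain i where i: "i < R" "x = (j - i) + (R - Suc i)" using x by (auto simp: bset_def beta_def stair_rowlen)
  consider "Suc i < j" | "Suc i = j" | "i \<ge> j" by linarith
  thus ?thesis proof cases
   case 1 thus ?thesis unfolding bset_def using i jR by (intro image_eqI[of _ _ "Suc i"]) (auto simp: beta_def stair_rowlen)
  next case 2
   thus ?thesis unfolding bset_def using i jR x(2) by (intro image_eqI[of _ _ j]) (auto simp: beta_def stair_rowlen)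
  next case 3
   thus ?thesis unfolding bset_def using i jR x(2) by (intro image_eqI[of _ _ "i + 2"]) (auto simp: beta_def stair_rowlen)
  qed
 qed
 have down: "x - 2 * k \<in> ?X" if "x \<in> ?X" "2 * k \<le> x" for x k using that(2) proof (induction k)
  case (Suc k) thus ?case using step[of "x - 2 * k"] by (simp add: diff_diff_eq add.commute)
 qed (use that in simp)
 note fin = finite_evens_odds[OF finite_bset[of R "stair j"]]
 have "evens ?X = {..<card (evens ?X)}" proof (rule down_closed_nat[OF fin(1)])
  fix a a' assume "a \<in> evens ?X" "a' \<le> a"
  thus "a' \<in> evens ?X" using down[of "2 * a" "a - a'"] by (simp add: evens_def diff_mult_distrib2)
 qed
 moreover have "odds ?X = {..<card (odds ?X)}" proof (rule down_closed_nat[OF fin(2)])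
  fix a a' assume h: "a \<in> odds ?X" "a' \<le> a"
  have "2 * a + 1 - 2 * (a - a') = 2 * a' + 1" using h(2) by simp
  thus "a' \<in> odds ?X" using down[of "2 * a + 1" "a - a'"] h by (simp add: odds_def)
 qed
 ultimately show ?thesis using join_evens_odds[of ?X] by simp
qed

lemma sum_alternating_join:
 assumes "finite X" shows "(SUM x:X. (- 1 :: int) ^ x) = int (card (evens X)) - int (card (odds X))"
 using sum_join[OF finite_evens_odds[OF assms], of "%x. (- 1 :: int) ^ x"] unfolding join_evens_odds by simp

text \<open>Equal \<open>ediff\<close> means equally many even beta-numbers, so \<open>D\<close> and
  the staircase differ only in the 2-quotient, whose size is the weight \<open>w\<close>. The number
  \<open>b\<close> is the \<open>bpath2\<close> of this quotient.\<close>

theorem degree_valuation: assumes D: "young n D" and m: "m = \<Sum>{..j}" "m \<le> n" and ed: "ediff D = ediff (stair j)"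
 shows "\<exists>w. n = m + 2 * w \<and> syt n D > 0 \<and>
   (\<exists>b. b > 0 \<and> v2 (syt n D) + w + v2 (fact w) = v2 (fact n) + v2 b \<and> even (pathc (stair j) m (2 * w) D + b))"
proof -
 let ?X = "bset n D" and ?Z = "bset n (stair j)"
 let ?A = "evens ?X" and ?B = "odds ?X"
 have K: "young m (stair j)" unfolding m(1) by (rule stair_young)
 note fin = finite_evens_odds[OF finite_bset[of n D]]
 note fin0 = finite_evens_odds[OF finite_bset[of n "stair j"]]
 have X: "join ?A ?B = ?X" by (rule join_evens_odds)
 have "card ?A + card ?B = n" "card (evens ?Z) + card (odds ?Z) = n"
  using card_join[OF fin] card_join[OF fin0] card_bset[OF D, of n] card_bset[OF K, of n] by (simp_all add: join_evens_odds)
 moreover have "int (card ?A) - int (card ?B) = int (card (evens ?Z)) - int (card (odds ?Z))"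
  using ediff_bset[OF D order_refl] ediff_bset[OF K m(2)] ed by (simp add: sum_alternating_join)
 ultimately have c: "card (evens ?Z) = card ?A" "card (odds ?Z) = card ?B" by linarith+
 have X0: "?Z = join {..<card ?A} {..<card ?B}" proof -
  have "\<Sum>{..j} \<le> n" using m(2) unfolding m(1) .
  from stair_bset[OF this] show ?thesis unfolding c .
 qed
 have s: "\<Sum>(join A B) = 2 * (\<Sum>A + \<Sum>B) + card B" if "finite A" "finite B" for A B
  using sum_join[OF that, of "%x. x"] by (simp add: sum_Suc sum_distrib_left)
 have sX: "2 * (\<Sum>?A + \<Sum>?B) + card ?B = \<Sum>{..<n} + n"
  using s[OF fin] sum_bset[OF D order_refl] unfolding X by simp
 have sX0: "2 * (\<Sum>{..<card ?A} + \<Sum>{..<card ?B}) + card ?B = \<Sum>{..<n} + m"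
  using s[of "{..<card ?A}" "{..<card ?B}"] sum_bset[OF K m(2)] unfolding X0 by simp
 define w where "w = \<Sum>?A + \<Sum>?B - (\<Sum>{..<card ?A} + \<Sum>{..<card ?B})"
 have w: "\<Sum>?A + \<Sum>?B = \<Sum>{..<card ?A} + \<Sum>{..<card ?B} + w"
  unfolding w_def using sum_nat_set_ge(1)[OF fin(1)] sum_nat_set_ge(1)[OF fin(2)] by simp
 have "2 * a + c = s + n ==> 2 * d + c = s + m ==> a = d + w ==> n = m + 2 * w" for a c d s :: nat by simp
 from this[OF sX sX0 w] have n: "n = m + 2 * w" .
 have card: "card (join ?A ?B) = n" unfolding X by (rule card_bset[OF D])
 have "\<Sum>(join ?A ?B) = \<Sum>{..<card (join ?A ?B)} + n" unfolding card unfolding X by (rule sum_bset[OF D order_refl])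
 note v = v2_bpath[OF fin this w, unfolded X card_bset[OF D]]
 have f: "syt n D = bpath {..<n} n ?X" by (rule syt_bpath[OF D order_refl])
 have "pathc (stair j) m (2 * w) D = bpath ?Z (2 * w) ?X" by (rule pathc_bpath[OF K]) (use n D in auto)
 hence e: "even (pathc (stair j) m (2 * w) D + bpath2 w ?A ?B)" using bpath_parity[OF fin, of w] unfolding X0 X by simp
 show ?thesis proof (rule exI[of _ w], intro conjI)
  show "n = m + 2 * w" by (rule n)
  show "0 < syt n D" unfolding f by (rule v(2))
  show "\<exists>b. b > 0 \<and> v2 (syt n D) + w + v2 (fact w) = v2 (fact n) + v2 b \<and> even (pathc (stair j) m (2 * w) D + b)"
  proof (rule exI[of _ "bpath2 w ?A ?B"], intro conjI)
   show "0 < bpath2 w ?A ?B" by (rule v(3))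
   show "v2 (syt n D) + w + v2 (fact w) = v2 (fact n) + v2 (bpath2 w ?A ?B)" unfolding f by (rule v(1))
  qed (rule e)
 qed
qed

section \<open>Cores and weights of partitions\<close>

lemma partition_of_nth_le: assumes "partition_of la n" "i \<le> i'" "i' < length la" shows "la ! i' \<le> la ! i"
proof (cases "i = i'")
 case False hence "i < i'" using assms by simp
 thus ?thesis using assms sorted_wrt_nth_less[of "(\<ge>)" la i i'] by (auto simp: partition_of_def)
qed simp

lemma diagram_Sigma: "diagram la = (SIGMA i:{..<length la}. {..<la ! i})" by (auto simp: diagram_def)

lemma diagram_young: assumes "partition_of la n" shows "young n (diagram la)" unfolding young_def
proof (intro conjI allI impI)
 show "finite (diagram la)" unfolding diagram_Sigma by simp
 have "card (diagram la) = (\<Sum>i<length la. la ! i)" unfolding diagram_Sigma by simp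
 also have "... = n" using assms by (simp add: partition_of_def sum_list_sum_nth atLeast0LessThan)
 finally show "card (diagram la) = n" .
next fix i j i' j' assume h: "(i, j) \<in> diagram la \<and> i' \<le> i \<and> j' \<le> j"
 hence "i < length la" "j < la ! i" by (auto simp: diagram_def)
 moreover have "la ! i \<le> la ! i'" by (rule partition_of_nth_le[OF assms]) (use h calculation in auto)
 ultimately show "(i', j') \<in> diagram la" using h by (auto simp: diagram_def)
qed

lemma young_diagram: assumes D: "young n D" obtains la where "partition_of la n" "diagram la = D"
proof -
 define l where "l = rowlen D 0"
 define c where "c = card {i. (i, 0) \<in> D}"
 have fin: "finite {i. (i, 0) \<in> D}" by (rule finite_subset[of _ "fst ` D"]) (use youngD(1)[OF D] in force)+
 have c: "(i, 0) \<in> D \<longleftrightarrow> i < c" for i proof -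
  have "{i. (i, 0) \<in> D} = {..<c}" unfolding c_def by (rule down_closed_nat[OF fin]) (use youngD(3)[OF D] in blast)
  thus ?thesis by blast
 qed
 define la where "la = map (rowlen D) [0..<c]"
 have mem: "(i, j) \<in> D \<longleftrightarrow> j < rowlen D i" for i j by (rule young_rowlen[OF D])
 have pos: "0 < rowlen D i \<longleftrightarrow> i < c" for i using mem[of i 0] c by simp
 have dia: "diagram la = D" proof (rule set_eqI, clarify)
  fix i j show "(i, j) \<in> diagram la \<longleftrightarrow> (i, j) \<in> D"
   unfolding mem la_def diagram_def using pos[of i] by auto
 qed
 have "sorted_wrt (\<ge>) la" unfolding la_def sorted_wrt_iff_nth_less using rowlen_antimono[OF D] by simp
 moreover have "0 \<notin> set la" proof
  assume "0 \<in> set la"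
  then obtain i where "i < c" "rowlen D i = 0" unfolding la_def by auto
  thus False using pos[of i] by simp
 qed
 moreover have "card (diagram la) = sum_list la" unfolding diagram_Sigma by (simp add: sum_list_sum_nth atLeast0LessThan)
 ultimately have "partition_of la n" unfolding partition_of_def dia using youngD(2)[OF D] by simp
 with dia that show thesis by blast
qed

lemma staircase_diagram: "diagram (staircase k) = stair k"
proof -
 have "staircase k ! i = k - i" if "i < k" for i using that unfolding staircase_def by (simp add: rev_nth del: upt_Suc)
 thus ?thesis unfolding diagram_def stair_def by (auto simp: staircase_def simp del: upt_Suc)
qed

lemma young_remove: assumes D: "young n D" and E: "E \<subseteq> D"
  "\<And>i j i' j'. (i, j) \<in> E ==> (i', j') \<in> D ==> i \<le> i' ==> j \<le> j' ==> (i', j') \<in> E"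
 shows "young (n - card E) (D - E)" unfolding young_def
proof (intro conjI allI impI)
 show "finite (D - E)" using youngD(1)[OF D] by simp
 show "card (D - E) = n - card E" using card_Diff_subset[of E D] finite_subset[OF E(1)] youngD(1,2)[OF D] E(1) by simp
 fix i j i' j' assume h: "(i, j) \<in> D - E \<and> i' \<le> i \<and> j' \<le> j"
 hence "(i', j') \<in> D" using youngD(3)[OF D] by blast
 thus "(i', j') \<in> D - E" using h E(2) by blast
qed

lemma domino_ediff: "domino E ==> ediff E = 0 \<and> card E = 2 \<and> finite E" unfolding domino_def ediff_def by auto

text \<open>A row that exceeds the next by at least two ends in a removable horizontal domino, and
  equal consecutive nonzero rows lead to a removable vertical one. So the row lengths drop by
  exactly 1 until they reach 0.\<close>

lemma core_stair: assumes D: "young n D" and no: "\<And>E. E \<subseteq> D ==> domino E ==> \<not> young (n - 2) (D - E)"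
 shows "D = stair (rowlen D 0)"
proof -
 note mem = young_rowlen[OF D]
 note anti = rowlen_antimono[OF D]
 have rem: False if "E \<subseteq> D" "domino E"
  "\<And>i j i' j'. (i, j) \<in> E ==> (i', j') \<in> D ==> i \<le> i' ==> j \<le> j' ==> (i', j') \<in> E" for E
  using young_remove[OF D that(1,3)] no[OF that(1,2)] domino_ediff[OF that(2)] by simp
 have le1: "rowlen D i \<le> Suc (rowlen D (Suc i))" for i proof (rule ccontr)
  assume h: "\<not> ?thesis"
  define l where "l = rowlen D i - 2"
  have l: "rowlen D i = Suc (Suc l)" "rowlen D (Suc i) \<le> l" using h unfolding l_def by auto
  have d: "domino {(i, l), (i, Suc l)}" unfolding domino_def by blast
  have s: "{(i, l), (i, Suc l)} \<subseteq> D" using l mem by simp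
  have u: "(i', j') \<in> {(i, l), (i, Suc l)}"
   if "(i0, j0) \<in> {(i, l), (i, Suc l)}" "(i', j') \<in> D" "i0 \<le> i'" "j0 \<le> j'" for i0 j0 i' j' proof -
   have j': "j' < rowlen D i'" "l \<le> j'" "i \<le> i'" using that mem by auto
   have "\<not> Suc i \<le> i'" using anti[of "Suc i" i'] j' l(2) by fastforce
   hence "i' = i" using j' by simp
   thus ?thesis using j' l(1) by auto
  qed
  show False by (rule rem[OF s d u])
 qed
 have lt: "rowlen D (Suc i) < rowlen D i" if "rowlen D i > 0" for i proof (rule ccontr)
  assume h: "\<not> ?thesis"
  define P where "P = {i. rowlen D i > 0 \<and> \<not> rowlen D (Suc i) < rowlen D i}"
  have "P \<subseteq> {..n}"  proof
   fix i assume "i \<in> P"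
   hence "rowlen D i > 0" unfolding P_def by simp
   hence "\<not> n \<le> i" using rowlen_0[OF D, of i] by linarith
   thus "i \<in> {..n}" by simp
  qed
  hence fin: "finite P" by (rule finite_subset) simp
  have "P ~= {}" using h that unfolding P_def by blast
  \<comment> \<open>The last nonzero row that equals its successor: the row after these two is
    shorter, so the vertical domino at their ends can be removed.\<close>
  define i where "i = Max P"
  have "i \<in> P" unfolding i_def by (rule Max_in[OF fin \<open>P ~= {}\<close>])
  have "Suc i \<notin> P" using Max_ge[OF fin, of "Suc i"] unfolding i_def by auto
  define l where "l = rowlen D i - 1"
  have l: "rowlen D i = Suc l" "rowlen D (Suc i) = Suc l" "rowlen D (Suc (Suc i)) \<le> l"
   using \<open>i \<in> P\<close> \<open>Suc i \<notin> P\<close> anti[of i "Suc i"] unfolding l_def P_def by auto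
  have d: "domino {(i, l), (Suc i, l)}" unfolding domino_def by blast
  have s: "{(i, l), (Suc i, l)} \<subseteq> D" using l mem by simp
  have u: "(i', j') \<in> {(i, l), (Suc i, l)}"
   if "(i0, j0) \<in> {(i, l), (Suc i, l)}" "(i', j') \<in> D" "i0 \<le> i'" "j0 \<le> j'" for i0 j0 i' j' proof -
   have j': "j' < rowlen D i'" "l \<le> j'" "i \<le> i'" using that mem by auto
   have "\<not> Suc (Suc i) \<le> i'" using anti[of "Suc (Suc i)" i'] j' l(3) by fastforce
   hence "i' = i \<or> i' = Suc i" using j' by auto
   thus ?thesis using j' l(1,2) by auto
  qed
  show False by (rule rem[OF s d u])
 qed
 have r: "rowlen D i = rowlen D 0 - i" for i proof (induction i)
  case (Suc i) show ?case proof (cases "rowlen D i = 0")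
   case True thus ?thesis using Suc anti[of i "Suc i"] by simp
  next case False thus ?thesis using Suc le1[of i] lt[of i] by simp
  qed
 qed simp
 show ?thesis proof (rule set_eqI, clarify)
  fix i j show "(i, j) \<in> D \<longleftrightarrow> (i, j) \<in> stair (rowlen D 0)"
   unfolding mem stair_def using r[of i] by auto
 qed
qed

lemma ediff_stair: "ediff (stair (Suc j)) = ediff (stair j) + (- 1) ^ j * (1 + int j)"
proof -
 have "stair (Suc j) = stair j \<union> (%i. (i, j - i)) ` {..j}" unfolding stair_def by force
 moreover have "stair j \<inter> (%i. (i, j - i)) ` {..j} = {}" unfolding stair_def by auto
 moreover have "inj_on (%i. (i, j - i)) {..j}" by (auto simp: inj_on_def)
 ultimately have "ediff (stair (Suc j)) = ediff (stair j) + (\<Sum>i\<le>j. (- 1) ^ (i + (j - i)))"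
  unfolding ediff_def using youngD(1)[OF stair_young[of j]] by (simp add: sum.union_disjoint sum.reindex)
 also have "(\<Sum>i\<le>j. (- 1 :: int) ^ (i + (j - i))) = (\<Sum>i\<le>j. (- 1) ^ j)" by (rule sum.cong) auto
 finally show ?thesis by (simp add: algebra_simps)
qed

text \<open>The values are pairwise distinct, positive for odd \<open>j\<close> and not positive for
  even \<open>j\<close>, so \<open>ediff\<close> alone determines the core.\<close>

lemma ediff_stair_closed: "2 * ediff (stair j) = (if even j then - int j else int j + 1)"
proof (induction j)
 case 0 show ?case by (simp add: ediff_def stair_def)
next case (Suc j)
 have "2 * ediff (stair (Suc j)) = 2 * ediff (stair j) + 2 * ((- 1) ^ j * (1 + int j))" by (simp only: ediff_stair distrib_left)
 thus ?case unfolding Suc by (cases "even j") simp_all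
qed

lemma ediff_stair_inj: assumes "ediff (stair i) = ediff (stair j)" shows "i = j"
proof -
 have "(if even i then - int i else int i + 1) = (if even j then - int j else int j + 1)"
  unfolding ediff_stair_closed[symmetric] assms ..
 thus ?thesis by (auto split: if_split_asm)
qed

lemma remove_domino_invariants: assumes "partition_of la n" "remove_domino la \<mu>"
 shows "partition_of \<mu> (sum_list \<mu>)" "n = sum_list \<mu> + 2" "ediff (diagram la) = ediff (diagram \<mu>)"
proof -
 note y = diagram_young[OF assms(1)]
 show p: "partition_of \<mu> (sum_list \<mu>)" using assms(2) by (simp add: remove_domino_def)
 let ?E = "diagram la - diagram \<mu>"
 have E: "diagram \<mu> \<subseteq> diagram la" "domino ?E" using assms(2) by (simp_all add: remove_domino_def)
 note z = diagram_young[OF p]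
 have fin: "finite (diagram la)" by (rule youngD(1)[OF y])
 have "card (diagram la) = card (diagram \<mu>) + card ?E"
  using card_Diff_subset[OF youngD(1)[OF z] E(1)] card_mono[OF fin E(1)] by simp
 thus "n = sum_list \<mu> + 2" using domino_ediff[OF E(2)] youngD(2)[OF y] youngD(2)[OF z] by simp
 have "ediff (diagram la) = ediff (diagram \<mu>) + ediff ?E"
  unfolding ediff_def using sum.subset_diff[OF E(1) fin] by (simp add: add.commute)
 thus "ediff (diagram la) = ediff (diagram \<mu>)" using domino_ediff[OF E(2)] by simp
qed

lemma remove_dominoes_invariants: assumes "partition_of la n" "(remove_domino ^^ w) la \<mu>"
 shows "partition_of \<mu> (sum_list \<mu>) \<and> n = sum_list \<mu> + 2 * w \<and> ediff (diagram la) = ediff (diagram \<mu>)"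
 using assms(2)
proof (induction w arbitrary: \<mu>)
 case 0 thus ?case using assms(1) by (auto simp: partition_of_def)
next case (Suc w)
 then obtain \<nu> where n: "(remove_domino ^^ w) la \<nu>" "remove_domino \<nu> \<mu>" by auto
 note i = Suc.IH[OF n(1)]
 with remove_domino_invariants[OF _ n(2)] show ?case by fastforce
qed

lemma two_core_exists: "partition_of la n ==> \<exists>w \<kappa>. (remove_domino ^^ w) la \<kappa> \<and> is_2core \<kappa>"
proof (induction n arbitrary: la rule: less_induct)
 case (less n) show ?case proof (cases "is_2core la")
  case True thus ?thesis by (intro exI[of _ 0] exI[of _ la]) simp
 next case False
  then obtain \<mu> where m: "remove_domino la \<mu>" by (auto simp: is_2core_def)
  note i = remove_domino_invariants[OF less.prems m]
  obtain w \<kappa> where "(remove_domino ^^ w) \<mu> \<kappa>" "is_2core \<kappa>" using less.IH[OF _ i(1)] i(2) by auto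
  with m have "(remove_domino ^^ Suc w) la \<kappa>" by (meson relpowp_Suc_I2)
  with \<open>is_2core \<kappa>\<close> show ?thesis by blast
 qed
qed

lemma is_2core_stair: assumes p: "partition_of \<kappa> m" and c: "is_2core \<kappa>"
 obtains j where "diagram \<kappa> = stair j" "m = \<Sum>{..j}" proof -
 note y = diagram_young[OF p]
 have "diagram \<kappa> = stair (rowlen (diagram \<kappa>) 0)" proof (rule core_stair[OF y])
  fix E assume E: "E \<subseteq> diagram \<kappa>" "domino E"
  show "\<not> young (m - 2) (diagram \<kappa> - E)" proof
   assume "young (m - 2) (diagram \<kappa> - E)"
   then obtain \<mu> where mu: "partition_of \<mu> (m - 2)" "diagram \<mu> = diagram \<kappa> - E" by (rule young_diagram)
   have "remove_domino \<kappa> \<mu>" unfolding remove_domino_def mu(2)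
    using mu(1) E double_diff[OF E(1) order_refl] by (auto simp: partition_of_def)
   thus False using c by (auto simp: is_2core_def)
  qed
 qed
 then obtain j where j: "diagram \<kappa> = stair j" by blast
 hence "m = \<Sum>{..j}" using youngD(2)[OF y] youngD(2)[OF stair_young[of j]] by simp
 with j that show thesis by blast
qed

text \<open>Removing a domino does not change \<open>ediff\<close>, which determines the staircase
  reached at the end. Hence the number of dominoes removed does not depend on the choices, and
  \<open>weight2\<close> is well defined.\<close>

lemma weight2_core: assumes p: "partition_of la n"
 obtains j where "n = \<Sum>{..j} + 2 * weight2 la" "ediff (diagram la) = ediff (stair j)" proof -
 have *: "\<exists>j. n = \<Sum>{..j} + 2 * w \<and> ediff (diagram la) = ediff (stair j)"
  if r: "(remove_domino ^^ w) la \<kappa>" and c: "is_2core \<kappa>" for w \<kappa> proof -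
  note i = remove_dominoes_invariants[OF p r]
  obtain j where "diagram \<kappa> = stair j" "sum_list \<kappa> = \<Sum>{..j}" by (rule is_2core_stair[OF conjunct1[OF i] c])
  with i show ?thesis by auto
 qed
 obtain w \<kappa> where w: "(remove_domino ^^ w) la \<kappa>" "is_2core \<kappa>" using two_core_exists[OF p] by blast
 obtain j where j: "n = \<Sum>{..j} + 2 * w" "ediff (diagram la) = ediff (stair j)" using *[OF w] by blast
 have "weight2 la = w" unfolding weight2_def proof (rule the_equality)
  show "\<exists>\<kappa>. (remove_domino ^^ w) la \<kappa> \<and> is_2core \<kappa>" using w by blast
  fix w' assume "\<exists>\<kappa>. (remove_domino ^^ w') la \<kappa> \<and> is_2core \<kappa>"
  then obtain j' where "n = \<Sum>{..j'} + 2 * w'" "ediff (diagram la) = ediff (stair j')" using * by blast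
  thus "w' = w" using ediff_stair_inj[of j' j] j(1) unfolding j(2) by auto
 qed
 with j that show thesis by simp
qed

text \<open>Either alternative makes the number \<open>b\<close> of \<open>degree_valuation\<close>
  odd: height 0 by Legendre's formula for the defect, odd degree because \<open>fact (2 * w)\<close>
  divides \<open>fact n\<close>.\<close>

theorem height_zero_odd_paths: assumes p: "partition_of la n"
  and h: "v2 (syt n (diagram la)) = n - binary_digit_sum n - defect2 la \<or> odd (syt n (diagram la))"
 obtains j w where "n = \<Sum>{..j} + 2 * w" "ediff (diagram la) = ediff (stair j)"
  "odd (pathc (stair j) (\<Sum>{..j}) (2 * w) (diagram la))" proof -
 let ?D = "diagram la" and ?w = "weight2 la"
 obtain j where j: "n = \<Sum>{..j} + 2 * ?w" "ediff ?D = ediff (stair j)" by (rule weight2_core[OF p])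
 obtain w b where b: "n = \<Sum>{..j} + 2 * w" "syt n ?D > 0" "b > 0"
  "v2 (syt n ?D) + w + v2 (fact w) = v2 (fact n) + v2 b" "even (pathc (stair j) (\<Sum>{..j}) (2 * w) ?D + b)"
  using degree_valuation[OF diagram_young[OF p] refl _ j(2)] j(1) by auto
 have w: "?w = w" using b(1) j(1) by simp
 have "v2 (fact (2 * w)) \<le> v2 (fact n)" by (rule dvd_imp_multiplicity_le[OF fact_dvd]) (use b(1) in auto)
 hence "w + v2 (fact w) \<le> v2 (fact n)" by (simp only: v2_fact_double)
 hence "v2 b = 0" using b(2,4) h v2_odd[of "syt n ?D"] legendre_2[of n] legendre_2[of w] unfolding defect2_def w by auto
 hence "odd b" using v2_eq_0_iff[of b] b(3) by simp
 with b(5) have "odd (pathc (stair j) (\<Sum>{..j}) (2 * w) ?D)" by simp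
 with b(1) j(2) that show thesis by blast
qed

text \<open>The case of weight 0: the only path is the empty one, so \<open>b\<close> is odd and the
  degree contains the full power of 2 in \<open>fact n\<close>.\<close>

lemma stair_degree_unit: assumes "n = \<Sum>{..j}"
 shows "zint (fact n / of_nat (syt n (stair j)))" "\<not> zev (fact n / of_nat (syt n (stair j)))"
proof -
 have D: "young n (stair j)" unfolding assms by (rule stair_young)
 obtain w b where b: "n = n + 2 * w" "syt n (stair j) > 0" "b > 0"
  "v2 (syt n (stair j)) + w + v2 (fact w) = v2 (fact n) + v2 b" "even (pathc (stair j) n (2 * w) (stair j) + b)"
  using degree_valuation[OF D assms order_refl refl] by blast
 have w: "w = 0" using b(1) by simp
 have "odd b" using b(5) w by simp
 hence v: "v2 (syt n (stair j)) = v2 (fact n)" using b(4) w v2_odd by simp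
 have dec: "\<exists>a. x = 2 ^ v2 x * a \<and> odd a" if "x > 0" for x
  using multiplicity_decompose'[of x 2] that by (metis less_numeral_extra(3) odd_one)
 obtain a where a: "(fact n :: nat) = 2 ^ v2 (fact n) * a" "odd a" using dec[OF fact_gt_zero] by blast
 obtain c where c: "syt n (stair j) = 2 ^ v2 (syt n (stair j)) * c" "odd c" using dec[OF b(2)] by blast
 have "c ~= 0" using c(2) by (metis even_zero)
 have e: "(fact n :: rat) / of_nat (syt n (stair j)) = of_nat a * (1 / of_nat c)" proof -
  have "(fact n :: rat) = of_nat (fact n)" by simp
  also have "... = 2 ^ v2 (fact n) * of_nat a" by (subst a(1)) simp
  finally have 1: "(fact n :: rat) = 2 ^ v2 (fact n) * of_nat a" .
  have "(of_nat (syt n (stair j)) :: rat) = 2 ^ v2 (fact n) * of_nat c" by (subst c(1)) (simp add: v)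
  with 1 show ?thesis by simp
 qed
 have "\<not> zev (of_nat c)" using c(2) by simp
 note ci = zint_inverse[OF _ this]
 show "zint (fact n / of_nat (syt n (stair j)))" unfolding e using ci by (intro zint_mult) simp_all
 have zc: "zint (of_nat c)" by simp
 have "\<not> zev (of_nat a)" using a(2) by simp
 thus "\<not> zev (fact n / of_nat (syt n (stair j)))" unfolding e
  using zev_mult_iff[of "of_nat a" "1 / of_nat c"] ci[OF zc] by simp
qed

section \<open>Shuffle products\<close>

definition lo :: "nat => word => nat => nat" where
 "lo n a = (%x. if x \<le> n then a x else 0)"

text \<open>Positions count from 1 and words vanish at 0; without the case distinction, position 0
  would pick up the letter at \<open>n\<close>.\<close>

definition hi :: "nat => word => nat => nat" where
 "hi n a = (%x. if x = 0 then 0 else a (n + x))"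

definition wms :: "nat => word => nat multiset" where
 "wms n c = image_mset c (mset_set {1..n})"

lemma wms_split: "wms n (lo n c) + wms i (hi n c) = wms (n + i) c"
proof -
 have "image_mset (lo n c) (mset_set {1..n}) = image_mset c (mset_set {1..n})" by (rule image_mset_cong) (simp add: lo_def)
 moreover have "image_mset (hi n c) (mset_set {1..i}) = image_mset c (mset_set {Suc n..n + i})" proof -
  have im: "{Suc n..n + i} = (%x. n + x) ` {1..i}" by (simp add: image_add_atLeastAtMost)
  have "mset_set {Suc n..n + i} = image_mset (%x. n + x) (mset_set {1..i})"
   unfolding im by (rule image_mset_mset_set[symmetric]) simp
  moreover have "image_mset (hi n c) (mset_set {1..i}) = image_mset (%x. c (n + x)) (mset_set {1..i})"
   by (rule image_mset_cong) (simp add: hi_def)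
  ultimately show ?thesis by (simp add: image_mset.compositionality comp_def)
 qed
 moreover have "mset_set {1..n + i} = mset_set {1..n} + mset_set {Suc n..n + i}"
  by (subst mset_set_Union[symmetric]) (auto intro: arg_cong[where f = mset_set])
 ultimately show ?thesis unfolding wms_def by simp
qed

lemma wms_comp: assumes "g \<in> symg n" shows "wms n (c o g) = wms n c"
proof -
 have "image_mset g (mset_set {1..n}) = mset_set (g ` {1..n})"
  by (rule image_mset_mset_set[OF permutes_inj_on[OF symD(1)[OF assms]]])
 also have "g ` {1..n} = {1..n}" by (rule permutes_image[OF symD(1)[OF assms]])
 finally show ?thesis unfolding wms_def by (metis multiset.map_comp)
qed

lemma wms_eq_perm:
 assumes "wms n c = wms n c'" "\<And>x. x \<notin> {1..n} ==> c x = 0" "\<And>x. x \<notin> {1..n} ==> c' x = 0"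
 obtains g where "g \<in> symg n" "c = c' o g" proof -
 obtain g where g: "g permutes {1..n}" "\<forall>x\<in>{1..n}. c x = c' (g x)"
  using image_mset_eq_implies_permutes[of "{1..n}" c c'] assms(1) unfolding wms_def by auto
 have "c = c' o g" proof
  fix x show "c x = (c' o g) x" using g(2) assms(2,3)[of x] permutes_not_in[OF g(1), of x] by (cases "x \<in> {1..n}") auto
 qed
 with g that show thesis by (auto simp: symg_def)
qed

text \<open>The coefficients with the largest multiset of letters cannot cancel.\<close>

lemma shuffle_nonzero: fixes F E :: wfun
 assumes F: "\<And>g c. g \<in> symg n ==> F (c o g) = F c" "\<And>c x. F c ~= 0 ==> x \<notin> {1..n} ==> c x = 0"
   "finite {c. F c ~= 0}" "F d ~= 0"
  and E: "\<And>g c. g \<in> symg i ==> E (c o g) = E c" "\<And>c x. E c ~= 0 ==> x \<notin> {1..i} ==> c x = 0"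
   "finite {c. E c ~= 0}" "E d' ~= 0"
 shows "\<exists>c. (SUM g:symg (n + i). F (lo n (c o g)) * E (hi n (c o g))) ~= 0"
proof -
 have mx: "\<exists>c. F c ~= 0 \<and> (\<forall>c'. F c' ~= 0 --> wms n c' \<le> wms n c)"
  if F: "finite {c. F c ~= 0}" "F d ~= 0" for F :: wfun and n d proof -
  let ?S = "wms n ` {c. F c ~= 0}"
  have fS: "finite ?S" "?S ~= {}" using F by auto
  hence "Max ?S \<in> ?S" by (rule Max_in)
  then obtain c where "F c ~= 0" "wms n c = Max ?S" by force
  thus ?thesis using Max_ge[OF fS(1)] by (intro exI[of _ c]) simp
 qed
 obtain c1 where c1: "F c1 ~= 0" "\<And>c'. F c' ~= 0 ==> wms n c' \<le> wms n c1" using mx[OF F(3,4)] by blast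
 obtain c2 where c2: "E c2 ~= 0" "\<And>c'. E c' ~= 0 ==> wms i c' \<le> wms i c2" using mx[OF E(3,4)] by blast
 define c where "c = (%x. if x \<le> n then c1 x else c2 (x - n))"
 have lo: "lo n c = c1" using F(2)[OF c1(1)] by (auto simp: lo_def c_def fun_eq_iff)
 have hi: "hi n c = c2" using E(2)[OF c2(1), of 0] by (auto simp: hi_def c_def fun_eq_iff)
 let ?t = "%g. F (lo n (c o g)) * E (hi n (c o g))"
 \<comment> \<open>The two multisets of a term add up to the multiset of \<open>c\<close>, and
   neither exceeds its maximum. So in a nonzero term both are maximal, and invariance gives the
   value \<open>F c1 * E c2\<close>.\<close>
 have t: "?t g = of_bool (?t g ~= 0) * (F c1 * E c2)" if g: "g \<in> symg (n + i)" for g proof (cases "?t g = 0")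
  case False
  let ?x = "lo n (c o g)" and ?y = "hi n (c o g)"
  have nz: "F ?x ~= 0" "E ?y ~= 0" using False by auto
  have s: "wms n ?x + wms i ?y = wms n c1 + wms i c2"
   using wms_split[of n "c o g" i] wms_split[of n c i] wms_comp[OF g, of c] by (simp add: lo hi)
  have le: "wms n ?x \<le> wms n c1" "wms i ?y \<le> wms i c2" using nz c1(2) c2(2) by blast+
  have e1: "wms n ?x = wms n c1" proof (rule ccontr)
   assume "\<not> ?thesis"
   hence "wms n ?x < wms n c1" using le(1) by (simp add: order_less_le)
   from add_less_le_mono[OF this le(2)] s show False by simp
  qed
  hence e2: "wms i ?y = wms i c2" using s by simp
  obtain g1 where g1: "g1 \<in> symg n" "?x = c1 o g1" by (rule wms_eq_perm[OF e1 F(2)[OF nz(1)] F(2)[OF c1(1)]])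
  obtain g2 where g2: "g2 \<in> symg i" "?y = c2 o g2" by (rule wms_eq_perm[OF e2 E(2)[OF nz(2)] E(2)[OF c2(1)]])
  have "?t g = F c1 * E c2" unfolding g1(2) g2(2) F(1)[OF g1(1)] E(1)[OF g2(1)] ..
  thus ?thesis using False by simp
 qed simp
 have "(SUM g:symg (n + i). ?t g) = (SUM g:symg (n + i). of_bool (?t g ~= 0)) * (F c1 * E c2)"
  unfolding sum_distrib_right by (rule sum.cong[OF refl]) (rule t)
 also have "(SUM g:symg (n + i). of_bool (?t g ~= 0)) = (of_nat (card {g \<in> symg (n + i). ?t g ~= 0}) :: rat)"
  by (simp add: of_bool_def sum.If_cases Int_def)
 also have "... * (F c1 * E c2) ~= 0" proof -
  have "id \<in> {g \<in> symg (n + i). ?t g ~= 0}" using c1(1) c2(1) by (simp add: lo hi)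
  moreover have "finite {g \<in> symg (n + i). ?t g ~= 0}" by simp
  ultimately have "card {g \<in> symg (n + i). ?t g ~= 0} ~= 0" using card_0_eq by blast
  thus ?thesis using c1(1) c2(1) by simp
 qed
 finally show ?thesis by blast
qed

section \<open>Invariants of triple tensor products and their shuffle product\<close>

definition inv3 :: "nat => cells => cells => cells =>
  (word => word => wfun) => bool" where
 "inv3 n A B C F \<longleftrightarrow> (\<forall>y z. (%x. F x y z) \<in> specht n A) \<and> (\<forall>x z. (%y. F x y z) \<in> specht n B) \<and>
   (\<forall>x y. (%z. F x y z) \<in> specht n C) \<and> (\<forall>g\<in>symg n. \<forall>x y z. F (x o g) (y o g) (z o g) = F x y z)"

lemma inv3D: assumes "inv3 n A B C F"
 shows "(%x. F x y z) \<in> specht n A" "(%y. F x y z) \<in> specht n B" "(%z. F x y z) \<in> specht n C"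
  "g \<in> symg n ==> F (x o g) (y o g) (z o g) = F x y z" using assms unfolding inv3_def by blast+

lemma inv3_supp: assumes F: "inv3 n A B C F" and nz: "F x y z ~= 0"
 shows "x \<in> wd n A" "y \<in> wd n B" "z \<in> wd n C"
proof -
 show "x \<in> wd n A" using specht_supp[OF inv3D(1)[OF F, of y z], of x] nz by blast
 show "y \<in> wd n B" using specht_supp[OF inv3D(2)[OF F, of x z], of y] nz by blast
 show "z \<in> wd n C" using specht_supp[OF inv3D(3)[OF F, of x y], of z] nz by blast
qed

text \<open>Three letters are coded as one, so that a triple of words becomes a single word and
  \<open>shuffle_nonzero\<close> applies. The code 0 stands for three zeros, which keeps words 0
  outside their positions.\<close>

definition dc :: "nat => nat \<times> nat \<times> nat" where
 "dc c = (fst (prod_decode c), prod_decode (snd (prod_decode c)))"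

definition ec :: "nat \<times> nat \<times> nat => nat" where
 "ec t = prod_encode (fst t, prod_encode (snd t))"

lemma dc_ec [simp]: "dc (ec t) = t" "ec (dc c) = c" "dc 0 = (0, 0, 0)"
proof -
 show "dc (ec t) = t" "ec (dc c) = c" by (simp_all add: dc_def ec_def)
 have "prod_decode 0 = (0, 0)" by (simp add: prod_decode_def prod_decode_aux.simps)
 thus "dc 0 = (0, 0, 0)" by (simp add: dc_def)
qed

definition wfst :: "word => nat => nat" where "wfst c = (%i. fst (dc (c i)))"
definition wsnd :: "word => nat => nat" where "wsnd c = (%i. fst (snd (dc (c i))))"
definition wthd :: "word => nat => nat" where "wthd c = (%i. snd (snd (dc (c i))))"
definition wenc :: "word => word => word => nat => nat" where
 "wenc u v w = (%i. ec (u i, v i, w i))"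

lemma wenc_simps [simp]: "wfst (wenc u v w) = u" "wsnd (wenc u v w) = v" "wthd (wenc u v w) = w"
 "wenc (wfst c) (wsnd c) (wthd c) = c" by (simp_all add: wfst_def wsnd_def wthd_def wenc_def)

lemma wfst_simps [simp]: "wfst (c o g) = wfst c o g" "wsnd (c o g) = wsnd c o g" "wthd (c o g) = wthd c o g"
 "wfst (lo n c) = lo n (wfst c)" "wsnd (lo n c) = lo n (wsnd c)" "wthd (lo n c) = lo n (wthd c)"
 "wfst (hi n c) = hi n (wfst c)" "wsnd (hi n c) = hi n (wsnd c)" "wthd (hi n c) = hi n (wthd c)"
 by (auto simp: wfst_def wsnd_def wthd_def lo_def hi_def fun_eq_iff)

definition coded :: "(word => word => wfun) => wfun" where
 "coded F c = F (wfst c) (wsnd c) (wthd c)"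

lemma coded_inv: assumes "inv3 n A B C F" "g \<in> symg n" shows "coded F (c o g) = coded F c"
 using inv3D(4)[OF assms] unfolding coded_def wfst_simps .

lemma coded_supp: assumes "inv3 n A B C F" "coded F c ~= 0"
 shows "wfst c \<in> wd n A" "wsnd c \<in> wd n B" "wthd c \<in> wd n C"
 by (rule inv3_supp[OF assms(1), OF assms(2)[unfolded coded_def]])+

lemma coded_out: assumes F: "inv3 n A B C F" "coded F c ~= 0" and x: "x \<notin> {1..n}" shows "c x = 0"
proof -
 note s = coded_supp[OF F]
 have "wfst c x = 0" "wsnd c x = 0" "wthd c x = 0" by (rule wd_out[OF _ x], rule s)+
 hence "dc (c x) = dc 0" by (simp add: prod_eq_iff wfst_def wsnd_def wthd_def)
 thus ?thesis by (metis dc_ec(2))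
qed

lemma coded_finite: assumes F: "inv3 n A B C F" and D: "finite A" "finite B" "finite C"
 shows "finite {c. coded F c ~= 0}"
proof -
 have "{c. coded F c ~= 0} \<subseteq> (%(u, v, w). wenc u v w) ` (wd n A \<times> wd n B \<times> wd n C)" proof
  fix c assume "c \<in> {c. coded F c ~= 0}"
  hence "coded F c ~= 0" by simp
  note s = coded_supp[OF F this]
  show "c \<in> (%(u, v, w). wenc u v w) ` (wd n A \<times> wd n B \<times> wd n C)"
   by (rule image_eqI[of _ _ "(wfst c, wsnd c, wthd c)"]) (use s in simp_all)
 qed
 thus ?thesis by (rule finite_subset) (intro finite_imageI finite_cartesian_product finite_wd D)
qed

definition nzinv :: "nat => cells => cells => cells => bool" where
 "nzinv n A B C \<longleftrightarrow> (\<exists>F x y z. inv3 n A B C F \<and> F x y z ~= 0)"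

text \<open>The product of two invariants on disjoint sets of positions, symmetrized over the whole
  group.\<close>

definition shuf ::
 "nat => nat => (word => word => wfun) =>
  (word => word => wfun) =>
  word => word => wfun" where
 "shuf n i F E x y z = (SUM g:symg (n + i). F (lo n (x o g)) (lo n (y o g)) (lo n (z o g)) *
   E (hi n (x o g)) (hi n (y o g)) (hi n (z o g)))"

lemma shuf_nonzero: assumes F: "inv3 n A B C F" "finite A" "finite B" "finite C" "F u v w ~= 0"
  and E: "inv3 i A' B' C' E" "finite A'" "finite B'" "finite C'" "E u' v' w' ~= 0"
 shows "\<exists>x y z. shuf n i F E x y z ~= 0"
proof -
 have nz: "coded F (wenc u v w) ~= 0" "coded E (wenc u' v' w') ~= 0" using F(5) E(5) by (simp_all add: coded_def)
 have "\<exists>c. (SUM g:symg (n + i). coded F (lo n (c o g)) * coded E (hi n (c o g))) ~= 0"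
 proof (rule shuffle_nonzero[of n "coded F" "wenc u v w" i "coded E" "wenc u' v' w'"])
  show "finite {c. coded F c ~= 0}" "finite {c. coded E c ~= 0}" by (fact coded_finite[OF F(1-4)] coded_finite[OF E(1-4)])+
 qed (use nz coded_inv[OF F(1)] coded_inv[OF E(1)] coded_out[OF F(1)] coded_out[OF E(1)] in auto)
 then obtain c where c: "(SUM g:symg (n + i). coded F (lo n (c o g)) * coded E (hi n (c o g))) ~= 0" by blast
 have "shuf n i F E (wfst c) (wsnd c) (wthd c) ~= 0" using c unfolding shuf_def coded_def wfst_simps .
 thus ?thesis by blast
qed

lemma inv3_shuf: assumes Y: "young (n + i) A" "young (n + i) B" "young (n + i) C"
  and F: "\<And>y z y' z'. (%x. F (lo n x) y z * E (hi n x) y' z') \<in> specht (n + i) A"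
   "\<And>x z x' z'. (%y. F x (lo n y) z * E x' (hi n y) z') \<in> specht (n + i) B"
   "\<And>x y x' y'. (%z. F x y (lo n z) * E x' y' (hi n z)) \<in> specht (n + i) C"
 shows "inv3 (n + i) A B C (shuf n i F E)" unfolding inv3_def
proof (intro conjI allI ballI)
 fix y z
 have "ga g (%x. F (lo n x) (lo n (y o g)) (lo n (z o g)) * E (hi n x) (hi n (y o g)) (hi n (z o g))) \<in> specht (n + i) A"
  if "g \<in> symg (n + i)" for g by (rule ga_specht[OF Y(1) that F(1)])
 from lsp_sum'[OF lsp_specht this] show "(%x. shuf n i F E x y z) \<in> specht (n + i) A" unfolding shuf_def ga_def .
next fix x z
 have "ga g (%y. F (lo n (x o g)) (lo n y) (lo n (z o g)) * E (hi n (x o g)) (hi n y) (hi n (z o g))) \<in> specht (n + i) B"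
  if "g \<in> symg (n + i)" for g by (rule ga_specht[OF Y(2) that F(2)])
 from lsp_sum'[OF lsp_specht this] show "(%y. shuf n i F E x y z) \<in> specht (n + i) B" unfolding shuf_def ga_def .
next fix x y
 have "ga g (%z. F (lo n (x o g)) (lo n (y o g)) (lo n z) * E (hi n (x o g)) (hi n (y o g)) (hi n z)) \<in> specht (n + i) C"
  if "g \<in> symg (n + i)" for g by (rule ga_specht[OF Y(3) that F(3)])
 from lsp_sum'[OF lsp_specht this] show "(%z. shuf n i F E x y z) \<in> specht (n + i) C" unfolding shuf_def ga_def .
next fix h x y z assume h: "h \<in> symg (n + i)"
 show "shuf n i F E (x o h) (y o h) (z o h) = shuf n i F E x y z" unfolding shuf_def comp_assoc
  by (rule sum_sym_left[OF h, of "%g. F (lo n (x o g)) (lo n (y o g)) (lo n (z o g)) *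
   E (hi n (x o g)) (hi n (y o g)) (hi n (z o g))"])
qed

section \<open>Adding columns and lengthening the first row\<close>

definition col :: "nat => cells" where
 "col i = {..<i} \<times> {0}"

definition coltab :: "nat => nat \<times> nat" where
 "coltab x = (x - 1, 0)"

definition cadd :: "nat => cells => cells" where
 "cadd i A = col i \<union> (%c. (fst c, Suc (snd c))) ` A"

lemma young_col: "young i (col i)" unfolding young_def col_def by auto

lemma tab_col: "tab i (col i) coltab" unfolding tab_def coltab_def col_def
proof (rule bij_betwI[of _ _ _ "%c. Suc (fst c)"])
qed auto

lemma rowlen_cadd: assumes "finite A" shows "rowlen (cadd i A) r = rowlen A r + of_bool (r < i)"
proof -
 have fin: "finite {j. (r, j) \<in> A}" by (rule finite_subset[of _ "snd ` A"]) (use assms in force)+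
 have "{j. (r, j) \<in> cadd i A} = (if r < i then {0} else {}) \<union> Suc ` {j. (r, j) \<in> A}"
  unfolding cadd_def col_def by force
 moreover have "card (Suc ` {j. (r, j) \<in> A}) = rowlen A r" unfolding rowlen_def by (rule card_image) simp
 moreover have "(if r < i then {0} else {}) \<inter> Suc ` {j. (r, j) \<in> A} = {}" by auto
 ultimately show ?thesis unfolding rowlen_def[of "cadd i A"] using fin by (simp add: card_Un_disjoint)
qed

lemma young_cadd: assumes A: "young n A" "fst ` A \<subseteq> {..<i}" shows "young (n + i) (cadd i A)" unfolding young_def
proof (intro conjI allI impI)
 note fin = youngD(1)[OF A(1)]
 show "finite (cadd i A)" unfolding cadd_def col_def using fin by simp
 have "card ((%c. (fst c, Suc (snd c))) ` A) = n"
  using card_image[of "%c. (fst c, Suc (snd c))" A] youngD(2)[OF A(1)] by (auto simp: inj_on_def prod_eq_iff)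
 moreover have "col i \<inter> (%c. (fst c, Suc (snd c))) ` A = {}" unfolding col_def by auto
 ultimately show "card (cadd i A) = n + i" unfolding cadd_def using fin youngD(1,2)[OF young_col[of i]]
  by (simp add: card_Un_disjoint)
 fix r j r' j' assume h: "(r, j) \<in> cadd i A \<and> r' \<le> r \<and> j' \<le> j"
 hence r: "r < i" using A(2) unfolding cadd_def col_def by force
 show "(r', j') \<in> cadd i A" proof (cases j')
  case 0 thus ?thesis using h r unfolding cadd_def col_def by auto
 next case (Suc l)
  then obtain k where k: "j = Suc k" "(r, k) \<in> A" "l \<le> k" using h unfolding cadd_def col_def by auto
  hence "(r', l) \<in> A" using youngD(3)[OF A(1) k(2), of r' l] h by blast
  thus ?thesis unfolding cadd_def Suc by force
 qed
qed

text \<open>In \<open>p'\<close> the tableau \<open>p\<close> is shifted to the right and the last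
  \<open>i\<close> entries fill the new first column. The product alternates along the columns of
  \<open>p'\<close>, and the contents add up row by row, so \<open>pt_unique\<close> identifies
  it.\<close>

lemma pt_cadd: assumes A: "young n A" "fst ` A \<subseteq> {..<i}" and p: "tab n A p"
 defines "p' \<equiv> %x. if x \<le> n then (fst (p x), Suc (snd (p x))) else coltab (x - n)"
 shows "tab (n + i) (cadd i A) p'"
  "(%a. pt n p (lo n a) * pt i coltab (hi n a)) = pt (n + i) p'" (is "?f = _") proof -
 note fin = youngD(1)[OF A(1)]
 have inj: "inj_on p' {1..n + i}" proof (rule inj_onI)
  fix x y assume h: "x \<in> {1..n + i}" "y \<in> {1..n + i}" "p' x = p' y"
  show "x = y" using h tabD(2)[OF p, of x y] by (auto simp: p'_def coltab_def prod_eq_iff split: if_split_asm)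
 qed
 have sub: "p' ` {1..n + i} \<subseteq> cadd i A" proof
  fix c assume "c \<in> p' ` {1..n + i}"
  then obtain x where x: "x \<in> {1..n + i}" "c = p' x" by blast
  show "c \<in> cadd i A" proof (cases "x \<le> n")
   case True thus ?thesis using x tabD(1)[OF p, of x] unfolding cadd_def p'_def by auto
  next case False
   thus ?thesis using x unfolding cadd_def p'_def coltab_def col_def by auto
  qed
 qed
 note yc = young_cadd[OF A]
 have "p' ` {1..n + i} = cadd i A"
  by (rule card_subset_eq[OF youngD(1)[OF yc] sub]) (unfold card_image[OF inj] youngD(2)[OF yc], simp)
 thus t: "tab (n + i) (cadd i A) p'" unfolding tab_def using inj by (simp add: bij_betw_def)
 have calt: "calt (n + i) p' ?f" unfolding calt_def proof (intro allI impI)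
  fix x y a assume sc: "samecol (n + i) p' x y"
  show "?f (a o transpose x y) = - ?f a" proof (cases "x \<le> n")
   case True hence y: "y \<le> n" and s: "samecol n p x y" using sc
    by (auto simp: samecol_def p'_def coltab_def split: if_split_asm)
   have "lo n (a o transpose x y) = lo n a o transpose x y" "hi n (a o transpose x y) = hi n a"
    using True y by (auto simp: lo_def hi_def fun_eq_iff transpose_def)
   thus ?thesis using pt_calt[of n p] s unfolding calt_def by simp
  next case False
   hence y: "y > n" and s: "samecol i coltab (x - n) (y - n)" using sc
    by (auto simp: samecol_def p'_def coltab_def split: if_split_asm)
   have "lo n (a o transpose x y) = lo n a" "hi n (a o transpose x y) = hi n a o transpose (x - n) (y - n)"
    using False y by (auto simp: lo_def hi_def fun_eq_iff transpose_def)
   thus ?thesis using pt_calt[of i coltab] s unfolding calt_def by simp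
  qed
 qed
 have supp: "?f a = 0" if "a \<notin> wd (n + i) (cadd i A)" for a proof (rule ccontr)
  assume "?f a ~= 0"
  hence w: "lo n a \<in> wd n A" "hi n a \<in> wd i (col i)" using pt_supp[OF p] pt_supp[OF tab_col] by force+
  have "a \<in> wd (n + i) (cadd i A)" unfolding wd_def mem_Collect_eq proof (intro conjI allI impI)
   fix x assume x: "x \<notin> {1..n + i}"
   show "a x = 0" proof (cases "x = 0")
    case True thus ?thesis using wd_out[OF w(1), of 0] by (simp add: lo_def)
   next case False
    hence "x - n \<notin> {1..i}" "x - n ~= 0" "n + (x - n) = x" "\<not> x \<le> n" using x by auto
    thus ?thesis using wd_out[OF w(2), of "x - n"] by (simp add: hi_def)
   qed
  next fix r
   have "{x \<in> {1..n + i}. a x = r} = {x \<in> {1..n}. lo n a x = r} \<union> (%x. n + x) ` {x \<in> {1..i}. hi n a x = r}"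
   proof (rule set_eqI)
    fix x
    have "x \<in> (%x. n + x) ` {x \<in> {1..i}. hi n a x = r} \<longleftrightarrow> n < x \<and> x \<le> n + i \<and> a x = r"
    proof
     assume h: "n < x \<and> x \<le> n + i \<and> a x = r"
     thus "x \<in> (%x. n + x) ` {x \<in> {1..i}. hi n a x = r}" by (intro image_eqI[of _ _ "x - n"]) (auto simp: hi_def)
    qed (auto simp: hi_def)
    thus "x \<in> {x \<in> {1..n + i}. a x = r} \<longleftrightarrow> x \<in> {x \<in> {1..n}. lo n a x = r} \<union> (%x. n + x) ` {x \<in> {1..i}. hi n a x = r}"
     by (auto simp: lo_def)
   qed
   moreover have "{x \<in> {1..n}. lo n a x = r} \<inter> (%x. n + x) ` {x \<in> {1..i}. hi n a x = r} = {}" by auto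
   ultimately have "card {x \<in> {1..n + i}. a x = r} = card {x \<in> {1..n}. lo n a x = r} + card {x \<in> {1..i}. hi n a x = r}"
    by (simp add: card_Un_disjoint card_image)
   also have "... = rowlen A r + rowlen (col i) r" using wd_card[OF w(1)] wd_card[OF w(2)] by simp
   also have "rowlen (col i) r = of_bool (r < i)" unfolding rowlen_def col_def by simp
   finally show "card {x \<in> {1..n + i}. a x = r} = rowlen (cadd i A) r" unfolding rowlen_cadd[OF fin] .
  qed
  with that show False by contradiction
 qed
 have "lo n (rw (n + i) p') = rw n p" "hi n (rw (n + i) p') = rw i coltab"
  by (auto simp: lo_def hi_def rw_def p'_def fun_eq_iff)
 hence "?f (rw (n + i) p') = 1" using pt_rw[OF p] pt_rw[OF tab_col] by simp
 thus "?f = pt (n + i) p'" using pt_unique[OF yc t calt supp] by simp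
qed

lemma specht_cadd: assumes A: "young n A" "fst ` A \<subseteq> {..<i}" and f: "f \<in> specht n A"
 shows "(%a. f (lo n a) * pt i coltab (hi n a)) \<in> specht (n + i) (cadd i A)"
proof -
 have "lmap UNIV (%f a. f (lo n a) * pt i coltab (hi n a))" by (simp add: lmap_def algebra_simps)
 thus ?thesis proof (rule specht_image[OF lsp_specht _ _ f])
  fix p assume p: "tab n A p"
  show "(%a. pt n p (lo n a) * pt i coltab (hi n a)) \<in> specht (n + i) (cadd i A)"
   unfolding pt_cadd(2)[OF A p] by (rule pt_specht[OF pt_cadd(1)[OF A p]])
 qed
qed

section \<open>Lengthening the first row\<close>

definition tau :: "nat => nat => cells" where
 "tau j r = stair j \<union> {0} \<times> {j..<j + r}"

lemma tau_0: "tau j 0 = stair j" by (simp add: tau_def)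

lemma tau_Suc: "tau j (Suc r) = insert (0, j + r) (tau j r)" unfolding tau_def by auto

lemma young_tau: "young (\<Sum>{..j} + r) (tau j r)" unfolding young_def
proof (intro conjI allI impI)
 show "finite (tau j r)" unfolding tau_def using youngD(1)[OF stair_young] by simp
 have "stair j \<inter> {0} \<times> {j..<j + r} = {}" unfolding stair_def by auto
 thus "card (tau j r) = \<Sum>{..j} + r" unfolding tau_def
  using youngD(1,2)[OF stair_young[of j]] by (simp add: card_Un_disjoint)
qed (auto simp: tau_def stair_def)

text \<open>The new cell is alone in its column, and its letter is 0, which is also the value of
  words outside their positions. So the polytabloids are literally the same functions.\<close>

lemma specht_tau_Suc:
 assumes n: "n = \<Sum>{..j} + r" and f: "f \<in> specht n (tau j r)" shows "f \<in> specht (Suc n) (tau j (Suc r))"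
proof (rule specht_least[OF lsp_specht _ f])
 fix p assume p: "tab n (tau j r) p"
 let ?c = "(0 :: nat, j + r)"
 let ?p = "p(Suc n := ?c)"
 have nc: "snd c ~= j + r" if "c \<in> tau j r" for c using that unfolding tau_def stair_def by auto
 have c: "?c \<notin> tau j r" using nc by force
 have t: "tab (Suc n) (tau j (Suc r)) ?p" by (rule tab_extend) (use p c in \<open>simp_all add: tau_Suc\<close>)
 have "colst (Suc n) ?p = colst n p" proof (rule set_eqI, rule iffI)
  fix \<sigma> assume s: "\<sigma> \<in> colst (Suc n) ?p"
  hence sg: "\<sigma> \<in> symg (Suc n)" and col: "\<And>x. x \<in> {1..Suc n} ==> snd (?p (\<sigma> x)) = snd (?p x)" by (auto simp: colst_def)
  have fix1: "\<sigma> (Suc n) = Suc n" proof (rule ccontr)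
   assume ne: "\<sigma> (Suc n) ~= Suc n"
   moreover have "\<sigma> (Suc n) \<in> {1..Suc n}" using sym_in[OF sg, of "Suc n"] by simp
   ultimately have "\<sigma> (Suc n) \<in> {1..n}" by auto
   hence "snd (p (\<sigma> (Suc n))) ~= j + r" using nc[OF tabD(1)[OF p]] by blast
   thus False using col[of "Suc n"] ne by simp
  qed
  have "x = Suc n" if "x \<in> {1..Suc n} - {1..n}" for x using that by auto
  with fix1 have "\<sigma> \<in> symg n" using permutes_superset[OF symD(1)[OF sg], of "{1..n}"] unfolding symg_def by blast
  moreover have "snd (p (\<sigma> x)) = snd (p x)" if x: "x \<in> {1..n}" for x proof -
   have "\<sigma> x \<in> {1..n}" using sym_in[OF calculation, of x] x by blast
   thus ?thesis using col[of x] x by (auto split: if_split_asm)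
  qed
  ultimately show "\<sigma> \<in> colst n p" by (simp add: colst_def)
 next fix \<sigma> assume s: "\<sigma> \<in> colst n p"
  hence sg: "\<sigma> \<in> symg n" and col: "\<And>x. x \<in> {1..n} ==> snd (p (\<sigma> x)) = snd (p x)" by (auto simp: colst_def)
  have "\<sigma> (Suc n) = Suc n" by (rule sym_out[OF sg]) simp
  moreover have "\<sigma> x ~= Suc n" if "x \<in> {1..n}" for x using sym_in[OF sg, of x] that by auto
  moreover have "\<sigma> \<in> symg (Suc n)" using sg sym_mono[of n "Suc n"] by auto
  ultimately show "\<sigma> \<in> colst (Suc n) ?p" unfolding colst_def using col by (auto simp: le_Suc_eq)
 qed
 moreover have "rw (Suc n) ?p = rw n p" by (auto simp: rw_def fun_eq_iff le_Suc_eq)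
 ultimately have "pt (Suc n) ?p = pt n p" by (simp add: pt_def)
 thus "pt n p \<in> specht (Suc n) (tau j (Suc r))" using pt_specht[OF t] by simp
qed

lemma specht_tau: assumes "n = \<Sum>{..j} + r" "f \<in> specht n (tau j r)" shows "f \<in> specht (n + i) (tau j (r + i))"
proof (induction i)
 case (Suc i) thus ?case using specht_tau_Suc[of "n + i" j "r + i" f] assms(1) by simp
qed (use assms(2) in simp)

lemma stair_cadd: "stair (Suc j) = cadd (Suc j) (stair j)"
proof (rule set_eqI)
 fix c :: "nat \<times> nat"
 show "c \<in> stair (Suc j) \<longleftrightarrow> c \<in> cadd (Suc j) (stair j)"
  unfolding cadd_def stair_def col_def by (cases c; cases "snd c") force+
qed

text \<open>The invariant is shuffled with that of sign, sign and trivial character on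
  \<open>Suc k\<close> points. The signs put a column in front of each staircase, the trivial
  character lengthens the first row of the third diagram.\<close>

lemma inv3_step:
 assumes n: "n = \<Sum>{..k}" "n = \<Sum>{..j} + r" and F: "inv3 n (stair k) (stair k) (tau j r) F" "F u v w ~= 0"
 shows "nzinv (n + Suc k) (stair (Suc k)) (stair (Suc k)) (tau j (r + Suc k))"
proof -
 let ?i = "Suc k"
 define E where "E x y z = pt ?i coltab x * pt ?i coltab y * of_bool (z = (%_. 0))" for x y z :: word
 have yS: "young n (stair k)" unfolding n(1) by (rule stair_young)
 have st: "fst ` stair k \<subseteq> {..<?i}" by (auto simp: stair_def)
 have yT: "young n (tau j r)" unfolding n(2) by (rule young_tau)
 have yT': "young (n + ?i) (tau j (r + ?i))" unfolding n(2) add.assoc by (rule young_tau)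
 have yS': "young (n + ?i) (stair ?i)" unfolding stair_cadd by (rule young_cadd[OF yS st])
 have i1: "inv3 (n + ?i) (stair ?i) (stair ?i) (tau j (r + ?i)) (shuf n ?i F E)" proof (rule inv3_shuf[OF yS' yS' yT'])
  fix y z y' z' :: word
  have e: "(%x. F (lo n x) y z * E (hi n x) y' z')
   = (%x. (pt ?i coltab y' * of_bool (z' = (%_. 0))) * (F (lo n x) y z * pt ?i coltab (hi n x)))"
   by (rule ext) (simp add: E_def)
  show "(%x. F (lo n x) y z * E (hi n x) y' z') \<in> specht (n + ?i) (stair ?i)"
   unfolding e stair_cadd by (rule lsp_scale[OF lsp_specht specht_cadd[OF yS st inv3D(1)[OF F(1)]]])
 next fix x z x' z' :: word
  have e: "(%y. F x (lo n y) z * E x' (hi n y) z')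
   = (%y. (pt ?i coltab x' * of_bool (z' = (%_. 0))) * (F x (lo n y) z * pt ?i coltab (hi n y)))"
   by (rule ext) (simp add: E_def)
  show "(%y. F x (lo n y) z * E x' (hi n y) z') \<in> specht (n + ?i) (stair ?i)"
   unfolding e stair_cadd by (rule lsp_scale[OF lsp_specht specht_cadd[OF yS st inv3D(2)[OF F(1)]]])
 next fix x y x' y' :: word
  \<comment> \<open>In the third argument nothing changes: \<open>F\<close> already vanishes unless
    the letters of \<open>z\<close> after position \<open>n\<close> are 0.\<close>
  have e: "F x y (lo n z) * of_bool (hi n z = (%_. 0)) = F x y z" for z proof (cases "hi n z = (%_. 0)")
   case True
   have "lo n z = z" proof
    fix t show "lo n z t = z t" using fun_cong[OF True, of "t - n"] by (auto simp: lo_def hi_def split: if_split_asm)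
   qed
   thus ?thesis using True by simp
  next case False
   then obtain t where t: "t ~= 0" "z (n + t) ~= 0" by (auto simp: hi_def fun_eq_iff split: if_split_asm)
   have "F x y z = 0" proof (rule ccontr)
    assume nz: "F x y z ~= 0"
    have "z (n + t) = 0" by (rule wd_out[OF inv3_supp(3)[OF F(1), OF nz]]) (use t in simp)
    thus False using t by simp
   qed
   thus ?thesis using False by simp
  qed
  have e': "(%z. F x y (lo n z) * E x' y' (hi n z)) = (%z. (pt ?i coltab x' * pt ?i coltab y') * F x y z)" proof (rule ext)
   fix z
   have "F x y (lo n z) * E x' y' (hi n z) = (pt ?i coltab x' * pt ?i coltab y') * (F x y (lo n z) * of_bool (hi n z = (%_. 0)))"
    by (simp add: E_def)
   thus "F x y (lo n z) * E x' y' (hi n z) = (pt ?i coltab x' * pt ?i coltab y') * F x y z" unfolding e .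
  qed
  show "(%z. F x y (lo n z) * E x' y' (hi n z)) \<in> specht (n + ?i) (tau j (r + ?i))"
   unfolding e' by (rule lsp_scale[OF lsp_specht specht_tau[OF n(2) inv3D(3)[OF F(1)]]])
 qed
 have sgn: "pt ?i coltab (a o g) = of_int (sign g) * pt ?i coltab a" if g: "g \<in> symg ?i" for g a proof -
  have "inv g \<in> colst ?i coltab" using symD(4)[OF g] by (simp add: colst_def coltab_def)
  from calt_colst[OF pt_calt this, of a] show ?thesis using symD(3,7)[OF g] by (simp add: sign_inverse)
 qed
 define T where "T = {0 :: nat} \<times> {..<?i}"
 have yTT: "young ?i T" unfolding T_def young_def by auto
 have row: "(%z. of_bool (z = (%_. 0))) \<in> specht ?i T" proof -
  have t: "tab ?i T (%x. (0, x - 1))" unfolding tab_def T_def by (rule bij_betwI[of _ _ _ "%c. Suc (snd c)"]) auto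
  have "colst ?i (%x. (0 :: nat, x - 1)) = {id}" proof (rule set_eqI, rule iffI)
   fix \<sigma> assume s: "\<sigma> \<in> colst ?i (%x. (0 :: nat, x - 1))"
   hence sg: "\<sigma> \<in> symg ?i" by (simp add: colst_def)
   have "\<sigma> x = x" for x proof (cases "x \<in> {1..?i}")
    case True hence "\<sigma> x \<in> {1..?i}" using sym_in[OF sg] by blast
    moreover have "\<sigma> x - 1 = x - 1" using s True by (simp add: colst_def)
    ultimately show ?thesis using True by auto
   qed (rule sym_out[OF sg])
   thus "\<sigma> \<in> {id}" by auto
  qed (simp add: colst_def)
  moreover have "rw ?i (%x. (0, x - 1)) = (%_. 0)" by (auto simp: rw_def)
  ultimately have "pt ?i (%x. (0 :: nat, x - 1)) = (%z. of_bool (z = (%_. 0)))" unfolding pt_def by simp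
  thus ?thesis using pt_specht[OF t] by simp
 qed
 have i2: "inv3 ?i (col ?i) (col ?i) T E" unfolding inv3_def proof (intro conjI allI ballI)
  fix y z
  have "(%x. E x y z) = (%x. (pt ?i coltab y * of_bool (z = (%_. 0))) * pt ?i coltab x)" by (rule ext) (simp add: E_def)
  thus "(%x. E x y z) \<in> specht ?i (col ?i)"
   using lsp_scale[OF lsp_specht pt_specht[OF tab_col], of "pt ?i coltab y * of_bool (z = (%_. 0))" ?i] by simp
 next fix x z
  have "(%y. E x y z) = (%y. (pt ?i coltab x * of_bool (z = (%_. 0))) * pt ?i coltab y)" by (rule ext) (simp add: E_def)
  thus "(%y. E x y z) \<in> specht ?i (col ?i)"
   using lsp_scale[OF lsp_specht pt_specht[OF tab_col], of "pt ?i coltab x * of_bool (z = (%_. 0))" ?i] by simp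
 next fix x y show "(%z. E x y z) \<in> specht ?i T" unfolding E_def by (rule lsp_scale[OF lsp_specht row])
 next fix g and x y z :: word assume g: "g \<in> symg ?i"
  have "of_int (sign g) * of_int (sign g) = (1 :: rat)" using sign_idempotent[of g] by (metis of_int_1 of_int_mult)
  moreover have "z o g = (%_. 0) \<longleftrightarrow> z = (%_. 0)" proof
   assume h: "z o g = (%_. 0)"
   show "z = (%_. 0)" proof
    fix t show "z t = 0" using fun_cong[OF h, of "inv g t"] surj_f_inv_f[OF bij_is_surj[OF symD(2)[OF g]]] by simp
   qed
  qed auto
  ultimately show "E (x o g) (y o g) (z o g) = E x y z" unfolding E_def sgn[OF g] by (simp add: algebra_simps)
 qed
 have nz: "E (rw ?i coltab) (rw ?i coltab) (%_. 0) ~= 0" unfolding E_def using pt_rw[OF tab_col[of ?i]] by simp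
 have "\<exists>x y z. shuf n ?i F E x y z ~= 0"
  by (rule shuf_nonzero[where F = F and u = u and v = v and w = w and E = E and u' = "rw ?i coltab"
     and v' = "rw ?i coltab" and w' = "%_. 0", OF F(1) youngD(1)[OF yS] youngD(1)[OF yS] youngD(1)[OF yT] F(2)
   i2 youngD(1)[OF young_col] youngD(1)[OF young_col] youngD(1)[OF yTT] nz])
 then obtain x y z where "shuf n ?i F E x y z ~= 0" by (elim exE)
 thus ?thesis unfolding nzinv_def by (intro exI conjI) (rule i1)
qed

lemma nzinv_stairs: assumes F: "nzinv (\<Sum>{..j}) (stair j) (stair j) (stair j)" and k: "\<Sum>{..k} = \<Sum>{..j} + r"
 shows "nzinv (\<Sum>{..k}) (stair k) (stair k) (tau j r)"
proof -
 have *: "nzinv (\<Sum>{..j + d}) (stair (j + d)) (stair (j + d)) (tau j (\<Sum>{..j + d} - \<Sum>{..j}))" for d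
 proof (induction d)
  case 0 thus ?case using F by (simp add: tau_0)
 next case (Suc d)
  let ?k = "j + d"
  have le: "\<Sum>{..j} \<le> \<Sum>{..?k}" by (rule sum_mono2) auto
  hence e: "\<Sum>{..?k} = \<Sum>{..j} + (\<Sum>{..?k} - \<Sum>{..j})" by simp
  have s: "\<Sum>{..?k} + Suc ?k = \<Sum>{..j + Suc d}" "\<Sum>{..?k} - \<Sum>{..j} + Suc ?k = \<Sum>{..j + Suc d} - \<Sum>{..j}"
   using le by simp_all
  have "nzinv (\<Sum>{..?k} + Suc ?k) (stair (Suc ?k)) (stair (Suc ?k)) (tau j (\<Sum>{..?k} - \<Sum>{..j} + Suc ?k))"
   using Suc.IH unfolding nzinv_def[of "\<Sum>{..?k}"] by (elim exE conjE) (rule inv3_step[OF refl e])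
  thus ?case unfolding s by simp
 qed
 have "j \<le> k" proof (rule ccontr)
  assume "\<not> ?thesis"
  hence "k < j" by simp
  have "\<Sum>{..k} < \<Sum>{..j}" by (rule sum_strict_mono2[of _ _ j]) (use \<open>k < j\<close> in auto)
  thus False using k by simp
 qed
 then obtain d where "k = j + d" using le_Suc_ex by blast
 thus ?thesis using *[of d] k by simp
qed

section \<open>Lattices, invariant forms and rank one elements of the group algebra\<close>

definition ip :: "'a set => ('a => rat) => ('a => rat) => rat" where
 "ip W u v = (SUM a:W. u a * v a)"

definition lat :: "nat => cells => wfun set" where
 "lat n D = {f \<in> specht n D. \<forall>a. zint (f a)}"

lemma latD: "f \<in> lat n D ==> f \<in> specht n D" "f \<in> lat n D ==> zint (f a)" by (auto simp: lat_def)

lemma ip_commute: "ip W u v = ip W v u" by (simp add: ip_def mult.commute)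

lemma lfun_ip: "lfun S (ip W u)" by (simp add: lfun_def ip_def algebra_simps sum.distrib sum_distrib_left)

lemma ip_linear: "ip W u (%a. v a + w a) = ip W u v + ip W u w" "ip W u (%a. v a - w a) = ip W u v - ip W u w"
 "ip W u (%a. c * v a) = c * ip W u v"
 "ip W u (%a. SUM k:L. x k * f k a) = (SUM k:L. x k * ip W u (f k))" proof -
 show "ip W u (%a. v a + w a) = ip W u v + ip W u w" "ip W u (%a. v a - w a) = ip W u v - ip W u w"
  "ip W u (%a. c * v a) = c * ip W u v" by (simp_all add: ip_def algebra_simps sum.distrib sum_subtractf sum_distrib_left)
 show "ip W u (%a. SUM k:L. x k * f k a) = (SUM k:L. x k * ip W u (f k))"
  unfolding ip_def by (simp add: sum_distrib_left algebra_simps) (rule sum.swap)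
qed

lemma ip_zero: "finite W ==> ip W f f = 0 ==> a \<in> W ==> f a = 0"
proof -
 assume W: "finite W" and z: "ip W f f = 0" and a: "a \<in> W"
 have "\<forall>a\<in>W. f a * f a = 0" using sum_nonneg_eq_0_iff[OF W, of "%a. f a * f a"] z by (simp add: ip_def)
 thus "f a = 0" using a by simp
qed

lemma ip_ga: assumes g: "g \<in> symg n" shows "ip (wd n D) (ga g u) v = ip (wd n D) u (ga (inv g) v)"
 unfolding ip_def ga_def proof (rule sum.reindex_bij_witness[of _ "%a. a o inv g" "%a. a o g"])
 fix a assume a: "a \<in> wd n D"
 show "a o g o inv g = a" "a o inv g o g = a" using symD(5,6)[OF g] by (simp_all add: comp_assoc)
 show "a o g \<in> wd n D" "a o inv g \<in> wd n D" using wd_comp[OF a] g symD(4)[OF g] by blast+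
 show "u (a o g) * v (a o g o inv g) = u (a o g) * v a" using symD(5)[OF g] by (simp add: comp_assoc)
qed

lemma act_ga: "act n u f = (%a. SUM g:symg n. u g * ga g f a)" by (simp add: act_def ga_def)

lemma ip_act: "ip (wd n D) (act n u f) h = ip (wd n D) f (act n (%g. u (inv g)) h)"
proof -
 have "ip (wd n D) (act n u f) h = (SUM g:symg n. u g * ip (wd n D) (ga g f) h)"
  unfolding act_ga ip_commute[of _ _ h] by (rule ip_linear(4))
 also have "... = (SUM g:symg n. u g * ip (wd n D) f (ga (inv g) h))" by (rule sum.cong) (simp_all add: ip_ga)
 also have "... = (SUM g:symg n. u (inv (inv g)) * ip (wd n D) f (ga (inv g) h))" by (rule sum.cong) (simp_all add: symD(7))
 also have "... = (SUM g:symg n. u (inv g) * ip (wd n D) f (ga g h))"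
  by (rule sum_sym_inv[of "%g. u (inv g) * ip (wd n D) f (ga g h)"])
 also have "... = ip (wd n D) f (act n (%g. u (inv g)) h)" unfolding act_ga by (rule ip_linear(4)[symmetric])
 finally show ?thesis .
qed

definition conv :: "nat => wfun => wfun => wfun" where
 "conv n u v = (%g. SUM h:symg n. u h * v (inv h o g))"

lemma act_conv: "act n (conv n u v) f = act n u (act n v f)"
proof
 fix a
 have "act n (conv n u v) f a = (SUM g:symg n. SUM h:symg n. u h * v (inv h o g) * f (a o g))"
  unfolding act_def conv_def sum_distrib_right ..
 also have "... = (SUM h:symg n. SUM g:symg n. u h * v (inv h o g) * f (a o g))" by (rule sum.swap)
 also have "... = (SUM h:symg n. SUM g:symg n. u h * v g * f (a o h o g))" proof (rule sum.cong[OF refl])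
  fix h assume h: "h \<in> symg n"
  have "(SUM g:symg n. u h * v (inv h o g) * f (a o g)) = (SUM g:symg n. u h * v (inv h o (h o g)) * f (a o (h o g)))"
   by (rule sum_sym_left[OF h, of "%g. u h * v (inv h o g) * f (a o g)", symmetric])
  also have "... = (SUM g:symg n. u h * v g * f (a o h o g))" using symD(6)[OF h] by (simp add: comp_assoc[symmetric])
  finally show "(SUM g:symg n. u h * v (inv h o g) * f (a o g)) = (SUM g:symg n. u h * v g * f (a o h o g))" .
 qed
 also have "... = act n u (act n v f) a" unfolding act_def by (simp add: sum_distrib_left mult.assoc)
 finally show "act n (conv n u v) f a = act n u (act n v f) a" .
qed

lemma faithful_eq: assumes "\<And>D f. young n D ==> f \<in> specht n D ==> act n u f = act n v f" "g \<in> symg n"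
 shows "u g = v g"
proof -
 have "(%g. u g - v g) g = 0" proof (rule faithful[OF _ assms(2)])
  fix D f assume D: "young n D" "f \<in> specht n D"
  show "act n (%g. u g - v g) f = (%_. 0)" proof
   fix a show "act n (%g. u g - v g) f a = 0"
    using fun_cong[OF assms(1)[OF D], of a] by (simp add: act_def sum_subtractf left_diff_distrib)
  qed
 qed
 thus ?thesis by simp
qed

lemma act_cong: "(\<And>g. g \<in> symg n ==> u g = v g) ==> act n u f = act n v f" by (simp add: act_def)

lemma act_supp: assumes "m \<le> n" "\<And>g. g \<notin> symg m ==> u g = 0" shows "act n u f = act m u f" unfolding act_def
proof
 fix a show "(SUM g:symg n. u g * f (a o g)) = (SUM g:symg m. u g * f (a o g))"
  by (rule sum.mono_neutral_right) (use sym_mono[OF assms(1)] assms(2) in auto)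
qed

lemma act_linear: "act n (%g. u g + v g) f = (%a. act n u f a + act n v f a)"
 "act n (%g. u g - v g) f = (%a. act n u f a - act n v f a)"
 "act n (%g. c * u g) f = (%a. c * act n u f a)"
 "act n u (%a. c * f a) = (%a. c * act n u f a)"
 "act n u (%a. f a - f' a) = (%a. act n u f a - act n u f' a)"
 "act n u (%_. 0) = (%_. 0)" by (auto simp: act_def fun_eq_iff algebra_simps sum.distrib sum_subtractf sum_distrib_left)

lemma act_delta: "h \<in> symg n ==> act n (%g. of_bool (g = h)) f = ga h f"
 unfolding act_def ga_def by (rule ext) (rule sum_of_bool_eq(1)[OF finite_sym])

lemma act_zint: "(\<And>g. zint (u g)) ==> (\<And>a. zint (f a)) ==> zint (act n u f a)"
 unfolding act_def by (intro zint_sum zint_mult) blast+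

lemma act_lat: "young n D ==> f \<in> lat n D ==> (\<And>g. zint (u g)) ==> act n u f \<in> lat n D"
 unfolding lat_def using act_specht act_zint by blast

lemma ga_lat: "young n D ==> g \<in> symg n ==> f \<in> lat n D ==> ga g f \<in> lat n D"
 unfolding lat_def using ga_specht by (auto simp: ga_def)

lemma pB_lat: "young n D ==> j \<in> pJ n D ==> pB n D j \<in> lat n D"
 unfolding lat_def using pBD(2) pivot_specht(2) by blast

lemma sum_product3: fixes f g h :: "_ => rat"
 shows "(SUM x:A. f x) * ((SUM z:B. g z) * (SUM w:C. h w)) / c = (SUM x:A. SUM z:B. SUM w:C. f x * (g z * h w) / c)"
 unfolding sum_product[of g B h C] sum_distrib_right[of f] sum_distrib_left[of "f _"] sum_divide_distrib ..

text \<open>The number \<open>q\<close> is a value of the form on the lattice with least valuation,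
  attained at \<open>y\<close> and \<open>b\<close>. So the form divided by \<open>q\<close> is
  integral and takes the value 1, and by \<open>unit\<close> the matrix coefficients formed with it
  give integral elements of the group ring.\<close>

locale core =
 fixes m :: nat and K :: cells and b y :: wfun and q :: rat
 assumes K: "young m K"
  and unit: "zint (fact m / of_nat (sdim m K))" "\<not> zev (fact m / of_nat (sdim m K))"
  and b: "b \<in> lat m K" and y: "y \<in> lat m K"
  and q: "q ~= 0" "ip (wd m K) y b = q"
  and integral: "u \<in> lat m K ==> v \<in> lat m K ==> zint (ip (wd m K) u v / q)"

text \<open>By bilinearity it suffices to minimize the valuation over the nonzero entries of the
  Gram matrix of the integral pivot basis.\<close>

lemma core_exists: assumes K: "young m K"
  and unit: "zint (fact m / of_nat (sdim m K))" "\<not> zev (fact m / of_nat (sdim m K))"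
 obtains b y q where "core m K b y q" proof -
 let ?W = "wd m K" and ?J = "pJ m K" and ?B = "pB m K"
 note piv = pivot_specht(1)[OF K]
 have finW: "finite ?W" by (rule finite_wd[OF youngD(1)[OF K]])
 have finJ: "finite ?J" by (rule pivotD(1)[OF piv])
 define P where "P = {ip ?W (?B i) (?B j) | i j. i \<in> ?J \<and> j \<in> ?J \<and> ip ?W (?B i) (?B j) ~= 0}"
 have "P \<subseteq> (%(i, j). ip ?W (?B i) (?B j)) ` (?J \<times> ?J)" unfolding P_def by auto
 hence finP: "finite P" by (rule finite_subset) (simp add: finJ)
 have "?J ~= {}" using sdim_pos[OF K] unfolding sdim_def by auto
 then obtain j where j: "j \<in> ?J" by blast
 have "?B j j = 1" using pivotD(3)[OF piv j j] by simp
 moreover have "j \<in> ?W" using specht_supp[OF pivotD(2)[OF piv j], of j] calculation by fastforce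
 ultimately have "ip ?W (?B j) (?B j) ~= 0" using ip_zero[OF finW, of "?B j" j] by auto
 hence neP: "P ~= {}" unfolding P_def using j by blast
 have nz: "p ~= 0" if "p \<in> P" for p using that unfolding P_def by auto
 have "\<exists>p\<in>P. \<forall>r\<in>P. zint (r / p)" proof (rule min_valuation[OF finP neP])
  show "q \<in> P ==> q ~= 0" for q by (rule nz)
 qed blast
 then obtain p where p: "p \<in> P" "\<And>r. r \<in> P ==> zint (r / p)" by blast
 obtain i1 i2 where i: "i1 \<in> ?J" "i2 \<in> ?J" "p = ip ?W (?B i1) (?B i2)" using p(1) unfolding P_def by blast
 have basis: "zint (ip ?W (?B i) (?B j) / p)" if "i \<in> ?J" "j \<in> ?J" for i j proof (cases "ip ?W (?B i) (?B j) = 0")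
  case False thus ?thesis using p(2) that unfolding P_def by blast
 qed simp
 have int: "zint (ip ?W u v / p)" if u: "u \<in> lat m K" and v: "v \<in> lat m K" for u v proof -
  have "ip ?W u v = ip ?W (%a. SUM i:?J. u i * ?B i a) (%a. SUM j:?J. v j * ?B j a)"
   using arg_cong2[OF pivotD(4)[OF piv latD(1)[OF u]] pivotD(4)[OF piv latD(1)[OF v]], of "ip ?W"] .
  also have "... = (SUM j:?J. v j * (SUM i:?J. u i * ip ?W (?B i) (?B j)))"
   unfolding ip_linear(4) by (rule sum.cong[OF refl], subst ip_commute, unfold ip_linear(4)) (simp add: ip_commute)
  finally have "ip ?W u v / p = (SUM j:?J. v j * (SUM i:?J. u i * (ip ?W (?B i) (?B j) / p)))"
   by (simp add: sum_divide_distrib[symmetric])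
  also have "zint \<dots>" using latD(2)[OF u] latD(2)[OF v] basis by (intro zint_sum zint_mult) auto
  finally show ?thesis .
 qed
 have "core m K (?B i2) (?B i1) p" using K unit pB_lat[OF K] i nz[OF p(1)] int by (simp add: core_def)
 with that show thesis by blast
qed

context core begin

definition fm :: "wfun => wfun => rat" where
 "fm u v = ip (wd m K) u v / q"

text \<open>The element of the group algebra acting on the Specht module of K as the rank one operator
 sending x to \<open>fm u x\<close> times v, and as zero on the other Specht modules.\<close>

definition br :: "wfun => wfun => wfun" where
 "br v u = (%h. if h \<in> symg m then of_nat (sdim m K) / fact m * fm u (ga (inv h) v) else 0)"

lemma fm_commute: "fm u v = fm v u" by (simp add: fm_def ip_commute)

lemma lfun_fm: "lfun S (fm u)" using lfun_ip[of S "wd m K" u] by (simp add: lfun_def fm_def add_divide_distrib)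

lemma fm_by [simp]: "fm y b = 1" "fm b y = 1"
proof -
 show "fm y b = 1" unfolding fm_def q(2) using q(1) by simp
 thus "fm b y = 1" by (simp add: fm_commute[of b])
qed

lemma fm_zint: "u \<in> lat m K ==> v \<in> lat m K ==> zint (fm u v)" using integral by (simp add: fm_def)

lemma br_out: "h \<notin> symg m ==> br v u h = 0" by (simp add: br_def)

lemma unit': "zint (of_nat (sdim m K) / fact m)" "\<not> zev (of_nat (sdim m K) / fact m)"
 using zint_inverse[OF unit] by simp_all

lemma br_zint: "u \<in> lat m K ==> v \<in> lat m K ==> zint (br v u h)"
 unfolding br_def using zint_mult[OF unit'(1) fm_zint[OF _ ga_lat[OF K symD(4)]]] by simp

text \<open>Inverting group elements gives the adjoint for the invariant form, and the adjoint of a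
  rank one operator exchanges its two vectors.\<close>

lemma br_inv: assumes "h \<in> symg m" shows "br v u (inv h) = br u v h"
proof -
 have "fm u (ga h v) = fm v (ga (inv h) u)" unfolding fm_def ip_commute[of _ u] ip_ga[OF assms] ..
 thus ?thesis using assms symD(4,7)[OF assms] by (simp add: br_def)
qed

lemma act_br_avg: "act m (br v u) x = (%a. of_nat (sdim m K) / fact m * avg m (fm u) x v a)"
 by (auto simp: act_def avg_def br_def ga_def sum_distrib_left mult.assoc fun_eq_iff)

lemma act_br: assumes "v \<in> specht m K" "x \<in> specht m K" shows "act m (br v u) x = (%a. fm u x * v a)"
 unfolding act_br_avg schur_scalar[OF K lfun_fm assms(2,1)] using sdim_pos[OF K] by simp

lemma act_br_other:
 assumes "v \<in> specht m K" "young m D" "D ~= K" "x \<in> specht m D" shows "act m (br v u) x = (%_. 0)"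
 unfolding act_br_avg schur_distinct[OF K assms(2) not_sym[OF assms(3)] lfun_fm assms(4) assms(1)] by simp

text \<open>The product rule of rank one operators is checked on every Specht module of the smaller
  group. By \<open>faithful_eq\<close> it holds in the group ring, so \<open>f\<close> may be a
  function of longer words.\<close>

lemma br_mult: assumes v: "v \<in> specht m K" and v': "v' \<in> specht m K"
 shows "act m (br v u) (act m (br v' u') f) = (%a. fm u v' * act m (br v u') f a)"
proof -
 have "conv m (br v u) (br v' u') g = fm u v' * br v u' g" if g: "g \<in> symg m" for g proof (rule faithful_eq[OF _ g])
  fix D x assume D: "young m D" "x \<in> specht m D"
  show "act m (conv m (br v u) (br v' u')) x = act m (%g. fm u v' * br v u' g) x" proof (cases "D = K")
   case True hence x: "x \<in> specht m K" using D by simp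
   have "act m (br v u) v' = (%a. fm u v' * v a)" by (rule act_br[OF v v'])
   thus ?thesis unfolding act_conv act_linear act_br[OF v' x] act_br[OF v x] by (simp add: act_br[OF v v'] mult_ac)
  next case False
   show ?thesis unfolding act_conv act_linear act_br_other[OF v' D(1) False D(2)] act_br_other[OF v D(1) False D(2)] by simp
  qed
 qed
 hence "act m (conv m (br v u) (br v' u')) f = act m (%g. fm u v' * br v u' g) f" by (rule act_cong)
 thus ?thesis unfolding act_conv act_linear .
qed

text \<open>Branching down to size \<open>m\<close> yields one copy of the module of
  \<open>K\<close> for each path, with trace \<open>fm u v\<close>, and modules of other diagrams,
  on which the element vanishes.\<close>

lemma trace_br: assumes v: "v \<in> specht m K"
 shows "young (m + p) D ==> tr (specht (m + p) D) (act m (br v u)) = fm u v * of_nat (pathc K m p D)"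
proof (induction p arbitrary: D)
 case 0 hence D: "young m D" by simp
 note piv = pivot_specht(1)[OF D]
 have F: "act m (br v u) f \<in> specht m D" if "f \<in> specht m D" for f by (rule act_specht[OF D that])
 have t: "tr (specht m D) (act m (br v u)) = (SUM j:pJ m D. act m (br v u) (pB m D j) j)"
  by (rule tr_frame[OF fdsp_specht[OF D] pivot_frame[OF piv] lmap_act F])
 show ?case proof (cases "D = K")
  case True
  have "(SUM j:pJ m K. act m (br v u) (pB m K j) j) = (SUM j:pJ m K. v j * fm u (pB m K j))"
   by (rule sum.cong) (simp_all add: act_br[OF v pBD(2)[OF K]])
  also have "... = fm u (%a. SUM j:pJ m K. v j * pB m K j a)"
   by (rule lfun_sum[OF lsp_specht lfun_fm pBD(2)[OF K], symmetric])
  also have "... = fm u v" using arg_cong[OF pBD(4)[OF K v], of "fm u"] by simp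
  finally show ?thesis using True t by simp
 next case False
  have "(SUM j:pJ m D. act m (br v u) (pB m D j) j) = 0"
   by (rule sum.neutral) (simp add: act_br_other[OF v D False pBD(2)[OF D]])
  thus ?thesis using False t by simp
 qed
next case (Suc p)
 have D: "young (Suc (m + p)) D" using Suc.prems by simp
 have "act (m + p) (br v u) = act m (br v u)" by (rule ext, rule act_supp) (simp_all add: br_out)
 hence "tr (specht (Suc (m + p)) D) (act m (br v u)) = (SUM c:corners (m + p) D. tr (specht (m + p) (D - {c})) (act m (br v u)))"
  using trace_branching[OF D, of "br v u"] by simp
 also have "... = (SUM c:corners (m + p) D. fm u v * of_nat (pathc K m p (D - {c})))"
  by (rule sum.cong) (simp_all add: Suc.IH cornerD(2)[OF D])
 finally show ?case by (simp add: sum_distrib_left)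
qed

lemma nzinv_core: "nzinv m K K K"
proof -
 define F where "F x z w = (SUM g:symg m. b (x o g) * b (z o g) * y (w o g))" for x z w :: word
 have bS: "b \<in> specht m K" "y \<in> specht m K" using b y latD by blast+
 have i: "inv3 m K K K F" unfolding inv3_def proof (intro conjI allI ballI)
  fix z w
  have "(%x. F x z w) = (%x. SUM g:symg m. (b (z o g) * y (w o g)) * ga g b x)" by (simp add: F_def ga_def mult_ac)
  thus "(%x. F x z w) \<in> specht m K" using lsp_sum[OF lsp_specht ga_specht[OF K _ bS(1)]] by simp
 next fix x w
  have "(%z. F x z w) = (%z. SUM g:symg m. (b (x o g) * y (w o g)) * ga g b z)" by (simp add: F_def ga_def mult_ac)
  thus "(%z. F x z w) \<in> specht m K" using lsp_sum[OF lsp_specht ga_specht[OF K _ bS(1)]] by simp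
 next fix x z
  have "(%w. F x z w) = (%w. SUM g:symg m. (b (x o g) * b (z o g)) * ga g y w)" by (simp add: F_def ga_def mult_ac)
  thus "(%w. F x z w) \<in> specht m K" using lsp_sum[OF lsp_specht ga_specht[OF K _ bS(2)]] by simp
 next fix h and x z w :: word assume h: "h \<in> symg m"
  show "F (x o h) (z o h) (w o h) = F x z w" unfolding F_def comp_assoc
   by (rule sum_sym_left[OF h, of "%g. b (x o g) * b (z o g) * y (w o g)"])
 qed
 define c where "c g = fm y (ga g b)" for g
 \<comment> \<open>The matrix coefficient \<open>c\<close> at the inverse, as it occurs in Schur's
   relation.\<close>
 define d where "d g = fm y (ga (inv g) b)" for g
 have cz: "zint (c g)" "zint (d g)" if "g \<in> symg m" for g
  unfolding c_def d_def using fm_zint[OF y ga_lat[OF K _ b]] that symD(4)[OF that] by blast+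
 let ?W = "wd m K"
 have "\<exists>x z w. F x z w ~= 0" proof (rule ccontr)
  assume "\<not> ?thesis"
  hence z: "F x z w = 0" for x z w by blast
  \<comment> \<open>Pairing \<open>F\<close> with \<open>y\<close>, \<open>y\<close> and
    \<open>b\<close> in its three arguments gives this sum up to the factor
    \<open>q * q * q\<close>.\<close>
  have "(SUM g:symg m. c g * c g * d g) = 0" proof -
   have d: "d g = ip ?W b (ga g y) / q" if "g \<in> symg m" for g
    unfolding d_def fm_def using ip_ga[OF that, of K y b] by (simp add: ip_commute)
   have "(SUM g:symg m. c g * c g * d g) = (SUM g:symg m. SUM x:?W. SUM z:?W. SUM w:?W.
     (y x * y z * b w / (q * q * q)) * (b (x o g) * b (z o g) * y (w o g)))" proof (rule sum.cong[OF refl])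
    fix g assume g: "g \<in> symg m"
    have "c g * c g * d g = ip ?W y (ga g b) * (ip ?W y (ga g b) * ip ?W b (ga g y)) / (q * q * q)"
     unfolding d[OF g] c_def fm_def by simp
    also have "... = (SUM x:?W. SUM z:?W. SUM w:?W. (y x * y z * b w / (q * q * q)) * (b (x o g) * b (z o g) * y (w o g)))"
     unfolding ip_def sum_product3 ga_def by (intro sum.cong refl) simp
    finally show "c g * c g * d g = (SUM x:?W. SUM z:?W. SUM w:?W. (y x * y z * b w / (q * q * q)) * (b (x o g) * b (z o g) * y (w o g)))" .
   qed
   also have "... = (SUM x:?W. SUM z:?W. SUM w:?W. (y x * y z * b w / (q * q * q)) * F x z w)"
    unfolding F_def sum_distrib_left
    by (subst sum.swap, rule sum.cong[OF refl], subst sum.swap, rule sum.cong[OF refl], subst sum.swap, rule refl)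
   also have "... = 0" by (simp add: z)
   finally show ?thesis .
  qed
  moreover have "(SUM g:symg m. c g * d g) = fact m / of_nat (sdim m K)"
   unfolding c_def d_def using schur_functional[OF K lfun_fm lfun_fm bS(1) bS(1), of y y] by simp
  ultimately have e: "fact m / of_nat (sdim m K) = - (SUM g:symg m. (c g * c g - c g) * d g)"
   by (simp add: left_diff_distrib sum_subtractf)
  have "zev (c g * c g - c g)" if "g \<in> symg m" for g proof -
   have "c g * c g - c g = c g * (c g - 1)" by (simp add: algebra_simps)
   moreover have "zint (c g - 1)" using cz(1)[OF that] by (intro zint_diff) simp_all
   ultimately show ?thesis using cz(1)[OF that] by (metis zint_cases zev_mult1 zev_mult2)
  qed
  hence "zev (SUM g:symg m. (c g * c g - c g) * d g)" using cz(2) by (intro zev_sum zev_mult1)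
  thus False using unit(2) unfolding e by simp
 qed
 with i show ?thesis unfolding nzinv_def by blast
qed

end

section \<open>A horizontal strip condition\<close>

definition sy :: "nat => nat => word set" where
 "sy m n = {g. g permutes {m<..n}}"

lemma syD: assumes "s \<in> sy m n"
 shows "s \<in> symg n" "x \<le> m ==> s x = x" "m < x ==> m < s x" "inv s \<in> sy m n"
proof -
 have p: "s permutes {m<..n}" using assms by (simp add: sy_def)
 have "{m<..n} \<subseteq> {1..n}" by auto
 from permutes_subset[OF p this] show "s \<in> symg n" by (simp add: symg_def)
 show "x \<le> m ==> s x = x" using permutes_not_in[OF p, of x] by simp
 show "inv s \<in> sy m n" using permutes_inv[OF p] by (simp add: sy_def)
 show "m < s x" if "m < x" proof (cases "x \<in> {m<..n}")
  case True thus ?thesis using permutes_in_image[OF p, of x] by simp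
 next case False thus ?thesis using permutes_not_in[OF p False] that by simp
 qed
qed

lemma sy_comp: "s \<in> sy m n ==> t \<in> sy m n ==> s o t \<in> sy m n" unfolding sy_def using permutes_compose by blast

lemma sy_id [simp]: "id \<in> sy m n" by (simp add: sy_def permutes_id)

lemma finite_sy [simp]: "finite (sy m n)" by (rule finite_subset[of _ "symg n"]) (use syD(1) in auto)

lemma sy_mono: "n \<le> n' ==> sy m n \<subseteq> sy m n'"
proof
 fix s assume "n \<le> n'" "s \<in> sy m n"
 moreover have "{m<..n} \<subseteq> {m<..n'}" using \<open>n \<le> n'\<close> by auto
 ultimately show "s \<in> sy m n'" using permutes_subset[of s "{m<..n}"] by (simp add: sy_def)
qed

lemma sy_transpose: "m < k ==> k < n ==> transpose k (Suc k) \<in> sy m n" unfolding sy_def by (simp add: permutes_swap_id)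

lemma sy_commute: assumes "s \<in> sy m n" "h \<in> symg m" shows "s o h = h o s"
proof
 fix x
 show "(s o h) x = (h o s) x" proof (cases "x \<le> m")
  case True
  have "h x \<le> m" using sym_in[OF assms(2), of x] sym_out[OF assms(2), of x] True by (cases "x \<in> {1..m}") auto
  thus ?thesis using True syD(2)[OF assms(1)] by simp
 next case False
  hence "m < s x" using syD(3)[OF assms(1)] by simp
  thus ?thesis using False sym_out[OF assms(2), of x] sym_out[OF assms(2), of "s x"] by simp
 qed
qed

lemma ga_act_sy: assumes "s \<in> sy m n" shows "ga s (act m u f) = act m u (ga s f)" unfolding ga_def act_def
proof
 fix a show "(SUM g:symg m. u g * f (a o s o g)) = (SUM g:symg m. u g * f (a o g o s))"
  by (rule sum.cong[OF refl]) (simp add: comp_assoc sy_commute[OF assms])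
qed

definition hstrip :: "cells => cells => bool" where
 "hstrip K D \<longleftrightarrow> K \<subseteq> D \<and> (\<forall>i i' l. (i, l) \<in> D - K --> (i', l) \<in> D - K --> i = i')"

lemma jm_specht: assumes "young n D" "k \<le> n" "f \<in> specht n D" shows "jm k f \<in> specht n D" unfolding jm_ga
proof (rule lsp_sum'[OF lsp_specht])
 fix i assume "i \<in> {1..<k}"
 hence "transpose i k \<in> symg n" using assms(2) by (intro sym_transpose) auto
 thus "ga (transpose i k) f \<in> specht n D" by (rule ga_specht[OF assms(1) _ assms(3)])
qed

text \<open>On coefficient functions \<open>jm k\<close> is right multiplication by the Jucys-Murphy
  element, which can therefore be moved to the argument of the action.\<close>

lemma act_jm: assumes k: "k \<le> n" shows "act n (jm k u) f = act n u (jm k f)"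
proof
 fix a
 have "act n (jm k u) f a = (SUM g:symg n. SUM i:{1..<k}. u (g o transpose i k) * f (a o g))"
  unfolding act_def jm_def sum_distrib_right ..
 also have "... = (SUM i:{1..<k}. SUM g:symg n. u (g o transpose i k) * f (a o g))" by (rule sum.swap)
 also have "... = (SUM i:{1..<k}. SUM g:symg n. u g * f (a o g o transpose i k))" proof (rule sum.cong[OF refl])
  fix i assume "i \<in> {1..<k}"
  hence t: "transpose i k \<in> symg n" using k by (intro sym_transpose) auto
  have "(SUM g:symg n. u g * f (a o g o transpose i k))
    = (SUM g:symg n. u (g o transpose i k) * f (a o (g o transpose i k) o transpose i k))"
   by (rule sum_sym_right[OF t, of "%g. u g * f (a o g o transpose i k)", symmetric])
  also have "... = (SUM g:symg n. u (g o transpose i k) * f (a o g))" by (simp add: comp_assoc)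
  finally show "(SUM g:symg n. u (g o transpose i k) * f (a o g)) = (SUM g:symg n. u g * f (a o g o transpose i k))" ..
 qed
 also have "... = (SUM g:symg n. SUM i:{1..<k}. u g * f (a o g o transpose i k))" by (rule sum.swap)
 also have "... = act n u (jm k f) a" unfolding act_def jm_def by (simp add: sum_distrib_left)
 finally show "act n (jm k u) f a = act n u (jm k f) a" .
qed

lemma act_jel: "k \<le> n ==> act n (jel k i u) f = act n u (jel k i f)"
proof (induction k arbitrary: i u f)
 case 0 thus ?case by (simp add: act_def mult.assoc mult.left_commute)
next case (Suc k)
 note IH = Suc.IH[OF Suc_leD[OF Suc.prems]]
 have 1: "act n (jm (Suc k) (jel k i u)) f = act n u (jm (Suc k) (jel k i f))"
  unfolding act_jm[OF Suc.prems] IH jel_intertwine[OF jm_comm, symmetric] ..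
 have add: "act n (%g. v g + w g) f = (%a. act n v f a + act n w f a)" "act n u (%a. h a + h' a) = (%a. act n u h a + act n u h' a)"
  for v w h h' by (auto simp: act_def fun_eq_iff algebra_simps sum.distrib)
 have z: "act n (%_. 0) f = (%_. 0)" by (simp add: act_def)
 show ?case proof (cases "i = 0")
  case True thus ?thesis using 1 by simp
 next case False thus ?thesis using 1 IH[of "i - 1" u f] by (simp add: add)
 qed
qed

context core begin

abbreviation eps :: wfun where "eps \<equiv> br b y"

lemma bS: "b \<in> specht m K" and yS: "y \<in> specht m K" using b y latD by blast+

text \<open>On the image of \<open>br v u\<close> the smaller group acts as on copies of the module
  of \<open>K\<close>, whatever larger module \<open>f\<close> comes from.\<close>

lemma jel_br: assumes v: "v \<in> specht m K"
 shows "jel m i (act m (br v u) f) = (%a. of_int (coeff (cpoly K) i) * act m (br v u) f a)"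
proof -
 let ?c = "of_int (coeff (cpoly K) i) :: rat"
 have e: "jel m i (br v u) g = ?c * br v u g" if g: "g \<in> symg m" for g proof (rule faithful_eq[OF _ g])
  fix D x assume D: "young m D" "x \<in> specht m D"
  show "act m (jel m i (br v u)) x = act m (%g. ?c * br v u g) x"
   unfolding act_jel[OF order_refl] jel_specht[OF D] act_linear
   by (cases "D = K") (simp_all add: act_br_other[OF v D(1) _ D(2)])
 qed
 have "jel m i (act m (br v u) f) = act m (br v u) (jel m i f)" by (rule comm_act[OF jel_comm])
 also have "... = act m (jel m i (br v u)) f" by (rule act_jel[OF order_refl, symmetric])
 also have "... = act m (%g. ?c * br v u g) f" by (rule act_cong[OF e])
 finally show ?thesis unfolding act_linear .
qed

text \<open>Invariance under adjacent transpositions turns the eigenvalue \<open>z\<close> of the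
  last Jucys-Murphy element into \<open>z - 1\<close>, \<open>z - 2\<close> and so on for the
  preceding ones. So the contents of \<open>D\<close> are those of \<open>K\<close> together with
  \<open>z - p\<close> up to \<open>z\<close>, and \<open>z + 1\<close> is not among the added
  ones.\<close>

lemma rigid_contents: assumes D: "young (m + Suc p) D" and f: "f \<in> specht (m + Suc p) D" "f ~= (%_. 0)"
  and e: "act m eps f = f" and s: "\<And>s. s \<in> sy m (m + Suc p) ==> ga s f = f"
  and X: "jm (m + Suc p) f = (%a. of_int z * f a)"
 shows "card {d \<in> D. cont d = z + 1} = card {d \<in> K. cont d = z + 1}"
proof -
 have jm: "jm (m + Suc p - t) f = (%a. of_int (z - int t) * f a)" if "t \<le> p" for t using that proof (induction t)
  case 0 thus ?case using X by simp
 next case (Suc t)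
  let ?k = "m + Suc p - Suc t" let ?s = "transpose ?k (Suc ?k)"
  have k: "Suc ?k = m + Suc p - t" using Suc.prems by simp
  have ss: "?s \<in> sy m (m + Suc p)" by (rule sy_transpose) (use Suc.prems in auto)
  have "ga ?s (jm ?k f) = (%a. jm (Suc ?k) (ga ?s f) a - f a)" by (rule adjacent_jm) (use Suc.prems in auto)
  also have "... = (%a. of_int (z - int (Suc t)) * f a)"
   unfolding s[OF ss] unfolding k Suc.IH[OF Suc_leD[OF Suc.prems]] by (simp add: algebra_simps)
  finally have "ga ?s (ga ?s (jm ?k f)) = (%a. of_int (z - int (Suc t)) * ga ?s f a)" by (simp add: ga_def)
  moreover have "ga ?s (ga ?s (jm ?k f)) = jm ?k f" by (simp add: ga_ga)
  ultimately show ?case unfolding s[OF ss] by simp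
 qed
 \<comment> \<open>The cells \<open>x t\<close> merely carry the prescribed contents: they are
   placed far away from \<open>K\<close>, and \<open>E t\<close> need not be a diagram, because only
   its polynomial \<open>cpoly\<close> matters.\<close>
 define M where "M = m + nat \<bar>z\<bar>"
 define x where "x t = (M + (Suc p - t), nat (int M + z))" for t
 have cx: "cont (x t) = z - int (Suc p - t)" for t proof -
  have "0 \<le> int M + z" unfolding M_def by arith
  thus ?thesis unfolding cont_def x_def by simp
 qed
 define E where "E t = K \<union> x ` {1..t}" for t
 have finE: "finite (E t)" for t unfolding E_def using youngD(1)[OF K] by simp
 have xK: "x t \<notin> K" for t using young_bound(1)[OF K, of "fst (x t)" "snd (x t)"] unfolding x_def M_def by force
 have jel: "jel (m + t) i f = (%a. of_int (coeff (cpoly (E t)) i) * f a)" if "t \<le> Suc p" for t i using that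
 proof (induction t arbitrary: i)
  case 0 thus ?case using jel_br[OF bS, of i y f] unfolding e by (simp add: E_def)
 next case (Suc t)
  have new: "x (Suc t) \<in> E (Suc t)" "E (Suc t) - {x (Suc t)} = E t" proof -
   have "x (Suc t) \<notin> x ` {1..t}" using Suc.prems unfolding x_def by auto
   moreover have "E (Suc t) = insert (x (Suc t)) (E t)" unfolding E_def by (simp add: atLeastAtMostSuc_conv)
   ultimately show "x (Suc t) \<in> E (Suc t)" "E (Suc t) - {x (Suc t)} = E t" using xK[of "Suc t"] unfolding E_def by auto
  qed
  have IH: "jel (m + t) i f = (%a. of_int (coeff (cpoly (E t)) i) * f a)" for i using Suc by simp
  have j: "jm (Suc (m + t)) f = (%a. of_int (cont (x (Suc t))) * f a)"
   using jm[of "p - t"] Suc.prems unfolding cx by (simp add: Suc_diff_le)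
  have "jm (Suc (m + t)) (jel (m + t) i f) = (%a. of_int (coeff (cpoly (E t)) i) * jm (Suc (m + t)) f a)"
   unfolding IH by (simp only: jm_def sum_distrib_left)
  thus ?case unfolding cpoly_insert[OF finE new(1)] new(2) j by (auto simp: IH fun_eq_iff algebra_simps)
 qed
 obtain a where a: "f a ~= 0" using f(2) by auto
 have "coeff (cpoly D) i = coeff (cpoly (E (Suc p))) i" for i
  using fun_cong[OF trans[OF jel_specht[OF D f(1), symmetric] jel[OF order_refl]], where x = a] a by simp
 hence "cpoly D = cpoly (E (Suc p))" by (rule poly_eqI)
 hence "card {d \<in> D. cont d = z + 1} = card {d \<in> E (Suc p). cont d = z + 1}"
  by (rule cpoly_card[OF youngD(1)[OF D] _ finE])
 also have "{d \<in> E (Suc p). cont d = z + 1} = {d \<in> K. cont d = z + 1}" unfolding E_def by (auto simp: cx)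
 finally show ?thesis .
qed

text \<open>One half of Pieri's rule. Removing the leading corner \<open>c\<close> of
  \<open>f\<close> preserves the assumptions. If the strip condition fails only when
  \<open>c\<close> is added, \<open>f\<close> is an eigenvector of the last Jucys-Murphy element for
  the content of \<open>c\<close>, and the cell above \<open>c\<close> contradicts
  \<open>rigid_contents\<close>.\<close>

lemma pieri: "young (m + p) D ==> f \<in> specht (m + p) D ==> f ~= (%_. 0) ==> act m eps f = f ==>
  (\<forall>s\<in>sy m (m + p). ga s f = f) ==> hstrip K D" proof (induction p arbitrary: D f)
 case 0
 have "D = K" proof (rule ccontr)
  assume "D ~= K"
  hence "act m eps f = (%_. 0)" using act_br_other[OF bS] 0 by simp
  thus False using 0 by simp
 qed
 thus ?case by (simp add: hstrip_def)
next case (Suc p)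
 let ?n = "m + p"
 have D: "young (Suc ?n) D" and f: "f \<in> specht (Suc ?n) D" using Suc.prems by simp_all
 have strip: "hstrip K (D - {d}) \<and> rs ?n (fst d) h \<in> specht ?n (D - {d})"
  if d: "d \<in> corners ?n D" and r: "rs ?n (fst d) h \<in> specht ?n (D - {d})" "rs ?n (fst d) h ~= (%_. 0)"
   and h: "act m eps h = h" "\<And>s. s \<in> sy m ?n ==> ga s h = h" for d h proof -
  have "act m eps (rs ?n (fst d) h) = rs ?n (fst d) h"
   using comm_act[OF comm_mono[OF rs_comm[of ?n "fst d"], of m], of eps h] unfolding h(1) by simp
  moreover have "ga s (rs ?n (fst d) h) = rs ?n (fst d) h" if "s \<in> sy m ?n" for s
   using commD(2)[OF rs_comm syD(1)[OF that], of "fst d" h] unfolding h(2)[OF that] by simp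
  ultimately show ?thesis using Suc.IH[OF cornerD(2)[OF D d] r] r(1) by blast
 qed
 have sf: "ga s f = f" if "s \<in> sy m ?n" for s using Suc.prems(5) that sy_mono[of ?n "m + Suc p" m] by auto
 obtain c where c: "c \<in> corners ?n D" "rs ?n (fst c) f \<in> specht ?n (D - {c})" "rs ?n (fst c) f ~= (%_. 0)"
  by (rule specht_top[OF D f Suc.prems(3)])
 have sc: "hstrip K (D - {c})" using strip[OF c Suc.prems(4) sf] by blast
 show ?case proof (rule ccontr)
  assume nh: "\<not> hstrip K D"
  have KD: "K \<subseteq> D - {c}" using sc by (simp add: hstrip_def)
  have cD: "c \<in> D - K" using cornerD(1)[OF D c(1)] KD by blast
  obtain i' where i': "(i', snd c) \<in> D - K" "i' ~= fst c" proof -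
   obtain i1 i2 l where h: "(i1, l) \<in> D - K" "(i2, l) \<in> D - K" "i1 ~= i2" using nh KD unfolding hstrip_def by blast
   have "\<not> ((i1, l) ~= c \<and> (i2, l) ~= c)" using sc h unfolding hstrip_def by blast
   thus thesis using that[of i1] that[of i2] h by (cases c) auto
  qed
  have less: "i' < fst c" using cornerD(3)[OF D c(1), of "(i', snd c)"] i' by (cases c) (force simp: not_less)
  \<comment> \<open>Removing another corner would leave two added cells in the column of
    \<open>c\<close>; the upper one is no corner, since \<open>c\<close> lies below it.\<close>
  have uniq: "d = c" if d: "d \<in> corners ?n D" "hstrip K (D - {d})" for d proof (rule ccontr)
   assume ne: "d ~= c"
   have "d ~= (i', snd c)" using cornerD(3)[OF D d(1), of c] cD less ne by auto
   hence "(i', snd c) \<in> D - {d} - K" "(fst c, snd c) \<in> D - {d} - K" using i' cD ne by auto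
   thus False using d(2) i'(2) unfolding hstrip_def by blast
  qed
  let ?e = "of_int (cont c) :: rat"
  define f1 where "f1 = (%a. jm (Suc ?n) f a - ?e * f a)"
  \<comment> \<open>A nonzero \<open>f1\<close> would satisfy the same assumptions for the smaller
    group, so its leading corner would be \<open>c\<close> by \<open>uniq\<close>. But
    \<open>jm\<close> acts on the component at \<open>c\<close> as the content of \<open>c\<close>,
    so this component of \<open>f1\<close> is 0.\<close>
  have "f1 = (%_. 0)" proof (rule ccontr)
   assume nz: "f1 ~= (%_. 0)"
   have f1: "f1 \<in> specht (Suc ?n) D" unfolding f1_def
    by (rule lsp_diff[OF lsp_specht jm_specht[OF D order_refl f] lsp_scale[OF lsp_specht f]])
   have jc: "comm m (jm (Suc ?n))" by (rule comm_mono[OF jm_comm]) simp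
   have e1: "act m eps f1 = f1" unfolding f1_def act_linear comm_act[OF jc, symmetric] Suc.prems(4) ..
   have s1: "ga s f1 = f1" if "s \<in> sy m ?n" for s proof -
    have "ga s f1 = (%a. ga s (jm (Suc ?n) f) a - ?e * ga s f a)" by (simp add: f1_def ga_def)
    also have "... = f1" unfolding commD(2)[OF jm_comm syD(1)[OF that], symmetric] sf[OF that] f1_def ..
    finally show ?thesis .
   qed
   obtain d where d: "d \<in> corners ?n D" "rs ?n (fst d) f1 \<in> specht ?n (D - {d})" "rs ?n (fst d) f1 ~= (%_. 0)"
    by (rule specht_top[OF D f1 nz])
   have "d = c" using uniq[OF d(1)] strip[OF d e1 s1] by blast
   let ?r = "rs ?n (fst c)"
   have sum: "(SUM d:D. cont d) = cont c + (SUM d:D - {c}. cont d)" using youngD(1)[OF D] cD by (simp add: sum.remove)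
   have "?r (jsum ?n f) = (%a. of_int (SUM d:D - {c}. cont d) * ?r f a)"
    unfolding comm_jsum[OF rs_comm] jsum_specht[OF cornerD(2)[OF D c(1)] c(2)] ..
   moreover have "?r (jsum (Suc ?n) f) = (%a. of_int (SUM d:D. cont d) * ?r f a)"
    unfolding jsum_specht[OF D f] by (rule commD(6)[OF rs_comm])
   moreover have "?r (jsum (Suc ?n) f) = (%a. ?r (jsum ?n f) a + ?r (jm (Suc ?n) f) a)"
    unfolding jsum_Suc by (rule commD(4)[OF rs_comm])
   ultimately have "?r (jm (Suc ?n) f) = (%a. ?e * ?r f a)" unfolding sum by (auto simp: fun_eq_iff algebra_simps)
   moreover have "?r f1 = (%a. ?r (jm (Suc ?n) f) a - ?e * ?r f a)" by (auto simp: f1_def rs_def fun_eq_iff)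
   ultimately have "?r f1 = (%_. 0)" by simp
   thus False using d(3) \<open>d = c\<close> by simp
  qed
  hence X: "jm (m + Suc p) f = (%a. ?e * f a)" by (auto simp: f1_def fun_eq_iff)
  have "card {d \<in> D. cont d = cont c + 1} = card {d \<in> K. cont d = cont c + 1}"
   by (rule rigid_contents[OF Suc.prems(1-4) _ X]) (use Suc.prems(5) in blast)
  moreover have "{d \<in> K. cont d = cont c + 1} \<subset> {d \<in> D. cont d = cont c + 1}" proof -
   \<comment> \<open>The cell above \<open>c\<close>. It is not in \<open>K\<close> because the cell
     in row \<open>i'\<close> of the same column, at least as high, is not.\<close>
   let ?d = "(fst c - 1, snd c)"
   have "?d \<in> D" using youngD(3)[OF D, of "fst c" "snd c" "fst c - 1" "snd c"] cD by simp
   moreover have "?d \<notin> K"  proof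
    assume "?d \<in> K"
    moreover have "i' \<le> fst c - 1" using less by simp
    ultimately show False using youngD(3)[OF K, of "fst c - 1" "snd c" i' "snd c"] i'(1) by blast
   qed
   moreover have "cont ?d = cont c + 1" using less by (simp add: cont_def)
   ultimately show ?thesis using KD by blast
  qed
  moreover have "finite {d \<in> D. cont d = cont c + 1}" using youngD(1)[OF D] by simp
  ultimately show False using psubset_card_mono[of "{d \<in> D. cont d = cont c + 1}" "{d \<in> K. cont d = cont c + 1}"] by linarith
 qed
qed

end

text \<open>An added cell below the first row lies directly outside the staircase, since otherwise
  the cell above it would be added too. All such cells have sign \<open>(-1) ^ j\<close>, and the
  cells added to the first row alternate beginning with this sign. So nothing can cancel them, and
  equality of \<open>ediff\<close> excludes them.\<close>

lemma hstrip_tau: assumes D: "young (\<Sum>{..j} + r) D" and h: "hstrip (stair j) D" and ed: "ediff D = ediff (stair j)"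
 shows "D = tau j r"
proof -
 let ?E = "D - stair j" let ?L = "rowlen D 0"
 have sub: "stair j \<subseteq> D" using h by (simp add: hstrip_def)
 have hs: "(i, l) \<in> ?E ==> (i', l) \<in> ?E ==> i = i'" for i i' l using h unfolding hstrip_def by blast
 define E1 where "E1 = {c \<in> ?E. fst c ~= 0}"
 have mem0: "(0, l) \<in> D \<longleftrightarrow> l < ?L" for l by (rule young_rowlen[OF D])
 have jL: "j \<le> ?L" proof (cases j)
  case (Suc i) hence "(0, i) \<in> stair j" by (simp add: stair_def) hence "(0, i) \<in> D" using sub by blast
  thus ?thesis using mem0[of i] Suc by simp
 qed simp
 have E0: "{c \<in> ?E. fst c = 0} = {0} \<times> {j..<?L}" proof (rule set_eqI)
  fix c :: "nat \<times> nat"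
  obtain i l where c: "c = (i, l)" by (cases c)
  show "c \<in> {c \<in> ?E. fst c = 0} \<longleftrightarrow> c \<in> {0} \<times> {j..<?L}" proof (cases "i = 0")
   case True thus ?thesis unfolding c using mem0[of l] by (simp add: stair_def not_less conj_commute)
  qed (simp add: c)
 qed
 have E1j: "fst c + snd c = j" if c: "c \<in> E1" for c proof (rule ccontr)
  assume ne: "fst c + snd c ~= j"
  define i l where "i = fst c - 1" and "l = snd c"
  have "fst c ~= 0" using c unfolding E1_def by blast
  hence il: "c = (Suc i, l)" by (simp add: i_def l_def)
  have m: "(Suc i, l) \<in> ?E" using c unfolding E1_def il by blast
  hence "\<not> Suc i + l < j" by (simp add: stair_def)
  hence "j \<le> i + l" using ne unfolding il by simp
  moreover have "(i, l) \<in> D" using youngD(3)[OF D, of "Suc i" l i l] m by simp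
  ultimately have "(i, l) \<in> ?E" by (simp add: stair_def)
  hence "i = Suc i" using m by (rule hs)
  thus False by simp
 qed
 have fin: "finite ?E" using youngD(1)[OF D] by simp
 have s1: "(SUM c:E1. (- 1 :: int) ^ (fst c + snd c)) = (- 1) ^ j * int (card E1)" proof -
  have "(SUM c:E1. (- 1 :: int) ^ (fst c + snd c)) = (SUM c:E1. (- 1) ^ j)" by (rule sum.cong[OF refl]) (simp only: E1j)
  thus ?thesis by simp
 qed
 have s0: "(SUM c:{0} \<times> {j..<?L}. (- 1 :: int) ^ (fst c + snd c)) = (- 1) ^ j * (\<Sum>t<?L - j. (- 1) ^ t)" proof -
  have "(SUM c:{0 :: nat} \<times> {j..<?L}. (- 1 :: int) ^ (fst c + snd c)) = (SUM l:{j..<?L}. (- 1) ^ l)"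
   by (rule sum.reindex_bij_witness[of _ "%l. (0, l)" snd]) auto
  also have "... = (\<Sum>t<?L - j. (- 1) ^ (j + t))" by (rule sum.reindex_bij_witness[of _ "%t. j + t" "%l. l - j"]) auto
  finally show ?thesis by (simp add: power_add sum_distrib_left)
 qed
 have "ediff D = ediff (stair j) + (SUM c:?E. (- 1) ^ (fst c + snd c))"
  unfolding ediff_def using sum.subset_diff[OF sub youngD(1)[OF D]] by (simp add: add.commute)
 moreover have "?E = E1 \<union> {0} \<times> {j..<?L}" unfolding E0[symmetric] E1_def by auto
 moreover have "E1 \<inter> {0} \<times> {j..<?L} = {}" unfolding E1_def by auto
 moreover have "finite E1" unfolding E1_def by (rule finite_subset[OF _ fin]) blast
 ultimately have "(- 1 :: int) ^ j * (int (card E1) + (\<Sum>t<?L - j. (- 1) ^ t)) = 0"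
  using ed s0 s1 by (simp add: sum.union_disjoint distrib_left)
 hence "int (card E1) + (\<Sum>t<?L - j. (- 1) ^ t) = 0" by simp
 moreover have "(\<Sum>t<?L - j. (- 1 :: int) ^ t) \<ge> 0"
  using alternating_sum[of "?L - j"] by (cases "even (?L - j)") simp_all
 ultimately have "card E1 = 0" by simp
 hence "E1 = {}" using \<open>finite E1\<close> by simp
 hence "?E = {0} \<times> {j..<?L}" using \<open>?E = E1 \<union> {0} \<times> {j..<?L}\<close> by simp
 hence T: "D = tau j (?L - j)" unfolding tau_def using sub jL by auto
 have "\<Sum>{..j} + (?L - j) = \<Sum>{..j} + r" using youngD(2)[OF D] youngD(2)[OF young_tau[of j "?L - j"]] T by simp
 thus ?thesis using T by simp
qed

section \<open>Central elements separating blocks\<close>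

text \<open>The list encodes a product of factors \<open>jel n i - c\<close>, that is, a central
  element; \<open>zsc\<close> is its eigenvalue.\<close>

primrec zop :: "nat => (nat \<times> rat) list => wfun => wfun" where
 "zop n [] f = f"
| "zop n (x # xs) f = (%a. jel n (fst x) (zop n xs f) a - snd x * zop n xs f a)"

definition zsc :: "(nat \<times> rat) list => cells => rat" where
 "zsc xs D = prod_list (map (%x. of_int (coeff (cpoly D) (fst x)) - snd x) xs)"

lemma zop_comm: "comm n (zop n xs)"
proof (induction xs)
 case Nil show ?case by (simp add: comm_def lmap_def)
next case (Cons x xs)
 note J = jel_comm[of n "fst x"]
 show ?case unfolding comm_def lmap_def proof (intro conjI ballI allI)
  fix f g c
  show "zop n (x # xs) (%a. f a + c * g a) = (%a. zop n (x # xs) f a + c * zop n (x # xs) g a)"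
   unfolding zop.simps commD(3)[OF Cons] commD(3)[OF J] by (simp add: algebra_simps)
 next fix g f assume g: "g \<in> symg n"
  show "zop n (x # xs) (ga g f) = ga g (zop n (x # xs) f)"
   unfolding zop.simps commD(2)[OF Cons g] commD(2)[OF J g] by (simp add: ga_def)
 qed
qed

lemma zop_act: "act n (zop n xs u) f = act n u (zop n xs f)"
proof (induction xs arbitrary: f)
 case (Cons x xs)
 have "zop n xs (jel n (fst x) f) = jel n (fst x) (zop n xs f)" by (rule jel_intertwine[OF zop_comm])
 hence "act n (jel n (fst x) (zop n xs u)) f = act n u (jel n (fst x) (zop n xs f))"
  unfolding act_jel[OF order_refl] Cons by simp
 thus ?case unfolding zop.simps act_linear Cons by simp
qed simp

lemma zop_specht: assumes "young n D" "f \<in> specht n D" shows "zop n xs f = (%a. zsc xs D * f a)"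
proof (induction xs)
 case (Cons x xs)
 have "jel n (fst x) (%a. zsc xs D * f a) = (%a. zsc xs D * jel n (fst x) f a)" by (rule commD(6)[OF jel_comm])
 thus ?case unfolding zop.simps Cons jel_specht[OF assms] by (simp add: zsc_def algebra_simps)
qed (simp add: zsc_def)

lemma jm_zint: "(\<And>a. zint (f a)) ==> zint (jm k f a)" unfolding jm_def by (intro zint_sum)

lemma jel_zint: "(\<And>a. zint (f a)) ==> zint (jel n i f a)"
proof (induction n arbitrary: i a)
 case (Suc n) hence "zint (jel n i f a)" for i a by blast thus ?case by (auto intro: jm_zint)
qed auto

lemma zop_zint: "(\<And>x. x \<in> set xs ==> zint (snd x)) ==> (\<And>a. zint (f a)) ==> zint (zop n xs f a)"
proof (induction xs arbitrary: a)
 case (Cons x xs) hence "zint (zop n xs f a)" for a by simp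
 moreover have "zint (snd x)" using Cons.prems(1)[of x] by simp
 ultimately show ?case unfolding zop.simps by (intro zint_diff zint_mult jel_zint)
qed simp

lemma even_coeff_mult: fixes p r :: "int poly"
 assumes "\<And>i. even (coeff p i)" shows "even (coeff (p * r) i)"
 unfolding coeff_mult by (intro dvd_sum) (use assms in simp)

lemma cpoly_parity: assumes "finite D"
 shows "even (coeff (cpoly D - [:0, 1:] ^ card {c \<in> D. even (cont c)} * [:1, 1:] ^ card {c \<in> D. odd (cont c)}) i)"
 using assms
proof (induction D arbitrary: i rule: finite_induct)
 case empty show ?case by (simp add: cpoly_def)
next case (insert c D)
 let ?q = "[:0, 1:] ^ card {c \<in> D. even (cont c)} * [:1, 1:] ^ card {c \<in> D. odd (cont c)} :: int poly"
 let ?l = "(if even (cont c) then [:0, 1:] else [:1, 1:]) :: int poly"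
 have q: "[:0, 1:] ^ card {d \<in> insert c D. even (cont d)} * [:1, 1:] ^ card {d \<in> insert c D. odd (cont d)} = ?l * ?q"
 proof (cases "even (cont c)")
  case True
  hence "{d \<in> insert c D. even (cont d)} = insert c {d \<in> D. even (cont d)}" "{d \<in> insert c D. odd (cont d)} = {d \<in> D. odd (cont d)}" by auto
  moreover have "card (insert c {d \<in> D. even (cont d)}) = Suc (card {d \<in> D. even (cont d)})" using insert.hyps by simp
  ultimately show ?thesis using True by (simp only: power_Suc mult_ac if_True)
 next case False
  hence "{d \<in> insert c D. even (cont d)} = {d \<in> D. even (cont d)}" "{d \<in> insert c D. odd (cont d)} = insert c {d \<in> D. odd (cont d)}" by auto
  moreover have "card (insert c {d \<in> D. odd (cont d)}) = Suc (card {d \<in> D. odd (cont d)})" using insert.hyps by simp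
  ultimately show ?thesis using False by (simp only: power_Suc mult_ac if_False)
 qed
 have "cpoly (insert c D) - ?l * ?q = (cpoly D - ?q) * ?l + ([:cont c, 1:] - ?l) * cpoly D"
  using insert.hyps by (simp add: cpoly_def algebra_simps)
 moreover have "even (coeff ([:cont c, 1:] - ?l) i)" for i by (auto simp: coeff_pCons split: nat.splits)
 ultimately show ?case unfolding q using even_coeff_mult insert.IH by (simp add: even_coeff_mult)
qed

text \<open>Modulo 2 the polynomial is \<open>x ^ e * (x + 1) ^ (n - e)\<close>, where
  \<open>e\<close> is the number of cells of even content, and \<open>ediff\<close> is
  \<open>2 * e - n\<close>. So the central characters are congruent exactly for equal checkerboard
  counts, the case 2 of Nakayama's criterion for blocks.\<close>

lemma cpoly_congruent: assumes D: "young n D" "young n D'"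
 shows "ediff D = ediff D' ==> even (coeff (cpoly D) i - coeff (cpoly D') i)"
  "ediff D ~= ediff D' ==> \<exists>i. odd (coeff (cpoly D) i - coeff (cpoly D') i)" proof -
 define e where "e D = card {c \<in> D. even (cont c)}" for D
 define q where "q t = ([:0, 1:] ^ t * [:1, 1:] ^ (n - t) :: int poly)" for t
 have en: "ediff D = 2 * int (e D) - int n \<and> card {c \<in> D. odd (cont c)} = n - e D" if D: "young n D" for D proof -
  have un: "D = {c \<in> D. even (cont c)} \<union> {c \<in> D. odd (cont c)}" by blast
  have card: "n = e D + card {c \<in> D. odd (cont c)}"
   unfolding e_def using youngD(1,2)[OF D] card_Un_disjoint[of "{c \<in> D. even (cont c)}" "{c \<in> D. odd (cont c)}"] un by auto
  have par: "even (fst c + snd c) \<longleftrightarrow> even (cont c)" for c unfolding cont_def by auto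
  have "ediff D = (SUM c:D. if even (cont c) then 1 else - 1)" unfolding ediff_def
   by (rule sum.cong) (simp_all add: par[symmetric] minus_one_power_iff)
  also have "... = int (e D) - int (card {c \<in> D. odd (cont c)})"
   using youngD(1)[OF D] by (simp add: sum.If_cases e_def Int_def Collect_neg_eq)
  finally show ?thesis using card by simp
 qed
 have cq: "even (coeff (cpoly D) i - coeff (q (e D)) i)" if "young n D" for D i
  using cpoly_parity[OF youngD(1)[OF that], of i] en[OF that] unfolding q_def e_def by simp
 show "even (coeff (cpoly D) i - coeff (cpoly D') i)" if "ediff D = ediff D'" proof -
  have "e D = e D'" using en[OF D(1)] en[OF D(2)] that by simp
  thus ?thesis using cq[OF D(1), of i] cq[OF D(2), of i] by simp
 qed
 have qc: "coeff (q t) i = (if i < t then 0 else coeff ([:1, 1:] ^ (n - t)) (i - t))" for t i proof -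
  have "[:0, 1:] ^ t = (monom 1 t :: int poly)" by (simp add: monom_altdef)
  thus ?thesis unfolding q_def by (simp add: coeff_monom_mult)
 qed
 have lead: "coeff (q t) t = 1" for t unfolding qc by (simp add: coeff_0_power)
 have low: "coeff (q t) i = 0" if "i < t" for t i unfolding qc using that by simp
 show "\<exists>i. odd (coeff (cpoly D) i - coeff (cpoly D') i)" if "ediff D ~= ediff D'" proof -
  have "e D ~= e D'" using en[OF D(1)] en[OF D(2)] that by auto
  \<comment> \<open>The lowest nonzero coefficient of \<open>q t\<close> is 1, in degree
    \<open>t\<close>, so two of these polynomials differ by an odd number in the smaller
    degree.\<close>
  hence "odd (coeff (q (e D)) (min (e D) (e D')) - coeff (q (e D')) (min (e D) (e D')))"
   using lead low by (cases "e D < e D'") (simp_all add: min_def)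
  hence "odd (coeff (cpoly D) (min (e D) (e D')) - coeff (cpoly D') (min (e D) (e D')))"
   using cq[OF D(1), of "min (e D) (e D')"] cq[OF D(2), of "min (e D) (e D')"] by simp
  thus ?thesis by blast
 qed
qed

text \<open>One factor for each diagram \<open>E\<close> outside the block: from some
  \<open>jel\<close> whose eigenvalues on \<open>E\<close> and \<open>D0\<close> differ by an odd
  number, its eigenvalue on \<open>E\<close> is subtracted. This kills \<open>E\<close> and is odd
  on the whole block, where eigenvalues are congruent.\<close>

lemma block_separator: assumes D0: "young n D0"
 obtains xs where "\<And>x. x \<in> set xs ==> zint (snd x)"
  "\<And>D. young n D ==> ediff D ~= ediff D0 ==> zsc xs D = 0"
  "\<And>D. young n D ==> ediff D = ediff D0 ==> zint (zsc xs D) \<and> \<not> zev (zsc xs D)" proof -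
 let ?P = "{D \<in> par n. ediff D ~= ediff D0}"
 have "finite Q ==> Q \<subseteq> ?P ==> \<exists>xs. (\<forall>x\<in>set xs. zint (snd x)) \<and> (\<forall>D\<in>Q. zsc xs D = 0) \<and>
   (\<forall>D. young n D --> ediff D = ediff D0 --> zint (zsc xs D) \<and> \<not> zev (zsc xs D))" for Q
 proof (induction Q rule: finite_induct)
  case empty show ?case by (rule exI[of _ "[]"]) (simp add: zsc_def)
 next case (insert E Q)
  then obtain xs where xs: "\<forall>x\<in>set xs. zint (snd x)" "\<forall>D\<in>Q. zsc xs D = 0"
   "\<forall>D. young n D --> ediff D = ediff D0 --> zint (zsc xs D) \<and> \<not> zev (zsc xs D)" by auto
  have E: "young n E" "ediff E ~= ediff D0" using insert.prems by (auto simp: par_def)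
  obtain i where i: "odd (coeff (cpoly D0) i - coeff (cpoly E) i)" using cpoly_congruent(2)[OF D0 E(1)] E(2) by metis
  let ?x = "(i, of_int (coeff (cpoly E) i) :: rat)"
  have z: "zsc (?x # xs) D = of_int (coeff (cpoly D) i - coeff (cpoly E) i) * zsc xs D" for D by (simp add: zsc_def)
  have "zint (zsc (?x # xs) D) \<and> \<not> zev (zsc (?x # xs) D)" if D: "young n D" "ediff D = ediff D0" for D proof -
   have "odd (coeff (cpoly D) i - coeff (cpoly E) i)" using cpoly_congruent(1)[OF D(1) D0 D(2), of i] i by simp
   thus ?thesis unfolding z using xs(3) D by (simp add: zev_mult_iff zint_mult del: of_int_diff)
  qed
  moreover have "zsc (?x # xs) D = 0" if "D \<in> insert E Q" for D using that xs(2) unfolding z by auto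
  ultimately show ?case using xs(1) by (intro exI[of _ "?x # xs"]) auto
 qed
 from this[of ?P] obtain xs where "\<forall>x\<in>set xs. zint (snd x)" "\<forall>D\<in>?P. zsc xs D = 0"
   "\<forall>D. young n D --> ediff D = ediff D0 --> zint (zsc xs D) \<and> \<not> zev (zsc xs D)" by auto
 with that[of xs] show thesis by (simp add: par_def)
qed

section \<open>Symmetric forms of odd rank over the 2-local integers\<close>

text \<open>Jordan decomposition over the 2-local integers. After division by an entry of least
  valuation there is a unit on the diagonal, or else a unimodular plane with even diagonal, which
  splits off. Planes use up an even number of dimensions, so odd rank leads to the first case;
  \<open>p\<close> is the scale reached then.\<close>

lemma odd_form: fixes M :: "'i => 'i => rat"
 assumes "finite J" "odd (card J)" "\<And>i j. i \<in> J ==> j \<in> J ==> M i j = M j i"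
  and "\<And>c. (\<forall>i\<in>J. (SUM j:J. M i j * c j) = 0) ==> (\<forall>j\<in>J. c j = 0)"
 shows "\<exists>p x. p ~= 0 \<and> (\<forall>j. zint (x j)) \<and> (\<forall>i\<in>J. zint ((SUM j:J. M i j * x j) / p)) \<and>
   \<not> zev ((SUM i:J. x i * (SUM j:J. M i j * x j)) / p)" using assms
proof (induction "card J" arbitrary: J M rule: less_induct)
 case less
 note fin = less.prems(1) and sym = less.prems(3) and nd = less.prems(4)
 define P where "P = {M i j | i j. i \<in> J \<and> j \<in> J \<and> M i j ~= 0}"
 have "P \<subseteq> (%(i, j). M i j) ` (J \<times> J)" unfolding P_def by auto
 hence finP: "finite P" by (rule finite_subset) (simp add: fin)
 have neJ: "J ~= {}" using less.prems(2) by auto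
 have neP: "P ~= {}" proof
  assume "P = {}"
  hence z: "M i j = 0" if "i \<in> J" "j \<in> J" for i j using that unfolding P_def by blast
  have "\<forall>i\<in>J. (SUM j:J. M i j * 1) = 0" using z by simp
  from nd[OF this] show False using neJ by auto
 qed
 have nz: "p ~= 0" if "p \<in> P" for p using that unfolding P_def by auto
 have "\<exists>p\<in>P. \<forall>r\<in>P. zint (r / p)" proof (rule min_valuation[OF finP neP])
  show "q \<in> P ==> q ~= 0" for q by (rule nz)
 qed blast
 then obtain p where p: "p \<in> P" "\<And>r. r \<in> P ==> zint (r / p)" by blast
 obtain i1 i2 where i: "i1 \<in> J" "i2 \<in> J" "p = M i1 i2" using p(1) unfolding P_def by blast
 have p0: "p ~= 0" by (rule nz[OF p(1)])
 define N where "N i j = M i j / p" for i j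
 have Nz: "zint (N i j)" if "i \<in> J" "j \<in> J" for i j
  using p(2)[of "M i j"] that unfolding N_def P_def by (cases "M i j = 0") auto
 have Ns: "N i j = N j i" if "i \<in> J" "j \<in> J" for i j unfolding N_def using sym that by simp
 have MN: "M i j = p * N i j" for i j unfolding N_def using p0 by simp
 have N12: "N i1 i2 = 1" unfolding N_def using i(3) p0 by simp
 show ?case proof (cases "\<exists>d\<in>J. \<not> zev (N d d)")
  case True then obtain d where d: "d \<in> J" "\<not> zev (N d d)" by blast
  have s: "(SUM j:J. M i j * of_bool (j = d)) = M i d" for i by (rule sum_of_bool_eq(2)[OF fin d(1)])
  have t: "(SUM i:J. of_bool (i = d) * M i d) = M d d" by (rule sum_of_bool_eq(1)[OF fin d(1)])
  show ?thesis by (rule exI[of _ p], rule exI[of _ "%j. of_bool (j = d)"], unfold s t)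
    (use p0 Nz d in \<open>auto simp: N_def\<close>)
 next case False
  hence dz: "zev (N d d)" if "d \<in> J" for d using that by blast
  have ne: "i1 ~= i2" using dz[OF i(1)] N12 by auto
  \<comment> \<open>The determinant of the plane: a product of two even numbers minus 1, hence a
    unit.\<close>
  define \<Delta> where "\<Delta> = N i1 i1 * N i2 i2 - 1"
  have D: "zint \<Delta>" "\<not> zev \<Delta>" proof -
   show "zint \<Delta>" unfolding \<Delta>_def by (intro zint_diff zint_mult Nz i) simp
   show "\<not> zev \<Delta>" proof
    assume "zev \<Delta>"
    moreover have "zev (N i1 i1 * N i2 i2)" using dz i Nz by (intro zev_mult1)
    ultimately have "zev (N i1 i1 * N i2 i2 - \<Delta>)" by (intro zev_diff)
    thus False unfolding \<Delta>_def by simp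
   qed
  qed
  have D0: "\<Delta> ~= 0" using D(2) by auto
  have Di: "zint (1 / \<Delta>)" by (rule zint_inverse(1)[OF D])
  \<comment> \<open>By Cramer's rule, adding \<open>u k\<close> times the first and
    \<open>t k\<close> times the second vector of the plane makes the basis vector \<open>k\<close>
    orthogonal to the plane.\<close>
  define u where "u k = (N i2 k - N i2 i2 * N i1 k) * (1 / \<Delta>)" for k
  define t where "t k = (N i1 k - N i1 i1 * N i2 k) * (1 / \<Delta>)" for k
  have uz: "zint (u k)" "zint (t k)" if "k \<in> J" for k unfolding u_def t_def by (intro zint_mult zint_diff Nz i that Di)+
  have utD: "u k * \<Delta> = N i2 k - N i2 i2 * N i1 k" "t k * \<Delta> = N i1 k - N i1 i1 * N i2 k" for k
   unfolding u_def t_def using D0 by simp_all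
  have o1: "N i1 k + u k * N i1 i1 + t k * N i1 i2 = 0" for k proof -
   have "(N i1 k + u k * N i1 i1 + t k * N i1 i2) * \<Delta> = N i1 k * \<Delta> + (u k * \<Delta>) * N i1 i1 + t k * \<Delta>"
    unfolding N12 by (simp add: algebra_simps)
   also have "... = 0" unfolding utD unfolding \<Delta>_def by (simp add: algebra_simps)
   finally show ?thesis using D0 by simp
  qed
  have o2: "N i2 k + u k * N i2 i1 + t k * N i2 i2 = 0" for k proof -
   have "(N i2 k + u k * N i2 i1 + t k * N i2 i2) * \<Delta> = N i2 k * \<Delta> + u k * \<Delta> + (t k * \<Delta>) * N i2 i2"
    unfolding Ns[OF i(2,1)] N12 by (simp add: algebra_simps)
   also have "... = 0" unfolding utD unfolding \<Delta>_def by (simp add: algebra_simps)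
   finally show ?thesis using D0 by simp
  qed
  define M' where "M' k l = M k l + u k * M i1 l + t k * M i2 l" for k l
  let ?J = "J - {i1, i2}"
  have J: "J = insert i1 (insert i2 ?J)" using i by blast
  have M's: "M' k l = M l k + u k * M l i1 + t k * M l i2" if "l \<in> J" "k \<in> J" for k l
   unfolding M'_def using sym[OF that] sym[OF i(1) that(1)] sym[OF i(2) that(1)] by simp
  have M'sym: "M' k l = M' l k" if "k \<in> J" "l \<in> J" for k l proof -
   have "u k * N i1 l + t k * N i2 l = u l * N i1 k + t l * N i2 k"
    unfolding u_def t_def by (simp add: add_divide_distrib[symmetric]) (simp add: algebra_simps)
   hence "p * (N k l + (u k * N i1 l + t k * N i2 l)) = p * (N l k + (u l * N i1 k + t l * N i2 k))"
    using Ns[OF that] by simp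
   thus ?thesis unfolding M'_def MN by (simp add: algebra_simps)
  qed
  \<comment> \<open>The original coordinates of the vector with coordinates \<open>c\<close> in the
    orthogonal complement.\<close>
  define ext where "ext c l = (if l = i1 then SUM k:?J. c k * u k else if l = i2 then SUM k:?J. c k * t k else c l)"
   for c :: "'i => rat" and l
  have split: "(SUM l:J. h l) = h i1 + (h i2 + (SUM l:?J. h l))" for h :: "'i => rat"
   by (subst J, subst sum.insert, use fin ne in simp, use ne in simp, subst sum.insert) (use fin in auto)
  have lifted: "(SUM l:J. M i l * ext c l) = (if i \<in> ?J then SUM l:?J. M' i l * c l else 0)" if iJ: "i \<in> J" for c i
  proof -
   have "(SUM l:J. M i l * ext c l) = M i i1 * (SUM k:?J. c k * u k) + (M i i2 * (SUM k:?J. c k * t k) + (SUM l:?J. M i l * c l))"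
    unfolding split[of "%l. M i l * ext c l"] using ne by (simp add: ext_def)
   also have "... = (SUM l:?J. (M i l + u l * M i i1 + t l * M i i2) * c l)"
    unfolding sum_distrib_left sum.distrib[symmetric] by (rule sum.cong) (simp_all add: algebra_simps)
   also have "... = (SUM l:?J. M' l i * c l)" by (rule sum.cong) (simp_all add: M's[OF iJ])
   finally have 1: "(SUM l:J. M i l * ext c l) = (SUM l:?J. M' l i * c l)" .
   show ?thesis proof (cases "i \<in> ?J")
    case True
    moreover have "(SUM l:?J. M' l i * c l) = (SUM l:?J. M' i l * c l)"
     by (rule sum.cong[OF refl]) (simp add: M'sym[OF _ iJ])
    ultimately show ?thesis unfolding 1 if_P[OF True] by simp
   next case False
    hence "i = i1 \<or> i = i2" using iJ by blast
    moreover have "M' l i1 = p * (N i1 l + u l * N i1 i1 + t l * N i1 i2)" if "l \<in> J" for l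
     unfolding M's[OF i(1) that] MN by (simp add: algebra_simps)
    moreover have "M' l i2 = p * (N i2 l + u l * N i2 i1 + t l * N i2 i2)" if "l \<in> J" for l
     unfolding M's[OF i(2) that] MN by (simp add: algebra_simps)
    ultimately have z: "M' l i = 0" if "l \<in> J" for l using o1 o2 that by auto
    have "(SUM l:?J. M' l i * c l) = 0" by (rule sum.neutral) (simp add: z)
    thus ?thesis unfolding 1 if_not_P[OF False] .
   qed
  qed
  have two: "card {i1, i2} = 2" using ne by simp
  have cJ: "card ?J = card J - 2" unfolding two[symmetric] by (rule card_Diff_subset) (use i in auto)
  have "card {i1, i2} \<le> card J" by (rule card_mono[OF fin]) (use i in auto)
  hence le: "2 \<le> card J" using two by simp
  have lt: "card ?J < card J" and od: "odd (card ?J)" using cJ le less.prems(2) by auto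
  have nd': "\<forall>j\<in>?J. c j = 0" if c: "\<forall>i\<in>?J. (SUM j:?J. M' i j * c j) = 0" for c proof -
   have "\<forall>i\<in>J. (SUM l:J. M i l * ext c l) = 0" using lifted c by auto
   from nd[OF this] have "\<forall>j\<in>J. ext c j = 0" .
   thus ?thesis by (auto simp: ext_def split: if_split_asm)
  qed
  have fin': "finite ?J" using fin by simp
  have "\<exists>p x. p ~= 0 \<and> (\<forall>j. zint (x j)) \<and> (\<forall>i\<in>?J. zint ((SUM j:?J. M' i j * x j) / p)) \<and>
    \<not> zev ((SUM i:?J. x i * (SUM j:?J. M' i j * x j)) / p)"
   by (rule less.hyps[OF lt fin' od]) (use M'sym nd' in blast)+
  then obtain p' x where x: "p' ~= 0" "\<forall>j. zint (x j)" "\<forall>i\<in>?J. zint ((SUM j:?J. M' i j * x j) / p')"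
    "\<not> zev ((SUM i:?J. x i * (SUM j:?J. M' i j * x j)) / p')" by blast
  have ez: "zint (ext x j)" for j unfolding ext_def using x(2) uz by (auto intro!: zint_sum zint_mult)
  have "(SUM i:J. ext x i * (SUM j:J. M i j * ext x j)) = (SUM i:J. ext x i * (if i \<in> ?J then SUM l:?J. M' i l * x l else 0))"
   by (rule sum.cong) (simp_all add: lifted)
  also have "... = (SUM i:?J. x i * (SUM l:?J. M' i l * x l))" proof -
   have "(SUM i:?J. ext x i * (if i \<in> ?J then SUM l:?J. M' i l * x l else 0)) = (SUM i:?J. x i * (SUM l:?J. M' i l * x l))"
    by (rule sum.cong[OF refl]) (simp add: ext_def)
   thus ?thesis unfolding split[of "%i. ext x i * (if i \<in> ?J then SUM l:?J. M' i l * x l else 0)"] by simp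
  qed
  finally have q: "(SUM i:J. ext x i * (SUM j:J. M i j * ext x j)) = (SUM i:?J. x i * (SUM l:?J. M' i l * x l))" .
  show ?thesis proof (rule exI[of _ p'], rule exI[of _ "ext x"], intro conjI allI ballI)
   show "p' ~= 0" by (rule x(1))
   show "zint (ext x j)" for j by (rule ez)
   show "\<not> zev ((SUM i:J. ext x i * (SUM j:J. M i j * ext x j)) / p')" unfolding q by (rule x(4))
   show "zint ((SUM j:J. M i j * ext x j) / p')" if "i \<in> J" for i unfolding lifted[OF that] using x(3) by auto
  qed
 qed
qed

text \<open>Off the diagonal the terms come in equal pairs, and \<open>w g * w g\<close> is
  congruent to \<open>w g\<close> modulo 2.\<close>

lemma quadratic_parity: fixes P :: "'i => 'i => rat"
 assumes "finite G" "\<And>g h. g \<in> G ==> h \<in> G ==> zint (P g h) \<and> P g h = P h g" "\<And>g. g \<in> G ==> zint (w g)"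
 shows "zev ((SUM g:G. SUM h:G. w g * w h * P g h) - (SUM g:G. w g * P g g))" using assms
proof (induction G rule: finite_induct)
 case (insert x G)
 let ?s = "SUM h:G. w x * w h * P x h"
 have e: "(SUM g:insert x G. SUM h:insert x G. w g * w h * P g h)
  = w x * w x * P x x + 2 * ?s + (SUM g:G. SUM h:G. w g * w h * P g h)" proof -
  have "(SUM g:G. w g * w x * P g x) = ?s" by (rule sum.cong) (use insert.prems in \<open>auto simp: mult.commute\<close>)
  thus ?thesis using insert.hyps by (simp add: sum.distrib algebra_simps)
 qed
 have zP: "zint (P x x)" "zint (w x)" and zs: "zint ?s" using insert.prems by (auto intro!: zint_sum zint_mult)
 have "zev (w x * (w x - 1))" proof (cases rule: zint_cases[OF zP(2)])
  case 1 thus ?thesis using zP by (intro zev_mult1) (auto intro: zint_diff)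
 next case 2 thus ?thesis using zP by (intro zev_mult2)
 qed
 hence "zev (w x * (w x - 1) * P x x + 2 * ?s + ((SUM g:G. SUM h:G. w g * w h * P g h) - (SUM g:G. w g * P g g)))"
 proof (intro zev_add)
  show "zev (w x * (w x - 1) * P x x)" using \<open>zev (w x * (w x - 1))\<close> zP(1) by (rule zev_mult1)
  show "zev (2 * ?s)" by (rule zev_double[OF zs])
  show "zev ((SUM g:G. SUM h:G. w g * w h * P g h) - (SUM g:G. w g * P g g))"
   by (rule insert.IH) (use insert.prems in blast)+
 qed
 thus ?case unfolding e using insert.hyps by (simp add: algebra_simps)
qed simp

lemma transversal:
 obtains R where "R \<subseteq> symg n" "\<And>F :: _ => rat. (\<And>g s. g \<in> symg n ==> s \<in> sy m n ==> F (g o s) = F g) ==>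
   (SUM g:symg n. F g) = of_nat (card (sy m n)) * (SUM g:R. F g)" proof -
 define cs where "cs g = (%s. g o s) ` sy m n" for g :: word
 have cs: "cs (g o s) = cs g" if s: "s \<in> sy m n" for g s proof
  show "cs (g o s) \<subseteq> cs g" unfolding cs_def using sy_comp[OF s] by (auto simp: comp_assoc)
  show "cs g \<subseteq> cs (g o s)" proof
   fix x assume "x \<in> cs g"
   then obtain t where t: "t \<in> sy m n" "x = g o t" unfolding cs_def by blast
   have "g o s o (inv s o t) = g o (s o inv s) o t" by (simp add: comp_assoc)
   hence "x = g o s o (inv s o t)" using t symD(5)[OF syD(1)[OF s]] by simp
   thus "x \<in> cs (g o s)" unfolding cs_def using sy_comp[OF syD(4)[OF s] t(1)] by blast
  qed
 qed
 have self: "g \<in> cs g" for g unfolding cs_def by (rule image_eqI[of _ _ id]) simp_all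
 define rep where "rep g = (SOME x. x \<in> cs g)" for g
 have rep: "rep g \<in> cs g" for g unfolding rep_def by (rule someI[of "%x. x \<in> cs g", OF self])
 have cs_eq: "cs x = cs g" if x: "x \<in> cs g" for x g proof -
  obtain s where "s \<in> sy m n" "x = g o s" using x unfolding cs_def by blast
  thus ?thesis using cs by simp
 qed
 define R where "R = rep ` symg n"
 have sub: "R \<subseteq> symg n" proof
  fix x assume "x \<in> R"
  then obtain g where g: "g \<in> symg n" "x \<in> cs g" unfolding R_def using rep by blast
  thus "x \<in> symg n" unfolding cs_def using sym_comp[OF g(1) syD(1)] by blast
 qed
 have fib: "{x \<in> symg n. rep x = z} = cs z" if z: "z \<in> R" for z proof
  obtain g where g: "g \<in> symg n" "z = rep g" using z unfolding R_def by blast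
  have zg: "cs z = cs g" using cs_eq[OF rep[of g]] g(2) by simp
  show "{x \<in> symg n. rep x = z} \<subseteq> cs z" proof
   fix x assume "x \<in> {x \<in> symg n. rep x = z}"
   hence "cs z = cs x" using cs_eq[OF rep[of x]] by simp
   thus "x \<in> cs z" using self by simp
  qed
  show "cs z \<subseteq> {x \<in> symg n. rep x = z}" proof
   fix x assume x: "x \<in> cs z"
   have "rep x = rep g" unfolding rep_def using cs_eq[OF x] zg by simp
   moreover have "x \<in> symg n" using x sym_comp[OF subsetD[OF sub z] syD(1)] unfolding cs_def by blast
   ultimately show "x \<in> {x \<in> symg n. rep x = z}" using g(2) by simp
  qed
 qed
 have card: "card (cs z) = card (sy m n)" if z: "z \<in> symg n" for z unfolding cs_def
 proof (rule card_image, rule inj_onI)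
  fix s t assume "z o s = z o t"
  hence "inv z o z o s = inv z o z o t" by (simp add: comp_assoc)
  thus "s = t" using symD(6)[OF z] by simp
 qed
 have "(SUM g:symg n. F g) = of_nat (card (sy m n)) * (SUM g:R. F g)"
  if F: "\<And>g s. g \<in> symg n ==> s \<in> sy m n ==> F (g o s) = F g" for F :: "_ => rat" proof -
  have "(SUM g:symg n. F g) = (SUM z:R. SUM g:cs z. F g)"
   unfolding R_def by (subst sum.image_gen[of _ _ rep]) (auto intro!: sum.cong simp: fib[unfolded R_def])
  also have "... = (SUM z:R. of_nat (card (sy m n)) * F z)" proof (rule sum.cong[OF refl])
   fix z assume "z \<in> R"
   hence z: "z \<in> symg n" using sub by blast
   have "(SUM g:cs z. F g) = (SUM g:cs z. F z)" by (rule sum.cong) (use F[OF z] in \<open>auto simp: cs_def\<close>)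
   thus "(SUM g:cs z. F g) = of_nat (card (sy m n)) * F z" by (simp add: card[OF z])
  qed
  finally show ?thesis by (simp add: sum_distrib_left)
 qed
 with sub that show thesis by blast
qed

lemma pathc_subset: "pathc K m p D ~= 0 ==> K \<subseteq> D"
proof (induction p arbitrary: D)
 case (Suc p) hence "(SUM c:corners (m + p) D. pathc K m p (D - {c})) ~= 0" by simp
 then obtain c where "c \<in> corners (m + p) D" "pathc K m p (D - {c}) ~= 0" by (rule sum.not_neutral_contains_not_neutral)
 thus ?case using Suc.IH[of "D - {c}"] by blast
qed (auto split: if_split_asm)

text \<open>The end of the first row is the only corner outside the staircase. As a consequence the
  idempotent of the staircase has rank one on the module of \<open>tau\<close> too.\<close>

lemma pathc_tau: "pathc (stair j) (\<Sum>{..j}) r (tau j r) = 1"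
proof (induction r)
 case (Suc r)
 let ?n = "\<Sum>{..j} + r" let ?D = "tau j (Suc r)" let ?c = "(0 :: nat, j + r)"
 have D: "young (Suc ?n) ?D" using young_tau[of j "Suc r"] by simp
 have nc: "?c \<notin> tau j r" unfolding tau_def stair_def by auto
 have "?c \<in> corners ?n ?D" proof (rule cornerI[OF D])
  show "?c \<in> ?D" by (simp add: tau_Suc)
  fix d assume "d \<in> ?D" "fst ?c \<le> fst d" "snd ?c \<le> snd d"
  thus "d = ?c" by (auto simp: tau_def stair_def)
 qed
 moreover have "pathc (stair j) (\<Sum>{..j}) r (?D - {d}) = 0" if d: "d \<in> corners ?n ?D" "d ~= ?c" for d
 proof (rule ccontr)
  assume "\<not> ?thesis"
  hence "stair j \<subseteq> ?D - {d}" by (rule pathc_subset)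
  hence "d \<notin> stair j" by blast
  hence d': "fst d = 0" "snd d \<le> j + r" using cornerD(1)[OF D d(1)] unfolding tau_def by auto
  have "?c = d" by (rule cornerD(3)[OF D d(1)]) (use d' in \<open>simp_all add: tau_Suc\<close>)
  thus False using d(2) by simp
 qed
 ultimately have "pathc (stair j) (\<Sum>{..j}) (Suc r) ?D = pathc (stair j) (\<Sum>{..j}) r (?D - {?c})"
  using finite_corners[OF D] by (simp add: sum.remove)
 moreover have "?D - {?c} = tau j r" using nc by (simp add: tau_Suc)
 ultimately show ?case using Suc by simp
qed (simp add: tau_0)

lemma ediff_tau: "ediff (tau j (2 * w)) = ediff (stair j)"
proof (induction w)
 case (Suc w)
 have nc: "(0, j + r) \<notin> tau j r" for r unfolding tau_def stair_def by auto
 have fin: "finite (tau j r)" for r using youngD(1)[OF young_tau] .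
 have "ediff (tau j (Suc r)) = (- 1) ^ (j + r) + ediff (tau j r)" for r unfolding tau_Suc ediff_def using nc fin by simp
 hence "ediff (tau j (Suc (Suc (2 * w)))) = ediff (tau j (2 * w))" by simp
 thus ?case using Suc by simp
qed (simp add: tau_0)

section \<open>The block element\<close>

locale fong = core m K b y q for m K b y q +
 fixes n j r :: nat and D :: cells
 assumes Kj: "K = stair j" "m = \<Sum>{..j}" and n: "n = m + r" and r: "even r" and D: "young n D"
  and ed: "ediff D = ediff K" and odd_paths: "odd (pathc K m r D)"
begin

abbreviation T :: cells where "T \<equiv> tau j r"

lemma mn: "m \<le> n" using n by simp

lemma yT: "young n T" unfolding n Kj(2) by (rule young_tau)

lemma ediff_T: "ediff T = ediff D" using ediff_tau[of j "r div 2"] r ed Kj(1) by simp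

lemma act_br_n: "act n (br v u) = act m (br v u)" by (rule ext, rule act_supp[OF mn br_out])

lemma act_br_specht: "young n E ==> f \<in> specht n E ==> act m (br v u) f \<in> specht n E"
 using act_specht[of n E f "br v u"] unfolding act_br_n .

text \<open>By \<open>specht_tau\<close> the very same function lies in the modules of
  \<open>K\<close> and of \<open>T\<close>.\<close>

lemma b_T: "b \<in> specht n T" using specht_tau[of m j 0 b r] bS unfolding n Kj(1) tau_0 using Kj(2) by simp

lemma comp_sy: assumes "b a ~= 0" "s \<in> sy m n" shows "a o s = a"
proof
 fix x
 have a: "a \<in> wd m K" using specht_supp[OF bS] assms(1) by blast
 show "(a o s) x = a x" proof (cases "x \<le> m")
  case False hence "a x = 0" "a (s x) = 0" using wd_out[OF a] syD(3)[OF assms(2), of x] by simp_all thus ?thesis by simp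
 qed (simp add: syD(2)[OF assms(2)])
qed

lemma b_sy: assumes s: "s \<in> sy m n" shows "ga s b = b"
proof
 fix a
 have "b (a o s) = b a" proof (cases "b (a o s) = 0")
  case False
  from comp_sy[OF False syD(4)[OF s]] have "a = a o s" using symD(5)[OF syD(1)[OF s]] by (simp add: comp_assoc)
  thus ?thesis by simp
 next case True
  have "b a = 0" proof (rule ccontr)
   assume nz: "b a ~= 0"
   from comp_sy[OF this s] nz True show False by simp
  qed
  thus ?thesis using True by simp
 qed
 thus "ga s b a = b a" by (simp add: ga_def)
qed

lemma eps_b: "act m eps b = b" unfolding act_br[OF bS bS] by simp

lemma b_nonzero: obtains a where "b a ~= 0"
proof -
 have "\<exists>a. b a ~= 0" proof (rule ccontr)
  assume "\<not> ?thesis"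
  hence "fm y b = 0" by (simp add: fm_def ip_def)
  thus False by simp
 qed
 with that show thesis by blast
qed

text \<open>The trace of the idempotent \<open>eps\<close> is the number of paths from
  \<open>K\<close> to \<open>T\<close>, which is 1, and \<open>b\<close> is a nonzero fixed
  vector.\<close>

lemma eps_T: assumes x: "x \<in> specht n T" obtains c where "act m eps x = (%a. c * b a)"
proof -
 let ?S = "specht n T" let ?F = "act m eps"
 have F: "?F f \<in> ?S" if "f \<in> ?S" for f by (rule act_br_specht[OF yT that])
 have idem: "?F (?F f) = ?F f" for f using br_mult[OF bS bS, of y y f] by simp
 obtain J b' where J: "pivot (?F ` ?S) J b'" "tr ?S ?F = of_nat (card J)"
  by (rule idempotent_trace[OF fdsp_specht[OF yT] lmap_act F idem]) blast+
 have "tr ?S ?F = of_nat (pathc K m r T)" using trace_br[OF bS, of r T y] yT n by simp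
 hence "card J = 1" using J(2) pathc_tau[of j r] Kj by (metis of_nat_eq_iff of_nat_1)
 then obtain p where p: "J = {p}" by (auto simp: card_1_singleton_iff)
 have ex: "f = (%a. f p * b' p a)" if "f \<in> ?F ` ?S" for f using pivotD(4)[OF J(1) that] unfolding p by simp
 have "?F b \<in> ?F ` ?S" using b_T by (rule imageI)
 hence bF: "b \<in> ?F ` ?S" unfolding eps_b .
 have bp: "b p ~= 0" proof
  assume "b p = 0"
  hence "b a = 0" for a using fun_cong[OF ex[OF bF], of a] by simp
  thus False using b_nonzero by blast
 qed
 have "?F x a = ?F x p / b p * b a" for a proof -
  have "?F x a = ?F x p * b' p a" by (rule fun_cong[OF ex[OF imageI[OF x]]])
  moreover have "b a = b p * b' p a" by (rule fun_cong[OF ex[OF bF]])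
  ultimately show ?thesis using bp by simp
 qed
 thus thesis by (intro that[of "?F x p / b p"] ext)
qed

definition zl :: "(nat \<times> rat) list" where
 "zl = (SOME xs. (\<forall>x\<in>set xs. zint (snd x)) \<and> (\<forall>E. young n E --> ediff E ~= ediff D --> zsc xs E = 0) \<and>
   (\<forall>E. young n E --> ediff E = ediff D --> zint (zsc xs E) \<and> \<not> zev (zsc xs E)))"

lemma zl: shows "x \<in> set zl ==> zint (snd x)" "young n E ==> ediff E ~= ediff D ==> zsc zl E = 0"
  "young n E ==> ediff E = ediff D ==> zint (zsc zl E)" "young n E ==> ediff E = ediff D ==> \<not> zev (zsc zl E)" proof -
 have "\<exists>xs. (\<forall>x\<in>set xs. zint (snd x)) \<and> (\<forall>E. young n E --> ediff E ~= ediff D --> zsc xs E = 0) \<and>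
   (\<forall>E. young n E --> ediff E = ediff D --> zint (zsc xs E) \<and> \<not> zev (zsc xs E))"
  by (rule block_separator[OF D]) blast
 from someI_ex[OF this] have "(\<forall>x\<in>set zl. zint (snd x)) \<and> (\<forall>E. young n E --> ediff E ~= ediff D --> zsc zl E = 0) \<and>
   (\<forall>E. young n E --> ediff E = ediff D --> zint (zsc zl E) \<and> \<not> zev (zsc zl E))" unfolding zl_def .
 thus "x \<in> set zl ==> zint (snd x)" "young n E ==> ediff E ~= ediff D ==> zsc zl E = 0"
  "young n E ==> ediff E = ediff D ==> zint (zsc zl E)" "young n E ==> ediff E = ediff D ==> \<not> zev (zsc zl E)"
  by blast+
qed

definition ze :: wfun where "ze = zop n zl eps"

definition shat :: wfun where "shat = (%g. of_bool (g \<in> sy m n))"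

text \<open>On every Specht module this symmetrizes over the last points, projects by
  \<open>eps\<close> and multiplies by the separating scalar. Only the module of \<open>T\<close>
  survives.\<close>

definition t0 :: wfun where "t0 = conv n ze shat"

lemma conv_zint: "(\<And>g. zint (u g)) ==> (\<And>g. zint (v g)) ==> zint (conv n u v g)"
 unfolding conv_def by (intro zint_sum zint_mult) blast+

lemma ze_zint: "zint (ze g)" unfolding ze_def by (rule zop_zint[OF zl(1) br_zint[OF y b]])

lemma t0_zint: "zint (t0 g)" unfolding t0_def by (rule conv_zint[OF ze_zint]) (simp add: shat_def)

lemma act_ze: assumes "young n E" "f \<in> specht n E" shows "act n ze f = (%a. zsc zl E * act m eps f a)"
 unfolding ze_def zop_act zop_specht[OF assms] act_linear act_br_n ..

lemma act_shat: "act n shat f = (%a. SUM s:sy m n. ga s f a)"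
proof
 fix a
 have "(SUM g:symg n. shat g * f (a o g)) = (SUM g:sy m n. shat g * f (a o g))"
  by (rule sum.mono_neutral_right) (use syD(1) in \<open>auto simp: shat_def\<close>)
 thus "act n shat f a = (SUM s:sy m n. ga s f a)" by (simp add: act_def shat_def ga_def)
qed

lemma sum_sy_left: assumes "t \<in> sy m n" shows "(SUM s:sy m n. F (t o s)) = (SUM s:sy m n. F s)"
proof (rule sum.reindex_bij_witness[of _ "%s. inv t o s" "%s. t o s"])
 fix s assume s: "s \<in> sy m n"
 have i: "inv t o (t o s) = s" "t o (inv t o s) = s"
  using symD(5,6)[OF syD(1)[OF assms]] by (simp_all add: comp_assoc[symmetric])
 show "inv t o (t o s) = s" "t o (inv t o s) = s" by (rule i)+
 show "t o s \<in> sy m n" "inv t o s \<in> sy m n" using sy_comp s assms syD(4)[OF assms] by blast+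
qed simp

lemma ga_shat: assumes "t \<in> sy m n" shows "ga t (act n shat f) = act n shat f"
proof
 fix a
 have "ga t (act n shat f) a = (SUM s:sy m n. ga (t o s) f a)" unfolding act_shat ga_ga[symmetric] by (simp add: ga_def)
 also have "... = (SUM s:sy m n. ga s f a)" by (rule sum_sy_left[OF assms, of "%s. ga s f a"])
 finally show "ga t (act n shat f) a = act n shat f a" unfolding act_shat .
qed

lemma shat_br: "act n shat (act m (br v u) f) = act m (br v u) (act n shat f)"
proof -
 have "act m (br v u) (act n shat f) = (%a. SUM s:sy m n. act m (br v u) (ga s f) a)"
  unfolding act_shat by (auto simp: act_def sum_distrib_left fun_eq_iff intro: sum.swap)
 also have "... = act n shat (act m (br v u) f)" unfolding act_shat by (rule ext, rule sum.cong) (simp_all add: ga_act_sy)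
 finally show ?thesis ..
qed

lemma shat_specht: "young n E ==> f \<in> specht n E ==> act n shat f \<in> specht n E" by (rule act_specht)

lemma act_t0: assumes "young n E" "f \<in> specht n E"
 shows "act n t0 f = (%a. zsc zl E * act m eps (act n shat f) a)"
 unfolding t0_def act_conv by (rule act_ze[OF assms(1) shat_specht[OF assms]])

text \<open>Outside the block the scalar is 0. Inside it, a nonzero value would satisfy the
  assumptions of \<open>pieri\<close>, and then \<open>hstrip_tau\<close> leaves only
  \<open>T\<close>.\<close>

lemma t0_other: assumes E: "young n E" "E ~= T" and f: "f \<in> specht n E" shows "act n t0 f = (%_. 0)"
proof (cases "ediff E = ediff D")
 case False thus ?thesis unfolding act_t0[OF E(1) f] zl(2)[OF E(1) False] by simp
next case True
 let ?h = "act m eps (act n shat f)"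
 have "?h = (%_. 0)" proof (rule ccontr)
  assume nz: "?h ~= (%_. 0)"
  have h: "?h \<in> specht n E" by (rule act_br_specht[OF E(1) shat_specht[OF E(1) f]])
  have e: "act m eps ?h = ?h" using br_mult[OF bS bS, of y y "act n shat f"] by simp
  have s: "\<forall>s\<in>sy m n. ga s ?h = ?h" using ga_act_sy ga_shat by simp
  have "hstrip K E" by (rule pieri[of r E ?h]) (use E h nz e s n in simp_all)
  hence "E = T" using hstrip_tau[of j r E] E(1) True ed n Kj by simp
  thus False using E(2) by simp
 qed
 thus ?thesis unfolding act_t0[OF E(1) f] by simp
qed

lemma t0_T: assumes f: "f \<in> specht n T" obtains c where "act n t0 f = (%a. c * b a)"
proof -
 obtain c where "act m eps (act n shat f) = (%a. c * b a)" by (rule eps_T[OF shat_specht[OF yT f]])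
 hence "act n t0 f = (%a. zsc zl T * c * b a)" unfolding act_t0[OF yT f] by simp
 with that show thesis .
qed

lemma t0_b: "act n t0 b = (%a. zsc zl T * of_nat (card (sy m n)) * b a)"
proof -
 have e: "act n shat b = (%a. of_nat (card (sy m n)) * b a)"  proof
  fix a
  have "(SUM s:sy m n. ga s b a) = (SUM s:sy m n. b a)" by (rule sum.cong[OF refl]) (simp only: b_sy)
  thus "act n shat b a = of_nat (card (sy m n)) * b a" unfolding act_shat sum_constant .
 qed
 show ?thesis unfolding act_t0[OF yT b_T] e act_linear(4) eps_b mult.assoc ..
qed

text \<open>The idempotent \<open>eps\<close> commutes with the symmetrization, so it is absorbed by
  the factor \<open>eps\<close> already present.\<close>

lemma t0_eps: assumes "young n E" "f \<in> specht n E" shows "act n t0 (act m eps f) = act n t0 f"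
 unfolding act_t0[OF assms] act_t0[OF assms(1) act_br_specht[OF assms]] shat_br
 using br_mult[OF bS bS, of y y "act n shat f"] by simp

lemma card_sy: "of_nat (card (sy m n)) ~= (0 :: rat)"
proof -
 have "sy m n ~= {}" using sy_id by blast
 thus ?thesis by (simp add: card_eq_0_iff)
qed

lemma conv_sy: assumes "s \<in> sy m n" shows "conv n u shat (g o s) = conv n u shat g"
proof -
 have "inv h o (g o s) \<in> sy m n \<longleftrightarrow> inv h o g \<in> sy m n" for h proof
  assume "inv h o g \<in> sy m n"
  from sy_comp[OF this assms] show "inv h o (g o s) \<in> sy m n" by (simp add: comp_assoc)
 next assume "inv h o (g o s) \<in> sy m n"
  from sy_comp[OF this syD(4)[OF assms]] have "inv h o g o (s o inv s) \<in> sy m n" by (simp add: comp_assoc)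
  thus "inv h o g \<in> sy m n" using symD(5)[OF syD(1)[OF assms]] by simp
 qed
 thus ?thesis by (simp add: conv_def shat_def)
qed

text \<open>The image of \<open>b\<close> lies in twice the lattice that \<open>b\<close> generates
  under the integral group ring.\<close>

definition div2 :: "wfun => bool" where
 "div2 U \<longleftrightarrow> (\<exists>a. (\<forall>g. zint (a g)) \<and> act n U b = (%x. 2 * act n a b x))"

definition annih :: "wfun => bool" where
 "annih U \<longleftrightarrow> (\<forall>g. zint (U g)) \<and> (\<forall>f\<in>specht n D. act n U f = (%_. 0))"

lemma annihD: "annih U ==> zint (U g)" "annih U ==> f \<in> specht n D ==> act n U f = (%_. 0)" by (auto simp: annih_def)

definition absorbs :: "wfun => bool" where
 "absorbs V \<longleftrightarrow> (\<forall>E. young n E --> (\<forall>f\<in>specht n E. act n V (act n t0 f) = act n t0 f))"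

lemma absorbsD: "absorbs V ==> young n E ==> f \<in> specht n E ==> act n V (act n t0 f) = act n t0 f"
 by (auto simp: absorbs_def)

text \<open>An element of the left ideal generated by t0 which is divisible by 2 in the integral group
 algebra is divisible by 2 on b as well: it is constant on the cosets of \<open>sy m n\<close>, which fixes b.\<close>

lemma divisible_t0: assumes U: "\<And>g. zint (U g)" and ev: "\<And>g. g \<in> symg n ==> zev (conv n U t0 g)"
 shows "div2 U"
proof -
 obtain R where R: "R \<subseteq> symg n" "\<And>F :: _ => rat. (\<And>g s. g \<in> symg n ==> s \<in> sy m n ==> F (g o s) = F g) ==>
   (SUM g:symg n. F g) = of_nat (card (sy m n)) * (SUM g:R. F g)" by (rule transversal[of n m]) blast
 let ?X = "conv n U t0" let ?N = "of_nat (card (sy m n)) :: rat" let ?z = "zsc zl T"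
 have z: "zint ?z" "\<not> zev ?z" using zl(3,4)[OF yT ediff_T] by blast+
 have z0: "?z ~= 0" using z(2) by auto
 \<comment> \<open>One coefficient for each coset: the coefficients of the product and the
   translates of \<open>b\<close> are constant on cosets, so the size of a coset cancels against the
   factor \<open>card (sy m n)\<close> in \<open>t0_b\<close>.\<close>
 define a where "a g = (if g \<in> R then ?X g / 2 * (1 / ?z) else 0)" for g
 have az: "zint (a g)" for g proof (cases "g \<in> R")
  case True hence "zint (?X g / 2)" using ev R(1) unfolding zev_def by blast
  from zint_mult[OF this zint_inverse(1)[OF z]] show ?thesis unfolding a_def if_P[OF True] .
 qed (simp add: a_def)
 have inv: "?X (g o s) = ?X g" if "s \<in> sy m n" for g s proof -
  have "t0 (inv h o (g o s)) = t0 (inv h o g)" for h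
   unfolding t0_def using conv_sy[OF that, of ze "inv h o g"] by (simp add: comp_assoc)
  thus ?thesis by (simp add: conv_def)
 qed
 have main: "act n U b x = 2 * act n a b x" for x proof -
  have "act n ?X b x = ?N * (SUM g:R. ?X g * b (x o g))" unfolding act_def proof (rule R(2))
   fix g s assume s: "s \<in> sy m n"
   have "b (x o (g o s)) = b (x o g)" using fun_cong[OF b_sy[OF s], of "x o g"] by (simp add: ga_def comp_assoc)
   thus "?X (g o s) * b (x o (g o s)) = ?X g * b (x o g)" using inv[OF s] by simp
  qed
  moreover have "act n ?X b x = ?z * ?N * act n U b x" unfolding act_conv t0_b act_linear ..
  ultimately have "?N * (?z * act n U b x) = ?N * (SUM g:R. ?X g * b (x o g))" by (simp add: mult_ac)
  hence e: "?z * act n U b x = (SUM g:R. ?X g * b (x o g))" using card_sy by simp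
  have "2 * act n a b x = 2 * (SUM g:R. a g * b (x o g))" proof -
   have "(SUM g:symg n. a g * b (x o g)) = (SUM g:R. a g * b (x o g))"
    by (rule sum.mono_neutral_right) (use R(1) in \<open>auto simp: a_def\<close>)
   thus ?thesis by (simp add: act_def)
  qed
  also have "... = (SUM g:R. ?X g * b (x o g)) / ?z" by (simp add: a_def sum_distrib_left sum_divide_distrib)
  also have "... = act n U b x" using z0 unfolding e[symmetric] by simp
  finally show ?thesis ..
 qed
 show ?thesis unfolding div2_def proof (rule exI[of _ a], rule conjI)
  show "\<forall>g. zint (a g)" by (rule allI) (rule az)
  show "act n U b = (%x. 2 * act n a b x)" by (rule ext) (rule main)
 qed
qed

text \<open>The product of \<open>U\<close> and \<open>t0\<close> has an odd coefficient at some
  \<open>g0\<close>. As \<open>eps\<close> maps the module of \<open>T\<close> to multiples of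
  \<open>b\<close>, the product of \<open>eps\<close>, the inverse of \<open>g0\<close> and
  \<open>U\<close> multiplies \<open>t0\<close> by a scalar \<open>c\<close>. Comparing coefficients
  at the identity, \<open>c * t0 id\<close> is that odd coefficient, so \<open>1 / c\<close> is
  integral and \<open>c\<close> can be divided out.\<close>

lemma absorbing_element: assumes ann: "annih U" and nd: "\<not> div2 U"
 shows "\<exists>V. annih V \<and> absorbs V"
proof -
 note U = annihD[OF ann]
 let ?X = "conv n U t0"
 have "\<exists>g0\<in>symg n. \<not> zev (?X g0)" proof (rule ccontr)
  assume ev: "\<not> ?thesis"
  have "div2 U" proof (rule divisible_t0)
   show "zint (U g)" for g by (rule U(1))
   show "zev (?X g)" if "g \<in> symg n" for g using ev that by blast
  qed
  thus False using nd by contradiction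
 qed
 then obtain g0 where g0: "g0 \<in> symg n" "\<not> zev (?X g0)" by blast
 have Xz: "zint (?X g)" for g by (rule conv_zint) (rule U(1) t0_zint)+
 let ?d = "%g. of_bool (g = inv g0) :: rat"
 have i0: "inv g0 \<in> symg n" by (rule symD(4)[OF g0(1)])
 obtain c where c: "act m eps (ga (inv g0) (act n U b)) = (%a. c * b a)"
  by (rule eps_T[OF ga_specht[OF yT i0 act_specht[OF yT b_T]]])
 define V2 where "V2 = conv n eps (conv n ?d U)"
 have V2: "act n V2 f = act m eps (ga (inv g0) (act n U f))" for f unfolding V2_def act_conv act_delta[OF i0] act_br_n ..
 have V2t: "act n V2 (act n t0 f) = (%a. c * act n t0 f a)" if E: "young n E" "f \<in> specht n E" for E f
 proof (cases "E = T")
  case True hence f: "f \<in> specht n T" using E by simp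
  obtain d where d: "act n t0 f = (%a. d * b a)" by (rule t0_T[OF f])
  have "act n V2 (%a. d * b a) = (%a. d * act n V2 b a)" by (rule act_linear(4))
  also have "act n V2 b = (%a. c * b a)" unfolding V2 by (rule c)
  finally have "act n V2 (%a. d * b a) = (%a. d * (c * b a))" .
  moreover have "(%a. d * (c * b a)) = (%a. c * (d * b a))" by (rule ext) (rule mult.left_commute)
  ultimately show ?thesis unfolding d by (rule trans)
 next case False
  have "act n V2 (%_. 0) = (%_. 0)" by (rule act_linear(6))
  thus ?thesis unfolding t0_other[OF E(1) False E(2)] mult_zero_right .
 qed
 define Y where "Y = conv n eps (conv n ?d ?X)"
 have Yc: "Y g = c * t0 g" if "g \<in> symg n" for g proof (rule faithful_eq[OF _ that])
  fix E f assume E: "young n E" "f \<in> specht n E"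
  have "act n Y f = act n V2 (act n t0 f)" unfolding Y_def V2 act_conv act_delta[OF i0] act_br_n ..
  thus "act n Y f = act n (%g. c * t0 g) f" unfolding V2t[OF E] act_linear .
 qed
 have dX: "conv n ?d ?X g = ?X (g0 o g)" for g
  unfolding conv_def[of n ?d] sum_of_bool_eq(1)[OF finite_sym i0] symD(7)[OF g0(1)] ..
 \<comment> \<open>By \<open>t0_eps\<close> a factor \<open>eps\<close> on the right changes
   nothing. The coefficient at the identity of \<open>Y\<close>, where \<open>eps\<close> stands on
   the left, is rewritten below as this one.\<close>
 have Xeps: "conv n ?X eps g0 = ?X g0" proof (rule faithful_eq[OF _ g0(1)])
  fix E f assume E: "young n E" "f \<in> specht n E"
  show "act n (conv n ?X eps) f = act n ?X f" unfolding act_conv act_br_n t0_eps[OF E] ..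
 qed
 have "Y id = (SUM h:symg n. eps h * ?X (g0 o inv h))" unfolding Y_def conv_def[of n eps] dX by simp
 also have "... = (SUM h:symg n. ?X h * eps (inv h o g0))"
 proof (rule sum.reindex_bij_witness[of _ "%k. inv k o g0" "%h. g0 o inv h"])
  fix h assume h: "h \<in> symg n"
  have 1: "inv (g0 o inv h) o g0 = h"
   using symD(6)[OF g0(1)] by (simp add: inv_comp[OF g0(1) symD(4)[OF h]] symD(7)[OF h] comp_assoc)
  show "inv (g0 o inv h) o g0 = h" by (rule 1)
  show "g0 o inv h \<in> symg n" by (rule sym_comp[OF g0(1) symD(4)[OF h]])
  show "?X (g0 o inv h) * eps (inv (g0 o inv h) o g0) = eps h * ?X (g0 o inv h)" unfolding 1 by simp
 next fix k assume k: "k \<in> symg n"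
  show "inv k o g0 \<in> symg n" by (rule sym_comp[OF symD(4)[OF k] g0(1)])
  show "g0 o inv (inv k o g0) = k"
   using symD(5)[OF g0(1)] by (simp add: inv_comp[OF symD(4)[OF k] g0(1)] symD(7)[OF k] comp_assoc[symmetric])
 qed
 also have "... = ?X g0" using Xeps by (simp add: conv_def[of n ?X])
 finally have Xc: "?X g0 = c * t0 id" using Yc[OF sym_id] by simp
 have c0: "c ~= 0" using Xc g0(2) by auto
 have X0: "?X g0 ~= 0" using g0(2) by auto
 have "1 / c = t0 id * (1 / ?X g0)" using Xc c0 X0 by (simp add: field_simps)
 hence ci: "zint (1 / c)" using zint_mult[OF t0_zint zint_inverse(1)[OF Xz g0(2)]] by simp
 define V where "V g = 1 / c * V2 g" for g
 have Va: "act n V f = (%a. 1 / c * act n V2 f a)" for f unfolding V_def[abs_def] by (rule act_linear(3))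
 have V2z: "zint (V2 g)" for g unfolding V2_def by (intro conv_zint br_zint[OF y b] U(1)) simp
 have "annih V" unfolding annih_def proof (intro conjI allI ballI)
  show "zint (V g)" for g unfolding V_def by (rule zint_mult[OF ci V2z])
  show "act n V f = (%_. 0)" if "f \<in> specht n D" for f unfolding Va V2 U(2)[OF that] by (simp add: act_def ga_def)
 qed
 moreover have "absorbs V" unfolding absorbs_def proof (intro allI impI ballI)
  show "act n V (act n t0 f) = act n t0 f" if "young n E" "f \<in> specht n E" for E f
   unfolding Va V2t[OF that] using c0 by simp
 qed
 ultimately show ?thesis by blast
qed

end

section \<open>Lifting a vanishing Kronecker coefficient to characteristic two\<close>

lemma clear_denominator: "\<exists>e. zint (2 ^ e * q)"
proof -
 obtain a c where q: "q = of_int a / of_int c" "c ~= 0"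
  using quotient_of_div[of q] quotient_of_denom_pos[of q] by (metis less_irrefl prod.collapse)
 obtain d where d: "c = 2 ^ multiplicity 2 c * d" "odd d" using multiplicity_decompose'[of c 2] q(2) by (metis odd_one)
 have "2 ^ multiplicity 2 c * q = of_int a / of_int d" proof -
  have "of_int c = (2 ^ multiplicity 2 c * of_int d :: rat)" by (subst d(1)) simp
  thus ?thesis unfolding q(1) by simp
 qed
 thus ?thesis using d(2) unfolding zint_def by blast
qed

lemma clear_denominators: "finite Q ==> \<exists>e. \<forall>q\<in>Q. zint (2 ^ e * q)"
proof (induction Q rule: finite_induct)
 case (insert q Q) then obtain e where e: "\<forall>q\<in>Q. zint (2 ^ e * q)" by blast
 obtain d where d: "zint (2 ^ d * q)" using clear_denominator by blast
 have "zint (2 ^ (e + d) * x)" if "x \<in> insert q Q" for x proof -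
  have "zint (2 ^ e * (2 ^ d * q))" by (rule zint_mult[OF _ d]) (rule zint_power, simp)
  moreover have "zint (2 ^ d * (2 ^ e * x))" if "x \<in> Q"
   by (rule zint_mult[OF _ bspec[OF e that]]) (rule zint_power, simp)
  ultimately show ?thesis using that by (auto simp: power_add mult_ac)
 qed
 thus ?case by blast
qed simp

context fong begin

text \<open>The lattice generated by \<open>b\<close> under the integral group ring; membership is a
  stronger condition than having integral values.\<close>

definition Lb :: "wfun => bool" where
 "Lb x \<longleftrightarrow> (\<exists>a. (\<forall>g. zint (a g)) \<and> x = act n a b)"

lemma Lb_act: "(\<And>g. zint (a g)) ==> Lb (act n a b)" unfolding Lb_def by (intro exI[of _ a] conjI allI refl)

lemma Lb_add: assumes "Lb x" "Lb x'" shows "Lb (%a. x a + x' a)"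
proof -
 obtain a a' where a: "\<forall>g. zint (a g)" "x = act n a b" "\<forall>g. zint (a' g)" "x' = act n a' b"
  using assms unfolding Lb_def by (elim exE conjE)
 have "Lb (act n (%g. a g + a' g) b)" by (rule Lb_act) (use a in auto)
 thus ?thesis unfolding act_linear(1) a(2,4) .
qed

lemma Lb_scale: assumes "Lb x" "zint c" shows "Lb (%a. c * x a)"
proof -
 obtain a where a: "\<forall>g. zint (a g)" "x = act n a b" using assms(1) unfolding Lb_def by (elim exE conjE)
 have "Lb (act n (%g. c * a g) b)" by (rule Lb_act) (use a assms(2) in auto)
 thus ?thesis unfolding act_linear(3) a(2) .
qed

lemma Lb_sum: assumes "finite J" "\<And>i. i \<in> J ==> Lb (f i)" shows "Lb (%a. SUM i:J. f i a)" using assms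
proof (induction J rule: finite_induct)
 case empty
 have "Lb (act n (%_. 0) b)" by (rule Lb_act) simp
 thus ?case by (simp add: act_def)
next case (insert i J)
 have "Lb (%a. f i a + (SUM i:J. f i a))" by (rule Lb_add) (use insert in auto)
 thus ?case using insert.hyps by simp
qed

lemma Lb_zint: assumes "Lb x" shows "zint (x a)"
proof -
 obtain c where c: "\<forall>g. zint (c g)" "x = act n c b" using assms unfolding Lb_def by (elim exE conjE)
 show ?thesis unfolding c(2) by (rule act_zint) (use c(1) latD(2)[OF b] in auto)
qed

lemma annih_Lb: assumes H: "\<And>U. annih U ==> div2 U" and U: "annih U" and x: "Lb x"
 shows "Lb (%a. act n U x a / 2)"
proof -
 obtain c where c: "\<forall>g. zint (c g)" "x = act n c b" using x unfolding Lb_def by (elim exE conjE)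
 have "annih (conv n U c)" unfolding annih_def proof (intro conjI allI ballI)
  show "zint (conv n U c g)" for g by (rule conv_zint) (use annihD(1)[OF U] c(1) in auto)
  show "act n (conv n U c) f = (%_. 0)" if "f \<in> specht n D" for f
   unfolding act_conv by (rule annihD(2)[OF U act_specht[OF D that]])
 qed
 from H[OF this] obtain d where d: "\<forall>g. zint (d g)" "act n (conv n U c) b = (%x. 2 * act n d b x)"
  unfolding div2_def by (elim exE conjE)
 have "(%a. act n U x a / 2) = act n d b" using d(2) unfolding act_conv c(2)[symmetric] by simp
 thus ?thesis using Lb_act[of d] d(1) by simp
qed

text \<open>Schur's relation for the evaluation at a point where \<open>b\<close> is nonzero writes
  every vector as an explicit combination of translates of \<open>b\<close>.\<close>

lemma T_generated: "\<exists>C p. \<forall>x\<in>specht n T. x = act n (%g. C * x (p o inv g)) b"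
proof -
 obtain p where p: "b p ~= 0" by (rule b_nonzero)
 let ?d = "of_nat (sdim n T) :: rat"
 have d0: "?d ~= 0" using sdim_pos[OF yT] by simp
 let ?C = "?d / (fact n * b p)"
 have "x = act n (%g. ?C * x (p o inv g)) b" if x: "x \<in> specht n T" for x proof
  fix a
  have "avg n (%f. f p) b x a = fact n * b p / ?d * x a" by (rule fun_cong[OF schur_scalar[OF yT lfun_eval b_T x]])
  hence "x a = ?C * avg n (%f. f p) b x a" using p d0 by simp
  also have "... = act n (%g. ?C * x (p o inv g)) b a"
   unfolding avg_def act_def ga_def sum_distrib_left by (simp only: mult.assoc)
  finally show "x a = act n (%g. ?C * x (p o inv g)) b a" .
 qed
 thus ?thesis by (intro exI[of _ ?C] exI[of _ p] ballI)
qed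

text \<open>Suppose every annihilator maps \<open>b\<close> into twice its lattice. The invariant is
  scaled so that all its slices lie in the lattice but not all their halves do. Products of
  coefficients of two staircase vectors are annihilators by \<open>ten\<close>, and Schur's relation
  for the staircase, whose constant is a unit, recovers the slices from their actions; so the halves
  would lie in the lattice as well.\<close>

lemma lift_element: assumes k: "n = \<Sum>{..k}"
  and ten: "\<And>u v f a1 a2 a3. u \<in> specht n (stair k) ==> v \<in> specht n (stair k) ==> f \<in> specht n D ==>
   (SUM g:symg n. u (a1 o g) * v (a2 o g) * f (a3 o g)) = 0"
 shows "\<exists>U. annih U \<and> \<not> div2 U"
proof (rule ccontr)
 assume "\<not> ?thesis"
 hence H: "div2 U" if "annih U" for U using that by blast
 let ?R = "stair k"
 have yR: "young n ?R" unfolding k by (rule stair_young)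
 have "nzinv n ?R ?R T" unfolding k by (rule nzinv_stairs) (use nzinv_core Kj n k in simp_all)
 moreover define nz where "nz F \<longleftrightarrow> (\<exists>u v w. F u v w ~= 0)" for F :: "word => word => wfun"
 ultimately have "\<exists>F. inv3 n ?R ?R T F \<and> nz F" unfolding nzinv_def nz_def by simp
 then obtain F where F0: "inv3 n ?R ?R T F" "nz F" by blast
 obtain u v w where Fn: "F u v w ~= 0" using F0(2) unfolding nz_def by (elim exE)
 note F = F0(1) Fn
 obtain C p where Cp: "\<forall>x\<in>specht n T. x = act n (%g. C * x (p o inv g)) b" using T_generated by (elim exE)
 obtain e0 where e0: "zint (2 ^ e0 * (C * F x z a))" for x z a proof -
  let ?Q = "(%(x, z, a). C * F x z a) ` (wd n ?R \<times> wd n ?R \<times> wd n T)"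
  have "finite ?Q"
   using finite_wd[OF youngD(1)[OF yR]] finite_wd[OF youngD(1)[OF yT]] by (intro finite_imageI finite_cartesian_product)
  then obtain e where e: "\<forall>q\<in>?Q. zint (2 ^ e * q)" using clear_denominators by blast
  have "zint (2 ^ e * (C * F x z a))" for x z a proof (cases "F x z a = 0")
   case False
   from inv3_supp[OF F(1), OF False] have "(x, z, a) \<in> wd n ?R \<times> wd n ?R \<times> wd n T" by simp
   hence "C * F x z a \<in> ?Q" by (intro image_eqI[of _ _ "(x, z, a)"]) simp_all
   thus ?thesis using e by blast
  qed simp
  thus thesis by (rule that)
 qed
 obtain N where N: "\<not> zint (F u v w / 2 ^ N)" using zint_pow2_bound[OF F(2)] by blast
 \<comment> \<open>The choice of \<open>N\<close> makes \<open>P 0\<close> fail, and clearing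
   denominators makes \<open>P (N + e0)\<close> hold, so somewhere in between \<open>P\<close>
   changes from false to true.\<close>
 define P where "P e \<longleftrightarrow> (\<forall>x z. Lb (%a. 2 ^ e / 2 ^ N * F x z a))" for e :: nat
 have "P (N + e0)" unfolding P_def proof (intro allI)
  fix x z
  have x: "(%a. F x z a) \<in> specht n T" by (rule inv3D(3)[OF F(1)])
  have "Lb (act n (%g. 2 ^ e0 * (C * F x z (p o inv g))) b)" by (rule Lb_act) (rule e0)
  also have "act n (%g. 2 ^ e0 * (C * F x z (p o inv g))) b = (%a. 2 ^ e0 * F x z a)" proof -
   have "act n (%g. 2 ^ e0 * (C * F x z (p o inv g))) b = (%a. 2 ^ e0 * act n (%g. C * F x z (p o inv g)) b a)"
    by (rule act_linear(3))
   moreover have "act n (%g. C * F x z (p o inv g)) b = (%a. F x z a)" by (rule bspec[OF Cp x, symmetric])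
   ultimately show ?thesis by simp
  qed
  finally show "Lb (%a. 2 ^ (N + e0) / 2 ^ N * F x z a)" by (simp add: power_add)
 qed
 moreover have "\<not> P 0" proof
  assume "P 0"
  hence "Lb (%a. 2 ^ 0 / 2 ^ N * F u v a)" unfolding P_def by blast
  from Lb_zint[OF this, of w] N show False by simp
 qed
 ultimately obtain e where e: "\<not> P e" "P (Suc e)" proof -
  assume a: "P (N + e0)" "\<not> P 0" and t: "\<And>e. \<not> P e ==> P (Suc e) ==> thesis"
  have "P d ==> thesis" for d by (induction d) (use a(2) t in blast)+
  thus thesis using a(1) by blast
 qed
 define G where "G x z a = 2 ^ Suc e / 2 ^ N * F x z a" for x z a
 have GL: "Lb (G x z)" for x z using e(2) unfolding P_def G_def[abs_def] by blast
 let ?c = "fact n / of_nat (sdim n ?R) :: rat"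
 have c: "zint ?c" "\<not> zev ?c" using stair_degree_unit[OF k] sdim_eq_syt[OF yR] by simp_all
 have c0: "?c ~= 0" using c(2) zev_0 by metis
 obtain j0 where j0: "j0 \<in> pJ n ?R" using sdim_pos[OF yR] unfolding sdim_def by fastforce
 note piv = pivot_specht(1)[OF yR]
 have "P e" unfolding P_def proof (intro allI)
  fix a1 a2 :: word
  define U where "U i g = pB n ?R j0 (a1 o g) * pB n ?R i (a2 o g)" for i :: word and g :: word
  have ann: "annih (U i)" if i: "i \<in> pJ n ?R" for i unfolding annih_def proof (intro conjI allI ballI)
   show "zint (U i g)" for g unfolding U_def by (intro zint_mult pivot_specht(2)[OF yR] j0 i)
   fix f assume f: "f \<in> specht n D"
   show "act n (U i) f = (%_. 0)" unfolding act_def U_def by (rule ext) (rule ten[OF pBD(2)[OF yR j0] pBD(2)[OF yR i] f])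
  qed
  have "Lb (%a. SUM i:pJ n ?R. act n (U i) (G j0 i) a / 2)"
   by (rule Lb_sum[OF pivotD(1)[OF piv]]) (rule annih_Lb[OF H ann GL])
  \<comment> \<open>Summing over \<open>i\<close> is the expansion of the second argument in the
    pivot basis. By invariance of \<open>G\<close> the remaining sum over the group is a Schur
    relation in the first argument.\<close>
  also have "(%a. SUM i:pJ n ?R. act n (U i) (G j0 i) a / 2) = (%a. ?c * G a1 a2 a / 2)" proof
   fix a
   have Gs: "(%z. G x z y') \<in> specht n ?R" "(%x. G x z y') \<in> specht n ?R" for x z y'
    unfolding G_def by (rule lsp_scale[OF lsp_specht], rule inv3D[OF F(1)])+
   have Gi: "G (x o g) (z o g) (t o g) = G x z t" if "g \<in> symg n" for x z t g
    unfolding G_def using inv3D(4)[OF F(1) that] by simp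
   have "(SUM i:pJ n ?R. act n (U i) (G j0 i) a) = (SUM g:symg n. SUM i:pJ n ?R. U i g * G j0 i (a o g))"
    unfolding act_def by (rule sum.swap)
   also have "... = (SUM g:symg n. pB n ?R j0 (a1 o g) * G (j0 o inv g) a2 a)" proof (rule sum.cong[OF refl])
    fix g assume g: "g \<in> symg n"
    have "(SUM i:pJ n ?R. U i g * G j0 i (a o g)) = pB n ?R j0 (a1 o g) * (SUM i:pJ n ?R. G j0 i (a o g) * pB n ?R i (a2 o g))"
     unfolding U_def by (simp add: sum_distrib_left mult_ac)
    also have "(SUM i:pJ n ?R. G j0 i (a o g) * pB n ?R i (a2 o g)) = G j0 (a2 o g) (a o g)"
     by (rule fun_cong[OF pivotD(4)[OF piv Gs(1)], symmetric])
    also have "... = G ((j0 o inv g) o g) (a2 o g) (a o g)" using symD(6)[OF g] by (simp add: comp_assoc)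
    also have "... = G (j0 o inv g) a2 a" by (rule Gi[OF g])
    finally show "(SUM i:pJ n ?R. U i g * G j0 i (a o g)) = pB n ?R j0 (a1 o g) * G (j0 o inv g) a2 a" .
   qed
   also have "... = ?c * G a1 a2 a * pB n ?R j0 j0"
    using schur_functional[OF yR lfun_eval[of UNIV a1] lfun_eval[of UNIV j0] pBD(2)[OF yR j0] Gs(2)[of a2 a]]
    unfolding ga_def .
   also have "... = ?c * G a1 a2 a" using pBD(3)[OF yR j0 j0] by simp
   finally show "(SUM i:pJ n ?R. act n (U i) (G j0 i) a / 2) = ?c * G a1 a2 a / 2"
    unfolding sum_divide_distrib[symmetric] by simp
  qed
  finally have "Lb (%a. 1 / ?c * (?c * G a1 a2 a / 2))" by (rule Lb_scale[OF _ zint_inverse(1)[OF c]])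
  moreover have "(%a. 1 / ?c * (?c * G a1 a2 a / 2)) = (%a. 2 ^ e / 2 ^ N * F a1 a2 a)" proof
   fix a
   have "1 / ?c * (?c * G a1 a2 a / 2) = G a1 a2 a / 2" using c0 by simp
   thus "1 / ?c * (?c * G a1 a2 a / 2) = 2 ^ e / 2 ^ N * F a1 a2 a" unfolding G_def by simp
  qed
  ultimately show "Lb (%a. 2 ^ e / 2 ^ N * F a1 a2 a)" by simp
 qed
 with e(1) show False by contradiction
qed

section \<open>The form on the bottom layer\<close>

text \<open>The element \<open>X\<close> acts on the module of \<open>D\<close> like
  \<open>ze\<close>, since \<open>V\<close> acts there as 0, while its coefficients sum to 0 over
  cosets of \<open>sy m n\<close>, since \<open>V\<close> fixes \<open>t0\<close>. For the adjoint
  \<open>w\<close> of \<open>X\<close> and a vector of odd norm, the double sum of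
  \<open>quadratic_parity\<close> is odd by the first property, and its diagonal is 0 by the
  second.\<close>

lemma absorbing_impossible: assumes V: "annih V" "absorbs V" shows False
proof -
 let ?S = "specht n D" let ?W = "wd n D"
 \<comment> \<open>\<open>?es\<close> is the adjoint of \<open>eps\<close>. The self-adjoint
   \<open>?gam\<close> carries the image of \<open>?es\<close> to that of \<open>eps\<close>, and
   \<open>?del\<close> carries it back.\<close>
 let ?es = "br y b" and ?gam = "br b b" and ?del = "br y y"
 let ?s = "zsc zl D"
 have s: "zint ?s" "\<not> zev ?s" using zl(3,4)[OF D refl] by blast+
 note acS = act_br_specht[OF D]
 have posdef: "f = (%_. 0)" if f: "f \<in> ?S" and z: "ip ?W f f = 0" for f proof
  fix a show "f a = 0" using ip_zero[OF finite_wd[OF youngD(1)[OF D]] z, of a] specht_supp[OF f, of a] by blast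
 qed
 have adj: "ip ?W (act m (br v u) f) h = ip ?W f (act m (br u v) h)" for u v f h proof -
  have "ip ?W (act n (br v u) f) h = ip ?W f (act n (%g. br v u (inv g)) h)" by (rule ip_act)
  also have "act n (%g. br v u (inv g)) h = act n (br u v) h" proof (rule act_cong)
   fix g assume g: "g \<in> symg n"
   show "br v u (inv g) = br u v g" proof (cases "g \<in> symg m")
    case True thus ?thesis by (rule br_inv)
   next case False
    hence "inv g \<notin> symg m" using symD(4)[of "inv g" m] symD(7)[OF g] by auto
    thus ?thesis using False by (simp add: br_out)
   qed
  qed
  finally show ?thesis unfolding act_br_n .
 qed
 define X where "X g = ze g - conv n V ze g" for g
 have Xz: "zint (X g)" for g unfolding X_def by (intro zint_diff ze_zint conv_zint annihD(1)[OF V(1)])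
 have actX: "act n X f = (%a. act n ze f a - act n V (act n ze f) a)" for f
  unfolding X_def[abs_def] act_linear(2) act_conv ..
 \<comment> \<open>These coset sums are the coefficients of the product of \<open>X\<close> with
   \<open>shat\<close>, which is the difference of \<open>t0\<close> and its product with
   \<open>V\<close>, hence 0.\<close>
 have Xsum: "(SUM t:sy m n. X (g o inv t)) = 0" if g: "g \<in> symg n" for g proof -
  have "conv n X shat g = (%_. 0) g" proof (rule faithful_eq[OF _ g])
   fix E f assume E: "young n E" "f \<in> specht n E"
   have "act n ze (act n shat f) = act n t0 f" unfolding t0_def act_conv ..
   hence "act n (conv n X shat) f = (%_. 0)" unfolding act_conv actX using absorbsD[OF V(2) E] by simp
   thus "act n (conv n X shat) f = act n (%_. 0) f" by (simp add: act_def)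
  qed
  moreover have "conv n X shat g = (SUM t:sy m n. X (g o inv t))" proof -
   have "conv n X shat g = (SUM h:(%t. g o inv t) ` sy m n. X h)" unfolding conv_def
   proof (rule sum.mono_neutral_cong_right)
    show "(%t. g o inv t) ` sy m n \<subseteq> symg n" using sym_comp[OF g syD(1)[OF syD(4)]] by auto
    have mem: "h = g o inv (inv h o g)" if "h \<in> symg n" for h
     using symD(5)[OF g] by (simp add: inv_comp[OF symD(4)[OF that] g] symD(7)[OF that] comp_assoc[symmetric])
    show "\<forall>h\<in>symg n - (%t. g o inv t) ` sy m n. X h * shat (inv h o g) = 0" using mem by (auto simp: shat_def)
    fix h assume "h \<in> (%t. g o inv t) ` sy m n"
    then obtain t where t: "t \<in> sy m n" "h = g o inv t" by blast
    have "inv h o g = t" unfolding t(2) inv_comp[OF g syD(1)[OF syD(4)[OF t(1)]]] symD(7)[OF syD(1)[OF t(1)]]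
     using symD(6)[OF g] by (simp add: comp_assoc)
    thus "X h * shat (inv h o g) = X h" using t(1) by (simp add: shat_def)
   qed simp
   also have "... = (SUM t:sy m n. X (g o inv t))" proof (rule sum.reindex_cong[of "%t. g o inv t"])
    show "inj_on (%t. g o inv t) (sy m n)" proof (rule inj_onI)
     fix t t' assume t: "t \<in> sy m n" "t' \<in> sy m n" "g o inv t = g o inv t'"
     hence "inv g o g o inv t = inv g o g o inv t'" by (simp add: comp_assoc)
     hence "inv t = inv t'" using symD(6)[OF g] by simp
     thus "t = t'" using symD(7)[OF syD(1)[OF t(1)]] symD(7)[OF syD(1)[OF t(2)]] by metis
    qed
   qed simp_all
   finally show ?thesis .
  qed
  ultimately show ?thesis by simp
 qed
 \<comment> \<open>Inversion gives the adjoint, so on the module of \<open>D\<close> this acts as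
   \<open>?s\<close> times \<open>?es\<close>.\<close>
 define w where "w g = X (inv g)" for g
 have wz: "zint (w g)" for g unfolding w_def by (rule Xz)
 have wv: "act n w v = (%a. ?s * act m ?es v a)" if v: "v \<in> ?S" for v proof -
  let ?u = "%a. act n w v a - ?s * act m ?es v a"
  have uS: "?u \<in> ?S" by (rule lsp_diff[OF lsp_specht act_specht[OF D v] lsp_scale[OF lsp_specht acS[OF v]]])
  have "ip ?W ?u h = 0" if h: "h \<in> ?S" for h proof -
   have "ip ?W (act n w v) h = ip ?W v (act n (%g. w (inv g)) h)" by (rule ip_act)
   also have "act n (%g. w (inv g)) h = act n X h" by (rule act_cong) (simp add: w_def symD(7))
   also have "act n X h = (%a. ?s * act m eps h a)" proof -
    have "act n V (act n ze h) = (%_. 0)" by (rule annihD(2)[OF V(1) act_specht[OF D h]])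
    thus ?thesis unfolding actX act_ze[OF D h] by simp
   qed
   finally have "ip ?W (act n w v) h = ?s * ip ?W v (act m eps h)" unfolding ip_linear(3) .
   thus ?thesis unfolding ip_commute[of ?W _ h] ip_linear(2,3) using adj[of y b v h] by (simp add: ip_commute[of ?W h])
  qed
  from posdef[OF uS this[OF uS]] have "?u a = 0" for a by (rule fun_cong)
  thus ?thesis by (intro ext) simp
 qed
 let ?V = "act m ?es ` ?S"
 have mult: "act m (br v u) (act m (br v' u') f) = (%a. fm u v' * act m (br v u') f a)"
  if "v \<in> {b, y}" "v' \<in> {b, y}" for v v' u u' f using br_mult[of v v'] bS yS that by blast
 have es_gam: "act m ?gam (act m ?es f) = act m ?gam f" "act m ?es (act m ?es f) = act m ?es f"
  "act m eps (act m ?gam f) = act m ?gam f" "act m ?del (act m ?gam f) = act m ?es f"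
  "act m ?gam (act m ?del f) = act m eps f" for f by (simp_all add: mult)
 obtain J0 b0 where J0: "fdsp ?W ?V" "pivot ?V J0 b0" "tr ?S (act m ?es) = of_nat (card J0)"
  by (rule idempotent_trace[OF fdsp_specht[OF D] lmap_act acS es_gam(2)]) blast+
 define intg where "intg J e \<longleftrightarrow> (\<forall>i\<in>J. \<forall>a. zint (e i a))"
  for J and e :: "word => wfun"
 have "\<exists>J e. J \<subseteq> ?W \<and> pivot ?V J e \<and> intg J e" unfolding intg_def proof (rule integral_pivot)
  show "finite ?W" "lsp ?V" by (rule fdspD[OF J0(1)])+
  show "f a = 0" if "f \<in> ?V" "a \<notin> ?W" for f a using fdspD(3)[OF J0(1) that] .
 qed
 then obtain J e where J: "pivot ?V J e" and Je: "intg J e" by blast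
 note Jz = Je[unfolded intg_def]
 have lV: "lsp ?V" by (rule fdspD(2)[OF J0(1)])
 have "card J = card J0" by (rule frame_card_eq[OF lV pivot_frame[OF J] pivot_frame[OF J0(2)]])
 hence "(of_nat (card J) :: rat) = of_nat (pathc K m r D)" using J0(3) trace_br[OF yS, of r D b] D n by simp
 hence oddJ: "odd (card J)" using odd_paths by simp
 note finJ = pivotD(1)[OF J]
 have VS: "v \<in> ?S \<and> act m ?es v = v" if v: "v \<in> ?V" for v proof -
  obtain x where "x \<in> ?S" "v = act m ?es x" using v by blast
  thus ?thesis using acS es_gam(2) by simp
 qed
 have eV: "e i \<in> ?V" if "i \<in> J" for i by (rule pivotD(2)[OF J that])
 \<comment> \<open>The invariant form twisted by \<open>?gam\<close>. It depends on each argument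
   only through its image under \<open>?es\<close>, which is why its values on the whole lattice are
   controlled by those on the image of \<open>?es\<close>.\<close>
 define \<beta> where "\<beta> u v = ip ?W u (act m ?gam v)" for u v
 have \<beta>s: "\<beta> u v = \<beta> v u" for u v unfolding \<beta>_def using adj[of b b u v] by (simp add: ip_commute)
 have \<beta>l: "\<beta> u (%a. SUM i:J. x i * e i a) = (SUM i:J. x i * \<beta> u (e i))" for u x proof -
  have "act m ?gam (%a. SUM i:J. x i * e i a) = (%a. SUM i:J. x i * act m ?gam (e i) a)"
   by (rule lmap_sum[OF lsp_UNIV lmap_act]) simp
  thus ?thesis unfolding \<beta>_def by (simp only: ip_linear(4))
 qed
 \<comment> \<open>If \<open>?v\<close> is orthogonal to the image of \<open>?es\<close>, then
   \<open>?gam\<close> maps it to a vector of norm 0, which is 0 by definiteness, and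
   \<open>?del\<close> recovers \<open>?v\<close> from that vector.\<close>
 have nd: "\<forall>i\<in>J. c i = 0" if c: "\<forall>i\<in>J. (SUM l:J. \<beta> (e i) (e l) * c l) = 0" for c proof -
  let ?v = "%a. SUM l:J. c l * e l a"
  have v: "?v \<in> ?V" by (rule lsp_sum[OF lV eV])
  have 1: "\<beta> (e i) ?v = 0" if "i \<in> J" for i using c that unfolding \<beta>l by (simp add: mult.commute)
  have 2: "\<beta> u ?v = 0" if u: "u \<in> ?V" for u proof -
   have "\<beta> ?v u = \<beta> ?v (%a. SUM i:J. u i * e i a)" by (rule arg_cong[OF pivotD(4)[OF J u]])
   also have "... = 0" unfolding \<beta>l by (rule sum.neutral) (simp add: \<beta>s[of ?v] 1)
   finally show ?thesis unfolding \<beta>s[of u] .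
  qed
  have gS: "act m ?gam ?v \<in> ?S" by (rule acS) (use VS[OF v] in blast)
  have "ip ?W (act m ?gam ?v) (act m ?gam ?v) = ip ?W (act m ?gam ?v) (act m eps (act m ?gam ?v))" unfolding es_gam ..
  also have "... = ip ?W (act m ?es (act m ?gam ?v)) (act m ?gam ?v)" by (rule adj[symmetric])
  also have "... = 0" using 2[OF imageI[OF gS]] unfolding \<beta>_def .
  finally have g0: "act m ?gam ?v = (%_. 0)" by (rule posdef[OF gS])
  have "?v = act m ?del (act m ?gam ?v)" unfolding es_gam(4) using VS[OF v] by simp
  also have "... = (%_. 0)" unfolding g0 by (rule act_linear(6))
  finally have v0: "?v = (%_. 0)" .
  show ?thesis proof
   fix i assume "i \<in> J"
   from frame_lin_indep[OF pivot_frame[OF J] lV v0 this] show "c i = 0" .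
  qed
 qed
 have "\<exists>p x. p ~= 0 \<and> (\<forall>l. zint (x l)) \<and> (\<forall>i\<in>J. zint ((SUM l:J. \<beta> (e i) (e l) * x l) / p)) \<and>
   \<not> zev ((SUM i:J. x i * (SUM l:J. \<beta> (e i) (e l) * x l)) / p)" proof (rule odd_form[OF finJ oddJ])
  show "\<beta> (e i) (e l) = \<beta> (e l) (e i)" for i l by (rule \<beta>s)
  show "\<forall>i\<in>J. c i = 0" if "\<forall>i\<in>J. (SUM l:J. \<beta> (e i) (e l) * c l) = 0" for c by (rule nd[OF that])
 qed
 then obtain p x where p: "p ~= 0" and x: "\<And>l. zint (x l)"
  and xi: "\<And>i. i \<in> J ==> zint ((SUM l:J. \<beta> (e i) (e l) * x l) / p)"
  and xo: "\<not> zev ((SUM i:J. x i * (SUM l:J. \<beta> (e i) (e l) * x l)) / p)" by (elim exE conjE) blast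
 define v where "v = (%a. SUM l:J. x l * e l a)"
 have vV: "v \<in> ?V" unfolding v_def by (rule lsp_sum[OF lV eV])
 have vL: "v \<in> lat n D" unfolding lat_def  proof (intro CollectI conjI allI)
  show "v \<in> ?S" using VS[OF vV] ..
  show "zint (v a)" for a unfolding v_def by (intro zint_sum zint_mult x) (use Jz in blast)
 qed
 have \<beta>e: "\<beta> (e i) v = (SUM l:J. \<beta> (e i) (e l) * x l)" for i unfolding v_def \<beta>l by (simp add: mult.commute)
 have \<beta>v: "\<beta> u v = (SUM i:J. u i * (SUM l:J. \<beta> (e i) (e l) * x l))" if u: "u \<in> ?V" for u proof -
  have "\<beta> v u = \<beta> v (%a. SUM i:J. u i * e i a)" by (rule arg_cong[OF pivotD(4)[OF J u]])
  thus ?thesis unfolding \<beta>l \<beta>s[of v] \<beta>e .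
 qed
 have vi: "v i = x i" if "i \<in> J" for i unfolding v_def by (rule pivot_coeff[OF J that])
 have "\<beta> v v = (SUM i:J. x i * (SUM l:J. \<beta> (e i) (e l) * x l))"
  unfolding \<beta>v[OF vV] by (rule sum.cong) (simp_all add: vi)
 hence vo: "\<not> zev (\<beta> v v / p)" using xo by simp
 have int: "zint (\<beta> v u / p)" if u: "u \<in> lat n D" for u proof -
  let ?u = "act m ?es u"
  have uV: "?u \<in> ?V" by (rule imageI[OF latD(1)[OF u]])
  have uz: "zint (?u a)" for a by (rule act_zint[OF br_zint[OF b y] latD(2)[OF u]])
  have "\<beta> v u = \<beta> v ?u" unfolding \<beta>_def es_gam(1) ..
  also have "... = \<beta> ?u v" by (rule \<beta>s)
  also have "... / p = (SUM i:J. ?u i * ((SUM l:J. \<beta> (e i) (e l) * x l) / p))"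
   unfolding \<beta>v[OF uV] by (simp add: sum_divide_distrib[symmetric])
  also have "zint \<dots>" by (intro zint_sum zint_mult uz xi)
  finally show ?thesis .
 qed
 define P where "P g h = ip ?W (ga g v) (act m ?gam (ga h v)) / p" for g h
 \<comment> \<open>All operators are moved away from \<open>v\<close>, and \<open>eps\<close> is
   written as \<open>?gam\<close> after \<open>?del\<close>; this gives a value of
   \<open>\<beta>\<close> at \<open>v\<close> and a lattice vector.\<close>
 have Pz: "zint (P g h)" if g: "g \<in> symg n" and h: "h \<in> symg n" for g h proof -
  let ?h = "act m ?gam (ga h v)"
  have hL: "?h \<in> lat n D" using act_lat[OF D ga_lat[OF D h vL], of ?gam] br_zint[OF b b] unfolding act_br_n by blast
  have gL: "ga (inv g) ?h \<in> lat n D" by (rule ga_lat[OF D symD(4)[OF g] hL])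
  have dL: "act m ?del (ga (inv g) ?h) \<in> lat n D"
   using act_lat[OF D gL, of ?del] br_zint[OF y y] unfolding act_br_n by blast
  have "ip ?W (ga g v) ?h = ip ?W v (ga (inv g) ?h)" by (rule ip_ga[OF g])
  also have "... = ip ?W (act m ?es v) (ga (inv g) ?h)" using VS[OF vV] by simp
  also have "... = ip ?W v (act m eps (ga (inv g) ?h))" by (rule adj)
  also have "... = \<beta> v (act m ?del (ga (inv g) ?h))" unfolding \<beta>_def es_gam(5) ..
  finally show ?thesis unfolding P_def using int[OF dL] by simp
 qed
 have Ps: "P g h = P h g" for g h using \<beta>s[of "ga g v" "ga h v"] unfolding P_def \<beta>_def by simp
 have quad: "(SUM g:symg n. SUM h:symg n. w g * w h * P g h) = ?s * ?s * (\<beta> v v / p)" proof -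
  have wvv: "act n w v = (%a. ?s * v a)" using wv[of v] VS[OF vV] by simp
  have "\<beta> (act n w v) (act n w v) = ?s * ?s * \<beta> v v" proof -
   have "\<beta> (%a. ?s * v a) (%a. ?s * v a) = ip ?W (%a. ?s * v a) (%a. ?s * act m ?gam v a)"
    unfolding \<beta>_def by (rule arg_cong[OF act_linear(4)])
   also have "... = ?s * ip ?W (%a. ?s * v a) (act m ?gam v)" by (rule ip_linear(3))
   also have "ip ?W (%a. ?s * v a) (act m ?gam v) = ip ?W (act m ?gam v) (%a. ?s * v a)" by (rule ip_commute)
   also have "... = ?s * ip ?W (act m ?gam v) v" by (rule ip_linear(3))
   finally show ?thesis unfolding wvv \<beta>_def by (simp add: ip_commute[of ?W v])
  qed
  moreover have "\<beta> (act n w v) (act n w v) = (SUM g:symg n. SUM h:symg n. w g * w h * ip ?W (ga g v) (act m ?gam (ga h v)))"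
  proof -
   have 1: "act m ?gam (act n w v) = (%a. SUM h:symg n. w h * act m ?gam (ga h v) a)"
    unfolding act_ga[of n w v] by (rule lmap_sum[OF lsp_UNIV lmap_act]) simp
   have 2: "ip ?W (act n w v) u = (SUM g:symg n. w g * ip ?W (ga g v) u)" for u
    unfolding ip_commute[of ?W _ u] act_ga[of n w v] by (rule ip_linear(4))
   show ?thesis unfolding \<beta>_def 1 unfolding 2 unfolding ip_linear(4) sum_distrib_left by (simp only: mult.assoc)
  qed
  ultimately show ?thesis unfolding P_def by (simp add: sum_divide_distrib[symmetric])
 qed
 have Pinv: "P (t o g) (t o g) = P g g" if t: "t \<in> sy m n" for t g proof -
  have "ip ?W (ga t (ga g v)) (act m ?gam (ga t (ga g v))) = ip ?W (ga t (ga g v)) (ga t (act m ?gam (ga g v)))"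
   unfolding ga_act_sy[OF t] ..
  also have "... = ip ?W (ga g v) (act m ?gam (ga g v))" unfolding ip_ga[OF syD(1)[OF t]] ga_inv(2)[OF syD(1)[OF t]] ..
  finally show ?thesis unfolding P_def ga_ga by simp
 qed
 \<comment> \<open>\<open>P g g\<close> is constant on the cosets over which \<open>w\<close> sums
   to 0, because \<open>?gam\<close> commutes with \<open>sy m n\<close> and the form is
   invariant.\<close>
 have "of_nat (card (sy m n)) * (SUM g:symg n. w g * P g g) = (SUM t:sy m n. SUM g:symg n. w (t o g) * P (t o g) (t o g))"
 proof -
  have "(SUM g:symg n. w (t o g) * P (t o g) (t o g)) = (SUM g:symg n. w g * P g g)" if "t \<in> sy m n" for t
   by (rule sum_sym_left[OF syD(1)[OF that], of "%g. w g * P g g"])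
  thus ?thesis by simp
 qed
 also have "... = (SUM t:sy m n. SUM g:symg n. w (t o g) * P g g)" by (intro sum.cong refl) (simp add: Pinv)
 also have "... = (SUM g:symg n. SUM t:sy m n. w (t o g) * P g g)" by (rule sum.swap)
 also have "... = 0" proof (rule sum.neutral, rule ballI)
  fix g assume g: "g \<in> symg n"
  have "(SUM t:sy m n. w (t o g)) = (SUM t:sy m n. X (inv g o inv t))"
   unfolding w_def by (rule sum.cong[OF refl]) (simp add: inv_comp[OF syD(1) g])
  also have "... = 0" by (rule Xsum[OF symD(4)[OF g]])
  finally show "(SUM t:sy m n. w (t o g) * P g g) = 0" unfolding sum_distrib_right[symmetric] by simp
 qed
 finally have diag: "(SUM g:symg n. w g * P g g) = 0" using card_sy by simp
 have "zev ((SUM g:symg n. SUM h:symg n. w g * w h * P g h) - (SUM g:symg n. w g * P g g))"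
  by (rule quadratic_parity) (use Pz Ps wz in auto)
 hence "zev (?s * ?s * (\<beta> v v / p))" unfolding quad diag by simp
 moreover have "zint (\<beta> v v / p)" by (rule int[OF vL])
 ultimately show False using s vo zev_mult_iff zint_mult by metis
qed

lemma tensor_nonzero: assumes k: "n = \<Sum>{..k}"
 shows "\<exists>u\<in>specht n (stair k). \<exists>v\<in>specht n (stair k). \<exists>f\<in>specht n D. \<exists>a1 a2 a3.
  (SUM g:symg n. u (a1 o g) * v (a2 o g) * f (a3 o g)) ~= 0" proof (rule ccontr)
 assume h: "\<not> ?thesis"
 have "\<exists>U. annih U \<and> \<not> div2 U" by (rule lift_element[OF k]) (use h in blast)
 then obtain U where "annih U" "\<not> div2 U" by blast
 then obtain V where "annih V" "absorbs V" using absorbing_element by blast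
 thus False by (rule absorbing_impossible)
qed

end

section \<open>Transfer to the complex Specht characters\<close>

definition tb :: "nat => word => nat => nat set" where
 "tb n a = (%i. {x \<in> {1..n}. a x = i})"

text \<open>The tabloids underlying \<open>specht_module\<close> are maps from rows to sets of
  entries; \<open>tb\<close> turns words into them, and a rational function of words becomes a
  complex function of tabloids.\<close>

definition emb :: "nat => cells => wfun => (nat => nat set) => complex" where
 "emb n D f = (%t. SUM a:wd n D. of_rat (f a) * of_bool (t = tb n a))"

definition rchar :: "nat => cells => wfun" where
 "rchar n D \<sigma> = (SUM j:pJ n D. pB n D j (j o \<sigma>))"

lemma tb_inj: assumes "a \<in> wd n D" "a' \<in> wd n D" "tb n a = tb n a'" shows "a = a'"
proof
 fix x show "a x = a' x" proof (cases "x \<in> {1..n}")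
  case True hence "x \<in> tb n a (a x)" by (simp add: tb_def) hence "x \<in> tb n a' (a x)" by (simp add: assms(3))
  thus ?thesis by (simp add: tb_def)
 qed (use wd_out assms in metis)
qed

lemma emb_tb: assumes "finite D" "a \<in> wd n D" shows "emb n D f (tb n a) = of_rat (f a)"
proof -
 have "emb n D f (tb n a) = (\<Sum>a'\<in>wd n D. if a' = a then of_rat (f a') else 0)"
  unfolding emb_def using tb_inj[OF assms(2)] by (intro sum.cong) auto
 thus ?thesis using finite_wd[OF assms(1), of n] assms(2) by simp
qed

lemma emb_add: "emb n D (%a. f a + c * g a) = (%t. emb n D f t + of_rat c * emb n D g t)"
 by (rule ext) (simp add: emb_def of_rat_add of_rat_mult algebra_simps sum.distrib sum_distrib_left)

lemma emb_zero: "emb n D (%_. 0) = (%_. 0)" by (simp add: emb_def)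

lemma emb_sum: "emb n D (%a. SUM j:J. x j * f j a) = (%t. SUM j:J. of_rat (x j) * emb n D (f j) t)"
proof
 fix t
 have "emb n D (%a. SUM j:J. x j * f j a) t = (SUM a:wd n D. SUM j:J. of_rat (x j) * (of_rat (f j a) * of_bool (t = tb n a)))"
  unfolding emb_def of_rat_sum of_rat_mult sum_distrib_right by (simp only: mult.assoc)
 also have "... = (SUM j:J. of_rat (x j) * emb n D (f j) t)" unfolding emb_def sum_distrib_left by (rule sum.swap)
 finally show "emb n D (%a. SUM j:J. x j * f j a) t = (SUM j:J. of_rat (x j) * emb n D (f j) t)" .
qed

lemma tb_comp: assumes "g \<in> symg n" shows "(%i. inv g ` tb n a i) = tb n (a o g)"
proof
 fix i
 show "inv g ` tb n a i = tb n (a o g) i" proof (rule set_eqI)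
  fix x
  have "x \<in> inv g ` tb n a i \<longleftrightarrow> g x \<in> tb n a i"
   using bij_inv_eq_iff[OF symD(2)[OF assms]] bij_is_inj[OF symD(2)[OF assms]] by (metis image_iff)
  thus "x \<in> inv g ` tb n a i \<longleftrightarrow> x \<in> tb n (a o g) i" using sym_in[OF assms, of x] by (auto simp: tb_def)
 qed
qed

lemma perm_action_emb: assumes g: "g \<in> symg n" shows "perm_action g (emb n D f) = emb n D (ga g f)"
proof
 fix t
 have eq: "(%i. inv g ` t i) = tb n (a o g) \<longleftrightarrow> t = tb n a" for a proof
  assume h: "(%i. inv g ` t i) = tb n (a o g)"
  show "t = tb n a" proof
   fix i
   have "inv g ` t i = inv g ` tb n a i" using fun_cong[OF h, of i] fun_cong[OF tb_comp[OF g, of a], of i] by simp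
   thus "t i = tb n a i" using inj_image_eq_iff[OF bij_is_inj[OF symD(2)[OF symD(4)[OF g]]]] by blast
  qed
 next assume "t = tb n a" thus "(%i. inv g ` t i) = tb n (a o g)" using tb_comp[OF g, of a] by simp
 qed
 have "perm_action g (emb n D f) t = (SUM a:wd n D. of_rat (f a) * of_bool ((%i. inv g ` t i) = tb n a))"
  by (simp add: perm_action_def emb_def)
 also have "... = (SUM a:wd n D. of_rat (f (a o g)) * of_bool ((%i. inv g ` t i) = tb n (a o g)))"
 proof (rule sum.reindex_bij_witness[of _ "%a. a o g" "%a. a o inv g"])
  fix a assume a: "a \<in> wd n D"
  show 1: "a o inv g o g = a" "a o g o inv g = a" using symD(5,6)[OF g] by (simp_all add: comp_assoc)
  show "a o inv g \<in> wd n D" "a o g \<in> wd n D" using wd_comp[OF a] g symD(4)[OF g] by blast+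
  show "of_rat (f (a o inv g o g)) * of_bool ((%i. inv g ` t i) = tb n (a o inv g o g))
    = of_rat (f a) * of_bool ((%i. inv g ` t i) = tb n a)" unfolding 1 ..
 qed
 also have "... = emb n D (ga g f) t" unfolding eq by (simp add: emb_def ga_def)
 finally show "perm_action g (emb n D f) t = emb n D (ga g f) t" .
qed

text \<open>Here \<open>t\<close> maps cells to entries and \<open>p\<close> is its inverse. The two
  column stabilizers coincide, and the tabloid of a permuted tableau corresponds to the row word
  composed with the inverse permutation.\<close>

lemma polytabloid_emb: assumes la: "partition_of la n" and p: "tab n (diagram la) p"
  and t: "bij_betw t (diagram la) {1..n}" and tp: "\<And>x. x \<in> {1..n} ==> t (p x) = x"
 shows "polytabloid la t = emb n (diagram la) (pt n p)"
proof -
 let ?D = "diagram la"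
 note fin = youngD(1)[OF diagram_young[OF la]]
 have sl: "sum_list la = n" using la by (simp add: partition_of_def)
 have pt: "p (t c) = c" if "c \<in> ?D" for c proof -
  have tc: "t c \<in> {1..n}" using t that by (auto simp: bij_betw_def)
  have "p (t c) \<in> ?D" by (rule tabD(1)[OF p tc])
  thus ?thesis using tp[OF tc] that t by (auto simp: bij_betw_def inj_on_def)
 qed
 have im: "t ` {c \<in> ?D. P c} = {x \<in> {1..n}. P (p x)}" for P proof (rule set_eqI, rule iffI)
  fix x assume "x \<in> t ` {c \<in> ?D. P c}"
  thus "x \<in> {x \<in> {1..n}. P (p x)}" using t pt by (auto simp: bij_betw_def)
 next fix x assume x: "x \<in> {x \<in> {1..n}. P (p x)}"
  thus "x \<in> t ` {c \<in> ?D. P c}" using tp[of x] tabD(1)[OF p, of x] by (intro image_eqI[of _ _ "p x"]) auto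
 qed
 have im': "g ` {x \<in> {1..n}. P x} = {x \<in> {1..n}. P (inv g x)}" if g: "g \<in> symg n" for g P
 proof (rule set_eqI, rule iffI)
  fix x assume "x \<in> g ` {x \<in> {1..n}. P x}"
  thus "x \<in> {x \<in> {1..n}. P (inv g x)}" using sym_in[OF g] inv_f_f[OF bij_is_inj[OF symD(2)[OF g]]] by auto
 next fix x assume "x \<in> {x \<in> {1..n}. P (inv g x)}"
  thus "x \<in> g ` {x \<in> {1..n}. P x}"
   using sym_in[OF symD(4)[OF g], of x] surj_f_inv_f[OF bij_is_surj[OF symD(2)[OF g]], of x]
   by (intro image_eqI[of _ _ "inv g x"]) auto
 qed
 have cs: "column_stabilizer la t = colst n p" proof (rule set_eqI)
  fix g
  show "g \<in> column_stabilizer la t \<longleftrightarrow> g \<in> colst n p" proof (cases "g \<in> symg n")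
   case g: True
   have "g ` (t ` {c \<in> ?D. snd c = j}) = {x \<in> {1..n}. snd (p (inv g x)) = j}" for j
    unfolding im[of "%c. snd c = j"] by (rule im'[OF g])
   hence "g \<in> column_stabilizer la t \<longleftrightarrow> (\<forall>j. {x \<in> {1..n}. snd (p (inv g x)) = j} = {x \<in> {1..n}. snd (p x) = j})"
    using g by (simp add: column_stabilizer_def sl im symg_def)
   also have "... \<longleftrightarrow> (\<forall>x\<in>{1..n}. snd (p (inv g x)) = snd (p x))"
   proof (intro iffI ballI allI)
    fix x assume h: "\<forall>j. {x \<in> {1..n}. snd (p (inv g x)) = j} = {x \<in> {1..n}. snd (p x) = j}" and x: "x \<in> {1..n}"
    have "x \<in> {z \<in> {1..n}. snd (p z) = snd (p x)}" using x by simp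
    also have "... = {z \<in> {1..n}. snd (p (inv g z)) = snd (p x)}" using spec[OF h, of "snd (p x)"] by (rule sym)
    finally show "snd (p (inv g x)) = snd (p x)" by simp
   next fix j assume h: "\<forall>x\<in>{1..n}. snd (p (inv g x)) = snd (p x)"
    show "{x \<in> {1..n}. snd (p (inv g x)) = j} = {x \<in> {1..n}. snd (p x) = j}" by (rule Collect_cong) (use h in auto)
   qed
   also have "... \<longleftrightarrow> (\<forall>x\<in>{1..n}. snd (p (g x)) = snd (p x))" proof
    assume h: "\<forall>x\<in>{1..n}. snd (p (inv g x)) = snd (p x)"
    show "\<forall>x\<in>{1..n}. snd (p (g x)) = snd (p x)" proof
     fix x assume "x \<in> {1..n}"
     hence "g x \<in> {1..n}" using sym_in[OF g] by blast
     from bspec[OF h this] show "snd (p (g x)) = snd (p x)" using inv_f_f[OF bij_is_inj[OF symD(2)[OF g]]] by simp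
    qed
   next assume h: "\<forall>x\<in>{1..n}. snd (p (g x)) = snd (p x)"
    show "\<forall>x\<in>{1..n}. snd (p (inv g x)) = snd (p x)" proof
     fix x assume "x \<in> {1..n}"
     hence "inv g x \<in> {1..n}" using sym_in[OF symD(4)[OF g]] by blast
     from bspec[OF h this] show "snd (p (inv g x)) = snd (p x)" using surj_f_inv_f[OF bij_is_surj[OF symD(2)[OF g]]] by simp
    qed
   qed
   finally show ?thesis using g by (simp add: colst_def)
  next case False thus ?thesis by (simp add: column_stabilizer_def colst_def symg_def sl)
  qed
 qed
 have tl: "tabloid la (g o t) = tb n (rw n p o inv g)" if g: "g \<in> symg n" for g proof
  fix i
  have "tabloid la (g o t) i = g ` {x \<in> {1..n}. fst (p x) = i}" unfolding tabloid_def image_comp[symmetric] im ..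
  also have "... = {x \<in> {1..n}. fst (p (inv g x)) = i}" by (rule im'[OF g])
  also have "... = tb n (rw n p o inv g) i" using sym_in[OF symD(4)[OF g]] by (auto simp: tb_def rw_def)
  finally show "tabloid la (g o t) i = tb n (rw n p o inv g) i" .
 qed
 show ?thesis proof
  fix T
  have "emb n ?D (pt n p) T = (SUM a:wd n ?D. SUM g:colst n p. of_int (sign g) * of_bool (a = rw n p o inv g) * of_bool (T = tb n a))"
   unfolding emb_def pt_def by (simp add: of_rat_sum of_rat_mult sum_distrib_right of_bool_def if_distrib[of of_rat] cong: if_cong)
  also have "... = (SUM g:colst n p. SUM a:wd n ?D. of_int (sign g) * of_bool (a = rw n p o inv g) * of_bool (T = tb n a))"
   by (rule sum.swap)
  also have "... = (SUM g:colst n p. of_int (sign g) * of_bool (T = tabloid la (g o t)))" proof (rule sum.cong[OF refl])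
   fix g assume "g \<in> colst n p"
   hence g: "g \<in> symg n" by (rule colst_sym)
   have a: "rw n p o inv g \<in> wd n ?D" by (rule wd_comp[OF rw_wd[OF p] symD(4)[OF g]])
   show "(SUM a:wd n ?D. of_int (sign g) * of_bool (a = rw n p o inv g) * of_bool (T = tb n a))
     = of_int (sign g) * (of_bool (T = tabloid la (g o t)) :: complex)"
    using sum_of_bool_eq(1)[OF finite_wd[OF fin] a, of "%a. of_int (sign g) * of_bool (T = tb n a) :: complex"]
    unfolding tl[OF g] by (simp add: mult_ac)
  qed
  finally show "polytabloid la t T = emb n ?D (pt n p) T" unfolding polytabloid_def cs ..
 qed
qed

lemma specht_module_span: assumes la: "partition_of la n"
 shows "specht_module la = cfun.span {emb n (diagram la) (pt n p) | p. tab n (diagram la) p}"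
proof -
 let ?D = "diagram la"
 have sl: "sum_list la = n" using la by (simp add: partition_of_def)
 have "{polytabloid la t | t. tableau la t} = {emb n ?D (pt n p) | p. tab n ?D p}" proof (rule set_eqI, rule iffI)
  fix f assume "f \<in> {polytabloid la t | t. tableau la t}"
  then obtain t where t: "f = polytabloid la t" "bij_betw t ?D {1..n}" unfolding tableau_def sl by blast
  let ?p = "inv_into ?D t"
  have p: "tab n ?D ?p" unfolding tab_def by (rule bij_betw_inv_into[OF t(2)])
  have "polytabloid la t = emb n ?D (pt n ?p)"
   by (rule polytabloid_emb[OF la p t(2)]) (rule bij_betw_inv_into_right[OF t(2)])
  thus "f \<in> {emb n ?D (pt n p) | p. tab n ?D p}" using p t(1) by blast
 next fix f assume "f \<in> {emb n ?D (pt n p) | p. tab n ?D p}"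
  then obtain p where p: "f = emb n ?D (pt n p)" "tab n ?D p" by blast
  let ?t = "inv_into {1..n} p"
  have t: "bij_betw ?t ?D {1..n}" using p(2) unfolding tab_def by (rule bij_betw_inv_into)
  have "polytabloid la ?t = emb n ?D (pt n p)"
   by (rule polytabloid_emb[OF la p(2) t]) (use p(2) in \<open>simp add: tab_def bij_betw_inv_into_left\<close>)
  hence "f = polytabloid la ?t" using p(1) by simp
  moreover have "tableau la ?t" unfolding tableau_def sl by (rule t)
  ultimately show "f \<in> {polytabloid la t | t. tableau la t}" by blast
 qed
 thus ?thesis by (simp add: specht_module_def)
qed

lemma cspan_lsp: "lsp (cfun.span B)" unfolding lsp_subspace by (rule kf.subspace_span)

lemma span_frame: fixes B :: "('a => complex) set"
 assumes "cfun.independent B" "finite B" shows "frame (cfun.span B) B (%b. b) (%b f. cfun.representation B f b)"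
 unfolding frame_def proof (intro conjI ballI)
 show "finite B" by (rule assms(2))
 show "b \<in> cfun.span B" if "b \<in> B" for b using that by (rule kf.span_base)
 show "lfun (cfun.span B) (%f. cfun.representation B f b)" for b unfolding lfun_def proof (intro ballI allI)
  fix f g c assume f: "f \<in> cfun.span B" and g: "g \<in> cfun.span B"
  have cg: "(%x. c * g x) \<in> cfun.span B" by (rule kf.span_scale[OF g])
  have "cfun.representation B (f + (%x. c * g x)) b = cfun.representation B f b + cfun.representation B (%x. c * g x) b"
   by (rule fun_cong[OF kf.representation_add[OF assms(1) cg f]])
  moreover have "cfun.representation B (%x. c * g x) b = c * cfun.representation B g b"
   using kf.representation_scale[OF assms(1) g, of c] by simp
  moreover have "f + (%x. c * g x) = (%a. f a + c * g a)" by (rule ext) simp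
  ultimately show "cfun.representation B (%a. f a + c * g a) b = cfun.representation B f b + c * cfun.representation B g b"
   by simp
 qed
 show "f = (%a. SUM b:B. cfun.representation B f b * b a)" if f: "f \<in> cfun.span B" for f proof
  fix a
  have "(SUM b:B. (%x. cfun.representation B f b * b x)) = f"
   by (rule kf.sum_representation_eq[OF assms(1) f assms(2) order_refl])
  from fun_cong[OF this, of a] show "f a = (SUM b:B. cfun.representation B f b * b a)" by (simp add: fun_sum_apply)
 qed
 show "cfun.representation B l k = of_bool (k = l)" if "k \<in> B" "l \<in> B" for k l
  unfolding kf.representation_basis[OF assms(1) that(2)] by (simp only: of_bool_def)
qed

text \<open>The embedded rational pivot basis is a basis of the complex module, with coordinates
  still given by values at the pivots, and the trace does not depend on the basis. In particular the
  characters are rational.\<close>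

lemma specht_char_rchar: assumes la: "partition_of la n" and g: "g \<in> symg n"
 shows "specht_char la g = of_rat (rchar n (diagram la) g)"
proof -
 let ?D = "diagram la" and ?V = "specht_module la"
 note Dy = diagram_young[OF la]
 note fin = youngD(1)[OF Dy] and piv = pivot_specht(1)[OF Dy]
 let ?J = "pJ n ?D" and ?B = "%j. emb n ?D (pB n ?D j)"
 have V: "?V = cfun.span {emb n ?D (pt n p) | p. tab n ?D p}" by (rule specht_module_span[OF la])
 have lV: "lsp ?V" unfolding V by (rule cspan_lsp)
 have Jwd: "j \<in> wd n ?D" if "j \<in> ?J" for j proof (rule ccontr)
  assume "j \<notin> wd n ?D"
  hence "pB n ?D j j = 0" by (rule specht_supp[OF pBD(2)[OF Dy that]])
  thus False using pBD(3)[OF Dy that that] by simp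
 qed
 have embV: "emb n ?D f \<in> ?V" if f: "f \<in> specht n ?D" for f proof -
  have "f \<in> {f. emb n ?D f \<in> ?V}" proof (rule specht_least[OF _ _ f])
   show "lsp {f. emb n ?D f \<in> ?V}" unfolding lsp_def using lspD[OF lV] by (auto simp: emb_add emb_zero)
   fix p assume "tab n ?D p"
   hence "emb n ?D (pt n p) \<in> {emb n ?D (pt n p) | p. tab n ?D p}" by blast
   hence "emb n ?D (pt n p) \<in> cfun.span {emb n ?D (pt n p) | p. tab n ?D p}" by (rule kf.span_base)
   thus "pt n p \<in> {f. emb n ?D f \<in> ?V}" unfolding V[symmetric] by (simp only: mem_Collect_eq)
  qed
  thus ?thesis by simp
 qed
 have ex: "f = (%t. SUM j:?J. f (tb n j) * ?B j t)" if f: "f \<in> ?V" for f proof -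
  let ?S = "{f. f = (%t. SUM j:?J. f (tb n j) * ?B j t)}"
  have "cfun.span {emb n ?D (pt n p) | p. tab n ?D p} \<subseteq> ?S" proof (rule kf.span_minimal)
   show "{emb n ?D (pt n p) | p. tab n ?D p} \<subseteq> ?S" proof
    fix f assume "f \<in> {emb n ?D (pt n p) | p. tab n ?D p}"
    then obtain p where p: "f = emb n ?D (pt n p)" "tab n ?D p" by blast
    have "emb n ?D (pt n p) = emb n ?D (%a. SUM j:?J. pt n p j * pB n ?D j a)"
     by (rule arg_cong[OF pivotD(4)[OF piv pt_specht[OF p(2)]]])
    also have "... = (%t. SUM j:?J. of_rat (pt n p j) * ?B j t)" by (rule emb_sum)
    also have "... = (%t. SUM j:?J. emb n ?D (pt n p) (tb n j) * ?B j t)"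
     by (rule ext, rule sum.cong[OF refl]) (simp add: emb_tb[OF fin Jwd])
    finally show "f \<in> ?S" unfolding p(1) mem_Collect_eq .
   qed
   have "lsp ?S" unfolding lsp_def proof (intro conjI ballI allI)
    show "(%_. 0) \<in> ?S" by simp
    fix f h c assume "f \<in> ?S" "h \<in> ?S"
    hence e: "f t = (SUM j:?J. f (tb n j) * ?B j t)" "h t = (SUM j:?J. h (tb n j) * ?B j t)" for t
     unfolding mem_Collect_eq by (metis (no_types, lifting))+
    have "f t + c * h t = (SUM j:?J. (f (tb n j) + c * h (tb n j)) * ?B j t)" for t proof -
     have "f t + c * h t = (SUM j:?J. f (tb n j) * ?B j t) + c * (SUM j:?J. h (tb n j) * ?B j t)" using e[of t] by simp
     thus ?thesis by (simp add: sum.distrib sum_distrib_left algebra_simps)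
    qed
    thus "(%a. f a + c * h a) \<in> ?S" by blast
   qed
   thus "kf.subspace ?S" unfolding lsp_subspace .
  qed
  thus ?thesis using f unfolding V by blast
 qed
 have fr: "frame ?V ?J ?B (%j f. f (tb n j))" unfolding frame_def proof (intro conjI ballI)
  show "finite ?J" by (rule pivotD(1)[OF piv])
  show "?B j \<in> ?V" if "j \<in> ?J" for j by (rule embV[OF pBD(2)[OF Dy that]])
  show "lfun ?V (%f. f (tb n j))" for j by (rule lfun_eval)
  show "f = (%t. SUM j:?J. f (tb n j) * ?B j t)" if "f \<in> ?V" for f by (rule ex[OF that])
  show "?B l (tb n k) = of_bool (k = l)" if "k \<in> ?J" "l \<in> ?J" for k l
   using emb_tb[OF fin Jwd[OF that(1)]] pBD(3)[OF Dy that] by simp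
 qed
 have lin: "lmap S (perm_action g)" for S by (simp add: lmap_def perm_action_def)
 have act: "perm_action g f \<in> ?V" if f: "f \<in> ?V" for f proof -
  have "perm_action g f = perm_action g (%t. SUM j:?J. f (tb n j) * ?B j t)" by (rule arg_cong[OF ex[OF f]])
  also have "... = (%t. SUM j:?J. f (tb n j) * perm_action g (?B j) t)" by (simp add: perm_action_def)
  also have "... \<in> ?V" proof (rule lsp_sum[OF lV])
   fix j assume "j \<in> ?J"
   thus "perm_action g (?B j) \<in> ?V" unfolding perm_action_emb[OF g] by (intro embV ga_specht[OF Dy g] pBD(2)[OF Dy])
  qed
  finally show ?thesis .
 qed
 define B where "B = (SOME B. cfun.independent B \<and> cfun.span B = ?V)"
 have "\<exists>B. cfun.independent B \<and> cfun.span B = ?V" proof -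
  obtain B where B: "B \<subseteq> ?V" "cfun.independent B" "?V \<subseteq> cfun.span B"
   using cfun.maximal_independent_subset[of ?V] by blast
  have "cfun.span B \<subseteq> ?V" by (rule kf.span_minimal[OF B(1)]) (use lV in \<open>simp add: lsp_subspace\<close>)
  with B show ?thesis by blast
 qed
 hence B: "cfun.independent B" "cfun.span B = ?V" unfolding B_def by (metis (mono_tags, lifting) someI_ex)+
 have finB: "finite B" proof -
  have "?V \<subseteq> cfun.span (?B ` ?J)" proof
   fix f assume f: "f \<in> ?V"
   have "f = (SUM j:?J. (%x. f (tb n j) * ?B j x))" by (rule ext, subst ex[OF f]) (simp add: fun_sum_apply)
   also have "... \<in> cfun.span (?B ` ?J)" by (intro kf.span_sum kf.span_scale kf.span_base imageI)
   finally show "f \<in> cfun.span (?B ` ?J)" .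
  qed
  hence "B \<subseteq> cfun.span (?B ` ?J)" using kf.span_superset[of B] B(2) by blast
  from kf.independent_span_bound[OF finite_imageI[OF pivotD(1)[OF piv]] B(1) this] show ?thesis by blast
 qed
 have "specht_char la g = (SUM b:B. cfun.representation B (perm_action g b) b)"
  by (simp add: specht_char_def trace_on_def Let_def B_def)
 also have "... = (SUM j:?J. perm_action g (?B j) (tb n j))"
  by (rule frame_trace_eq[OF lV span_frame[OF B(1) finB, unfolded B(2)] fr lin act])
 also have "... = (SUM j:?J. of_rat (pB n ?D j (j o g)))"
  by (rule sum.cong[OF refl]) (simp add: perm_action_emb[OF g] emb_tb[OF fin Jwd] ga_def)
 finally show ?thesis by (simp add: rchar_def of_rat_sum)
qed

lemma char_degree_syt: assumes la: "partition_of la n" shows "char_degree la = syt n (diagram la)"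
proof -
 note D = diagram_young[OF la]
 have "(of_nat (char_degree la) :: complex) = of_rat (rchar n (diagram la) id)"
  using specht_char_id[of la] specht_char_rchar[OF la sym_id] by simp
 also have "rchar n (diagram la) id = of_nat (sdim n (diagram la))" unfolding rchar_def sdim_def using pBD(3)[OF D] by simp
 finally show ?thesis using sdim_eq_syt[OF D] by simp
qed

section \<open>Invariants in triple tensor products\<close>

text \<open>For spaces of finitely supported functions this is their tensor product: by
  \<open>pivot_tensor\<close> the products of basis vectors form a basis.\<close>

definition tensor :: "('a => rat) set => ('b => rat) set => ('a \<times> 'b => rat) set" where
 "tensor A B = {F. (\<forall>y. (%x. F (x, y)) \<in> A) \<and> (\<forall>x. (%y. F (x, y)) \<in> B)}"

lemma tensorD: assumes "F \<in> tensor A B" shows "(%x. F (x, y)) \<in> A" "(%y. F (x, y)) \<in> B"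
 using assms by (auto simp: tensor_def)

lemma tensor_product: assumes "lsp A" "lsp B" "u \<in> A" "v \<in> B" shows "(%t. u (fst t) * v (snd t)) \<in> tensor A B"
 unfolding tensor_def mem_Collect_eq fst_conv snd_conv proof (intro conjI allI)
 show "(%x. u x * v y) \<in> A" for y using lsp_scale[OF assms(1,3), of "v y"] by (simp add: mult.commute)
 show "(%y. u x * v y) \<in> B" for x using lsp_scale[OF assms(2,4), of "u x"] by simp
qed

lemma fdsp_tensor: assumes A: "fdsp V A" and B: "fdsp W B" shows "fdsp (V \<times> W) (tensor A B)"
 unfolding fdsp_def lsp_def proof (intro conjI ballI allI impI)
 show "finite (V \<times> W)" using fdspD(1)[OF A] fdspD(1)[OF B] by simp
 show "(%_. 0) \<in> tensor A B" unfolding tensor_def using lsp_zero[OF fdspD(2)[OF A]] lsp_zero[OF fdspD(2)[OF B]] by simp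
 fix F G c assume F: "F \<in> tensor A B" and G: "G \<in> tensor A B"
 show "(%a. F a + c * G a) \<in> tensor A B" unfolding tensor_def mem_Collect_eq
  by (intro conjI allI lsp_addc[OF fdspD(2)[OF A] tensorD(1)[OF F] tensorD(1)[OF G]]
   lsp_addc[OF fdspD(2)[OF B] tensorD(2)[OF F] tensorD(2)[OF G]])
next fix F t assume F: "F \<in> tensor A B" and t: "t \<notin> V \<times> W"
 obtain x y where t': "t = (x, y)" by (rule prod.exhaust)
 have "F (x, y) = 0" if "x \<notin> V" by (rule fdspD(3)[OF A tensorD(1)[OF F] that])
 moreover have "F (x, y) = 0" if "y \<notin> W" by (rule fdspD(3)[OF B tensorD(2)[OF F] that])
 ultimately show "F t = 0" using t unfolding t' by blast
qed

lemma pivot_tensor: assumes A: "pivot A I b" "lsp A" and B: "pivot B J c" "lsp B"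
 shows "pivot (tensor A B) (I \<times> J) (%k t. b (fst k) (fst t) * c (snd k) (snd t))" unfolding pivot_def
proof (intro conjI ballI)
 show "finite (I \<times> J)" using pivotD(1)[OF A(1)] pivotD(1)[OF B(1)] by simp
 fix k assume k: "k \<in> I \<times> J"
 thus "(%t. b (fst k) (fst t) * c (snd k) (snd t)) \<in> tensor A B"
  using tensor_product[OF A(2) B(2) pivotD(2)[OF A(1)] pivotD(2)[OF B(1)]] by auto
 show "b (fst k) (fst i) * c (snd k) (snd i) = of_bool (i = k)" if "i \<in> I \<times> J" for i
  using k that pivotD(3)[OF A(1)] pivotD(3)[OF B(1)] by (auto simp: prod_eq_iff)
next fix F assume F: "F \<in> tensor A B"
 show "F = (%a. SUM k:I \<times> J. F k * (b (fst k) (fst a) * c (snd k) (snd a)))" proof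
  fix t obtain x y where t: "t = (x, y)" "F t = F (x, y)" by (cases t) simp
  have "F (x, y) = (SUM i:I. F (i, y) * b i x)" by (rule fun_cong[OF pivotD(4)[OF A(1) tensorD(1)[OF F]]])
  also have "... = (SUM i:I. (SUM j:J. F (i, j) * c j y) * b i x)"
   by (rule sum.cong[OF refl], rule arg_cong[where f = "%z. z * _"], rule fun_cong[OF pivotD(4)[OF B(1) tensorD(2)[OF F]]])
  also have "... = (SUM k:I \<times> J. F k * (b (fst k) x * c (snd k) y))"
   unfolding sum.cartesian_product' by (simp add: sum_distrib_left sum_distrib_right mult_ac)
  finally show "F t = (SUM k:I \<times> J. F k * (b (fst k) (fst t) * c (snd k) (snd t)))" unfolding t(1) by simp
 qed
qed

text \<open>The average of the product of the three characters is the trace of the projection to the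
  invariants, hence a rank. A nonzero sum of products is a nonzero value of a projected vector, so
  then the rank is positive.\<close>

lemma triple_invariants: assumes A: "young n A" "young n B" "young n C"
 shows "\<exists>M. (SUM g:symg n. rchar n A g * rchar n B g * rchar n C g) / fact n = of_nat M \<and>
  ((\<exists>u\<in>specht n A. \<exists>v\<in>specht n B. \<exists>f\<in>specht n C. \<exists>a1 a2 a3.
    (SUM g:symg n. u (a1 o g) * v (a2 o g) * f (a3 o g)) ~= 0) --> M > 0)" proof -
 let ?BC = "tensor (specht n B) (specht n C)"
 define S where "S = tensor (specht n A) ?BC"
 let ?J = "pJ n A \<times> pJ n B \<times> pJ n C"
 define e where "e k t = pB n A (fst k) (fst t) * (pB n B (fst (snd k)) (fst (snd t)) * pB n C (snd (snd k)) (snd (snd t)))"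
  for k t :: "word \<times> word \<times> word"
 note fBC = fdsp_tensor[OF fdsp_specht[OF A(2)] fdsp_specht[OF A(3)]]
 have fS: "fdsp (wd n A \<times> wd n B \<times> wd n C) S" unfolding S_def by (rule fdsp_tensor[OF fdsp_specht[OF A(1)] fBC])
 have pS: "pivot S ?J e" unfolding S_def e_def[abs_def] by (rule pivot_tensor[OF pivot_specht(1)[OF A(1)] lsp_specht
   pivot_tensor[OF pivot_specht(1)[OF A(2)] lsp_specht pivot_specht(1)[OF A(3)] lsp_specht] fdspD(2)[OF fBC]])
 have SD: "(%x. F (x, y, z)) \<in> specht n A" "(%y. F (x, y, z)) \<in> specht n B" "(%z. F (x, y, z)) \<in> specht n C"
  if "F \<in> S" for F x y z using that unfolding S_def tensor_def by blast+
 have SI: "F \<in> S" if "\<And>y z. (%x. F (x, y, z)) \<in> specht n A" "\<And>x z. (%y. F (x, y, z)) \<in> specht n B"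
   "\<And>x y. (%z. F (x, y, z)) \<in> specht n C" for F unfolding S_def tensor_def using that by auto
 have prodS: "(%t. u (fst t) * (v (fst (snd t)) * f (snd (snd t)))) \<in> S"
  if uvf: "u \<in> specht n A" "v \<in> specht n B" "f \<in> specht n C" for u v f
  unfolding S_def by (rule tensor_product[OF lsp_specht fdspD(2)[OF fBC] uvf(1) tensor_product[OF lsp_specht lsp_specht uvf(2,3)]])
 define P where "P F = (%t. SUM g:symg n. 1 / fact n * F (fst t o g, fst (snd t) o g, snd (snd t) o g))"
  for F :: "word \<times> word \<times> word => rat"
 have lP: "lmap S P" unfolding lmap_def P_def by (simp add: algebra_simps sum.distrib sum_distrib_left)
 have PS: "P F \<in> S" if F: "F \<in> S" for F proof (rule SI)
  fix x y z :: word
  have "(%x. SUM g:symg n. 1 / fact n * ga g (%x. F (x, y o g, z o g)) x) \<in> specht n A"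
   by (rule lsp_sum[OF lsp_specht]) (rule ga_specht[OF A(1) _ SD(1)[OF F]])
  thus "(%x. P F (x, y, z)) \<in> specht n A" by (simp add: P_def ga_def)
  have "(%y. SUM g:symg n. 1 / fact n * ga g (%y. F (x o g, y, z o g)) y) \<in> specht n B"
   by (rule lsp_sum[OF lsp_specht]) (rule ga_specht[OF A(2) _ SD(2)[OF F]])
  thus "(%y. P F (x, y, z)) \<in> specht n B" by (simp add: P_def ga_def)
  have "(%z. SUM g:symg n. 1 / fact n * ga g (%z. F (x o g, y o g, z)) z) \<in> specht n C"
   by (rule lsp_sum[OF lsp_specht]) (rule ga_specht[OF A(3) _ SD(3)[OF F]])
  thus "(%z. P F (x, y, z)) \<in> specht n C" by (simp add: P_def ga_def)
 qed
 have PP: "P (P F) = P F" for F proof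
  fix t
  have "P (P F) t = (SUM g:symg n. 1 / fact n * P F t)" unfolding P_def[of "P F"] proof (rule sum.cong[OF refl])
   fix g assume g: "g \<in> symg n"
   have "P F (fst t o g, fst (snd t) o g, snd (snd t) o g) = P F t" unfolding P_def fst_conv snd_conv comp_assoc
    by (rule sum_sym_left[OF g, of "%g. 1 / fact n * F (fst t o g, fst (snd t) o g, snd (snd t) o g)"])
   thus "1 / fact n * P F (fst t o g, fst (snd t) o g, snd (snd t) o g) = 1 / fact n * P F t" by simp
  qed
  thus "P (P F) t = P F t" by (simp add: card_sym)
 qed
 obtain J b where J: "pivot (P ` S) J b" "tr S P = of_nat (card J)" by (rule idempotent_trace[OF fS lP PS PP]) blast+
 have "tr S P = (SUM k:?J. P (e k) k)" by (rule tr_frame[OF fS pivot_frame[OF pS] lP PS])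
 also have "... = (SUM g:symg n. SUM k:?J. 1 / fact n * e k (fst k o g, fst (snd k) o g, snd (snd k) o g))"
  unfolding P_def by (rule sum.swap)
 also have "... = (SUM g:symg n. rchar n A g * rchar n B g * rchar n C g / fact n)" proof (rule sum.cong[OF refl])
  fix g
  have "(SUM k:?J. 1 / fact n * e k (fst k o g, fst (snd k) o g, snd (snd k) o g))
   = (SUM i:pJ n A. SUM j:pJ n B. SUM l:pJ n C. pB n A i (i o g) * (pB n B j (j o g) * pB n C l (l o g)) / fact n)"
   unfolding e_def sum.cartesian_product' by simp
  also have "... = rchar n A g * rchar n B g * rchar n C g / fact n" unfolding rchar_def mult.assoc sum_product3 ..
  finally show "(SUM k:?J. 1 / fact n * e k (fst k o g, fst (snd k) o g, snd (snd k) o g)) = rchar n A g * rchar n B g * rchar n C g / fact n" .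
 qed
 finally have tr: "(SUM g:symg n. rchar n A g * rchar n B g * rchar n C g) / fact n = of_nat (card J)"
  unfolding J(2) by (simp add: sum_divide_distrib)
 have pos: "card J > 0" if uvf: "u \<in> specht n A" "v \<in> specht n B" "f \<in> specht n C"
   and nz: "(SUM g:symg n. u (a1 o g) * v (a2 o g) * f (a3 o g)) ~= 0" for u v f a1 a2 a3 proof (rule ccontr)
  let ?F = "%t. u (fst t) * (v (fst (snd t)) * f (snd (snd t)))"
  assume "\<not> 0 < card J"
  hence "J = {}" using pivotD(1)[OF J(1)] by simp
  moreover have "P ?F \<in> P ` S" by (rule imageI[OF prodS[OF uvf]])
  ultimately have "P ?F (a1, a2, a3) = 0" using fun_cong[OF pivotD(4)[OF J(1)], of "P ?F" "(a1, a2, a3)"] by simp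
  hence "1 / fact n * (SUM g:symg n. u (a1 o g) * v (a2 o g) * f (a3 o g)) = 0"
   unfolding P_def sum_distrib_left by (simp add: mult.assoc)
  thus False using nz by simp
 qed
 show ?thesis by (rule exI[of _ "card J"]) (use tr pos in blast)
qed

lemma cnj_of_rat: "cnj (of_rat q) = of_rat q" by (cases q) (simp add: of_rat_rat)

lemma of_rat_fact: "of_rat (fact k) = fact k" by (metis of_nat_fact of_rat_of_nat_eq)

lemma staircase_partition: "partition_of (staircase k) (\<Sum>{..k})" unfolding partition_of_def
proof (intro conjI)
 show "sorted_wrt (\<ge>) (staircase k)"
  unfolding staircase_def sorted_wrt_rev by (rule sorted_wrt_mono_rel[of _ "(<)"]) (auto simp: strict_sorted_iff simp del: upt_Suc)
 show "0 \<notin> set (staircase k)" by (auto simp: staircase_def simp del: upt_Suc)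
 have "sum_list (staircase k) = \<Sum>{1..<Suc k}"
  by (simp add: staircase_def interv_sum_list_conv_sum_set_nat del: upt_Suc)
 also have "... = \<Sum>{..k}" by (rule sum.mono_neutral_left) auto
 finally show "sum_list (staircase k) = \<Sum>{..k}" .
qed

text \<open>The pointwise assumption on \<open>\<phi>\<close> covers both the product in
  \<open>kronecker\<close> and the square in \<open>constituent\<close>. As the characters are
  rational, the inner product is the symmetric average of \<open>triple_invariants\<close>.\<close>

lemma multiplicity_in_square: assumes la: "partition_of la n" and k: "n = \<Sum>{..k}"
  and h: "v2 (char_degree la) = n - binary_digit_sum n - defect2 la \<or> odd (char_degree la)"
  and \<phi>: "\<And>g. \<phi> g = (specht_char (staircase k) g)\<^sup>2"
 shows "char_multiplicity n (specht_char la) \<phi> > 0"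
proof -
 let ?D = "diagram la"
 note D = diagram_young[OF la]
 obtain j w where j: "n = \<Sum>{..j} + 2 * w" "ediff ?D = ediff (stair j)"
  "odd (pathc (stair j) (\<Sum>{..j}) (2 * w) ?D)" by (rule height_zero_odd_paths[OF la h[unfolded char_degree_syt[OF la]]])
 let ?m = "\<Sum>{..j}"
 have K: "young ?m (stair j)" by (rule stair_young)
 obtain b y q where core: "core ?m (stair j) b y q"
  by (rule core_exists[OF K]) (use stair_degree_unit[OF refl, of j] sdim_eq_syt[OF K] in auto)
 interpret core ?m "stair j" b y q by (rule core)
 interpret fong ?m "stair j" b y q n j "2 * w" ?D by unfold_locales (use j D in auto)
 obtain M where M: "(SUM g:symg n. rchar n (stair k) g * rchar n (stair k) g * rchar n ?D g) / fact n = of_nat M" "M > 0"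
  using triple_invariants[of n "stair k" "stair k" ?D] stair_young[of k] k D tensor_nonzero[OF k] by auto
 have st: "partition_of (staircase k) n" unfolding k by (rule staircase_partition)
 have "char_inner n \<phi> (specht_char la) = of_nat M" proof -
  have "(SUM g:symg n. \<phi> g * cnj (specht_char la g)) = (SUM g:symg n. of_rat (rchar n (stair k) g * rchar n (stair k) g * rchar n ?D g))"
   by (rule sum.cong[OF refl])
    (simp add: \<phi> specht_char_rchar[OF st] specht_char_rchar[OF la] staircase_diagram cnj_of_rat power2_eq_square of_rat_mult)
  hence "char_inner n \<phi> (specht_char la) = of_rat ((SUM g:symg n. rchar n (stair k) g * rchar n (stair k) g * rchar n ?D g) / fact n)"
   unfolding char_inner_def symg_def[symmetric] by (simp add: of_rat_divide of_rat_sum of_rat_fact)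
  thus ?thesis unfolding M(1) by simp
 qed
 hence "char_multiplicity n (specht_char la) \<phi> = M" unfolding char_multiplicity_def by (intro the_equality) auto
 thus ?thesis using M(2) by simp
qed

theorem theoremB:
  fixes k n :: nat and la :: "nat list"
  assumes "k \<ge> 1" and "n = k * (k + 1) div 2" and "partition_of la n"
  shows "(height_zero2 la \<longrightarrow> kronecker (staircase k) (staircase k) la > 0) \<and>
         (odd (char_degree la) \<longrightarrow>
            constituent n (specht_char la) (\<lambda>\<sigma>. (specht_char (staircase k) \<sigma>)\<^sup>2))"
proof -
  have k: "n = \<Sum>{..k}" using assms(2) gauss_sum_nat[of k] by (simp add: atLeast0AtMost)
  have sl: "sum_list la = n" using assms(3) by (simp add: partition_of_def)
  note main = multiplicity_in_square[OF assms(3) k]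
  show ?thesis
  proof (intro conjI impI)
    assume "height_zero2 la"
    then have "v2 (char_degree la) = n - binary_digit_sum n - defect2 la" by (simp add: height_zero2_def sl Let_def)
    then show "kronecker (staircase k) (staircase k) la > 0"
      unfolding kronecker_def sl by (intro main disjI1) (simp_all add: power2_eq_square)
  next
    assume "odd (char_degree la)"
    then have "char_multiplicity n (specht_char la) (\<lambda>\<sigma>. (specht_char (staircase k) \<sigma>)\<^sup>2) > 0"
      by (intro main disjI2) simp_all
    then show "constituent n (specht_char la) (\<lambda>\<sigma>. (specht_char (staircase k) \<sigma>)\<^sup>2)" by (simp add: constituent_def)
  qed
qed

end
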